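(* Let $f$ be a non-constant meromorphic function on $\mathbb{C}$, let $\mathcal{L}$ be an $L$-function, and let $n,k$ be positive integers. Let $\eta(z)=az+b$ with $a,b\in\mathbb{C}$, $|a|+|b|\neq 0$. Let $l$ be a non-negative integer or infinity, and suppose that $(f^n)^{(k)}-\eta(z)$ and $(\mathcal{L}^n)^{(k)}-\eta(z)$ share $(0,l)$. If - $l\geq 2$ and $n>\frac{5k}{2}+6$, or - $l=1$ and $n>\frac{13k}{4}+\frac{27}{4}$, or - $l=0$ and $n>7k+\frac{21}{2}$, then $f=t\mathcal{L}$ for a constant $t$ satisfying $t^n=1$.
   Context: $L$-function: an element of the Selberg class, i.e. a Dirichlet series $\mathcal{L}(s)=\sum_{n=1}^{\infty}a(n)n^{-s}$ with $a(1)=1$ satisfying: (i) $a(n)\ll n^{\epsilon}$ for every $\epsilon>0$; (ii) there is a non-negative integer $k$ such that $(s-1)^k\mathcal{L}(s)$ is an entire function of finite order; (iii) $\Lambda_{\mathcal{L}}(s)=\omega\,\overline{\Lambda_{\mathcal{L}}(1-\overline{s})}$, where $\Lambda_{\mathcal{L}}(s)=\mathcal{L}(s)Q^s\prod_{j=1}^{K}\Gamma(\lambda_js+v_j)$ with $K$ a positive integer, positive reals $Q,\lambda_j$, and complex numbers $v_j,\omega$ with $\mathrm{Re}\,v_j\geq 0$, $|\omega|=1$; (iv) $\mathcal{L}(s)=\prod_p\exp\left(\sum_{k=1}^{\infty}\frac{b(p^k)}{p^{ks}}\right)$ (product over all primes) with coefficients satisfying $b(p^k)\ll p^{k\theta}$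 for some $\theta<\frac12$. (The symbols $s,n,k,a(n),Q,K$ in this definition are local to it.) An $L$-function is regarded as a meromorphic function on $\mathbb{C}$ by analytic continuation. "Meromorphic" means meromorphic in $\mathbb{C}$. Superscript $(k)$ denotes the $k$-th derivative. Weighted sharing: for $l$ a non-negative integer or $\infty$ and $c\in\mathbb{C}\cup\{\infty\}$, $E_l(c;h)$ is the set of all $c$-points of $h$, where a $c$-point of multiplicity $q$ is counted $q$ times if $q\leq l$ and $l+1$ times if $q>l$. Two functions $h_1,h_2$ share $(c,l)$ if $E_l(c;h_1)=E_l(c;h_2)$. *)

theory Defs
  imports
    "HOL-Complex_Analysis.Complex_Analysis"
    "HOL-Library.Extended_Nat"
    "HOL-Library.Landau_Symbols"
    "HOL-Computational_Algebra.Primes"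
begin

definition entire_of_finite_order :: "(complex \<Rightarrow> complex) \<Rightarrow> bool" where
  "entire_of_finite_order g \<longleftrightarrow> g holomorphic_on UNIV \<and>
     (\<exists>\<rho>::real. g \<in> O[at_infinity](\<lambda>s. of_real (exp (norm s powr \<rho>))))"

definition completed_L ::
  "(complex \<Rightarrow> complex) \<Rightarrow> nat \<Rightarrow> real \<Rightarrow> (nat \<Rightarrow> real) \<Rightarrow> (nat \<Rightarrow> complex) \<Rightarrow> complex \<Rightarrow> complex" where
  "completed_L L K Q lam v s =
     L s * of_real Q powr s * (\<Prod>j=1..K. Gamma (of_real (lam j) * s + v j))"

text \<open>
  \<open>L_function L\<close>: \<open>L\<close> is the meromorphic continuation to the whole plane of an element of the
  Selberg class. By the library's convention for \<open>nicely_meromorphic_on\<close>, \<open>L\<close> has the value 0 at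
  its poles and is continuous everywhere else.

  The Dirichlet series and the Euler product are required to represent \<open>L\<close> in the half-plane
  \<open>Re s > 1\<close>, where both converge absolutely because of the bounds on \<open>a\<close> and \<open>b\<close>.

  In the second condition \<open>g\<close> is \<open>(s - 1) ^ k * L s\<close> with its singularity at 1 removed.

  The functional equation is an identity of meromorphic functions. Since \<open>Gamma\<close> and \<open>L\<close> take the
  value 0 at their poles, the two sides are compared outside a set without limit points.
\<close>
definition L_function :: "(complex \<Rightarrow> complex) \<Rightarrow> bool" where
  "L_function L \<longleftrightarrow> L nicely_meromorphic_on UNIV \<and>
     (\<exists>a :: nat \<Rightarrow> complex. a 1 = 1 \<and>
        (\<forall>s. Re s > 1 \<longrightarrow> (\<lambda>n. a (Suc n) * of_nat (Suc n) powr (-s)) sums L s) \<and>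
        (\<forall>\<epsilon>::real. \<epsilon> > 0 \<longrightarrow> (\<lambda>n. norm (a n)) \<in> O(\<lambda>n. real n powr \<epsilon>))) \<and>
     (\<exists>(k::nat) g. entire_of_finite_order g \<and> (\<forall>s. s \<noteq> 1 \<longrightarrow> g s = (s - 1) ^ k * L s)) \<and>
     (\<exists>(K::nat) (Q::real) (lam :: nat \<Rightarrow> real) (v :: nat \<Rightarrow> complex) (\<omega>::complex).
        K > 0 \<and> Q > 0 \<and> (\<forall>j\<in>{1..K}. lam j > 0 \<and> Re (v j) \<ge> 0) \<and> norm \<omega> = 1 \<and>
        (\<forall>\<^sub>\<approx>s\<in>UNIV. completed_L L K Q lam v s = \<omega> * cnj (completed_L L K Q lam v (1 - cnj s)))) \<and>
     (\<exists>b :: nat \<Rightarrow> complex.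
        (\<exists>(\<theta>::real) (C::real). \<theta> < 1 / 2 \<and>
           (\<forall>p k. prime p \<and> k \<ge> 1 \<longrightarrow> norm (b (p ^ k)) \<le> C * real p powr (real k * \<theta>))) \<and>
        (\<forall>s. Re s > 1 \<longrightarrow>
           (\<lambda>p. if prime p
                then exp (\<Sum>k. b (p ^ Suc k) * of_nat p powr (- (of_nat (Suc k) * s)))
                else 1) has_prod L s))"

text \<open>
  The multiplicity of a \<open>c\<close>-point of a meromorphic function \<open>h\<close> at \<open>z\<close>, being 0 if \<open>z\<close> is not a
  \<open>c\<close>-point; \<open>None\<close> stands for the value \<open>\<infinity>\<close>, so the \<open>None\<close>-points are the poles. It depends only
  on \<open>h\<close> in a punctured neighbourhood of \<open>z\<close>, so the junk values that \<open>deriv\<close> takes at poles do not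
  matter. Where \<open>h\<close> is identically \<open>c\<close> near \<open>z\<close>, \<open>zorder\<close> of \<open>h - c\<close> is unspecified and the multiplicity is
  set to \<open>\<infinity>\<close> explicitly.
\<close>
definition point_mult :: "complex option \<Rightarrow> (complex \<Rightarrow> complex) \<Rightarrow> complex \<Rightarrow> enat" where
  "point_mult c h z = (case c of
     Some c' \<Rightarrow> if eventually (\<lambda>w. h w = c') (at z) then \<infinity>
                else enat (nat (zorder (\<lambda>w. h w - c') z))
   | None \<Rightarrow> if is_pole h z then enat (nat (- zorder h z)) else 0)"

text \<open>
  \<open>E_set l c h\<close> is a set whose elements are counted with multiplicity, given by its multiplicity
  function.
\<close>
definition E_set :: "enat \<Rightarrow> complex option \<Rightarrow> (complex \<Rightarrow> complex) \<Rightarrow> complex \<Rightarrow> enat" where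
  "E_set l c h = (\<lambda>z. let q = point_mult c h z in if q \<le> l then q else l + 1)"

definition share ::
  "(complex \<Rightarrow> complex) \<Rightarrow> (complex \<Rightarrow> complex) \<Rightarrow> complex option \<Rightarrow> enat \<Rightarrow> bool" where
  "share h1 h2 c l \<longleftrightarrow> E_set l c h1 = E_set l c h2"

end

theory Submission
  imports Defs
begin

text \<open>
  Put \<open>F = (f^n)^(k) / \<eta>\<close>, \<open>G = (L^n)^(k) / \<eta>\<close>, so that \<open>F\<close> and
  \<open>G\<close> share the value 1, and let \<open>Q\<close> be the quotient of the derivatives of \<open>1 /
  (F - 1)\<close> and \<open>1 / (G - 1)\<close>. If \<open>Q\<close> is not constant, then \<open>H = Q' /
  Q\<close> vanishes at the common simple 1-points, and has only simple poles. Jensen's formula and the lemma on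
  the logarithmic derivative, applied to \<open>F\<close>, \<open>G\<close> and \<open>H\<close>, bound
  \<open>T(f)\<close> by a multiple of \<open>T(L)\<close> and \<open>T(L)\<close> by a multiple of
  \<open>T(f)\<close>, up to \<open>O(ln r)\<close>; the conditions on \<open>n\<close> make the product of the
  two constants less than 1. Since \<open>L\<close> has infinitely many (trivial) zeros, \<open>T(L)\<close> is
  not \<open>O(ln r)\<close>, a contradiction. So \<open>1 / (F - 1) = A / (G - 1) + B\<close>. Unless \<open>A
  = 1\<close>, \<open>B = 0\<close>, either \<open>G\<close> vanishes only where \<open>F\<close> has a pole,
  which local orders forbid at a zero of \<open>L\<close>, or \<open>F\<close> and \<open>G\<close> each take
  some nonzero value essentially only at zeros or poles of the other; these have high multiplicity and the
  second main theorem excludes this. Finally \<open>f^n - L^n\<close> is a polynomial, and it vanishes by the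
  second main theorem once more.

  No growth of \<open>f\<close> is assumed. Sharing gives \<open>T(f) \<le> T(G) + error\<close>, and a growth
  lemma of Borel type turns this into polynomial growth of \<open>T(f)\<close>, whence no exceptional sets of
  radii of positive measure occur.
\<close>

section \<open>Means over circles\<close>

text \<open>The asymmetry between f and L shapes the estimates: L has at most one pole, so poles are
  charged only to f. Two linear inequalities result, n T(f) \<le> a T(f) + b T(L) and n T(L) \<le> c
  T(L) + 2 b T(f), the 2 standing for distinct zeros and distinct poles of f; eliminating T(f) needs
  2 b^2 < (n - a) (n - c). The weight l enters through two prices, \<open>\<alpha>\<close> and
  \<open>\<beta>\<close>, at which zeros of the derivatives of F and G are bought to pay for
  multiple common 1-points.

  The main obstacle is circular: the error in the lemma on the logarithmic derivative involves T(f),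
  while the growth of f has to be derived from inequalities containing that error. Every estimate is
  therefore made relative to an arbitrary majorant U, which is first a majorant of T(f) itself and
  later 0. Since derivatives and quotients have junk values at poles, identities are stated off a
  sparse set and become equalities everywhere only at the very end.\<close>

definition circle_mean :: "real \<Rightarrow> (complex \<Rightarrow> 'a::banach) \<Rightarrow> 'a" where
  "circle_mean r \<phi> = integral {0..1} (\<lambda>t. \<phi> (circlepath 0 r t))"

lemma norm_circlepath_0 [simp]: "norm (circlepath 0 r t) = \<bar>r\<bar>"
  by (simp add: circlepath norm_mult norm_exp_eq_Re)

lemma continuous_circlepath: "continuous_on A (circlepath z r)"
  unfolding circlepath by (intro continuous_intros)

lemma circle_mean_continuous:
  assumes "continuous_on (sphere 0 r) \<phi>" "0 \<le> r"
  shows "continuous_on {0..1} (\<lambda>t. \<phi> (circlepath 0 r t))"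
  by (rule continuous_on_compose2[OF assms(1) continuous_circlepath]) (use assms in auto)

lemma circle_mean_integrable:
  fixes \<phi> :: "complex \<Rightarrow> 'a::banach"
  assumes "continuous_on (sphere 0 r) \<phi>" "0 \<le> r"
  shows "(\<lambda>t. \<phi> (circlepath 0 r t)) integrable_on {0..1}"
  using circle_mean_continuous[OF assms] by (rule integrable_continuous_real)

lemma circle_mean_cong:
  assumes "\<And>z. norm z = r \<Longrightarrow> \<phi> z = \<psi> z" "0 \<le> r"
  shows "circle_mean r \<phi> = circle_mean r \<psi>"
  unfolding circle_mean_def by (intro integral_cong) (use assms in auto)

lemma circle_mean_const [simp]: "circle_mean r (\<lambda>_. c) = c"
  by (simp add: circle_mean_def)

lemma circle_mean_add:
  assumes "continuous_on (sphere 0 r) \<phi>" "continuous_on (sphere 0 r) \<psi>" "0 \<le> r"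
  shows "circle_mean r (\<lambda>z. \<phi> z + \<psi> z) = circle_mean r \<phi> + circle_mean r \<psi>"
  unfolding circle_mean_def by (intro integral_add circle_mean_integrable assms)

lemma circle_mean_diff:
  assumes "continuous_on (sphere 0 r) \<phi>" "continuous_on (sphere 0 r) \<psi>" "0 \<le> r"
  shows "circle_mean r (\<lambda>z. \<phi> z - \<psi> z) = circle_mean r \<phi> - circle_mean r \<psi>"
  unfolding circle_mean_def by (intro integral_diff circle_mean_integrable assms)

lemma circle_mean_cmult: "circle_mean r (\<lambda>z. (c::real) * \<phi> z) = c * circle_mean r \<phi>"
  unfolding circle_mean_def by simp

lemma circle_mean_sum:
  assumes "\<And>i. i \<in> I \<Longrightarrow> continuous_on (sphere 0 r) (\<phi> i)" "0 \<le> r" "finite I"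
  shows "circle_mean r (\<lambda>z. \<Sum>i\<in>I. \<phi> i z) = (\<Sum>i\<in>I. circle_mean r (\<phi> i))"
  unfolding circle_mean_def by (intro integral_sum circle_mean_integrable assms)

lemma circle_mean_mono:
  fixes \<phi> \<psi> :: "complex \<Rightarrow> real"
  assumes "continuous_on (sphere 0 r) \<phi>" "continuous_on (sphere 0 r) \<psi>" "0 \<le> r"
    and "\<And>z. norm z = r \<Longrightarrow> \<phi> z \<le> \<psi> z"
  shows "circle_mean r \<phi> \<le> circle_mean r \<psi>"
  unfolding circle_mean_def by (intro integral_le circle_mean_integrable assms) (use assms in auto)

lemma circle_mean_nonneg:
  fixes \<phi> :: "complex \<Rightarrow> real"
  assumes "\<And>z. norm z = r \<Longrightarrow> 0 \<le> \<phi> z" "0 \<le> r" "continuous_on (sphere 0 r) \<phi>"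
  shows "0 \<le> circle_mean r \<phi>"
  using circle_mean_mono[of r "\<lambda>_. 0" \<phi>] assms by simp

lemma norm_circle_mean_le:
  fixes \<phi> :: "complex \<Rightarrow> complex"
  assumes "continuous_on (sphere 0 r) \<phi>" "continuous_on (sphere 0 r) \<psi>" "0 \<le> r"
    and "\<And>z. norm z = r \<Longrightarrow> norm (\<phi> z) \<le> \<psi> z"
  shows "norm (circle_mean r \<phi>) \<le> circle_mean r \<psi>"
  unfolding circle_mean_def by (intro integral_norm_bound_integral circle_mean_integrable assms) (use assms in auto)

lemma Re_circle_mean:
  assumes "continuous_on (sphere 0 r) \<phi>" "0 \<le> r"
  shows "Re (circle_mean r \<phi>) = circle_mean r (\<lambda>z. Re (\<phi> z))"
  unfolding circle_mean_def
  using integral_linear[OF circle_mean_integrable[OF assms] bounded_linear_Re] by (simp add: o_def)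

lemma cnj_circle_mean: "cnj (circle_mean r \<phi>) = circle_mean r (\<lambda>z. cnj (\<phi> z))"
  unfolding circle_mean_def by (rule integral_cnj)

section \<open>Cauchy's and Schwarz's integral formulas as circle means\<close>

lemma has_contour_integral_circlepath_0_imp_circle_mean:
  assumes "(f has_contour_integral I) (circlepath 0 r)"
  shows "circle_mean r (\<lambda>u. f u * u) = I / (2 * of_real pi * \<i>)"
proof -
  \<comment> \<open>On the circle dz = 2 pi i z dt, which accounts for the factor u in the
    mean.\<close>
  have "((\<lambda>t. f (circlepath 0 r t) * (2 * pi * \<i> * r * exp (2 * of_real pi * \<i> * t))) has_integral I) {0..1}"
    using assms unfolding has_contour_integral_def
    by (rule has_integral_eq[rotated]) (simp add: vector_derivative_circlepath01)
  hence "((\<lambda>t. (2 * of_real pi * \<i>) * (f (circlepath 0 r t) * circlepath 0 r t)) has_integral I) {0..1}"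
    by (rule has_integral_eq[rotated]) (simp add: circlepath algebra_simps)
  from has_integral_mult_right[OF this, of "1 / (2 * of_real pi * \<i>)"]
  have "((\<lambda>t. (f (circlepath 0 r t) * circlepath 0 r t)) has_integral I / (2 * of_real pi * \<i>)) {0..1}"
    by (simp add: field_simps)
  thus ?thesis unfolding circle_mean_def by (rule integral_unique)
qed

lemma circle_mean_holomorphic:
  assumes "continuous_on (cball 0 r) H" "H holomorphic_on ball 0 r" "0 < r"
  shows "circle_mean r H = H 0"
proof -
  have "circle_mean r (\<lambda>u. H u / (u - 0) * u) = H 0"
    using has_contour_integral_circlepath_0_imp_circle_mean[OF Cauchy_integral_circlepath[OF assms(1,2), of 0]] assms(3)
    by simp
  also have "circle_mean r (\<lambda>u. H u / (u - 0) * u) = circle_mean r H"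
    by (rule circle_mean_cong) (use assms in auto)
  finally show ?thesis .
qed

text \<open>The Schwarz integral formula, differentiated. Cauchy's formula gives H' from H; the same
  integral with the conjugate of H in place of H vanishes, so adding it turns H into 2 Re H.\<close>

lemma deriv_eq_circle_mean_Re:
  assumes cont: "continuous_on (cball 0 r) H" and holo: "H holomorphic_on ball 0 r" and w: "norm w < r"
  shows "deriv H w = circle_mean r (\<lambda>u. 2 * of_real (Re (H u)) * u / (u - w)^2)"
proof -
  have r: "r > 0" using w norm_ge_zero[of w] by linarith
  have ne: "u \<noteq> w" if "norm u = r" for u using w that by auto
  have contS: "continuous_on (sphere 0 r) H"
    by (rule continuous_on_subset[OF cont]) auto
  have d: "deriv H w = circle_mean r (\<lambda>u. H u * u / (u - w)^2)"
  proof -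
    have wb: "w \<in> ball 0 r" using w by simp
    note * = Cauchy_derivative_integral_circlepath[OF cont holo wb]
    have "circle_mean r (\<lambda>u. H u / (u - w)^2 * u) = deriv H w"
      using has_contour_integral_circlepath_0_imp_circle_mean[OF has_contour_integral_integral[OF *(1)]]
        DERIV_imp_deriv[OF *(2)] by simp
    thus ?thesis by simp
  qed
  \<comment> \<open>On the circle the conjugate of u is r^2 / u, which turns the conjugate of the
    kernel u / (u - w)^2 into r^2 u / (r^2 - cnj w u)^2. Times H this is holomorphic in the disc and
    vanishes at 0, so its mean is 0.\<close>
  define G where "G = (\<lambda>u. H u * (of_real r^2 * u / (of_real r^2 - cnj w * u)^2))"
  have nz: "of_real r^2 - cnj w * u \<noteq> 0" if "norm u \<le> r" for u
  proof
    assume "of_real r^2 - cnj w * u = 0"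
    hence "norm (complex_of_real r^2) = norm (cnj w * u)" by simp
    also have "\<dots> \<le> norm w * r" using that by (simp add: norm_mult mult_left_mono)
    also have "\<dots> < r * r" using w r by simp
    also have "norm (complex_of_real r^2) = r * r" by (simp add: norm_mult power2_eq_square)
    finally show False by simp
  qed
  have "circle_mean r G = G 0"
  proof (rule circle_mean_holomorphic)
    show "continuous_on (cball 0 r) G" unfolding G_def
      by (intro continuous_intros cont) (use nz in auto)
    show "G holomorphic_on ball 0 r" unfolding G_def
      by (intro holomorphic_intros holo) (use nz in auto)
  qed (use r in auto)
  hence G0: "circle_mean r G = 0" by (simp add: G_def)
  have "circle_mean r (\<lambda>u. cnj (H u) * u / (u - w)^2) = circle_mean r (\<lambda>u. cnj (G u))"
  proof (rule circle_mean_cong)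
    fix u :: complex assume u: "norm u = r"
    hence u0: "u \<noteq> 0" using r by auto
    have cu: "cnj u = of_real r^2 / u"
      using u u0 complex_norm_square[of u] by (simp add: field_simps)
    have "cnj (of_real r^2 * u / (of_real r^2 - cnj w * u)^2) = of_real r^2 * cnj u / (of_real r^2 - w * cnj u)^2"
      by simp
    also have "of_real r^2 - w * cnj u = of_real r^2 * (u - w) / u"
      unfolding cu using u0 by (simp add: field_simps)
    also have "of_real r^2 * cnj u / (of_real r^2 * (u - w) / u)^2 = u / (u - w)^2"
    proof -
      have "of_real r^2 * (of_real r^2 / u) / (of_real r^2 * (u - w) / u)^2 = (R * R / u) / ((R * R) * (u - w)^2 / u^2)"
        if "R = complex_of_real r ^ 2" for R
        unfolding that by (simp add: power2_eq_square)
      also have "(R * R / u) / ((R * R) * (u - w)^2 / u^2) = u / (u - w)^2" if "R \<noteq> 0" for R :: complex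
        using that u0 ne[OF u] by (simp add: power2_eq_square)
      finally show ?thesis unfolding cu using r by simp
    qed
    finally have "cnj (of_real r^2 * u / (of_real r^2 - cnj w * u)^2) = u / (u - w)^2" .
    thus "cnj (H u) * u / (u - w)^2 = cnj (G u)"
      unfolding G_def complex_cnj_mult by simp
  qed (use r in auto)
  also have "\<dots> = cnj (circle_mean r G)" by (rule cnj_circle_mean[symmetric])
  finally have c0: "circle_mean r (\<lambda>u. cnj (H u) * u / (u - w)^2) = 0" using G0 by simp
  have "deriv H w = circle_mean r (\<lambda>u. H u * u / (u - w)^2) + circle_mean r (\<lambda>u. cnj (H u) * u / (u - w)^2)"
    using d c0 by simp
  also have "\<dots> = circle_mean r (\<lambda>u. H u * u / (u - w)^2 + cnj (H u) * u / (u - w)^2)"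
    by (rule circle_mean_add[symmetric]) (use ne r in \<open>auto intro!: continuous_intros contS\<close>)
  also have "\<dots> = circle_mean r (\<lambda>u. 2 * of_real (Re (H u)) * u / (u - w)^2)"
    by (rule circle_mean_cong)
      (use r in \<open>simp_all add: add_divide_distrib[symmetric] distrib_right[symmetric] complex_add_cnj\<close>)
  finally show ?thesis .
qed

text \<open>The zero-free factor of a meromorphic function is exp H. The characteristic controls its
  modulus, hence Re H, but not Im H; therefore H' has to be estimated by the mean of |Re H| on a
  larger circle.\<close>

lemma norm_deriv_le_circle_mean_Re:
  assumes cont: "continuous_on (cball 0 \<rho>) H" and holo: "H holomorphic_on ball 0 \<rho>"
    and w: "norm w \<le> r" "r < \<rho>"
  shows "norm (deriv H w) \<le> 2 * \<rho> / (\<rho> - r)^2 * circle_mean \<rho> (\<lambda>u. \<bar>Re (H u)\<bar>)"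
proof -
  have r: "\<rho> > 0" "norm w < \<rho>" using w norm_ge_zero[of w] by linarith+
  have ne: "u \<noteq> w" if "norm u = \<rho>" for u using r that by auto
  have contS: "continuous_on (sphere 0 \<rho>) H"
    by (rule continuous_on_subset[OF cont]) auto
  have "norm (deriv H w) = norm (circle_mean \<rho> (\<lambda>u. 2 * of_real (Re (H u)) * u / (u - w)^2))"
    using deriv_eq_circle_mean_Re[OF cont holo r(2)] by simp
  also have "\<dots> \<le> circle_mean \<rho> (\<lambda>u. 2 * \<rho> / (\<rho> - r)^2 * \<bar>Re (H u)\<bar>)"
  proof (rule norm_circle_mean_le)
    fix u :: complex assume u: "norm u = \<rho>"
    have "\<rho> - r \<le> norm (u - w)" using norm_triangle_ineq2[of u w] u w by linarith
    hence "(\<rho> - r)^2 \<le> norm (u - w)^2" using w by (intro power_mono) auto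
    moreover have "0 < (\<rho> - r)^2" using w by simp
    ultimately have "2 * \<bar>Re (H u)\<bar> * \<rho> / norm (u - w)^2 \<le> 2 * \<bar>Re (H u)\<bar> * \<rho> / (\<rho> - r)^2"
      using r by (intro divide_left_mono mult_pos_pos) auto
    thus "norm (2 * of_real (Re (H u)) * u / (u - w)^2) \<le> 2 * \<rho> / (\<rho> - r)^2 * \<bar>Re (H u)\<bar>"
      using u by (simp add: norm_mult norm_divide norm_power field_simps)
  qed (use ne r w in \<open>auto intro!: continuous_intros contS\<close>)
  also have "\<dots> = 2 * \<rho> / (\<rho> - r)^2 * circle_mean \<rho> (\<lambda>u. \<bar>Re (H u)\<bar>)"
    by (rule circle_mean_cmult)
  finally show ?thesis .
qed

section \<open>Means of logarithms\<close>

lemma circle_mean_ln_norm_holomorphic: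
  assumes "G holomorphic_on ball 0 R" "0 < r" "r < R" "\<And>z. z \<in> ball 0 R \<Longrightarrow> G z \<noteq> 0"
  shows "circle_mean r (\<lambda>z. ln (norm (G z))) = ln (norm (G 0))"
proof -
  obtain H where H: "H holomorphic_on ball 0 R" "\<And>z. z \<in> ball 0 R \<Longrightarrow> exp (H z) = G z"
    using contractible_imp_holomorphic_log[OF assms(1) convex_imp_contractible[OF convex_ball] assms(4)]
    by metis
  have ln: "ln (norm (G z)) = Re (H z)" if "z \<in> ball 0 R" for z
    using H(2)[OF that, symmetric] by simp
  have "circle_mean r (\<lambda>z. ln (norm (G z))) = circle_mean r (\<lambda>z. Re (H z))"
    by (rule circle_mean_cong) (use ln assms in auto)
  also have "\<dots> = Re (circle_mean r H)"
    by (rule Re_circle_mean[symmetric])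
       (use assms in \<open>auto intro!: continuous_on_subset[OF holomorphic_on_imp_continuous_on[OF H(1)]]\<close>)
  also have "circle_mean r H = H 0"
    by (rule circle_mean_holomorphic)
       (use assms in \<open>auto intro!: continuous_on_subset[OF holomorphic_on_imp_continuous_on[OF H(1)]]
          holomorphic_on_subset[OF H(1)]\<close>)
  also have "Re (H 0) = ln (norm (G 0))" using ln[of 0] assms by simp
  finally show ?thesis .
qed

lemma circle_mean_ln_norm_linear:
  assumes "0 < r" "norm a \<noteq> r"
  shows "circle_mean r (\<lambda>z. ln (norm (z - a))) = ln (max r (norm a))"
proof (cases "norm a < r")
  case True
  show ?thesis
  proof (cases "a = 0")
    case True
    have "circle_mean r (\<lambda>z. ln (norm (z - a))) = circle_mean r (\<lambda>z. ln r)"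
      by (rule circle_mean_cong) (use True assms in auto)
    thus ?thesis using True assms by simp
  next
    case a0: False
    \<comment> \<open>For |z| = r the distance |z - a| equals |r - cnj a z / r|: reflecting a in the
      circle moves the zero out to r^2 / cnj a, so the new function is zero-free in a disc larger
      than that of radius r.\<close>
    have "circle_mean r (\<lambda>z. ln (norm (z - a))) = circle_mean r (\<lambda>z. ln (norm (of_real r - cnj a * z / of_real r)))"
    proof (rule circle_mean_cong)
      fix z :: complex assume z: "norm z = r"
      have "norm (of_real r - cnj a * z / of_real r) * r = norm ((of_real r - cnj a * z / of_real r) * of_real r)"
        using assms by (simp add: norm_mult)
      also have "(of_real r - cnj a * z / of_real r) * of_real r = of_real (r^2) - cnj a * z"
        using assms by (simp add: field_simps power2_eq_square)
      also have "of_real (r^2) = z * cnj z" using z complex_norm_square[of z] by simp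
      also have "z * cnj z - cnj a * z = z * cnj (z - a)" by (simp add: algebra_simps)
      also have "norm \<dots> = norm (z - a) * r" using z by (simp add: norm_mult del: complex_cnj_diff)
      finally show "ln (norm (z - a)) = ln (norm (of_real r - cnj a * z / of_real r))"
        using assms by simp
    qed (use assms in auto)
    also have "\<dots> = ln (norm (of_real r - cnj a * 0 / of_real r))"
    proof (rule circle_mean_ln_norm_holomorphic[where R = "r^2 / norm a"])
      show "r < r^2 / norm a" using True a0 assms by (simp add: field_simps power2_eq_square)
      fix z assume "z \<in> ball (0::complex) (r^2 / norm a)"
      hence "norm z * norm a < r^2" using a0 by (simp add: field_simps)
      show "of_real r - cnj a * z / of_real r \<noteq> 0"
      proof
        assume "of_real r - cnj a * z / of_real r = 0"
        hence "cnj a * z = of_real (r^2)" using assms by (simp add: field_simps power2_eq_square)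
        hence "norm (cnj a * z) = r^2" by (simp add: norm_power)
        with \<open>norm z * norm a < r^2\<close> show False by (simp add: norm_mult mult.commute)
      qed
    qed (use assms in \<open>auto intro!: holomorphic_intros\<close>)
    finally show ?thesis using True assms by (simp add: max_def)
  qed
next
  case False
  hence "r < norm a" using assms by linarith
  moreover have "circle_mean r (\<lambda>z. ln (norm (z - a))) = ln (norm (0 - a))"
    by (rule circle_mean_ln_norm_holomorphic[where R = "norm a"])
       (use \<open>r < norm a\<close> assms in \<open>auto intro!: holomorphic_intros\<close>)
  ultimately show ?thesis by (simp add: max_def)
qed

section \<open>Uniform bounds for the mean of the square root of 1 / |z - a|\<close>

lemma has_integral_inverse_sqrt_dist:
  fixes c :: real
  defines "A \<equiv> \<lambda>t. 2 * sgn (t - c) * sqrt \<bar>t - c\<bar>"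
  shows "((\<lambda>t. 1 / sqrt \<bar>t - c\<bar>) has_integral (A 1 - A 0)) {0..1}"
proof (rule fundamental_theorem_of_calculus_strong[where S = "{c}"])
  show "continuous_on {0..1} A"
  proof -
    \<comment> \<open>Written as a difference of two square roots, A is seen to be continuous across
      c. With c as the only point without derivative, the strong form of the fundamental theorem
      applies although the integrand is unbounded.\<close>
    have "A = (\<lambda>t. 2 * (sqrt (max 0 (t - c)) - sqrt (max 0 (c - t))))"
      by (auto simp: A_def sgn_if max_def fun_eq_iff)
    thus ?thesis by (auto intro!: continuous_intros)
  qed
  show "(A has_vector_derivative 1 / sqrt \<bar>x - c\<bar>) (at x)" if "x \<in> {0..1} - {c}" for x
  proof (cases "x > c")
    case True
    have "((\<lambda>t. 2 * sqrt (t - c)) has_real_derivative 1 / sqrt \<bar>x - c\<bar>) (at x)"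
      using True by (auto intro!: derivative_eq_intros simp: field_simps)
    moreover have "eventually (\<lambda>t. A t = 2 * sqrt (t - c)) (nhds x)"
      using eventually_nhds_in_open[of "{c<..}" x] True
      by (auto elim!: eventually_mono simp: A_def)
    ultimately have "(A has_real_derivative 1 / sqrt \<bar>x - c\<bar>) (at x)"
      using DERIV_cong_ev[of x x A "\<lambda>t. 2 * sqrt (t - c)"] by blast
    thus ?thesis by (simp add: has_real_derivative_iff_has_vector_derivative)
  next
    case False
    hence lt: "x < c" using that by auto
    have "((\<lambda>t. - 2 * sqrt (c - t)) has_real_derivative 1 / sqrt \<bar>x - c\<bar>) (at x)"
      using lt by (auto intro!: derivative_eq_intros simp: field_simps)
    moreover have "eventually (\<lambda>t. A t = - 2 * sqrt (c - t)) (nhds x)"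
      using eventually_nhds_in_open[of "{..<c}" x] lt
      by (auto elim!: eventually_mono simp: A_def)
    ultimately have "(A has_real_derivative 1 / sqrt \<bar>x - c\<bar>) (at x)"
      using DERIV_cong_ev[of x x A "\<lambda>t. - 2 * sqrt (c - t)"] by blast
    thus ?thesis by (simp add: has_real_derivative_iff_has_vector_derivative)
  qed
qed auto

text \<open>Jordan's inequality: a concave function lies above its chord.\<close>

lemma sin_pi_ge:
  assumes "0 \<le> y" "y \<le> 1/2"
  shows "2 * y \<le> sin (pi * y)"
proof -
  have "concave_on {0..pi} sin"
    unfolding concave_on_def
    by (rule f''_ge0_imp_convex[where f' = "\<lambda>x. - cos x" and f'' = sin])
       (auto intro!: derivative_eq_intros sin_ge_zero)
  hence cc: "convex_on {0..pi} (\<lambda>x. - sin x)" by (simp add: concave_on_def)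
  have "- sin ((1 - 2 * y) *\<^sub>R 0 + (2 * y) *\<^sub>R (pi/2)) \<le> (1 - 2 * y) * (- sin 0) + (2 * y) * (- sin (pi/2))"
    by (rule convex_onD[OF cc]) (use assms in auto)
  thus ?thesis by (simp add: field_simps)
qed

text \<open>Let p be the point of the circle on the ray through a. Then |p - a| = ||z| - |a|| \<le>
  |z - a|, so |z - p| \<le> 2 |z - a|, and the chord |z - p| is 2 r |sin (pi (t - s))|. The three
  terms on the right account for the periodicity in t.\<close>

lemma inverse_sqrt_norm_circlepath_le:
  assumes r: "1 \<le> r" and s: "0 \<le> s" "s \<le> 1" and t: "0 \<le> t" "t \<le> 1"
    and ts: "t \<noteq> s" "t - s \<noteq> 1" "t - s \<noteq> -1" and \<alpha>: "0 \<le> \<alpha>"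
  shows "1 / sqrt (norm (circlepath 0 r t - of_real \<alpha> * exp (2 * of_real pi * \<i> * of_real s)))
     \<le> 1 / sqrt \<bar>t - s\<bar> + 1 / sqrt \<bar>t - (s + 1)\<bar> + 1 / sqrt \<bar>t - (s - 1)\<bar>"
proof -
  define e where "e = exp (2 * of_real pi * \<i> * of_real s)"
  define z where "z = circlepath 0 r t"
  define a where "a = of_real \<alpha> * e"
  have ne: "norm e = 1" by (simp add: e_def norm_exp_eq_Re)
  \<comment> \<open>The distance of t - s from the nearest integer.\<close>
  define d where "d = min \<bar>t - s\<bar> (min \<bar>t - (s + 1)\<bar> \<bar>t - (s - 1)\<bar>)"
  have d0: "0 < d" using ts by (auto simp: d_def)
  have d1: "d \<le> 1/2" unfolding d_def using s t by linarith
  have sin_eq: "\<bar>sin (pi * (t - s))\<bar> = sin (pi * d)"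
  proof -
    have pos: "0 \<le> sin (pi * d)"
      using sin_pi_ge[of d] d0 d1 by linarith
    have "d = \<bar>t - s\<bar> \<or> d = 1 - \<bar>t - s\<bar>" unfolding d_def using s t by linarith
    hence "\<bar>sin (pi * d)\<bar> = \<bar>sin (pi * (t - s))\<bar>"
    proof
      assume "d = \<bar>t - s\<bar>"
      thus ?thesis by (auto simp: abs_if algebra_simps sin_diff)
    next
      assume *: "d = 1 - \<bar>t - s\<bar>"
      have "sin (pi * d) = sin (pi - pi * \<bar>t - s\<bar>)" by (simp add: * algebra_simps)
      also have "\<dots> = sin (pi * \<bar>t - s\<bar>)" by (rule sin_pi_minus)
      also have "\<bar>\<dots>\<bar> = \<bar>sin (pi * (t - s))\<bar>"
        by (auto simp: abs_if algebra_simps sin_diff)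
      finally show ?thesis .
    qed
    thus ?thesis using pos by simp
  qed
  have ge: "2 * d \<le> \<bar>sin (pi * (t - s))\<bar>" using sin_pi_ge[of d] d0 d1 sin_eq by simp
  have "norm (z - of_real r * e) \<le> 2 * norm (z - a)"
  proof -
    have "norm (z - of_real r * e) \<le> norm (z - a) + norm (a - of_real r * e)"
      using norm_triangle_ineq[of "z - a" "a - of_real r * e"] by simp
    also have "a - of_real r * e = of_real (\<alpha> - r) * e" by (simp add: a_def algebra_simps)
    also have "norm \<dots> = \<bar>norm a - norm z\<bar>"
      using ne r \<alpha> by (simp add: norm_mult a_def z_def del: of_real_diff)
    also have "\<dots> \<le> norm (z - a)" using norm_triangle_ineq3[of a z] by (simp add: norm_minus_commute)
    finally show ?thesis by simp
  qed
  moreover have "norm (z - of_real r * e) = r * (2 * \<bar>sin (pi * (t - s))\<bar>)"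
  proof -
    have "z - of_real r * e = of_real r * (exp (\<i> * of_real (2 * pi * t)) - exp (\<i> * of_real (2 * pi * s)))"
      by (simp add: z_def e_def circlepath algebra_simps)
    hence "norm (z - of_real r * e) = r * norm (exp (\<i> * of_real (2 * pi * t)) - exp (\<i> * of_real (2 * pi * s)))"
      using r by (simp add: norm_mult)
    also have "norm (exp (\<i> * of_real (2 * pi * t)) - exp (\<i> * of_real (2 * pi * s))) = 2 * \<bar>sin (pi * (t - s))\<bar>"
    proof -
      have "exp (\<i> * of_real (2 * pi * t)) - exp (\<i> * of_real (2 * pi * s))
        = exp (\<i> * of_real (2 * pi * s)) * (exp (\<i> * of_real (2 * pi * t - 2 * pi * s)) - 1)"
        by (simp add: algebra_simps exp_diff)
      moreover have "(2 * pi * t - 2 * pi * s) / 2 = pi * (t - s)" by (simp add: field_simps)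
      ultimately show ?thesis by (simp add: norm_mult dist_exp_i_1 del: of_real_diff of_real_mult)
    qed
    finally show ?thesis .
  qed
  ultimately have "r * (2 * (2 * d)) \<le> 2 * norm (z - a)"
    using mult_left_mono[OF ge, of "2 * r"] r by linarith
  moreover have "1 * d \<le> r * d" using r d0 by (intro mult_right_mono) auto
  ultimately have dle: "d \<le> norm (z - a)" using d0 by linarith
  have "1 / sqrt (norm (z - a)) \<le> 1 / sqrt d"
    using dle d0 by (intro divide_left_mono mult_pos_pos) auto
  also have "\<dots> \<le> 1 / sqrt \<bar>t - s\<bar> + 1 / sqrt \<bar>t - (s + 1)\<bar> + 1 / sqrt \<bar>t - (s - 1)\<bar>"
    by (auto simp: d_def min_def)
  finally show ?thesis by (simp add: z_def a_def e_def)
qed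

text \<open>The point is uniformity in a and r: the means of 1 / |z - a| blow up as a approaches the
  circle, those of its square root do not. The bound is 3 times 12, with 12 for each of the three
  singular terms.\<close>

lemma circle_mean_inverse_sqrt_le:
  assumes r: "1 \<le> r" and a: "norm a \<noteq> r"
  shows "circle_mean r (\<lambda>z. 1 / sqrt (norm (z - a))) \<le> 36"
proof -
  obtain s where s: "0 \<le> s" "s \<le> 1" "a = of_real (norm a) * exp (2 * of_real pi * \<i> * of_real s)"
  proof -
    have "a = of_real (norm a) * exp (\<i> * of_real (Arg2pi a))" by (rule Arg2pi_eq)
    moreover have "0 \<le> Arg2pi a / (2 * pi)" "Arg2pi a / (2 * pi) \<le> 1"
      using Arg2pi_ge_0[of a] Arg2pi_lt_2pi[of a] by (auto simp: field_simps)
    ultimately show ?thesis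
      using that[of "Arg2pi a / (2 * pi)"] by (simp add: mult.commute)
  qed
  define B where "B = (\<lambda>t. 1 / sqrt \<bar>t - s\<bar> + 1 / sqrt \<bar>t - (s + 1)\<bar> + 1 / sqrt \<bar>t - (s - 1)\<bar>)"
  define I where "I = (\<lambda>c. (2 * sgn (1 - c) * sqrt \<bar>1 - c\<bar> - 2 * sgn (0 - c) * sqrt \<bar>0 - c\<bar> :: real))"
  have B: "(B has_integral (I s + I (s + 1) + I (s - 1))) {0..1}"
    unfolding B_def I_def by (intro has_integral_add has_integral_inverse_sqrt_dist)
  have I: "I c \<le> 12" if "-1 \<le> c" "c \<le> 2" for c
  proof -
    have b: "2 * sgn y * sqrt \<bar>y\<bar> \<le> 6" "- 6 \<le> 2 * sgn y * sqrt \<bar>y\<bar>" if "\<bar>y\<bar> \<le> 9" for y :: real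
    proof -
      have q: "sqrt \<bar>y\<bar> \<le> 3" "0 \<le> sqrt \<bar>y\<bar>" using that by (auto intro!: real_le_lsqrt)
      have "\<bar>sgn y * sqrt \<bar>y\<bar>\<bar> \<le> 1 * 3"
        unfolding abs_mult by (intro mult_mono) (use q in \<open>auto simp: abs_sgn_eq\<close>)
      thus "2 * sgn y * sqrt \<bar>y\<bar> \<le> 6" "- 6 \<le> 2 * sgn y * sqrt \<bar>y\<bar>" by linarith+
    qed
    show ?thesis unfolding I_def using b(1)[of "1 - c"] b(2)[of "0 - c"] that by linarith
  qed
  \<comment> \<open>At the three singular parameters the bound B may be too small, because 1 / 0 =
    0; setting the integrand to 0 there does not affect the integral.\<close>
  define f where "f = (\<lambda>t. if t \<in> {s, s + 1, s - 1} then 0 else 1 / sqrt (norm (circlepath 0 r t - a)))"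
  have cont: "continuous_on (sphere 0 r) (\<lambda>z. 1 / sqrt (norm (z - a)))"
    using a by (auto intro!: continuous_intros)
  have int: "((\<lambda>t. 1 / sqrt (norm (circlepath 0 r t - a))) has_integral circle_mean r (\<lambda>z. 1 / sqrt (norm (z - a)))) {0..1}"
    unfolding circle_mean_def using circle_mean_integrable[OF cont] r by (intro integrable_integral) auto
  have "(f has_integral circle_mean r (\<lambda>z. 1 / sqrt (norm (z - a)))) {0..1}"
    by (rule has_integral_spike_finite[OF _ _ int, where S = "{s, s + 1, s - 1}"]) (auto simp: f_def)
  hence "circle_mean r (\<lambda>z. 1 / sqrt (norm (z - a))) \<le> I s + I (s + 1) + I (s - 1)"
  proof (rule has_integral_le[OF _ B])
    fix t :: real assume t: "t \<in> {0..1}"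
    show "f t \<le> B t"
    proof (cases "t \<in> {s, s + 1, s - 1}")
      case True
      thus ?thesis by (auto simp: f_def B_def)
    next
      case False
      thus ?thesis
        using inverse_sqrt_norm_circlepath_le[OF r s(1,2), of t "norm a"] t s(3)
        by (auto simp: f_def B_def)
    qed
  qed
  also have "\<dots> \<le> 36" using I[of s] I[of "s + 1"] I[of "s - 1"] s by simp
  finally show ?thesis .
qed

text \<open>Jensen's inequality for the concave ln, by comparison with its tangent at A: ln x \<le>
  ln A + x / A - 1. The square root, paid for with the factor 2, is taken because for h'/h only the
  mean of the square root can be bounded uniformly.\<close>

lemma circle_mean_ln_le_ln_circle_mean_sqrt:
  fixes \<phi> :: "complex \<Rightarrow> real"
  assumes cont: "continuous_on (sphere 0 r) \<phi>" and nn: "\<And>z. norm z = r \<Longrightarrow> 0 \<le> \<phi> z" and r: "0 \<le> r"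
  shows "circle_mean r (\<lambda>z. ln (max 1 (\<phi> z))) \<le> 2 * ln (1 + circle_mean r (\<lambda>z. sqrt (\<phi> z)))"
proof -
  define A where "A = 1 + circle_mean r (\<lambda>z. sqrt (\<phi> z))"
  have conts: "continuous_on (sphere 0 r) (\<lambda>z. sqrt (\<phi> z))" by (intro continuous_intros cont)
  have A: "A \<ge> 1" unfolding A_def using circle_mean_nonneg[OF _ r conts] nn by simp
  hence A0: "A \<noteq> 0" by auto
  have "circle_mean r (\<lambda>z. ln (max 1 (\<phi> z))) \<le> circle_mean r (\<lambda>z. 2 * (ln A - 1 + 1 / A) + (2 / A) * sqrt (\<phi> z))"
  proof (rule circle_mean_mono)
    fix z :: complex assume z: "norm z = r"
    have "sqrt (max 1 (\<phi> z)) \<le> 1 + sqrt (\<phi> z)" using nn[OF z] by (auto simp: max_def)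
    hence "ln (sqrt (max 1 (\<phi> z))) \<le> ln (1 + sqrt (\<phi> z))"
      by (subst ln_le_cancel_iff) (use nn[OF z] in \<open>auto simp: add_pos_nonneg\<close>)
    hence "ln (max 1 (\<phi> z)) \<le> 2 * ln (1 + sqrt (\<phi> z))"
      by (simp add: ln_sqrt)
    also have "ln (1 + sqrt (\<phi> z)) = ln A + ln ((1 + sqrt (\<phi> z)) / A)"
    proof -
      have "0 < 1 + sqrt (\<phi> z)" using nn[OF z] by (auto simp: add_pos_nonneg)
      thus ?thesis using A by (subst ln_div) auto
    qed
    also have "ln ((1 + sqrt (\<phi> z)) / A) \<le> (1 + sqrt (\<phi> z)) / A - 1"
      using A nn[OF z] by (intro ln_le_minus_one divide_pos_pos) (auto simp: add_pos_nonneg)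
    finally show "ln (max 1 (\<phi> z)) \<le> 2 * (ln A - 1 + 1 / A) + (2 / A) * sqrt (\<phi> z)"
      by (simp add: algebra_simps add_divide_distrib)
  next
    show "continuous_on (sphere 0 r) (\<lambda>z. ln (max 1 (\<phi> z)))"
      by (intro continuous_intros cont) (auto simp: max_def)
  qed (use r A0 in \<open>auto intro!: continuous_intros cont\<close>)
  also have "\<dots> = 2 * (ln A - 1 + 1 / A) + (2 / A) * circle_mean r (\<lambda>z. sqrt (\<phi> z))"
  proof -
    have "circle_mean r (\<lambda>z. 2 * (ln A - 1 + 1 / A) + (2 / A) * sqrt (\<phi> z)) =
      circle_mean r (\<lambda>z. 2 * (ln A - 1 + 1 / A)) + circle_mean r (\<lambda>z. (2 / A) * sqrt (\<phi> z))"
      by (rule circle_mean_add) (use r in \<open>auto intro!: continuous_on_mult_left conts simp del: times_divide_eq_left\<close>)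
    thus ?thesis unfolding circle_mean_cmult[of r "2 / A"] circle_mean_const .
  qed
  also have "circle_mean r (\<lambda>z. sqrt (\<phi> z)) = A - 1" by (simp add: A_def)
  also have "2 * (ln A - 1 + 1 / A) + (2 / A) * (A - 1) = 2 * ln A"
    using A0 by (simp add: field_simps)
  finally show ?thesis by (simp add: A_def)
qed

section \<open>Zeros and poles in a disc\<close>

text \<open>"Not identically zero", in a form that survives junk values on a sparse set. By the
  identity theorem it is the exact alternative to vanishing off a sparse set.\<close>

definition mero_nz :: "(complex \<Rightarrow> complex) \<Rightarrow> bool" where
  "mero_nz h \<longleftrightarrow> h meromorphic_on UNIV \<and> (\<forall>\<^sub>\<approx>z\<in>UNIV. h z \<noteq> 0)"

text \<open>Besides zeros and poles this contains points with a removable singularity or a wrong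
  value, as they occur for derivatives and quotients. Their order may be 0, but circles of
  integration must avoid them too.\<close>

definition irregular_points :: "(complex \<Rightarrow> complex) \<Rightarrow> complex set" where
  "irregular_points h = {z. \<not> (h analytic_on {z} \<and> h z \<noteq> 0)}"

lemma mero_nz_meromorphic: "mero_nz h \<Longrightarrow> h meromorphic_on A"
  by (auto simp: mero_nz_def intro: meromorphic_on_subset)

lemma mero_nz_iff_frequently:
  assumes "h meromorphic_on UNIV" "\<exists>\<^sub>F z in at z0. h z \<noteq> 0"
  shows "mero_nz h"
  unfolding mero_nz_def
proof (intro conjI assms)
  have "\<not> eventually (\<lambda>z. h z = 0) (cosparse UNIV)"
    using assms(2) eventually_cosparse_imp_eventually_at[of "\<lambda>z. h z = 0" UNIV z0 UNIV]
    by (auto simp: frequently_def)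
  thus "\<forall>\<^sub>\<approx>z\<in>UNIV. h z \<noteq> 0"
    using meromorphic_imp_constant_or_avoid[OF assms(1), of 0] by auto
qed

lemma mero_nz_or_0:
  assumes "h meromorphic_on UNIV"
  shows "mero_nz h \<or> (\<forall>\<^sub>\<approx>z\<in>UNIV. h z = 0)"
  using meromorphic_imp_constant_or_avoid[OF assms, of 0] assms by (auto simp: mero_nz_def)

lemma mero_nz_eventually:
  assumes "mero_nz h"
  shows "\<forall>\<^sub>F z in at z0. h z \<noteq> 0"
  using assms eventually_cosparse_imp_eventually_at[of "\<lambda>z. h z \<noteq> 0" UNIV z0 UNIV]
  by (auto simp: mero_nz_def)

lemma mero_nz_frequently:
  assumes "mero_nz h"
  shows "\<exists>\<^sub>F z in at z0. h z \<noteq> 0"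
  using mero_nz_eventually[OF assms] by (intro eventually_frequently) auto

lemma mero_nz_cong:
  assumes "mero_nz h" "\<forall>\<^sub>\<approx>z\<in>UNIV. h z = g z"
  shows "mero_nz g"
proof -
  have "g meromorphic_on UNIV" using assms meromorphic_on_cong'[OF assms(2)] by (auto simp: mero_nz_def)
  moreover have "\<forall>\<^sub>\<approx>z\<in>UNIV. h z \<noteq> 0" using assms by (simp add: mero_nz_def)
  with assms(2) have "\<forall>\<^sub>\<approx>z\<in>UNIV. g z \<noteq> 0" by eventually_elim auto
  ultimately show ?thesis by (simp add: mero_nz_def)
qed

lemma mero_nz_const: "c \<noteq> 0 \<Longrightarrow> mero_nz (\<lambda>_. c)"
  by (auto simp: mero_nz_def)

lemma mero_nz_mult: "mero_nz f \<Longrightarrow> mero_nz g \<Longrightarrow> mero_nz (\<lambda>z. f z * g z)"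
  unfolding mero_nz_def by (auto intro!: meromorphic_intros elim: eventually_elim2)

lemma mero_nz_inverse: "mero_nz f \<Longrightarrow> mero_nz (\<lambda>z. inverse (f z))"
  unfolding mero_nz_def by (auto intro!: meromorphic_intros)

lemma mero_nz_divide: "mero_nz f \<Longrightarrow> mero_nz g \<Longrightarrow> mero_nz (\<lambda>z. f z / g z)"
  using mero_nz_mult[OF _ mero_nz_inverse, of f g] by (simp add: divide_inverse)

lemma mero_nz_power: "mero_nz f \<Longrightarrow> mero_nz (\<lambda>z. f z ^ n)"
  by (induction n) (auto intro: mero_nz_mult mero_nz_const)

lemma sparse_irregular_points:
  assumes "mero_nz h"
  shows "irregular_points h sparse_in UNIV"
proof -
  have "\<forall>\<^sub>\<approx>z\<in>UNIV. h analytic_on {z}"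
    using assms by (intro meromorphic_on_imp_analytic_cosparse mero_nz_meromorphic)
  moreover have "\<forall>\<^sub>\<approx>z\<in>UNIV. h z \<noteq> 0" using assms by (simp add: mero_nz_def)
  ultimately have "\<forall>\<^sub>\<approx>z\<in>UNIV. h analytic_on {z} \<and> h z \<noteq> 0" by eventually_elim auto
  thus ?thesis by (simp add: eventually_cosparse irregular_points_def)
qed

lemma finite_irregular_points:
  assumes "mero_nz h" "bounded B"
  shows "finite (irregular_points h \<inter> B)"
proof -
  have "finite (closure B \<inter> irregular_points h)"
    by (rule sparse_in_compact_finite[OF sparse_in_subset[OF sparse_irregular_points[OF assms(1)]]])
       (use assms in auto)
  thus ?thesis by (rule finite_subset[rotated]) (use closure_subset in auto)
qed

lemma countable_irregular_points: "mero_nz h \<Longrightarrow> countable (irregular_points h)"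
  using sparse_imp_countable[of UNIV "irregular_points h"] sparse_irregular_points by auto

lemma zorder_not_irregular_points: "z \<notin> irregular_points h \<Longrightarrow> zorder h z = 0"
  unfolding irregular_points_def by (auto intro: zorder_eq_0I)

lemma analytic_nonzero_of_zorder_0:
  assumes "mero_nz h" "h nicely_meromorphic_on UNIV" "zorder h z = 0"
  shows "z \<notin> irregular_points h"
proof -
  have np: "\<not> is_pole h z"
    using isolated_pole_imp_neg_zorder[of h z] assms
    by (metis less_irrefl meromorphic_at_iff mero_nz_meromorphic)
  have an: "h analytic_on {z}"
    using nicely_meromorphic_on_imp_analytic_at[OF assms(2)] np by auto
  have "h z \<noteq> 0" using zorder_eq_0_iff[OF an mero_nz_frequently[OF assms(1)]] assms(3) by simp
  with an show ?thesis by (simp add: irregular_points_def)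
qed

lemma cball_subset_open_ball:
  fixes S :: "complex set"
  assumes "open S" "cball 0 R \<subseteq> S" "0 < R"
  obtains R' where "R < R'" "ball 0 R' \<subseteq> S"
proof -
  obtain e where e: "0 < e" "(\<Union>x\<in>cball 0 R. ball x e) \<subseteq> S"
    using compact_subset_open_imp_ball_epsilon_subset[OF _ assms(1,2)] by auto
  have "ball 0 (R + e) \<subseteq> S"
  proof
    fix z :: complex assume z: "z \<in> ball 0 (R + e)"
    show "z \<in> S"
    proof (cases "norm z \<le> R")
      case True
      thus ?thesis using assms by auto
    next
      case False
      hence nz: "norm z > 0" using assms by linarith
      define w where "w = of_real (R / norm z) * z"
      have "norm w = R" using nz assms by (simp add: w_def norm_mult norm_divide)
      moreover have "z - w = of_real (1 - R / norm z) * z" by (simp add: w_def algebra_simps)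
      hence "norm (z - w) = \<bar>1 - R / norm z\<bar> * norm z" by (simp only: norm_mult norm_of_real)
      hence "norm (z - w) = norm z - R" using nz False assms by (simp add: left_diff_distrib)
      ultimately have "w \<in> cball 0 R" "z \<in> ball w e" using z by (auto simp: dist_norm norm_minus_commute)
      thus ?thesis using e(2) by blast
    qed
  qed
  with e(1) show ?thesis using that[of "R + e"] by auto
qed

lemma zorder_powi_linear: "zorder (\<lambda>z. (z - a) powi n) w = (if w = a then n else 0)"
proof (cases "w = a")
  case True
  have "zorder (\<lambda>z. (z - a) powi n) a = n"
    by (rule zorder_eqI[of UNIV _ "\<lambda>_. 1"]) auto
  thus ?thesis using True by simp
next
  case False
  hence "zorder (\<lambda>z. (z - a) powi n) w = 0"
    by (intro zorder_eq_0I) (auto intro!: analytic_intros)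
  thus ?thesis using False by simp
qed

lemma mero_nz_powi_linear: "mero_nz (\<lambda>z. (z - a) powi n)"
proof (rule mero_nz_iff_frequently)
  show "\<exists>\<^sub>F z in at a. (z - a) powi n \<noteq> 0"
  proof (rule eventually_frequently)
    have "\<forall>\<^sub>F z in at a. z \<noteq> a" by (simp add: eventually_at_filter)
    thus "\<forall>\<^sub>F z in at a. (z - a) powi n \<noteq> 0" by eventually_elim auto
  qed auto
qed (auto intro!: meromorphic_intros)

lemma mero_nz_prod: "(\<And>a. a \<in> A \<Longrightarrow> mero_nz (f a)) \<Longrightarrow> mero_nz (\<lambda>z. \<Prod>a\<in>A. f a z)"
  by (induction A rule: infinite_finite_induct) (auto intro: mero_nz_const mero_nz_mult)

text \<open>Division by the finite product cancels all orders in the closed disc. Once the remaining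
  singularities are removed, the quotient is analytic and zero-free there, and by compactness in a
  larger open disc; this margin makes its logarithm continuous up to the circle.\<close>

lemma factorization_disc:
  assumes h: "mero_nz h" and R: "0 < R" and regular_radius: "sphere 0 R \<inter> irregular_points h = {}"
  obtains g R' where "R < R'" "g holomorphic_on ball 0 R'" "\<And>z. z \<in> ball 0 R' \<Longrightarrow> g z \<noteq> 0"
    "\<And>z. z \<notin> irregular_points h \<Longrightarrow> z \<in> ball 0 R' \<Longrightarrow> h z = g z * (\<Prod>a\<in>irregular_points h \<inter> ball 0 R. (z - a) powi zorder h a)"
proof -
  define A where "A = irregular_points h \<inter> ball 0 R"
  have fin: "finite A" unfolding A_def by (intro finite_irregular_points h) auto
  define p where "p = (\<lambda>z. \<Prod>a\<in>A. (z - a) powi zorder h a)"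
  have p: "mero_nz p" unfolding p_def by (intro mero_nz_prod mero_nz_powi_linear)
  have zp: "zorder p z = (if z \<in> A then zorder h z else 0)" for z
  proof -
    have "zorder p z = (\<Sum>a\<in>A. zorder (\<lambda>z. (z - a) powi zorder h a) z)"
      unfolding p_def
      by (rule zorder_prod) (use p in \<open>auto intro!: mero_nz_meromorphic[OF mero_nz_powi_linear] mero_nz_eventually simp: p_def\<close>)
    also have "\<dots> = (\<Sum>a\<in>A. if z = a then zorder h a else 0)"
      by (simp add: zorder_powi_linear)
    finally show ?thesis using fin by simp
  qed
  define q0 where "q0 = (\<lambda>z. h z / p z)"
  have q0: "mero_nz q0" unfolding q0_def by (intro mero_nz_divide h p)
  define q where "q = remove_sings q0"
  have qn: "q nicely_meromorphic_on UNIV"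
    unfolding q_def by (intro remove_sings_nicely_meromorphic mero_nz_meromorphic q0)
  have ev: "\<forall>\<^sub>\<approx>z\<in>UNIV. q z = q0 z"
    unfolding q_def by (intro eventually_remove_sings_eq mero_nz_meromorphic q0)
  have q: "mero_nz q"
    by (rule mero_nz_cong[OF q0]) (use ev in eventually_elim, auto)
  have zq: "zorder q z = zorder h z - zorder p z" for z
  proof -
    have "zorder q z = zorder q0 z"
      by (rule zorder_cong) (use eventually_cosparse_imp_eventually_at[OF ev, of z] in auto)
    also have "\<dots> = zorder h z - zorder p z"
      unfolding q0_def by (rule zorder_divide) (use h p in \<open>auto intro: mero_nz_meromorphic mero_nz_frequently\<close>)
    finally show ?thesis .
  qed
  have "cball 0 R \<subseteq> - irregular_points q"
  proof
    fix z :: complex assume "z \<in> cball 0 R"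
    hence "z \<in> A \<or> z \<notin> irregular_points h" using regular_radius by (auto simp: A_def)
    hence "zorder q z = 0" using zq zp zorder_not_irregular_points[of z h] by auto
    thus "z \<in> - irregular_points q" using analytic_nonzero_of_zorder_0[OF q qn] by auto
  qed
  moreover have "open (- irregular_points q)"
    using sparse_in_UNIV_imp_closed[OF sparse_irregular_points[OF q]] by (simp add: open_Compl)
  ultimately obtain R' where R': "R < R'" "ball 0 R' \<subseteq> - irregular_points q"
    using cball_subset_open_ball R by metis
  have an: "q analytic_on {z}" "q z \<noteq> 0" if "z \<in> ball 0 R'" for z
    using R'(2) that by (auto simp: irregular_points_def)
  show ?thesis
  proof
    show "q holomorphic_on ball 0 R'"
      using an by (meson analytic_imp_holomorphic analytic_on_analytic_at)
    fix z :: complex assume z: "z \<notin> irregular_points h" "z \<in> ball 0 R'"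
    have pz: "p analytic_on {z}" "p z \<noteq> 0"
      unfolding p_def using z fin by (auto intro!: analytic_intros simp: A_def)
    hence "q z = q0 z" unfolding q_def
      by (intro remove_sings_at_analytic) (use z in \<open>auto simp: q0_def irregular_points_def intro!: analytic_intros\<close>)
    thus "h z = q z * (\<Prod>a\<in>irregular_points h \<inter> ball 0 R. (z - a) powi zorder h a)"
      using pz by (simp add: q0_def p_def A_def)
  qed (use R' an in auto)
qed

text \<open>
  The usual kernel is \<open>ln (r / norm z)\<close>. Truncating at \<open>norm z = 1\<close> changes the counting function
  by \<open>O(1)\<close> where it is used, the values on the unit disc being weighted by \<open>ln r\<close>; a zero or pole
  at the origin then needs no separate term.
\<close>

definition log_kernel :: "real \<Rightarrow> complex \<Rightarrow> real" where
  "log_kernel r z = ln (max 1 (r / max 1 (norm z)))"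

definition nev_N :: "real \<Rightarrow> (complex \<Rightarrow> real) \<Rightarrow> real" where
  "nev_N r \<nu> = (\<Sum>z\<in>{z. \<nu> z \<noteq> 0 \<and> norm z \<le> r}. \<nu> z * log_kernel r z)"

definition loc_fin :: "(complex \<Rightarrow> real) \<Rightarrow> bool" where
  "loc_fin \<nu> \<longleftrightarrow> {z. \<nu> z \<noteq> 0} sparse_in UNIV"

definition mero_ord :: "(complex \<Rightarrow> complex) \<Rightarrow> complex \<Rightarrow> real" where
  "mero_ord h z = real_of_int (zorder h z)"

lemma log_kernel_nonneg: "0 \<le> log_kernel r z"
  by (simp add: log_kernel_def)

lemma log_kernel_le: "1 \<le> r \<Longrightarrow> log_kernel r z \<le> ln r"
proof -
  assume r: "1 \<le> r"
  have "r / max 1 (norm z) \<le> r / 1" using r by (intro divide_left_mono) auto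
  thus ?thesis unfolding log_kernel_def using r by (subst ln_le_cancel_iff) auto
qed

lemma log_kernel_outside: "r \<le> norm z \<Longrightarrow> 1 \<le> r \<Longrightarrow> log_kernel r z = 0"
proof -
  assume "r \<le> norm z" "1 \<le> r"
  hence "r / max 1 (norm z) \<le> 1" by (subst divide_le_eq_1_pos) auto
  thus ?thesis by (simp add: log_kernel_def max_def)
qed

lemma log_kernel_inside: "norm z < r \<Longrightarrow> 1 \<le> r \<Longrightarrow> log_kernel r z = ln r - ln (max 1 (norm z))"
proof -
  assume "norm z < r" "1 \<le> r"
  hence "1 \<le> r / max 1 (norm z)" by (subst le_divide_eq_1_pos) auto
  thus ?thesis using \<open>1 \<le> r\<close> by (simp add: log_kernel_def max_absorb2 ln_div)
qed

lemma loc_fin_finite: "loc_fin \<nu> \<Longrightarrow> finite {z. \<nu> z \<noteq> 0 \<and> norm z \<le> r}"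
proof -
  assume "loc_fin \<nu>"
  hence "finite (cball 0 r \<inter> {z. \<nu> z \<noteq> 0})" unfolding loc_fin_def
    by (intro sparse_in_compact_finite[OF sparse_in_subset]) auto
  thus ?thesis by (rule finite_subset[rotated]) auto
qed

text \<open>The kernel vanishes on and outside the circle of radius r, so the sum may run over any
  finite set containing the support in the disc. Several divisors can thus be summed over one common
  set.\<close>

lemma nev_N_eq_sum:
  assumes "finite S" "{z. \<nu> z \<noteq> 0 \<and> norm z \<le> r} \<subseteq> S" "1 \<le> r"
  shows "nev_N r \<nu> = (\<Sum>z\<in>S. \<nu> z * log_kernel r z)"
  unfolding nev_N_def
  by (rule sum.mono_neutral_left) (use assms in \<open>auto intro: log_kernel_outside\<close>)

lemma nev_N_add:
  assumes "loc_fin \<nu>" "loc_fin \<mu>" "1 \<le> r"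
  shows "nev_N r (\<lambda>z. \<nu> z + \<mu> z) = nev_N r \<nu> + nev_N r \<mu>"
proof -
  define S where "S = {z. \<nu> z \<noteq> 0 \<and> norm z \<le> r} \<union> {z. \<mu> z \<noteq> 0 \<and> norm z \<le> r}"
  have S: "finite S" unfolding S_def using assms loc_fin_finite by auto
  have "nev_N r (\<lambda>z. \<nu> z + \<mu> z) = (\<Sum>z\<in>S. (\<nu> z + \<mu> z) * log_kernel r z)"
    by (rule nev_N_eq_sum[OF S _ assms(3)]) (auto simp: S_def)
  also have "\<dots> = (\<Sum>z\<in>S. \<nu> z * log_kernel r z) + (\<Sum>z\<in>S. \<mu> z * log_kernel r z)"
    by (simp add: algebra_simps sum.distrib)
  also have "\<dots> = nev_N r \<nu> + nev_N r \<mu>"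
    using nev_N_eq_sum[OF S _ assms(3), of \<nu>] nev_N_eq_sum[OF S _ assms(3), of \<mu>] by (auto simp: S_def)
  finally show ?thesis .
qed

lemma nev_N_cmult: "nev_N r (\<lambda>z. c * \<nu> z) = c * nev_N r \<nu>"
  by (cases "c = 0") (auto simp: nev_N_def sum_distrib_left algebra_simps)

lemma nev_N_mono:
  assumes "loc_fin \<nu>" "loc_fin \<mu>" "1 \<le> r" "\<And>z. \<nu> z \<le> \<mu> z"
  shows "nev_N r \<nu> \<le> nev_N r \<mu>"
proof -
  define S where "S = {z. \<nu> z \<noteq> 0 \<and> norm z \<le> r} \<union> {z. \<mu> z \<noteq> 0 \<and> norm z \<le> r}"
  have S: "finite S" unfolding S_def using assms loc_fin_finite by auto
  have "(\<Sum>z\<in>S. \<nu> z * log_kernel r z) \<le> (\<Sum>z\<in>S. \<mu> z * log_kernel r z)"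
    by (intro sum_mono mult_right_mono assms log_kernel_nonneg)
  thus ?thesis
    using nev_N_eq_sum[OF S _ assms(3), of \<nu>] nev_N_eq_sum[OF S _ assms(3), of \<mu>] by (auto simp: S_def)
qed

lemma nev_N_nonneg: "(\<And>z. 0 \<le> \<nu> z) \<Longrightarrow> 0 \<le> nev_N r \<nu>"
  unfolding nev_N_def by (intro sum_nonneg mult_nonneg_nonneg log_kernel_nonneg)

lemma nev_N_finite_le:
  assumes "finite {z. \<nu> z \<noteq> 0}" "1 \<le> r"
  shows "nev_N r \<nu> \<le> (\<Sum>z\<in>{z. \<nu> z \<noteq> 0}. \<bar>\<nu> z\<bar>) * ln r"
proof -
  have "nev_N r \<nu> = (\<Sum>z\<in>{z. \<nu> z \<noteq> 0}. \<nu> z * log_kernel r z)"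
    by (rule nev_N_eq_sum) (use assms in auto)
  also have "\<dots> \<le> (\<Sum>z\<in>{z. \<nu> z \<noteq> 0}. \<bar>\<nu> z\<bar> * ln r)"
    by (intro sum_mono mult_mono log_kernel_nonneg log_kernel_le) (use assms in auto)
  finally show ?thesis by (simp add: sum_distrib_right)
qed

lemma loc_fin_comp: "loc_fin \<nu> \<Longrightarrow> F 0 = 0 \<Longrightarrow> loc_fin (\<lambda>z. F (\<nu> z))"
  unfolding loc_fin_def by (erule sparse_in_subset2) auto

lemma loc_fin_comp2: "loc_fin \<nu> \<Longrightarrow> loc_fin \<mu> \<Longrightarrow> F 0 0 = 0 \<Longrightarrow> loc_fin (\<lambda>z. F (\<nu> z) (\<mu> z))"
  unfolding loc_fin_def by (rule sparse_in_subset2[OF sparse_in_union']) (assumption+, auto)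

lemma loc_fin_add: "loc_fin \<nu> \<Longrightarrow> loc_fin \<mu> \<Longrightarrow> loc_fin (\<lambda>z. \<nu> z + \<mu> z)"
  using loc_fin_comp2[of \<nu> \<mu> "(+)"] by simp

lemma loc_fin_cmult: "loc_fin \<nu> \<Longrightarrow> loc_fin (\<lambda>z. c * \<nu> z)"
  using loc_fin_comp[of \<nu> "(*) c"] by simp

lemma loc_fin_ord: "mero_nz h \<Longrightarrow> loc_fin (mero_ord h)"
  unfolding loc_fin_def
  by (rule sparse_in_subset2[OF sparse_irregular_points]) (use zorder_not_irregular_points in \<open>auto simp: mero_ord_def\<close>)

lemma loc_fin_finite_supp: "finite {z. \<nu> z \<noteq> 0} \<Longrightarrow> loc_fin \<nu>"
  unfolding loc_fin_def by (rule finite_imp_sparse)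

lemma ln_power_int_norm: "0 < x \<Longrightarrow> ln (x powi n) = real_of_int n * ln (x :: real)"
  by (cases n rule: int_cases4) (auto simp: power_int_minus ln_inverse ln_realpow)

lemma prod_powi_zorder_norm:
  fixes z :: complex
  assumes "finite A" "\<And>a. a \<in> A \<Longrightarrow> z \<noteq> a"
  shows "ln (norm (\<Prod>a\<in>A. (z - a) powi n a)) = (\<Sum>a\<in>A. real_of_int (n a) * ln (norm (z - a)))"
proof -
  have "ln (norm (\<Prod>a\<in>A. (z - a) powi n a)) = ln (\<Prod>a\<in>A. norm (z - a) powi n a)"
    by (simp only: prod_norm[symmetric] norm_power_int)
  also have "\<dots> = (\<Sum>a\<in>A. ln (norm (z - a) powi n a))"
    by (rule ln_prod) (use assms in auto)
  also have "\<dots> = (\<Sum>a\<in>A. real_of_int (n a) * ln (norm (z - a)))"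
    by (rule sum.cong) (use assms in \<open>auto simp: ln_power_int_norm\<close>)
  finally show ?thesis .
qed

section \<open>Jensen's formula\<close>

definition regular_radius :: "(complex \<Rightarrow> complex) \<Rightarrow> real \<Rightarrow> bool" where
  "regular_radius h r \<longleftrightarrow> sphere 0 r \<inter> irregular_points h = {}"

lemma regular_radius_analytic: "regular_radius h r \<Longrightarrow> norm z = r \<Longrightarrow> h analytic_on {z}"
  and regular_radius_nonzero: "regular_radius h r \<Longrightarrow> norm z = r \<Longrightarrow> h z \<noteq> 0"
  by (auto simp: regular_radius_def irregular_points_def)

lemma regular_radius_continuous: "regular_radius h r \<Longrightarrow> continuous_on (sphere 0 r) h"
  by (intro continuous_at_imp_continuous_on ballI analytic_at_imp_isCont) (auto dest: regular_radius_analytic)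

definition nev_m :: "real \<Rightarrow> (complex \<Rightarrow> complex) \<Rightarrow> real" where
  "nev_m r h = circle_mean r (\<lambda>z. ln (max 1 (norm (h z))))"

lemma continuous_lnmax: "continuous_on S h \<Longrightarrow> continuous_on S (\<lambda>z. ln (max 1 (norm (h z))))"
  by (intro continuous_intros) auto

lemma ln_max_1_diff:
  assumes "0 < (x :: real)"
  shows "ln (max 1 x) - ln (max 1 (inverse x)) = ln x" "ln (max 1 x) + ln (max 1 (inverse x)) = \<bar>ln x\<bar>"
proof -
  show "ln (max 1 x) - ln (max 1 (inverse x)) = ln x"
    using assms by (cases "x \<ge> 1") (auto simp: max_def ln_inverse inverse_le_1_iff one_le_inverse_iff)
  show "ln (max 1 x) + ln (max 1 (inverse x)) = \<bar>ln x\<bar>"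
    using assms by (cases "x \<ge> 1") (auto simp: max_def ln_inverse inverse_le_1_iff one_le_inverse_iff)
qed

lemma circle_mean_ln_eq_m:
  assumes "regular_radius h r" "0 \<le> r"
  shows "circle_mean r (\<lambda>z. ln (norm (h z))) = nev_m r h - nev_m r (\<lambda>z. inverse (h z))"
proof -
  have "circle_mean r (\<lambda>z. ln (norm (h z))) = circle_mean r (\<lambda>z. ln (max 1 (norm (h z))) - ln (max 1 (norm (inverse (h z)))))"
  proof (rule circle_mean_cong)
    fix z :: complex assume "norm z = r"
    hence "h z \<noteq> 0" using regular_radius_nonzero assms by blast
    thus "ln (norm (h z)) = ln (max 1 (norm (h z))) - ln (max 1 (norm (inverse (h z))))"
      using ln_max_1_diff[of "norm (h z)"] by (simp add: norm_inverse)
  qed fact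
  also have "\<dots> = nev_m r h - nev_m r (\<lambda>z. inverse (h z))"
    unfolding nev_m_def
    by (rule circle_mean_diff; (intro continuous_lnmax continuous_on_inverse)?)
       (use assms in \<open>auto intro: regular_radius_continuous dest: regular_radius_nonzero\<close>)
  finally show ?thesis .
qed

lemma circle_mean_ln_abs_eq_m:
  assumes "regular_radius h r" "0 \<le> r"
  shows "circle_mean r (\<lambda>z. \<bar>ln (norm (h z))\<bar>) = nev_m r h + nev_m r (\<lambda>z. inverse (h z))"
proof -
  have "circle_mean r (\<lambda>z. \<bar>ln (norm (h z))\<bar>) = circle_mean r (\<lambda>z. ln (max 1 (norm (h z))) + ln (max 1 (norm (inverse (h z)))))"
  proof (rule circle_mean_cong)
    fix z :: complex assume "norm z = r"
    hence "h z \<noteq> 0" using regular_radius_nonzero assms by blast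
    thus "\<bar>ln (norm (h z))\<bar> = ln (max 1 (norm (h z))) + ln (max 1 (norm (inverse (h z))))"
      using ln_max_1_diff[of "norm (h z)"] by (simp add: norm_inverse)
  qed fact
  also have "\<dots> = nev_m r h + nev_m r (\<lambda>z. inverse (h z))"
    unfolding nev_m_def
    by (rule circle_mean_add; (intro continuous_lnmax continuous_on_inverse)?)
       (use assms in \<open>auto intro: regular_radius_continuous dest: regular_radius_nonzero\<close>)
  finally show ?thesis .
qed

text \<open>The mean of ln |h| is read off from the factorization in the disc of radius r: the
  zero-free factor g contributes ln |g 0|, and each zero or pole its order times ln r. What remains
  is to see that the difference to the counting function does not depend on r.\<close>

theorem jensen_formula:
  assumes h: "mero_nz h"
  obtains C where "\<And>r. 1 \<le> r \<Longrightarrow> regular_radius h r \<Longrightarrow> nev_m r h - nev_m r (\<lambda>z. inverse (h z)) = nev_N r (mero_ord h) + C"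
proof -
  define n where "n = zorder h"
  define P where "P = zor_poly h 0"
  obtain \<rho> where \<rho>: "0 < \<rho>" "P holomorphic_on cball 0 \<rho>" "P 0 \<noteq> 0"
    "\<And>w. w \<in> cball 0 \<rho> - {0} \<Longrightarrow> h w = P w * w powi n 0"
  proof -
    have "h meromorphic_on {0}" by (rule mero_nz_meromorphic[OF h])
    hence "isolated_singularity_at h 0" "not_essential h 0" by (auto simp: meromorphic_at_iff)
    from zorder_exist[OF this mero_nz_frequently[OF h]] show ?thesis
      using that unfolding P_def n_def by fastforce
  qed
  define B where "B = irregular_points h \<inter> ball 0 1 - {0}"
  \<comment> \<open>The leading coefficient of h at 0, and the correction for truncating the kernel
    inside the unit disc.\<close>
  define C where "C = ln (norm (P 0)) + (\<Sum>a\<in>B. n a * (- ln (norm a)))"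
  have "nev_m r h - nev_m r (\<lambda>z. inverse (h z)) = nev_N r (mero_ord h) + C" if r: "1 \<le> r" "regular_radius h r" for r
  proof -
    define A where "A = irregular_points h \<inter> ball 0 r"
    have finA: "finite A" unfolding A_def by (intro finite_irregular_points h) auto
    obtain g R' where g: "r < R'" "g holomorphic_on ball 0 R'" "\<And>z. z \<in> ball 0 R' \<Longrightarrow> g z \<noteq> 0"
      "\<And>z. z \<notin> irregular_points h \<Longrightarrow> z \<in> ball 0 R' \<Longrightarrow> h z = g z * (\<Prod>a\<in>A. (z - a) powi n a)"
    proof -
      have "0 < r" "sphere 0 r \<inter> irregular_points h = {}" using r by (auto simp: regular_radius_def)
      from factorization_disc[OF h this] obtain g R' where "r < R'" "g holomorphic_on ball 0 R'"
        "\<And>z. z \<in> ball 0 R' \<Longrightarrow> g z \<noteq> 0"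
        "\<And>z. z \<notin> irregular_points h \<Longrightarrow> z \<in> ball 0 R' \<Longrightarrow>
           h z = g z * (\<Prod>a\<in>irregular_points h \<inter> ball 0 r. (z - a) powi zorder h a)"
        by metis
      thus ?thesis by (intro that[of R' g]) (simp_all add: A_def n_def)
    qed
    have ne: "norm a \<noteq> r" if "a \<in> A" for a using that by (auto simp: A_def)
    have contg: "continuous_on (sphere 0 r) g"
      by (rule continuous_on_subset[OF holomorphic_on_imp_continuous_on[OF g(2)]]) (use g(1) in auto)
    have gnz: "g z \<noteq> 0" if "norm z = r" for z using g(1,3) that by auto
    have "circle_mean r (\<lambda>z. ln (norm (h z))) = circle_mean r (\<lambda>z. ln (norm (g z)) + (\<Sum>a\<in>A. n a * ln (norm (z - a))))"
    proof (rule circle_mean_cong)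
      fix z :: complex assume z: "norm z = r"
      have "z \<notin> irregular_points h" using r(2) z by (auto simp: regular_radius_def)
      moreover have "z \<in> ball 0 R'" using z g(1) by auto
      ultimately have "norm (h z) = norm (g z) * norm (\<Prod>a\<in>A. (z - a) powi n a)"
        using g(4) by (simp add: norm_mult)
      moreover have za: "z \<noteq> a" if "a \<in> A" for a using ne[OF that] z by auto
      hence "(\<Prod>a\<in>A. (z - a) powi n a) \<noteq> 0" using finA by auto
      ultimately have "ln (norm (h z)) = ln (norm (g z)) + ln (norm (\<Prod>a\<in>A. (z - a) powi n a))"
        using gnz[OF z] by (simp add: ln_mult)
      thus "ln (norm (h z)) = ln (norm (g z)) + (\<Sum>a\<in>A. n a * ln (norm (z - a)))"
        using prod_powi_zorder_norm[OF finA za] by simp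
    qed (use r in auto)
    also have "\<dots> = circle_mean r (\<lambda>z. ln (norm (g z))) + circle_mean r (\<lambda>z. \<Sum>a\<in>A. n a * ln (norm (z - a)))"
      by (rule circle_mean_add) (use r contg gnz ne in \<open>auto intro!: continuous_intros\<close>)
    also have "circle_mean r (\<lambda>z. ln (norm (g z))) = ln (norm (g 0))"
      by (rule circle_mean_ln_norm_holomorphic[OF g(2)]) (use g r in auto)
    also have "circle_mean r (\<lambda>z. \<Sum>a\<in>A. n a * ln (norm (z - a))) = (\<Sum>a\<in>A. circle_mean r (\<lambda>z. n a * ln (norm (z - a))))"
      by (rule circle_mean_sum) (use r finA ne in \<open>auto intro!: continuous_intros\<close>)
    also have "\<dots> = (\<Sum>a\<in>A. n a * ln r)"
    proof (rule sum.cong)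
      fix a assume a: "a \<in> A"
      hence "norm a < r" by (auto simp: A_def)
      thus "circle_mean r (\<lambda>z. n a * ln (norm (z - a))) = n a * ln r"
        using circle_mean_ln_norm_linear[of r a] r by (simp add: circle_mean_cmult)
    qed auto
    finally have 1: "circle_mean r (\<lambda>z. ln (norm (h z))) = ln (norm (g 0)) + (\<Sum>a\<in>A. n a * ln r)" .
    \<comment> \<open>The factor g depends on r, the leading coefficient P 0 of h at the origin does
      not. Comparing the two factorizations near 0 expresses g 0 by P 0 and the orders in the
      disc.\<close>
    have P0: "P 0 = g 0 * (\<Prod>a\<in>A - {0}. (0 - a) powi n a)"
    proof (rule tendsto_unique)
      show "(P \<longlongrightarrow> P 0) (at 0)"
        using continuous_on_interior[OF holomorphic_on_imp_continuous_on[OF \<rho>(2)], of 0] \<rho>(1)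
        by (simp add: continuous_at isCont_def)
      have "isCont (\<lambda>z. g z * (\<Prod>a\<in>A - {0}. (z - a) powi n a)) 0"
        using continuous_on_interior[OF holomorphic_on_imp_continuous_on[OF g(2)], of 0] g(1) r
        by (intro continuous_intros) (auto)
      hence lim: "((\<lambda>z. g z * (\<Prod>a\<in>A - {0}. (z - a) powi n a)) \<longlongrightarrow> g 0 * (\<Prod>a\<in>A - {0}. (0 - a) powi n a)) (at 0)"
        by (simp add: isCont_def)
      have "\<forall>\<^sub>F z in at 0. z \<in> ball 0 \<rho> - {0}" using \<rho>(1) by (intro eventually_at_in_open) auto
      moreover have "\<forall>\<^sub>F z in at 0. z \<in> ball 0 R' - {0}" using g(1) r by (intro eventually_at_in_open) auto
      moreover have "\<forall>\<^sub>F z in at 0. z \<notin> irregular_points h"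
        using sparse_irregular_points[OF h] by (simp add: sparse_in_eventually_iff[of UNIV])
      ultimately have "\<forall>\<^sub>F z in at 0. P z = g z * (\<Prod>a\<in>A - {0}. (z - a) powi n a)"
      proof eventually_elim
        case (elim z)
        have pz: "(\<Prod>a\<in>A. (z - a) powi n a) = z powi n 0 * (\<Prod>a\<in>A - {0}. (z - a) powi n a)"
        proof (cases "0 \<in> A")
          case True
          thus ?thesis using finA by (subst prod.remove[of A 0]) auto
        next
          case False
          hence "0 \<notin> irregular_points h" using r by (auto simp: A_def)
          hence "n 0 = 0" unfolding n_def by (rule zorder_not_irregular_points)
          thus ?thesis using False by simp
        qed
        have "P z * z powi n 0 = g z * (\<Prod>a\<in>A. (z - a) powi n a)"
          using \<rho>(4)[of z] g(4)[of z] elim by auto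
        thus ?case using pz elim by auto
      qed
      from tendsto_cong[OF this] lim show "(P \<longlongrightarrow> g 0 * (\<Prod>a\<in>A - {0}. (0 - a) powi n a)) (at 0)"
        by simp
    qed auto
    have "g 0 \<noteq> 0" using g(1,3) r by auto
    hence 2: "ln (norm (P 0)) = ln (norm (g 0)) + (\<Sum>a\<in>A - {0}. n a * ln (norm a))"
      using prod_powi_zorder_norm[of "A - {0}" 0 n] finA \<rho>(3) unfolding P0
      by (simp add: norm_mult ln_mult)
    have "nev_N r (mero_ord h) = (\<Sum>a\<in>A. mero_ord h a * log_kernel r a)"
    proof (rule nev_N_eq_sum)
      show "{z. mero_ord h z \<noteq> 0 \<and> norm z \<le> r} \<subseteq> A"
        using zorder_not_irregular_points[of _ h] r(2) by (fastforce simp: mero_ord_def A_def regular_radius_def)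
    qed (use finA r in auto)
    also have "\<dots> = (\<Sum>a\<in>A. n a * ln r - n a * ln (max 1 (norm a)))"
      by (rule sum.cong) (use r in \<open>auto simp: A_def mero_ord_def n_def log_kernel_inside algebra_simps\<close>)
    finally have 3: "nev_N r (mero_ord h) = (\<Sum>a\<in>A. n a * ln r) - (\<Sum>a\<in>A. n a * ln (max 1 (norm a)))"
      by (simp add: sum_subtractf)
    have 4: "(\<Sum>a\<in>A. n a * ln (max 1 (norm a))) = (\<Sum>a\<in>A - {0}. n a * ln (max 1 (norm a)))"
      by (rule sum.mono_neutral_right) (use finA in auto)
    have 5: "(\<Sum>a\<in>A - {0}. n a * (ln (max 1 (norm a)) - ln (norm a))) = (\<Sum>a\<in>B. n a * (ln (max 1 (norm a)) - ln (norm a)))"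
      by (rule sum.mono_neutral_right) (use finA r in \<open>auto simp: A_def B_def max_def\<close>)
    also have "\<dots> = (\<Sum>a\<in>B. n a * (- ln (norm a)))"
      by (rule sum.cong) (auto simp: B_def max_def)
    finally have 6: "(\<Sum>a\<in>A - {0}. n a * ln (max 1 (norm a))) - (\<Sum>a\<in>A - {0}. n a * ln (norm a)) = (\<Sum>a\<in>B. n a * (- ln (norm a)))"
      by (simp add: sum_subtractf right_diff_distrib)
    have "nev_m r h - nev_m r (\<lambda>z. inverse (h z)) = circle_mean r (\<lambda>z. ln (norm (h z)))"
      using circle_mean_ln_eq_m[of h r] r by simp
    thus ?thesis unfolding 1 using 2 3 4 6 by (simp add: C_def)
  qed
  thus ?thesis by (rule that)
qed

section \<open>The characteristic function and the first main theorem\<close>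

definition nev_T :: "real \<Rightarrow> (complex \<Rightarrow> complex) \<Rightarrow> real" where
  "nev_T r h = nev_m r h + nev_N r (\<lambda>z. max 0 (- mero_ord h z))"

lemma nev_m_nonneg: "regular_radius h r \<Longrightarrow> 0 \<le> r \<Longrightarrow> 0 \<le> nev_m r h"
  unfolding nev_m_def by (intro circle_mean_nonneg continuous_lnmax regular_radius_continuous) auto

lemma loc_fin_pos_part: "loc_fin \<nu> \<Longrightarrow> loc_fin (\<lambda>z. max 0 (\<nu> z))"
  using loc_fin_comp[of \<nu> "max 0"] by simp

lemma loc_fin_neg_part: "loc_fin \<nu> \<Longrightarrow> loc_fin (\<lambda>z. max 0 (- \<nu> z))"
  using loc_fin_comp[of \<nu> "\<lambda>x. max 0 (- x)"] by simp

lemma nev_N_neg_part_nonneg: "0 \<le> nev_N r (\<lambda>z. max 0 (f z))"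
  by (intro nev_N_nonneg) auto

lemma nev_N_parts:
  assumes "loc_fin \<nu>" "1 \<le> r"
  shows "nev_N r \<nu> = nev_N r (\<lambda>z. max 0 (\<nu> z)) - nev_N r (\<lambda>z. max 0 (- \<nu> z))"
proof -
  have "nev_N r (\<lambda>z. max 0 (\<nu> z)) = nev_N r (\<lambda>z. \<nu> z + max 0 (- \<nu> z))"
    by (rule arg_cong[where f = "nev_N r"]) (auto simp: max_def fun_eq_iff)
  also have "\<dots> = nev_N r \<nu> + nev_N r (\<lambda>z. max 0 (- \<nu> z))"
    by (intro nev_N_add loc_fin_neg_part assms)
  finally show ?thesis by simp
qed

text \<open>The first two terms make up T(r, 1 / h), so this is the first main theorem for the value
  0.\<close>

lemma jensen_T:
  assumes h: "mero_nz h"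
  obtains K where "0 \<le> K" "\<And>r. 1 \<le> r \<Longrightarrow> regular_radius h r \<Longrightarrow>
    \<bar>nev_m r (\<lambda>z. inverse (h z)) + nev_N r (\<lambda>z. max 0 (mero_ord h z)) - nev_T r h\<bar> \<le> K"
proof -
  obtain C where C: "\<And>r. 1 \<le> r \<Longrightarrow> regular_radius h r \<Longrightarrow> nev_m r h - nev_m r (\<lambda>z. inverse (h z)) = nev_N r (mero_ord h) + C"
    using jensen_formula[OF h] by metis
  show ?thesis
  proof (rule that[of "\<bar>C\<bar>"])
    fix r assume r: "1 \<le> (r::real)" "regular_radius h r"
    show "\<bar>nev_m r (\<lambda>z. inverse (h z)) + nev_N r (\<lambda>z. max 0 (mero_ord h z)) - nev_T r h\<bar> \<le> \<bar>C\<bar>"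
      using C[OF r] nev_N_parts[OF loc_fin_ord[OF h] r(1)] by (simp add: nev_T_def)
  qed auto
qed

lemma nev_T_nonneg: "regular_radius h r \<Longrightarrow> 1 \<le> r \<Longrightarrow> 0 \<le> nev_T r h"
  unfolding nev_T_def by (intro add_nonneg_nonneg nev_m_nonneg nev_N_neg_part_nonneg) auto

section \<open>The logarithmic derivative\<close>

text \<open>If x \<le> B and B \<ge> 0, then |x| \<le> 2 B - x. So the mean of the absolute value is
  controlled by an upper bound for ln |z - a| together with the mean of ln |z - a|, which is at
  least ln r \<ge> 0.\<close>

lemma circle_mean_abs_ln_linear_le:
  assumes r: "1 \<le> r" "r \<le> M" and a: "norm a \<noteq> r" "norm a \<le> M"
  shows "circle_mean r (\<lambda>z. \<bar>ln (norm (z - a))\<bar>) \<le> 2 * ln (2 * M)"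
proof -
  have cont: "continuous_on (sphere 0 r) (\<lambda>z. ln (norm (z - a)))"
    using a(1) by (auto intro!: continuous_intros)
  have "circle_mean r (\<lambda>z. \<bar>ln (norm (z - a))\<bar>) \<le> circle_mean r (\<lambda>z. 2 * ln (2 * M) - ln (norm (z - a)))"
  proof (rule circle_mean_mono)
    fix z :: complex assume z: "norm z = r"
    have "norm (z - a) \<le> 2 * M" using norm_triangle_ineq4[of z a] z r a by linarith
    moreover have "0 < norm (z - a)" using z a by auto
    ultimately have "ln (norm (z - a)) \<le> ln (2 * M)" using r by (subst ln_le_cancel_iff) auto
    moreover have "0 \<le> ln (2 * M)" using r by simp
    ultimately show "\<bar>ln (norm (z - a))\<bar> \<le> 2 * ln (2 * M) - ln (norm (z - a))" by linarith
  qed (use r in \<open>auto intro!: continuous_intros cont continuous_on_rabs\<close>)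
  also have "\<dots> = 2 * ln (2 * M) - circle_mean r (\<lambda>z. ln (norm (z - a)))"
    using circle_mean_diff[of r "\<lambda>_. 2 * ln (2 * M)", OF _ cont] r by simp
  also have "\<dots> \<le> 2 * ln (2 * M)"
    using circle_mean_ln_norm_linear[of r a] r a by simp
  finally show ?thesis .
qed

lemma logderiv_prod_powi:
  fixes z :: complex
  assumes "finite A" "\<And>a. a \<in> A \<Longrightarrow> z \<noteq> a"
  shows "((\<lambda>z. \<Prod>a\<in>A. (z - a) powi n a) has_field_derivative
           (\<Prod>a\<in>A. (z - a) powi n a) * (\<Sum>a\<in>A. of_int (n a) / (z - a))) (at z)"
  using assms
proof (induction A rule: finite_induct)
  case (insert b A)
  have za: "z - b \<noteq> 0" using insert.prems by auto
  have d: "((\<lambda>z. (z - b) powi n b) has_field_derivative (z - b) powi n b * (of_int (n b) / (z - b))) (at z)"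
    using za by (auto intro!: derivative_eq_intros simp: power_int_diff)
  have "((\<lambda>z. (z - b) powi n b * (\<Prod>a\<in>A. (z - a) powi n a)) has_field_derivative
     (z - b) powi n b * (of_int (n b) / (z - b)) * (\<Prod>a\<in>A. (z - a) powi n a) +
     (\<Prod>a\<in>A. (z - a) powi n a) * (\<Sum>a\<in>A. of_int (n a) / (z - a)) * (z - b) powi n b) (at z)"
    by (rule DERIV_mult[OF d]) (rule insert.IH, use insert.prems in auto)
  thus ?case using insert.hyps by (simp add: algebra_simps)
qed auto

lemma sqrt_sum_le: "finite A \<Longrightarrow> (\<And>a. a \<in> A \<Longrightarrow> 0 \<le> f a) \<Longrightarrow> sqrt (\<Sum>a\<in>A. f a) \<le> (\<Sum>a\<in>A. sqrt (f a))"
proof (induction A rule: finite_induct)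
  case (insert b A)
  have "sqrt (f b + (\<Sum>a\<in>A. f a)) \<le> sqrt (f b) + sqrt (\<Sum>a\<in>A. f a)"
    using insert.prems by (intro sqrt_add_le_add_sqrt sum_nonneg) auto
  also have "\<dots> \<le> sqrt (f b) + (\<Sum>a\<in>A. sqrt (f a))" using insert by auto
  finally show ?case using insert.hyps by simp
qed auto

text \<open>H is a logarithm of the zero-free factor. Inside, h'/h is H' plus simple fractions; by
  \<open>norm_deriv_le_circle_mean_Re\<close> H' is governed by Re H on the circle, which the last
  clause expresses by ln |h| and the zeros and poles.\<close>

lemma logderiv_decomposition:
  assumes h: "mero_nz h" and r1: "1 \<le> r1" and regular_radius: "regular_radius h r1"
  defines "A \<equiv> irregular_points h \<inter> ball 0 r1" and "n \<equiv> zorder h"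
  obtains H where "continuous_on (cball 0 r1) H" "H holomorphic_on ball 0 r1"
    "\<And>z. norm z < r1 \<Longrightarrow> z \<notin> irregular_points h \<Longrightarrow> deriv h z / h z = deriv H z + (\<Sum>a\<in>A. of_int (n a) / (z - a))"
    "\<And>z. norm z = r1 \<Longrightarrow> Re (H z) = ln (norm (h z)) - (\<Sum>a\<in>A. n a * ln (norm (z - a)))"
proof -
  have finA: "finite A" unfolding A_def by (intro finite_irregular_points h) auto
  obtain g R' where g: "r1 < R'" "g holomorphic_on ball 0 R'" "\<And>z. z \<in> ball 0 R' \<Longrightarrow> g z \<noteq> 0"
    "\<And>z. z \<notin> irregular_points h \<Longrightarrow> z \<in> ball 0 R' \<Longrightarrow> h z = g z * (\<Prod>a\<in>A. (z - a) powi n a)"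
  proof -
    have "0 < r1" "sphere 0 r1 \<inter> irregular_points h = {}" using r1 regular_radius by (auto simp: regular_radius_def)
    from factorization_disc[OF h this] obtain g R' where "r1 < R'" "g holomorphic_on ball 0 R'"
      "\<And>z. z \<in> ball 0 R' \<Longrightarrow> g z \<noteq> 0"
      "\<And>z. z \<notin> irregular_points h \<Longrightarrow> z \<in> ball 0 R' \<Longrightarrow>
         h z = g z * (\<Prod>a\<in>irregular_points h \<inter> ball 0 r1. (z - a) powi zorder h a)"
      by metis
    thus ?thesis by (intro that[of R' g]) (simp_all add: A_def n_def)
  qed
  obtain H where H: "H holomorphic_on ball 0 R'" "\<And>z. z \<in> ball 0 R' \<Longrightarrow> exp (H z) = g z"
    using contractible_imp_holomorphic_log[OF g(2) convex_imp_contractible[OF convex_ball] g(3)]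
    by metis
  show ?thesis
  proof
    show "continuous_on (cball 0 r1) H"
      by (rule continuous_on_subset[OF holomorphic_on_imp_continuous_on[OF H(1)]]) (use g(1) in auto)
    show "H holomorphic_on ball 0 r1"
      by (rule holomorphic_on_subset[OF H(1)]) (use g(1) in auto)
    show "deriv h z / h z = deriv H z + (\<Sum>a\<in>A. of_int (n a) / (z - a))"
      if z: "norm z < r1" "z \<notin> irregular_points h" for z
    proof -
      define P where "P = (\<lambda>z. \<Prod>a\<in>A. (z - a) powi n a)"
      have zR: "z \<in> ball 0 R'" using z g(1) by auto
      have za: "z \<noteq> a" if "a \<in> A" for a using that z by (auto simp: A_def)
      have Pz: "P z \<noteq> 0" unfolding P_def using za finA by auto
      have op: "open (ball 0 R' - irregular_points h)"
        using sparse_in_UNIV_imp_closed[OF sparse_irregular_points[OF h]] by (intro open_Diff) auto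
      have Hd: "(H has_field_derivative deriv H z) (at z)"
        using H(1) zR holomorphic_derivI by blast
      have d: "((\<lambda>z. exp (H z) * P z) has_field_derivative
         exp (H z) * deriv H z * P z + P z * (\<Sum>a\<in>A. of_int (n a) / (z - a)) * exp (H z)) (at z)"
        unfolding P_def by (intro DERIV_mult DERIV_chain2[OF DERIV_exp Hd] logderiv_prod_powi finA za)
      have "(h has_field_derivative
         exp (H z) * deriv H z * P z + P z * (\<Sum>a\<in>A. of_int (n a) / (z - a)) * exp (H z)) (at z)"
        by (rule has_field_derivative_transform_within_open[OF d op])
           (use z zR H(2) g(4) in \<open>auto simp: P_def\<close>)
      hence "deriv h z = exp (H z) * P z * (deriv H z + (\<Sum>a\<in>A. of_int (n a) / (z - a)))"
        by (simp add: DERIV_imp_deriv algebra_simps)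
      moreover have "h z = exp (H z) * P z" using g(4)[OF z(2) zR] H(2)[OF zR] by (simp add: P_def)
      ultimately show ?thesis using Pz by simp
    qed
    show "Re (H z) = ln (norm (h z)) - (\<Sum>a\<in>A. n a * ln (norm (z - a)))" if z: "norm z = r1" for z
    proof -
      have zR: "z \<in> ball 0 R'" using z g(1) by auto
      have zb: "z \<notin> irregular_points h" using z regular_radius by (auto simp: regular_radius_def)
      have za: "z \<noteq> a" if "a \<in> A" for a using that z by (auto simp: A_def)
      have "ln (norm (h z)) = ln (norm (exp (H z)) * norm (\<Prod>a\<in>A. (z - a) powi n a))"
        using g(4)[OF zb zR] H(2)[OF zR] by (simp add: norm_mult)
      also have "\<dots> = Re (H z) + ln (norm (\<Prod>a\<in>A. (z - a) powi n a))"
        using za finA by (subst ln_mult) auto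
      also have "ln (norm (\<Prod>a\<in>A. (z - a) powi n a)) = (\<Sum>a\<in>A. n a * ln (norm (z - a)))"
        by (rule prod_powi_zorder_norm[OF finA za])
      finally show ?thesis by simp
    qed
  qed
qed

text \<open>Every point of the inner disc has kernel at least ln (r2 / r1) \<ge> (r2 - r1) / r2 with
  respect to the outer radius.\<close>

lemma count_le_N:
  assumes h: "mero_nz h" and r: "1 \<le> r1" "r1 < r2"
  shows "(\<Sum>a\<in>irregular_points h \<inter> ball 0 r1. \<bar>mero_ord h a\<bar>) * ((r2 - r1) / r2) \<le> nev_N r2 (\<lambda>z. \<bar>mero_ord h z\<bar>)"
proof -
  define A where "A = irregular_points h \<inter> ball 0 r1"
  define B where "B = irregular_points h \<inter> cball 0 r2"
  have fin: "finite B" unfolding B_def by (intro finite_irregular_points h) auto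
  have "nev_N r2 (\<lambda>z. \<bar>mero_ord h z\<bar>) = (\<Sum>a\<in>B. \<bar>mero_ord h a\<bar> * log_kernel r2 a)"
    by (rule nev_N_eq_sum[OF fin]) (use r zorder_not_irregular_points[of _ h] in \<open>auto simp: B_def mero_ord_def\<close>)
  also have "\<dots> \<ge> (\<Sum>a\<in>A. \<bar>mero_ord h a\<bar> * log_kernel r2 a)"
    by (rule sum_mono2[OF fin]) (use r in \<open>auto simp: A_def B_def log_kernel_nonneg\<close>)
  also have "(\<Sum>a\<in>A. \<bar>mero_ord h a\<bar> * log_kernel r2 a) \<ge> (\<Sum>a\<in>A. \<bar>mero_ord h a\<bar> * ((r2 - r1) / r2))"
  proof (intro sum_mono mult_left_mono)
    fix a assume "a \<in> A"
    hence a: "norm a < r1" by (auto simp: A_def)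
    have "ln (r1 / r2) \<le> r1 / r2 - 1" using r by (intro ln_le_minus_one) auto
    hence "(r2 - r1) / r2 \<le> ln r2 - ln r1" using r by (simp add: ln_div diff_divide_distrib)
    also have "ln (max 1 (norm a)) \<le> ln r1" using a r by simp
    hence "ln r2 - ln r1 \<le> log_kernel r2 a" using a r by (simp add: log_kernel_inside)
    finally show "(r2 - r1) / r2 \<le> log_kernel r2 a" .
  qed auto
  finally show ?thesis by (simp only: A_def sum_distrib_right)
qed

text \<open>Bookkeeping for \<open>log_derivative_raw\<close>: n is the number of zeros and poles
  with multiplicity, M the bound for |H'|. What counts is that the result is a power of X, since a
  logarithm is taken next.\<close>

lemma polynomial_bound_aux:
  fixes X K n M :: real
  assumes X: "2 \<le> X" and K: "0 \<le> K" and n: "0 \<le> n" "n \<le> X^2 * (2 * X + K)"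
    and M: "M \<le> 2 * X^3 * (2 * X + K + 4 * X * n)"
  shows "2 + M + 36 * n \<le> (100 * (2 + K)) * X^7"
proof -
  have X1: "1 \<le> X" using X by simp
  have p: "X^i \<le> X^7" if "i \<le> 7" for i using X1 that by (intro power_increasing) auto
  have a: "2 * X + K \<le> (2 + K) * X"
    using mult_right_mono[OF X1 K] by (simp add: algebra_simps)
  have n2: "n \<le> (2 + K) * X^3"
  proof -
    have "n \<le> X^2 * ((2 + K) * X)" using n(2) mult_left_mono[OF a, of "X^2"] by simp
    thus ?thesis by (simp add: power2_eq_square power3_eq_cube algebra_simps)
  qed
  have "4 * X * n \<le> 4 * X * ((2 + K) * X^3)" using n2 X by (intro mult_left_mono) auto
  also have "\<dots> = 4 * (2 + K) * X^4" by (simp add: power_eq_if)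
  finally have b: "2 * X + K + 4 * X * n \<le> (2 + K) * X + 4 * (2 + K) * X^4" using a by linarith
  have "X \<le> X^4" using power_increasing[of 1 4 X] X1 by simp
  hence "(2 + K) * X \<le> (2 + K) * X^4" using K by (intro mult_left_mono) auto
  hence b2: "2 * X + K + 4 * X * n \<le> 5 * (2 + K) * X^4" using b by linarith
  have "2 * X^3 * (2 * X + K + 4 * X * n) \<le> 2 * X^3 * (5 * (2 + K) * X^4)"
    using b2 X by (intro mult_left_mono) auto
  also have "\<dots> = 10 * (2 + K) * X^7" by (simp add: power_eq_if)
  finally have M2: "M \<le> 10 * (2 + K) * X^7" using M by linarith
  have "(2 + K) * X^3 \<le> (2 + K) * X^7" using p[of 3] K by (intro mult_left_mono) auto
  hence n3: "36 * n \<le> 36 * ((2 + K) * X^7)" using n2 by linarith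
  have "1 \<le> X^7" using p[of 0] by simp
  hence "1 * 1 \<le> (2 + K) * X^7" using K by (intro mult_mono) auto
  hence "2 \<le> 2 * ((2 + K) * X^7)" by simp
  thus ?thesis using M2 n3 \<open>1 * 1 \<le> (2 + K) * X^7\<close> by (simp only: mult.assoc)
qed

text \<open>Three radii occur: h'/h is estimated on the circle of radius r, through H and the zeros
  and poles in the disc of radius r1, and their number through the counting function at r2. X
  majorizes everything that enters, so that each loss is a power of X.\<close>

theorem log_derivative_raw:
  assumes h: "mero_nz h"
  obtains C where "0 \<le> C" "\<And>r r1 r2 X. 1 \<le> r \<Longrightarrow> r < r1 \<Longrightarrow> r1 < r2 \<Longrightarrow>
     regular_radius h r \<Longrightarrow> regular_radius h r1 \<Longrightarrow> regular_radius h r2 \<Longrightarrow> 2 \<le> X \<Longrightarrow> r2 \<le> X \<Longrightarrow> 1 / (r1 - r) \<le> X \<Longrightarrow>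
     1 / (r2 - r1) \<le> X \<Longrightarrow> nev_T r1 h \<le> X \<Longrightarrow> nev_T r2 h \<le> X \<Longrightarrow>
     nev_m r (\<lambda>z. deriv h z / h z) \<le> C * ln X"
proof -
  obtain K where K: "0 \<le> K" "\<And>r. 1 \<le> r \<Longrightarrow> regular_radius h r \<Longrightarrow>
    \<bar>nev_m r (\<lambda>z. inverse (h z)) + nev_N r (\<lambda>z. max 0 (mero_ord h z)) - nev_T r h\<bar> \<le> K"
    using jensen_T[OF h] by metis
  \<comment> \<open>The factor 2 comes from \<open>circle_mean_ln_le_ln_circle_mean_sqrt\<close>,
    the 7 is the exponent in \<open>polynomial_bound_aux\<close>, and since X \<ge> 2 the division
    by ln 2 absorbs the constant factor there.\<close>
  define C where "C = 2 * (7 + ln (100 * (2 + K)) / ln 2)"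
  have C0: "0 \<le> C" unfolding C_def using K(1) by simp
  have "nev_m r (\<lambda>z. deriv h z / h z) \<le> C * ln X"
    if r: "1 \<le> r" "r < r1" "r1 < r2" and gd: "regular_radius h r" "regular_radius h r1" "regular_radius h r2"
      and X: "2 \<le> X" "r2 \<le> X" "1 / (r1 - r) \<le> X" "1 / (r2 - r1) \<le> X" "nev_T r1 h \<le> X" "nev_T r2 h \<le> X"
    for r r1 r2 X
  proof -
    define A where "A = irregular_points h \<inter> ball 0 r1"
    define n where "n = zorder h"
    define n1 where "n1 = (\<Sum>a\<in>A. \<bar>mero_ord h a\<bar>)"
    have finA: "finite A" unfolding A_def by (intro finite_irregular_points h) auto
    have n1nn: "0 \<le> n1" unfolding n1_def by (intro sum_nonneg) auto
    have gi: "regular_radius (\<lambda>z. inverse (h z)) \<rho>" if "regular_radius h \<rho>" for \<rho>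
      using that by (auto simp: regular_radius_def irregular_points_def intro!: analytic_intros)
    have n1le: "n1 \<le> X^2 * (2 * X + K)"
    proof -
      have "nev_N r2 (\<lambda>z. \<bar>mero_ord h z\<bar>) = nev_N r2 (\<lambda>z. max 0 (mero_ord h z) + max 0 (- mero_ord h z))"
        by (rule arg_cong[where f = "nev_N r2"]) (auto simp: max_def fun_eq_iff)
      also have "\<dots> = nev_N r2 (\<lambda>z. max 0 (mero_ord h z)) + nev_N r2 (\<lambda>z. max 0 (- mero_ord h z))"
        using r by (intro nev_N_add loc_fin_pos_part loc_fin_neg_part loc_fin_ord h) auto
      also have "nev_N r2 (\<lambda>z. max 0 (mero_ord h z)) \<le> X + K"
        using K(2)[of r2] gd r X nev_m_nonneg[OF gi[OF gd(3)]] by (auto simp: abs_le_iff)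
      also have "nev_N r2 (\<lambda>z. max 0 (- mero_ord h z)) \<le> X"
        using X(6) nev_m_nonneg[OF gd(3)] r by (simp add: nev_T_def)
      finally have "nev_N r2 (\<lambda>z. \<bar>mero_ord h z\<bar>) \<le> 2 * X + K" by simp
      hence *: "n1 * ((r2 - r1) / r2) \<le> 2 * X + K"
        using count_le_N[OF h, of r1 r2] r by (simp add: n1_def A_def)
      have "1 / X \<le> r2 - r1" using X(1,4) r by (simp add: field_simps)
      hence "(1 / X) / X \<le> (r2 - r1) / r2" using X r by (intro frac_le) auto
      hence "n1 * (1 / X^2) \<le> n1 * ((r2 - r1) / r2)"
        using n1nn by (intro mult_left_mono) (auto simp: power2_eq_square)
      with * have "n1 * (1 / X^2) \<le> 2 * X + K" by linarith
      thus ?thesis using X(1) by (simp add: field_simps)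
    qed
    obtain H where H: "continuous_on (cball 0 r1) H" "H holomorphic_on ball 0 r1"
      "\<And>z. norm z < r1 \<Longrightarrow> z \<notin> irregular_points h \<Longrightarrow> deriv h z / h z = deriv H z + (\<Sum>a\<in>A. of_int (n a) / (z - a))"
      "\<And>z. norm z = r1 \<Longrightarrow> Re (H z) = ln (norm (h z)) - (\<Sum>a\<in>A. n a * ln (norm (z - a)))"
          proof -
      have "1 \<le> r1" using r by simp
      note D = logderiv_decomposition[OF h this gd(2), folded A_def n_def]
      show ?thesis by (rule D, rule that) assumption+
    qed
    have neA: "norm a \<noteq> r1" if "a \<in> A" for a using that by (auto simp: A_def)
    have contln: "continuous_on (sphere 0 r1) (\<lambda>z. \<bar>ln (norm (h z))\<bar>)"
      by (intro continuous_intros regular_radius_continuous gd) (use regular_radius_nonzero[OF gd(2)] in auto)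
    define S where "S = (\<lambda>z. \<Sum>a\<in>A. \<bar>mero_ord h a\<bar> * \<bar>ln (norm (z - a))\<bar>)"
    have contS: "continuous_on (sphere 0 r1) S" unfolding S_def
      by (intro continuous_intros) (use neA in auto)
    define M where "M = 2 * r1 / (r1 - r)^2 * circle_mean r1 (\<lambda>u. \<bar>Re (H u)\<bar>)"
    have cm: "circle_mean r1 (\<lambda>u. \<bar>Re (H u)\<bar>) \<le> 2 * X + K + 4 * X * n1"
    proof -
      have "circle_mean r1 (\<lambda>u. \<bar>Re (H u)\<bar>) \<le> circle_mean r1 (\<lambda>z. \<bar>ln (norm (h z))\<bar> + S z)"
      proof (rule circle_mean_mono)
        show "continuous_on (sphere 0 r1) (\<lambda>u. \<bar>Re (H u)\<bar>)"
          by (intro continuous_intros continuous_on_subset[OF H(1)]) auto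
        show "continuous_on (sphere 0 r1) (\<lambda>z. \<bar>ln (norm (h z))\<bar> + S z)"
          by (intro continuous_on_add contln contS)
        fix z :: complex assume z: "norm z = r1"
        have "\<bar>\<Sum>a\<in>A. n a * ln (norm (z - a))\<bar> \<le> S z"
          unfolding S_def by (rule order_trans[OF sum_abs]) (simp add: abs_mult mero_ord_def n_def)
        thus "\<bar>Re (H z)\<bar> \<le> \<bar>ln (norm (h z))\<bar> + S z" using H(4)[OF z] by linarith
      qed (use r in auto)
      also have "\<dots> = circle_mean r1 (\<lambda>z. \<bar>ln (norm (h z))\<bar>) + circle_mean r1 S"
        by (rule circle_mean_add[OF contln contS]) (use r in auto)
      also have "circle_mean r1 (\<lambda>z. \<bar>ln (norm (h z))\<bar>) = nev_m r1 h + nev_m r1 (\<lambda>z. inverse (h z))"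
        by (rule circle_mean_ln_abs_eq_m) (use r gd in auto)
      also have "nev_m r1 h \<le> X" using X(5) nev_N_neg_part_nonneg[of r1 "\<lambda>z. - mero_ord h z"] by (simp add: nev_T_def)
      also have "nev_m r1 (\<lambda>z. inverse (h z)) \<le> X + K"
        using K(2)[of r1] gd r X nev_N_neg_part_nonneg[of r1 "mero_ord h"] by (auto simp: abs_le_iff)
      also have "circle_mean r1 S = (\<Sum>a\<in>A. circle_mean r1 (\<lambda>z. \<bar>mero_ord h a\<bar> * \<bar>ln (norm (z - a))\<bar>))"
        unfolding S_def by (rule circle_mean_sum) (use r finA neA in \<open>auto intro!: continuous_intros\<close>)
      also have "\<dots> \<le> (\<Sum>a\<in>A. \<bar>mero_ord h a\<bar> * (4 * X))"
      proof (rule sum_mono)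
        fix a assume a: "a \<in> A"
        have "circle_mean r1 (\<lambda>z. \<bar>ln (norm (z - a))\<bar>) \<le> 2 * ln (2 * r1)"
          by (rule circle_mean_abs_ln_linear_le) (use r a neA[OF a] in \<open>auto simp: A_def\<close>)
        also have "\<dots> \<le> 4 * X" using ln_bound[of "2 * r1"] r X by simp
        finally show "circle_mean r1 (\<lambda>z. \<bar>mero_ord h a\<bar> * \<bar>ln (norm (z - a))\<bar>) \<le> \<bar>mero_ord h a\<bar> * (4 * X)"
          unfolding circle_mean_cmult by (rule mult_left_mono) auto
      qed
      also have "(\<Sum>a\<in>A. \<bar>mero_ord h a\<bar> * (4 * X)) = 4 * X * n1"
        by (simp add: n1_def sum_distrib_left sum_distrib_right algebra_simps)
      finally show ?thesis by simp
    qed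
    have cmnn: "0 \<le> circle_mean r1 (\<lambda>u. \<bar>Re (H u)\<bar>)"
      by (rule circle_mean_nonneg) (use r in \<open>auto intro!: continuous_intros continuous_on_subset[OF H(1)]\<close>)
    have Mnn: "0 \<le> M" unfolding M_def using cmnn r by auto
    have Mle: "M \<le> 2 * X^3 * (2 * X + K + 4 * X * n1)"
    proof -
      have "1 / (r1 - r) ^ 2 \<le> X^2"
        using power_mono[OF X(3), of 2] r by (simp add: power_divide)
      hence "r1 * (1 / (r1 - r) ^ 2) \<le> X * X^2" using r X by (intro mult_mono) auto
      hence "2 * r1 / (r1 - r)^2 \<le> 2 * X^3" by (simp add: power3_eq_cube power2_eq_square)
      thus ?thesis unfolding M_def using cm cmnn X by (intro mult_mono) auto
    qed
    have neAr: "norm a \<noteq> r" if "a \<in> A" for a using that gd(1) by (auto simp: A_def regular_radius_def)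
    define F where "F = (\<lambda>z. deriv h z / h z)"
    have contF: "continuous_on (sphere 0 r) F"
    proof -
      have "deriv h analytic_on {z}" if "norm z = r" for z
        using regular_radius_analytic[OF gd(1) that] by (rule analytic_deriv)
      hence "continuous_on (sphere 0 r) (deriv h)"
        by (intro continuous_at_imp_continuous_on ballI analytic_at_imp_isCont) auto
      thus ?thesis unfolding F_def
        by (rule continuous_on_divide[OF _ regular_radius_continuous[OF gd(1)]]) (use regular_radius_nonzero[OF gd(1)] in auto)
    qed
    define S2 where "S2 = (\<lambda>z. \<Sum>a\<in>A. \<bar>mero_ord h a\<bar> * (1 / sqrt (norm (z - a))))"
    have contS2: "continuous_on (sphere 0 r) S2" unfolding S2_def
      by (intro continuous_intros) (use neAr in auto)
    \<comment> \<open>The square root is subadditive, so each zero or pole contributes separately,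
      with the uniform bound 36 however close to the circle it lies.\<close>
    have cm2: "circle_mean r (\<lambda>z. sqrt (norm (F z))) \<le> (1 + M) + 36 * n1"
    proof -
      have "circle_mean r (\<lambda>z. sqrt (norm (F z))) \<le> circle_mean r (\<lambda>z. (1 + M) + S2 z)"
      proof (rule circle_mean_mono)
        fix z :: complex assume z: "norm z = r"
        have zb: "z \<notin> irregular_points h" using z gd(1) by (auto simp: regular_radius_def)
        have "norm (F z) \<le> norm (deriv H z) + (\<Sum>a\<in>A. norm (of_int (n a) / (z - a)))"
        proof -
          have "F z = deriv H z + (\<Sum>a\<in>A. of_int (n a) / (z - a))"
            unfolding F_def using H(3)[OF _ zb] z r by simp
          thus ?thesis by (metis add_left_mono norm_sum norm_triangle_le)
        qed
        also have "norm (deriv H z) \<le> M" unfolding M_def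
          by (rule norm_deriv_le_circle_mean_Re[OF H(1,2)]) (use z r in auto)
        finally have "sqrt (norm (F z)) \<le> sqrt (M + (\<Sum>a\<in>A. norm (of_int (n a) / (z - a))))" by simp
        also have "\<dots> \<le> sqrt M + sqrt (\<Sum>a\<in>A. norm (of_int (n a) / (z - a)))"
          by (intro sqrt_add_le_add_sqrt Mnn sum_nonneg) auto
        also have "sqrt M \<le> 1 + M" using Mnn by (intro real_le_lsqrt) (auto simp: power2_eq_square algebra_simps)
        also have "sqrt (\<Sum>a\<in>A. norm (of_int (n a) / (z - a))) \<le> (\<Sum>a\<in>A. sqrt (norm (of_int (n a) / (z - a))))"
          by (rule sqrt_sum_le[OF finA]) auto
        also have "\<dots> \<le> S2 z" unfolding S2_def
        proof (rule sum_mono)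
          fix a assume "a \<in> A"
          \<comment> \<open>Orders are integers, and the square root does not increase a number that
            is 0 or at least 1.\<close>
          have "sqrt \<bar>mero_ord h a\<bar> \<le> \<bar>mero_ord h a\<bar>"
          proof (cases "zorder h a = 0")
            case False
            hence "1 \<le> \<bar>mero_ord h a\<bar>" by (simp add: mero_ord_def)
            hence "1 * \<bar>mero_ord h a\<bar> \<le> \<bar>mero_ord h a\<bar> * \<bar>mero_ord h a\<bar>" by (intro mult_right_mono) auto
            thus ?thesis by (intro real_le_lsqrt) (auto simp: power2_eq_square)
          qed (simp add: mero_ord_def)
          hence "sqrt \<bar>mero_ord h a\<bar> * (1 / sqrt (norm (z - a))) \<le> \<bar>mero_ord h a\<bar> * (1 / sqrt (norm (z - a)))"
            by (rule mult_right_mono) auto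
          thus "sqrt (norm (of_int (n a) / (z - a))) \<le> \<bar>mero_ord h a\<bar> * (1 / sqrt (norm (z - a)))"
            by (simp add: norm_divide real_sqrt_divide mero_ord_def n_def)
        qed
        finally show "sqrt (norm (F z)) \<le> (1 + M) + S2 z" by simp
      qed (use r in \<open>auto intro!: continuous_intros contF contS2\<close>)
      also have "\<dots> = (1 + M) + circle_mean r S2"
        using circle_mean_add[OF continuous_on_const contS2, of "1 + M"] r by simp
      also have "circle_mean r S2 = (\<Sum>a\<in>A. circle_mean r (\<lambda>z. \<bar>mero_ord h a\<bar> * (1 / sqrt (norm (z - a)))))"
        unfolding S2_def by (rule circle_mean_sum) (use r finA neAr in \<open>auto intro!: continuous_intros\<close>)
      also have "\<dots> \<le> (\<Sum>a\<in>A. \<bar>mero_ord h a\<bar> * 36)"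
        unfolding circle_mean_cmult
        by (intro sum_mono mult_left_mono circle_mean_inverse_sqrt_le) (use r neAr in auto)
      also have "\<dots> = 36 * n1" by (simp add: n1_def sum_distrib_right[symmetric])
      finally show ?thesis by simp
    qed
    have cm2nn: "0 \<le> circle_mean r (\<lambda>z. sqrt (norm (F z)))"
      by (rule circle_mean_nonneg) (use r in \<open>auto intro!: continuous_intros contF\<close>)
    have "nev_m r F \<le> 2 * ln (1 + circle_mean r (\<lambda>z. sqrt (norm (F z))))"
      unfolding nev_m_def by (rule circle_mean_ln_le_ln_circle_mean_sqrt) (use r in \<open>auto intro!: continuous_intros contF\<close>)
    also have "ln (1 + circle_mean r (\<lambda>z. sqrt (norm (F z)))) \<le> ln (100 * (2 + K) * X^7)"
    proof (subst ln_le_cancel_iff)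
      show "1 + circle_mean r (\<lambda>z. sqrt (norm (F z))) \<le> 100 * (2 + K) * X^7"
        using polynomial_bound_aux[OF X(1) K(1) n1nn n1le Mle] cm2 by linarith
    qed (use cm2nn K(1) X in auto)
    also have "ln (100 * (2 + K) * X^7) = ln (100 * (2 + K)) + 7 * ln X"
      using K(1) X by (subst ln_mult) (auto simp: ln_realpow)
    also have "ln (100 * (2 + K)) \<le> ln (100 * (2 + K)) / ln 2 * ln X"
    proof -
      have "0 \<le> ln (100 * (2 + K))" using K(1) by simp
      moreover have "ln 2 \<le> ln X" using X by simp
      ultimately have "ln (100 * (2 + K)) * ln 2 \<le> ln (100 * (2 + K)) * ln X" by (rule mult_left_mono[rotated])
      thus ?thesis by (simp add: field_simps)
    qed
    finally show ?thesis by (simp add: C_def F_def algebra_simps)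
  qed
  with C0 show ?thesis by (rule that)
qed

section \<open>Estimates for almost all radii\<close>

text \<open>
  A limit along this filter ignores a countable set of radii. The circles through zeros or poles,
  where the proximity function would see junk values, are thereby excluded.
\<close>

definition radii :: "real filter" where
  "radii = (INF p\<in>{(B, r0). countable B}. principal ({snd p..} - fst p))"

lemma eventually_radii:
  "eventually P radii \<longleftrightarrow> (\<exists>B r0. countable B \<and> (\<forall>r\<ge>r0. r \<notin> B \<longrightarrow> P r))"
proof -
  have "eventually P radii \<longleftrightarrow> (\<exists>p\<in>{(B, r0). countable B}. eventually P (principal ({snd p..} - fst p)))"
    unfolding radii_def
  proof (rule eventually_INF_base)
    fix p q :: "real set \<times> real"
    assume "p \<in> {(B, r0). countable B}" "q \<in> {(B, r0). countable B}"
    thus "\<exists>x\<in>{(B, r0). countable B}. principal ({snd x..} - fst x)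
       \<le> inf (principal ({snd p..} - fst p)) (principal ({snd q..} - fst q))"
      by (intro bexI[of _ "(fst p \<union> fst q, max (snd p) (snd q))"]) auto
  qed (auto intro: exI[of _ "{}"])
  thus ?thesis by (auto simp: eventually_principal)
qed

lemma eventually_ge_radii: "\<forall>\<^sub>F r in radii. c \<le> r"
  unfolding eventually_radii by (rule exI[of _ "{}"]) auto

lemma radii_ex:
  assumes "\<forall>\<^sub>F r in radii. P r"
  shows "\<exists>r0. \<forall>a\<ge>r0. \<forall>b>a. \<exists>r. a < r \<and> r < b \<and> P r"
proof -
  obtain B r0 where B: "countable B" "\<And>r. r0 \<le> r \<Longrightarrow> r \<notin> B \<Longrightarrow> P r"
    using assms unfolding eventually_radii by blast
  have "\<exists>r. a < r \<and> r < b \<and> P r" if "r0 \<le> a" "a < b" for a b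
  proof -
    have "uncountable {a<..<b}" using that by (simp add: uncountable_open_interval)
    hence "\<not> {a<..<b} \<subseteq> B" using B(1) countable_subset by blast
    then obtain r where "r \<in> {a<..<b}" "r \<notin> B" by blast
    thus ?thesis using B(2)[of r] that by (intro exI[of _ r]) auto
  qed
  thus ?thesis by blast
qed

text \<open>A sparse set is countable, so it meets only countably many circles around 0. This turns
  identities off sparse sets into identities between proximity functions.\<close>

lemma eventually_sphere:
  assumes "\<forall>\<^sub>\<approx>z\<in>UNIV. P z"
  shows "\<forall>\<^sub>F r in radii. \<forall>z::complex. norm z = r \<longrightarrow> P z"
proof -
  have "countable {z. \<not> P z}"
    using assms sparse_imp_countable[of UNIV "{z. \<not> P z}"] by (simp add: eventually_cosparse)
  hence "countable (norm ` {z. \<not> P z})" by simp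
  thus ?thesis unfolding eventually_radii by blast
qed

lemma eventually_regular_radius: "mero_nz h \<Longrightarrow> \<forall>\<^sub>F r in radii. regular_radius h r"
proof -
  assume "mero_nz h"
  hence "\<forall>\<^sub>\<approx>z\<in>UNIV. z \<notin> irregular_points h" using sparse_irregular_points by (simp add: eventually_cosparse)
  from eventually_sphere[OF this] show ?thesis
    by eventually_elim (auto simp: regular_radius_def)
qed

lemma eventually_regular_radiusI:
  assumes "mero_nz h" "\<And>r. 1 \<le> r \<Longrightarrow> regular_radius h r \<Longrightarrow> P r"
  shows "\<forall>\<^sub>F r in radii. P r"
  using eventually_regular_radius[OF assms(1)] eventually_ge_radii[of 1]
  by eventually_elim (rule assms(2))

lemma eventually_continuous_sphere:
  assumes "h meromorphic_on UNIV"
  shows "\<forall>\<^sub>F r in radii. continuous_on (sphere 0 r) h"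
  using eventually_sphere[OF meromorphic_on_imp_analytic_cosparse[OF assms]]
  by eventually_elim (auto intro!: continuous_at_imp_continuous_on analytic_at_imp_isCont)

lemma eventually_m_cong:
  assumes "\<forall>\<^sub>\<approx>z\<in>UNIV. f z = g z"
  shows "\<forall>\<^sub>F r in radii. nev_m r f = nev_m r g"
  using eventually_sphere[OF assms] eventually_ge_radii[of 0]
  by eventually_elim (auto simp: nev_m_def intro!: circle_mean_cong)

lemma eventually_m_nonneg:
  assumes "h meromorphic_on UNIV"
  shows "\<forall>\<^sub>F r in radii. 0 \<le> nev_m r h"
  using eventually_continuous_sphere[OF assms] eventually_ge_radii[of 0]
  by eventually_elim (auto simp: nev_m_def intro!: circle_mean_nonneg continuous_lnmax)

lemma eventually_m_le3:
  assumes "f meromorphic_on UNIV" "g meromorphic_on UNIV" "h meromorphic_on UNIV"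
    and "\<And>z. ln (max 1 (norm (f z))) \<le> c + ln (max 1 (norm (g z))) + ln (max 1 (norm (h z)))"
  shows "\<forall>\<^sub>F r in radii. nev_m r f \<le> c + nev_m r g + nev_m r h"
  using assms(1-3)[THEN eventually_continuous_sphere] eventually_ge_radii[of 0]
proof eventually_elim
  case (elim r)
  have "nev_m r f \<le> circle_mean r (\<lambda>z. c + ln (max 1 (norm (g z))) + ln (max 1 (norm (h z))))"
    unfolding nev_m_def by (rule circle_mean_mono) (use elim assms(4) in \<open>auto intro!: continuous_on_add continuous_lnmax\<close>)
  also have "\<dots> = circle_mean r (\<lambda>z. c + ln (max 1 (norm (g z)))) + nev_m r h"
    unfolding nev_m_def by (rule circle_mean_add) (use elim in \<open>auto intro!: continuous_on_add continuous_lnmax\<close>)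
  also have "circle_mean r (\<lambda>z. c + ln (max 1 (norm (g z)))) = circle_mean r (\<lambda>z. c) + nev_m r g"
    unfolding nev_m_def by (rule circle_mean_add) (use elim in \<open>auto intro!: continuous_on_add continuous_lnmax\<close>)
  finally show ?case by simp
qed

lemma ln_max_mult_le:
  assumes "0 \<le> x" "0 \<le> y"
  shows "ln (max 1 (x * y)) \<le> ln (max 1 x) + ln (max 1 (y :: real))"
proof -
  have "x * y \<le> max 1 x * max 1 y" using assms by (intro mult_mono) auto
  moreover have "1 * 1 \<le> max 1 x * max 1 y" by (intro mult_mono) auto
  ultimately have "max 1 (x * y) \<le> max 1 x * max 1 y" by simp
  hence "ln (max 1 (x * y)) \<le> ln (max 1 x * max 1 y)" by (subst ln_le_cancel_iff) auto
  also have "ln (max 1 x * max 1 y) = ln (max 1 x) + ln (max 1 y)" by (rule ln_mult_pos) auto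
  finally show ?thesis .
qed

lemma ln_max_add_le:
  assumes "0 \<le> x" "0 \<le> y"
  shows "ln (max 1 (x + y)) \<le> ln 2 + ln (max 1 x) + ln (max 1 (y :: real))"
proof -
  have x: "max 1 x * 1 \<le> max 1 x * max 1 y" and y: "1 * max 1 y \<le> max 1 x * max 1 y"
    by (intro mult_mono; simp)+
  hence "max 1 (x + y) \<le> 2 * (max 1 x * max 1 y)" using assms by linarith
  hence "ln (max 1 (x + y)) \<le> ln (2 * (max 1 x * max 1 y))" by (subst ln_le_cancel_iff) auto
  also have "\<dots> = ln 2 + (ln (max 1 x) + ln (max 1 y))"
    by (simp add: ln_mult_pos)
  finally show ?thesis by simp
qed

lemma eventually_m_mult:
  assumes "f meromorphic_on UNIV" "g meromorphic_on UNIV"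
  shows "\<forall>\<^sub>F r in radii. nev_m r (\<lambda>z. f z * g z) \<le> nev_m r f + nev_m r g"
  using eventually_m_le3[of "\<lambda>z. f z * g z" f g 0] assms
  by (auto intro!: meromorphic_intros simp: norm_mult ln_max_mult_le)

lemma eventually_m_add:
  assumes "f meromorphic_on UNIV" "g meromorphic_on UNIV"
  shows "\<forall>\<^sub>F r in radii. nev_m r (\<lambda>z. f z + g z) \<le> ln 2 + nev_m r f + nev_m r g"
proof (rule eventually_m_le3)
  fix z
  have "ln (max 1 (norm (f z + g z))) \<le> ln (max 1 (norm (f z) + norm (g z)))"
    using norm_triangle_ineq[of "f z" "g z"] by (subst ln_le_cancel_iff) auto
  also have "\<dots> \<le> ln 2 + ln (max 1 (norm (f z))) + ln (max 1 (norm (g z)))"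
    by (rule ln_max_add_le) auto
  finally show "ln (max 1 (norm (f z + g z))) \<le> ln 2 + ln (max 1 (norm (f z))) + ln (max 1 (norm (g z)))" .
qed (use assms in \<open>auto intro!: meromorphic_intros\<close>)

lemma nev_m_const: "nev_m r (\<lambda>_. c) = ln (max 1 (norm c))"
  by (simp add: nev_m_def)

lemma eventually_m_add_const:
  assumes "f meromorphic_on UNIV"
  shows "\<forall>\<^sub>F r in radii. nev_m r (\<lambda>z. f z + c) \<le> nev_m r f + (ln 2 + ln (max 1 (norm c)))"
  using eventually_m_add[OF assms, of "\<lambda>_. c"] by (simp add: nev_m_const algebra_simps meromorphic_on_const)

section \<open>Characteristics and orders of powers, products, inverses and derivatives\<close>

lemma nev_m_power: "nev_m r (\<lambda>z. f z ^ n) = real n * nev_m r f"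
proof -
  have "ln (max 1 (norm (f z ^ n))) = real n * ln (max 1 (norm (f z)))" for z
  proof -
    have "max 1 (x ^ n) = max 1 x ^ n" if "0 \<le> x" for x :: real
      using that power_le_one[of x n] one_le_power[of x n] by (cases "x \<ge> 1") (simp_all add: max_absorb2 max_absorb1)
    thus ?thesis by (simp add: norm_power ln_realpow)
  qed
  thus ?thesis unfolding nev_m_def by (simp add: circle_mean_cmult)
qed

lemma ord_power: "mero_nz h \<Longrightarrow> mero_ord (\<lambda>z. h z ^ n) z = real n * mero_ord h z"
  unfolding mero_ord_def by (subst zorder_power) (auto intro: mero_nz_meromorphic mero_nz_frequently)

lemma ord_mult: "mero_nz f \<Longrightarrow> mero_nz g \<Longrightarrow> mero_ord (\<lambda>z. f z * g z) z = mero_ord f z + mero_ord g z"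
  unfolding mero_ord_def by (subst zorder_mult) (auto intro: mero_nz_meromorphic mero_nz_frequently)

lemma ord_divide: "mero_nz f \<Longrightarrow> mero_nz g \<Longrightarrow> mero_ord (\<lambda>z. f z / g z) z = mero_ord f z - mero_ord g z"
  unfolding mero_ord_def by (subst zorder_divide) (auto intro: mero_nz_meromorphic mero_nz_frequently)

lemma ord_inverse: "mero_nz f \<Longrightarrow> mero_ord (\<lambda>z. inverse (f z)) z = - mero_ord f z"
  using ord_divide[OF mero_nz_const[of 1], of f z] by (simp add: divide_inverse mero_ord_def)

lemma ord_cong: "\<forall>\<^sub>\<approx>z\<in>UNIV. f z = g z \<Longrightarrow> mero_ord f z = mero_ord g z"
  unfolding mero_ord_def using eventually_cosparse_imp_eventually_at[of "\<lambda>z. f z = g z" UNIV z UNIV]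
  by (subst zorder_cong[of f g z z]) auto

lemma nev_T_power:
  assumes "mero_nz h"
  shows "nev_T r (\<lambda>z. h z ^ n) = real n * nev_T r h"
proof -
  have "(\<lambda>z. max 0 (- mero_ord (\<lambda>z. h z ^ n) z)) = (\<lambda>z. real n * max 0 (- mero_ord h z))"
    by (auto simp: ord_power[OF assms] max_def fun_eq_iff mult_le_0_iff zero_le_mult_iff)
  thus ?thesis unfolding nev_T_def nev_m_power by (simp add: nev_N_cmult algebra_simps)
qed

lemma eventually_T_mult:
  assumes f: "mero_nz f" and g: "mero_nz g"
  shows "\<forall>\<^sub>F r in radii. nev_T r (\<lambda>z. f z * g z) \<le> nev_T r f + nev_T r g"
  using eventually_m_mult[OF mero_nz_meromorphic[OF f] mero_nz_meromorphic[OF g]] eventually_ge_radii[of 1]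
proof eventually_elim
  case (elim r)
  have "nev_N r (\<lambda>z. max 0 (- mero_ord (\<lambda>z. f z * g z) z)) \<le> nev_N r (\<lambda>z. max 0 (- mero_ord f z) + max 0 (- mero_ord g z))"
    by (intro nev_N_mono loc_fin_add loc_fin_neg_part loc_fin_ord mero_nz_mult f g elim) (auto simp: ord_mult[OF f g])
  also have "\<dots> = nev_N r (\<lambda>z. max 0 (- mero_ord f z)) + nev_N r (\<lambda>z. max 0 (- mero_ord g z))"
    by (intro nev_N_add loc_fin_neg_part loc_fin_ord f g elim)
  finally show ?case using elim by (simp add: nev_T_def)
qed

lemma eventually_T_inverse:
  assumes "mero_nz h"
  obtains K where "0 \<le> K" "\<forall>\<^sub>F r in radii. \<bar>nev_T r (\<lambda>z. inverse (h z)) - nev_T r h\<bar> \<le> K"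
proof -
  obtain K where K: "0 \<le> K" "\<And>r. 1 \<le> r \<Longrightarrow> regular_radius h r \<Longrightarrow>
    \<bar>nev_m r (\<lambda>z. inverse (h z)) + nev_N r (\<lambda>z. max 0 (mero_ord h z)) - nev_T r h\<bar> \<le> K"
    using jensen_T[OF assms] by metis
  have "nev_T r (\<lambda>z. inverse (h z)) = nev_m r (\<lambda>z. inverse (h z)) + nev_N r (\<lambda>z. max 0 (mero_ord h z))" for r
    unfolding nev_T_def by (simp add: ord_inverse[OF assms])
  with K(2) have "\<forall>\<^sub>F r in radii. \<bar>nev_T r (\<lambda>z. inverse (h z)) - nev_T r h\<bar> \<le> K"
    by (intro eventually_regular_radiusI[OF assms]) simp
  with K(1) show ?thesis by (rule that)
qed

lemma eventually_jensen:
  assumes "mero_nz h"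
  obtains K where "0 \<le> K" "\<forall>\<^sub>F r in radii. \<bar>nev_m r h - nev_m r (\<lambda>z. inverse (h z)) - nev_N r (mero_ord h)\<bar> \<le> K"
proof -
  obtain C where C: "\<And>r. 1 \<le> r \<Longrightarrow> regular_radius h r \<Longrightarrow> nev_m r h - nev_m r (\<lambda>z. inverse (h z)) = nev_N r (mero_ord h) + C"
    using jensen_formula[OF assms] by metis
  have "\<forall>\<^sub>F r in radii. \<bar>nev_m r h - nev_m r (\<lambda>z. inverse (h z)) - nev_N r (mero_ord h)\<bar> \<le> \<bar>C\<bar>"
    by (rule eventually_regular_radiusI[OF assms]) (simp add: C)
  thus ?thesis by (intro that[of "\<bar>C\<bar>"]) auto
qed

lemma eventually_T_nonneg: "mero_nz h \<Longrightarrow> \<forall>\<^sub>F r in radii. 0 \<le> nev_T r h"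
  by (erule eventually_regular_radiusI) (auto intro: nev_T_nonneg)

lemma ord_deriv:
  assumes "mero_nz h" "mero_ord h z \<noteq> 0"
  shows "mero_ord (deriv h) z = mero_ord h z - 1"
proof -
  have "h meromorphic_on {z}" by (rule mero_nz_meromorphic[OF assms(1)])
  hence "zorder (deriv h) z = zorder h z - 1"
    using assms by (intro zorder_deriv_minus_1) (auto simp: meromorphic_at_iff mero_ord_def intro: mero_nz_frequently)
  thus ?thesis by (simp add: mero_ord_def)
qed

lemma is_pole_iff_ord: "mero_nz h \<Longrightarrow> is_pole h z \<longleftrightarrow> mero_ord h z < 0"
  unfolding mero_ord_def
  using isolated_pole_imp_neg_zorder[of h z] zorder_neg_imp_is_pole[of h z] mero_nz_eventually[of h z]
    mero_nz_meromorphic[of h "{z}"] by (auto simp: meromorphic_at_iff)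

lemma ord_deriv_nonneg:
  assumes "mero_nz h" "mero_nz (deriv h)" "0 \<le> mero_ord h z"
  shows "0 \<le> mero_ord (deriv h) z"
  using is_pole_deriv_iff[OF mero_nz_meromorphic[OF assms(1)], of z] is_pole_iff_ord[OF assms(1), of z]
    is_pole_iff_ord[OF assms(2), of z] assms(3) by linarith

text \<open>A pole of order m becomes one of order m + 1 \<le> 2 m, and the proximity function is
  treated through h' = (h'/h) h.\<close>

lemma eventually_T_deriv:
  assumes h: "mero_nz h" and h': "mero_nz (deriv h)"
  shows "\<forall>\<^sub>F r in radii. nev_T r (deriv h) \<le> 2 * nev_T r h + nev_m r (\<lambda>z. deriv h z / h z)"
proof -
  have nz: "\<forall>\<^sub>\<approx>z\<in>UNIV. h z \<noteq> 0" using h by (simp add: mero_nz_def)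
  have "\<forall>\<^sub>\<approx>z\<in>UNIV. deriv h z = (deriv h z / h z) * h z" using nz by eventually_elim auto
  from eventually_m_cong[OF this] have "\<forall>\<^sub>F r in radii. nev_m r (deriv h) = nev_m r (\<lambda>z. (deriv h z / h z) * h z)" .
  moreover have "\<forall>\<^sub>F r in radii. nev_m r (\<lambda>z. (deriv h z / h z) * h z) \<le> nev_m r (\<lambda>z. deriv h z / h z) + nev_m r h"
    by (intro eventually_m_mult mero_nz_meromorphic mero_nz_divide h h')
  ultimately show ?thesis using eventually_ge_radii[of 1] eventually_m_nonneg[OF mero_nz_meromorphic[OF h]]
  proof eventually_elim
    case (elim r)
    have "nev_N r (\<lambda>z. max 0 (- mero_ord (deriv h) z)) \<le> nev_N r (\<lambda>z. 2 * max 0 (- mero_ord h z))"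
    proof (intro nev_N_mono loc_fin_cmult loc_fin_neg_part loc_fin_ord h h' elim)
      fix z
      show "max 0 (- mero_ord (deriv h) z) \<le> 2 * max 0 (- mero_ord h z)"
      proof (cases "mero_ord h z < 0")
        case True
        hence "mero_ord h z \<le> -1" by (simp add: mero_ord_def)
        thus ?thesis using ord_deriv[OF h, of z] by auto
      next
        case False
        thus ?thesis using ord_deriv_nonneg[OF h h', of z] by auto
      qed
    qed
    also have "\<dots> = 2 * nev_N r (\<lambda>z. max 0 (- mero_ord h z))" by (rule nev_N_cmult)
    finally show ?case using elim by (simp add: nev_T_def)
  qed
qed

lemma ord_neg_part_add_const:
  assumes h: "mero_nz h" and hc: "mero_nz (\<lambda>z. h z + c)"
  shows "max 0 (- mero_ord (\<lambda>z. h z + c) z) = max 0 (- mero_ord h z)"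
proof (cases "c = 0")
  case False
  have c: "(\<lambda>_. c) meromorphic_on {z}" "\<exists>\<^sub>F z in at z. c \<noteq> 0" "zorder (\<lambda>_. c) z = 0"
    using False by auto
  show ?thesis
  proof (cases "mero_ord h z < 0")
    case True
    hence "zorder (\<lambda>z. h z + c) z = zorder h z"
      using c by (intro zorder_add1 mero_nz_meromorphic[OF h] mero_nz_frequently[OF h]) (auto simp: mero_ord_def)
    thus ?thesis by (simp add: mero_ord_def)
  next
    case nn: False
    have "0 \<le> zorder (\<lambda>z. h z + c) z"
      by (rule zorder_add_ge[of h z "\<lambda>_. c"])
         (use c nn mero_nz_frequently[OF hc] in \<open>auto intro: mero_nz_meromorphic[OF h] mero_nz_frequently[OF h] simp: mero_ord_def\<close>)
    thus ?thesis using nn by (simp add: mero_ord_def)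
  qed
qed simp

lemma eventually_T_add_const:
  assumes h: "mero_nz h" and hc: "mero_nz (\<lambda>z. h z + c)"
  shows "\<forall>\<^sub>F r in radii. nev_T r (\<lambda>z. h z + c) \<le> nev_T r h + (ln 2 + ln (max 1 (norm c)))"
  using eventually_m_add_const[OF mero_nz_meromorphic[OF h], of c]
  by eventually_elim (simp add: nev_T_def ord_neg_part_add_const[OF h hc])

section \<open>Estimates up to the error of the logarithmic derivative\<close>

text \<open>
  In the lemma on the logarithmic derivative of \<open>h\<close> the larger radius \<open>R\<close> is kept free, with \<open>U R\<close>
  in the role of \<open>nev_T R h\<close>. For \<open>U = 0\<close>, which is admissible once \<open>h\<close> has polynomial growth,
  \<open>R = r + 1\<close> makes the error \<open>O(ln r)\<close>.
\<close>

definition error_bound :: "(real \<Rightarrow> real) \<Rightarrow> real \<Rightarrow> real \<Rightarrow> real" where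
  "error_bound U r R = ln (2 + R + 1 / (R - r) + U R)"

definition le_err :: "(real \<Rightarrow> real) \<Rightarrow> (real \<Rightarrow> real) \<Rightarrow> (real \<Rightarrow> real) \<Rightarrow> bool" where
  "le_err U \<phi> \<psi> \<longleftrightarrow> (\<exists>C\<ge>0. \<forall>\<^sub>F r in radii. \<forall>R>r. \<phi> r \<le> \<psi> r + C * error_bound U r R)"

text \<open>The exponential turns the error into an arbitrary power of 2 + R + 1 / (R - r) + U R.
  Sums and multiples of such bounds are again of this form and their logarithms are multiples of the
  error; hence the class is closed under arithmetic and derivation, degenerate cases aside.\<close>

definition moderate :: "(real \<Rightarrow> real) \<Rightarrow> (complex \<Rightarrow> complex) \<Rightarrow> bool" where
  "moderate U h \<longleftrightarrow> mero_nz h \<and> (\<exists>C\<ge>0. \<forall>\<^sub>F r in radii. \<forall>R>r. nev_T r h \<le> exp (C * error_bound U r R))"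

locale error_term =
  fixes U :: "real \<Rightarrow> real"
  assumes U_nonneg: "0 \<le> U R"
begin

text \<open>The summand 2 in the error serves this bound, since 2 + R \<ge> 3 \<ge> e. It allows
  additive constants to be absorbed.\<close>

lemma error_bound_ge_1:
  assumes "1 \<le> r" "r < R"
  shows "1 \<le> error_bound U r R"
proof -
  have "exp 1 \<le> (3::real)" by (rule exp_le)
  also have "3 \<le> 2 + R + 1 / (R - r) + U R"
    using assms U_nonneg[of R] by (smt (verit) divide_nonneg_nonneg)
  finally have "ln (exp 1) \<le> ln (2 + R + 1 / (R - r) + U R)"
    by (subst ln_le_cancel_iff) (auto intro: less_le_trans[OF exp_gt_zero])
  thus ?thesis by (simp add: error_bound_def)
qed

lemma error_bound_ge_ln:
  assumes "1 \<le> r" "r < R"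
  shows "ln r \<le> error_bound U r R"
  unfolding error_bound_def using assms U_nonneg[of R]
  by (subst ln_le_cancel_iff) (smt (verit) divide_nonneg_nonneg)+

lemma exp_error_bound:
  assumes "1 \<le> r" "r < R"
  shows "exp (error_bound U r R) = 2 + R + 1 / (R - r) + U R"
  unfolding error_bound_def using assms U_nonneg[of R]
  by (subst exp_ln) (smt (verit) divide_nonneg_nonneg)+

lemma le_errI_const:
  assumes "\<forall>\<^sub>F r in radii. \<phi> r \<le> \<psi> r + K"
  shows "le_err U \<phi> \<psi>"
  unfolding le_err_def
proof (intro exI conjI)
  show "0 \<le> \<bar>K\<bar>" by simp
  show "\<forall>\<^sub>F r in radii. \<forall>R>r. \<phi> r \<le> \<psi> r + \<bar>K\<bar> * error_bound U r R"
    using assms eventually_ge_radii[of 1]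
  proof eventually_elim
    case (elim r)
    show ?case
    proof (intro allI impI)
      fix R assume "r < R"
      hence "\<bar>K\<bar> * 1 \<le> \<bar>K\<bar> * error_bound U r R" using error_bound_ge_1[of r R] elim by (intro mult_left_mono) auto
      thus "\<phi> r \<le> \<psi> r + \<bar>K\<bar> * error_bound U r R" using elim by linarith
    qed
  qed
qed

lemma le_errI:
  assumes "\<forall>\<^sub>F r in radii. \<phi> r \<le> \<psi> r"
  shows "le_err U \<phi> \<psi>"
  by (rule le_errI_const[of _ _ 0]) (use assms in simp)

lemma le_errI_ln:
  assumes "\<forall>\<^sub>F r in radii. \<phi> r \<le> \<psi> r + K * ln r"
  shows "le_err U \<phi> \<psi>"
  unfolding le_err_def
proof (intro exI conjI)
  show "0 \<le> \<bar>K\<bar>" by simp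
  show "\<forall>\<^sub>F r in radii. \<forall>R>r. \<phi> r \<le> \<psi> r + \<bar>K\<bar> * error_bound U r R"
    using assms eventually_ge_radii[of 1]
  proof eventually_elim
    case (elim r)
    show ?case
    proof (intro allI impI)
      fix R assume "r < R"
      have "K * ln r \<le> \<bar>K\<bar> * ln r" using elim by (intro mult_right_mono) auto
      also have "\<dots> \<le> \<bar>K\<bar> * error_bound U r R" using error_bound_ge_ln[of r R] elim \<open>r < R\<close> by (intro mult_left_mono) auto
      finally show "\<phi> r \<le> \<psi> r + \<bar>K\<bar> * error_bound U r R" using elim by linarith
    qed
  qed
qed

lemma le_err_refl: "le_err U \<phi> \<phi>"
  by (rule le_errI) auto

lemma le_err_add:
  assumes "le_err U \<phi>1 \<psi>1" "le_err U \<phi>2 \<psi>2"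
  shows "le_err U (\<lambda>r. \<phi>1 r + \<phi>2 r) (\<lambda>r. \<psi>1 r + \<psi>2 r)"
proof -
  obtain C1 where C1: "0 \<le> C1" "\<forall>\<^sub>F r in radii. \<forall>R>r. \<phi>1 r \<le> \<psi>1 r + C1 * error_bound U r R"
    using assms(1) unfolding le_err_def by blast
  obtain C2 where C2: "0 \<le> C2" "\<forall>\<^sub>F r in radii. \<forall>R>r. \<phi>2 r \<le> \<psi>2 r + C2 * error_bound U r R"
    using assms(2) unfolding le_err_def by blast
  have "\<forall>\<^sub>F r in radii. \<forall>R>r. \<phi>1 r + \<phi>2 r \<le> \<psi>1 r + \<psi>2 r + (C1 + C2) * error_bound U r R"
    using C1(2) C2(2)
  proof eventually_elim
    case (elim r)
    show ?case
    proof (intro allI impI)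
      fix R assume "r < R"
      hence "\<phi>1 r \<le> \<psi>1 r + C1 * error_bound U r R" "\<phi>2 r \<le> \<psi>2 r + C2 * error_bound U r R" using elim by auto
      thus "\<phi>1 r + \<phi>2 r \<le> \<psi>1 r + \<psi>2 r + (C1 + C2) * error_bound U r R" by (simp add: distrib_right)
    qed
  qed
  with C1(1) C2(1) show ?thesis unfolding le_err_def by (intro exI[of _ "C1 + C2"]) auto
qed

lemma le_err_trans:
  assumes "le_err U \<phi> \<psi>" "le_err U \<psi> \<xi>"
  shows "le_err U \<phi> \<xi>"
proof -
  have "le_err U (\<lambda>r. \<phi> r + \<psi> r) (\<lambda>r. \<psi> r + \<xi> r)" by (rule le_err_add[OF assms])
  thus ?thesis unfolding le_err_def by (simp add: algebra_simps)
qed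

lemma le_err_cmult:
  assumes "le_err U \<phi> \<psi>" "0 \<le> c"
  shows "le_err U (\<lambda>r. c * \<phi> r) (\<lambda>r. c * \<psi> r)"
proof -
  obtain C1 where C1: "0 \<le> C1" "\<forall>\<^sub>F r in radii. \<forall>R>r. \<phi> r \<le> \<psi> r + C1 * error_bound U r R"
    using assms(1) unfolding le_err_def by blast
  have "\<forall>\<^sub>F r in radii. \<forall>R>r. c * \<phi> r \<le> c * \<psi> r + (c * C1) * error_bound U r R"
    using C1(2)
  proof eventually_elim
    case (elim r)
    show ?case
    proof (intro allI impI)
      fix R assume "r < R"
      hence "c * \<phi> r \<le> c * (\<psi> r + C1 * error_bound U r R)" using elim assms(2) by (intro mult_left_mono) auto
      thus "c * \<phi> r \<le> c * \<psi> r + (c * C1) * error_bound U r R" by (simp add: algebra_simps)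
    qed
  qed
  with C1(1) assms(2) show ?thesis unfolding le_err_def by (intro exI[of _ "c * C1"]) auto
qed

lemma le_err_mono:
  assumes "le_err U \<phi> \<psi>" "\<forall>\<^sub>F r in radii. \<phi>' r \<le> \<phi> r" "\<forall>\<^sub>F r in radii. \<psi> r \<le> \<psi>' r"
  shows "le_err U \<phi>' \<psi>'"
  using le_err_trans[OF le_errI[OF assms(2)] le_err_trans[OF assms(1) le_errI[OF assms(3)]]] .

lemma le_err_move:
  "le_err U \<phi> \<psi> \<longleftrightarrow> le_err U (\<lambda>r. \<phi> r - \<psi> r) (\<lambda>_. 0)"
  unfolding le_err_def by (simp add: algebra_simps)

lemma moderate_mero_nz: "moderate U h \<Longrightarrow> mero_nz h"
  by (simp add: moderate_def)

lemma moderateI: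
  assumes g: "mero_nz g" and f: "moderate U f" and h: "moderate U h" and c: "0 \<le> c"
    and le: "le_err U (\<lambda>r. nev_T r g) (\<lambda>r. c * (nev_T r f + nev_T r h))"
  shows "moderate U g"
proof -
  obtain C1 where C1: "0 \<le> C1" "\<forall>\<^sub>F r in radii. \<forall>R>r. nev_T r f \<le> exp (C1 * error_bound U r R)"
    using f unfolding moderate_def by blast
  obtain C2 where C2: "0 \<le> C2" "\<forall>\<^sub>F r in radii. \<forall>R>r. nev_T r h \<le> exp (C2 * error_bound U r R)"
    using h unfolding moderate_def by blast
  obtain C3 where C3: "0 \<le> C3" "\<forall>\<^sub>F r in radii. \<forall>R>r. nev_T r g \<le> c * (nev_T r f + nev_T r h) + C3 * error_bound U r R"
    using le unfolding le_err_def by blast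
  define D where "D = C1 + C2 + C3 + 2 * c + 1"
  have "\<forall>\<^sub>F r in radii. \<forall>R>r. nev_T r g \<le> exp (D * error_bound U r R)"
    using C1(2) C2(2) C3(2) eventually_ge_radii[of 1]
  proof eventually_elim
    case (elim r)
    show ?case
    proof (intro allI impI)
      fix R assume R: "r < R"
      define x where "x = error_bound U r R"
      have x: "1 \<le> x" unfolding x_def by (rule error_bound_ge_1) (use elim R in auto)
      define E where "E = exp ((C1 + C2 + C3) * x)"
      have E1: "1 \<le> E" unfolding E_def using C1(1) C2(1) C3(1) x by simp
      have "nev_T r f \<le> exp (C1 * x)" "nev_T r h \<le> exp (C2 * x)" using elim R by (auto simp: x_def)
      moreover have "exp (C1 * x) \<le> E" "exp (C2 * x) \<le> E"
        unfolding E_def using C1(1) C2(1) C3(1) x by (auto intro!: mult_right_mono)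
      ultimately have "c * (nev_T r f + nev_T r h) \<le> c * (2 * E)" using c by (intro mult_left_mono) auto
      moreover have "C3 * x \<le> E"
      proof -
        have "C3 * x \<le> exp (C3 * x)" using exp_ge_add_one_self[of "C3 * x"] by linarith
        also have "\<dots> \<le> E" unfolding E_def using C1(1) C2(1) C3(1) x by (auto intro!: mult_right_mono)
        finally show ?thesis .
      qed
      ultimately have "nev_T r g \<le> c * (2 * E) + E" using elim R by (fastforce simp: x_def)
      also have "\<dots> = (1 + 2 * c) * E" by (simp add: algebra_simps)
      also have "\<dots> \<le> exp ((2 * c + 1) * x) * E"
      proof (rule mult_right_mono)
        define y where "y = (2 * c + 1) * x"
        have "(2 * c + 1) * 1 \<le> y" unfolding y_def using x c by (intro mult_left_mono) auto
        hence "2 * c + 1 \<le> y" by simp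
        also have "\<dots> \<le> exp y" using exp_ge_add_one_self[of y] by linarith
        finally show "1 + 2 * c \<le> exp ((2 * c + 1) * x)" by (simp add: y_def)
      qed (use E1 in auto)
      also have "\<dots> = exp (D * x)" by (simp add: E_def D_def exp_add[symmetric] algebra_simps)
      finally show "nev_T r g \<le> exp (D * error_bound U r R)" by (simp add: x_def)
    qed
  qed
  moreover have "0 \<le> D" unfolding D_def using C1(1) C2(1) C3(1) c by simp
  ultimately show ?thesis using g unfolding moderate_def by blast
qed

lemma moderate_mult:
  assumes "moderate U f" "moderate U h"
  shows "moderate U (\<lambda>z. f z * h z)"
proof (rule moderateI[OF _ assms, of _ 1])
  have nz: "mero_nz f" "mero_nz h" using assms by (auto simp: moderate_mero_nz)
  show "mero_nz (\<lambda>z. f z * h z)" by (rule mero_nz_mult[OF nz])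
  show "le_err U (\<lambda>r. nev_T r (\<lambda>z. f z * h z)) (\<lambda>r. 1 * (nev_T r f + nev_T r h))"
    by (rule le_errI) (use eventually_T_mult[OF nz] in simp)
qed auto

lemma moderate_of_T_le:
  assumes "mero_nz g" "moderate U h" "le_err U (\<lambda>r. nev_T r g) (\<lambda>r. c * nev_T r h)" "0 \<le> c"
  shows "moderate U g"
proof (rule moderateI[OF assms(1,2,2), of c])
  have ev: "\<forall>\<^sub>F r in radii. 0 \<le> nev_T r h" by (rule eventually_T_nonneg) (use assms moderate_mero_nz in auto)
  show "le_err U (\<lambda>r. nev_T r g) (\<lambda>r. c * (nev_T r h + nev_T r h))"
    by (rule le_err_mono[OF assms(3)], simp)
       (use ev assms(4) in \<open>auto elim!: eventually_mono intro!: mult_left_mono\<close>)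
qed (use assms in auto)

lemma moderate_inverse:
  assumes "moderate U h"
  shows "moderate U (\<lambda>z. inverse (h z))"
proof -
  have nz: "mero_nz h" using assms by (rule moderate_mero_nz)
  obtain K where K: "\<forall>\<^sub>F r in radii. \<bar>nev_T r (\<lambda>z. inverse (h z)) - nev_T r h\<bar> \<le> K"
    using eventually_T_inverse[OF nz] by metis
  show ?thesis
  proof (rule moderate_of_T_le[OF mero_nz_inverse[OF nz] assms, of 1])
    show "le_err U (\<lambda>r. nev_T r (\<lambda>z. inverse (h z))) (\<lambda>r. 1 * nev_T r h)"
      by (rule le_errI_const[of _ _ K]) (use K in \<open>auto elim!: eventually_mono\<close>)
  qed auto
qed

lemma moderate_divide:
  assumes "moderate U f" "moderate U h"
  shows "moderate U (\<lambda>z. f z / h z)"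
  using moderate_mult[OF assms(1) moderate_inverse[OF assms(2)]] by (simp add: divide_inverse)

lemma moderate_power:
  assumes "moderate U h"
  shows "moderate U (\<lambda>z. h z ^ n)"
  proof (rule moderate_of_T_le[of _ h "real n"])
  show "mero_nz (\<lambda>z. h z ^ n)" by (intro mero_nz_power moderate_mero_nz assms)
  show "le_err U (\<lambda>r. nev_T r (\<lambda>z. h z ^ n)) (\<lambda>r. real n * nev_T r h)"
    unfolding nev_T_power[OF moderate_mero_nz[OF assms]] by (rule le_err_refl)
qed (use assms in auto)

lemma moderate_add_const:
  assumes "moderate U h" "mero_nz (\<lambda>z. h z + c)"
  shows "moderate U (\<lambda>z. h z + c)"
proof (rule moderate_of_T_le[OF assms(2,1), of 1])
  show "le_err U (\<lambda>r. nev_T r (\<lambda>z. h z + c)) (\<lambda>r. 1 * nev_T r h)"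
    by (rule le_errI_const) (use eventually_T_add_const[OF moderate_mero_nz[OF assms(1)] assms(2)] in simp)
qed auto

text \<open>\<open>log_derivative_raw\<close> asks for regular radii r1 and r2 between r and R at
  which the characteristic is under control. Every interval of large radii contains such, since only
  countably many radii are bad.\<close>

theorem log_derivative:
  assumes "moderate U h"
  shows "le_err U (\<lambda>r. nev_m r (\<lambda>z. deriv h z / h z)) (\<lambda>_. 0)"
proof -
  have nz: "mero_nz h" using assms by (rule moderate_mero_nz)
  obtain C where C: "0 \<le> C" "\<forall>\<^sub>F r in radii. \<forall>R>r. nev_T r h \<le> exp (C * error_bound U r R)"
    using assms unfolding moderate_def by blast
  obtain D where D: "0 \<le> D" "\<And>r r1 r2 X. 1 \<le> r \<Longrightarrow> r < r1 \<Longrightarrow> r1 < r2 \<Longrightarrow>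
     regular_radius h r \<Longrightarrow> regular_radius h r1 \<Longrightarrow> regular_radius h r2 \<Longrightarrow> 2 \<le> X \<Longrightarrow> r2 \<le> X \<Longrightarrow> 1 / (r1 - r) \<le> X \<Longrightarrow>
     1 / (r2 - r1) \<le> X \<Longrightarrow> nev_T r1 h \<le> X \<Longrightarrow> nev_T r2 h \<le> X \<Longrightarrow>
     nev_m r (\<lambda>z. deriv h z / h z) \<le> D * ln X"
    by (rule log_derivative_raw[OF nz], rule that, assumption) assumption
  have "\<forall>\<^sub>F r in radii. regular_radius h r \<and> (\<forall>R>r. nev_T r h \<le> exp (C * error_bound U r R))"
    using C(2) eventually_regular_radius[OF nz] by eventually_elim auto
  from radii_ex[OF this] obtain r0 where r0: "\<forall>a\<ge>r0. \<forall>b>a.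
     \<exists>r. a < r \<and> r < b \<and> regular_radius h r \<and> (\<forall>R>r. nev_T r h \<le> exp (C * error_bound U r R))" ..
  have "\<forall>\<^sub>F r in radii. \<forall>R>r. nev_m r (\<lambda>z. deriv h z / h z) \<le> 0 + (D * (3 * C + 3)) * error_bound U r R"
    using eventually_ge_radii[of 1] eventually_ge_radii[of r0] eventually_regular_radius[OF nz]
  proof eventually_elim
    case (elim r)
    show ?case
    proof (intro allI impI)
      fix R assume R: "r < R"
      \<comment> \<open>Five equal pieces: r1 is taken from the second and r2 from the fourth, so
        that all gaps, including the one between r2 and R, are at least d.\<close>
      define d where "d = (R - r) / 5"
      have d: "0 < d" "R = r + 5 * d" using R by (auto simp: d_def diff_divide_distrib)
      have "r0 \<le> r + d" "r + d < r + 2 * d" using d elim by auto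
      then obtain r1 where r1: "r + d < r1" "r1 < r + 2 * d" "regular_radius h r1" "\<And>R. r1 < R \<Longrightarrow> nev_T r1 h \<le> exp (C * error_bound U r1 R)"
        using r0 by blast
      have "r0 \<le> r + 3 * d" "r + 3 * d < r + 4 * d" using d elim by auto
      then obtain r2 where r2: "r + 3 * d < r2" "r2 < r + 4 * d" "regular_radius h r2" "\<And>R. r2 < R \<Longrightarrow> nev_T r2 h \<le> exp (C * error_bound U r2 R)"
        using r0 by blast
      define x where "x = error_bound U r R"
      have x: "1 \<le> x" unfolding x_def by (rule error_bound_ge_1) (use elim R in auto)
      have ex: "exp x = 2 + R + 1 / (R - r) + U R" unfolding x_def by (rule exp_error_bound) (use elim R in auto)
      have e5: "5 \<le> exp (2::real)"
        using exp_lower_Taylor_quadratic[of "2::real"] by simp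
      also have "\<dots> \<le> exp (2 * x)" using x by simp
      finally have e52: "5 \<le> exp (2 * x)" .
      \<comment> \<open>The factor 5 lost through 1 / d is swallowed by enlarging the exponent from
        x to 3 x, which is possible because x \<ge> 1 and e^2 \<ge> 5.\<close>
      have e3: "5 * exp x \<le> exp (3 * x)"
      proof -
        have "5 * exp x \<le> exp (2 * x) * exp x" using e52 by (intro mult_right_mono) auto
        thus ?thesis by (simp add: exp_add[symmetric])
      qed
      have dinv: "1 / d = 5 * (1 / (R - r))" by (simp add: d_def)
      have "1 / (R - r) \<le> exp x" using ex elim R U_nonneg[of R] by linarith
      hence inv: "1 / d \<le> 5 * exp x" using dinv by linarith
      have aux: "2 + y + p + u \<le> 5 * (2 + y + q + u)" if "p \<le> 5 * q" "1 \<le> y" "0 \<le> u" for p q y u :: real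
        using that by simp
      have Phi_le: "error_bound U s R \<le> 3 * x" if s: "r < s" "s \<le> R - d" for s
      proof -
        have "1 / (R - s) \<le> 1 / d" using s d by (intro divide_left_mono) auto
        also note dinv
        finally have "2 + R + 1 / (R - s) + U R \<le> 5 * (2 + R + 1 / (R - r) + U R)"
          using aux[of "1 / (R - s)" "1 / (R - r)" R "U R"] elim R U_nonneg[of R] by auto
        also have "\<dots> = 5 * exp x" by (simp add: ex)
        also note e3
        finally have "exp (error_bound U s R) \<le> exp (3 * x)" using exp_error_bound[of s R] s elim d by simp
        thus ?thesis by simp
      qed
      \<comment> \<open>Large enough for the characteristics, which are at most exp (3 C x), and for
        the radii and inverse gaps, which are at most exp (3 x).\<close>
      define X where "X = exp ((3 * C + 3) * x)"
      have eX: "exp (y * x) \<le> X" if "y \<le> 3 * C + 3" for y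
        unfolding X_def using that x by (auto intro: mult_right_mono)
      have Ts: "nev_T s h \<le> X" if s: "r < s" "s \<le> R - d" "\<And>R. s < R \<Longrightarrow> nev_T s h \<le> exp (C * error_bound U s R)" for s
      proof -
        have "nev_T s h \<le> exp (C * error_bound U s R)" using s d by auto
        also have "\<dots> \<le> exp (C * (3 * x))" using Phi_le[OF s(1,2)] C(1) by (auto intro: mult_left_mono)
        also have "\<dots> \<le> X" using eX[of "C * 3"] by (simp add: mult.assoc)
        finally show ?thesis .
      qed
      have d1: "1 / (r1 - r) \<le> 1 / d" "1 / (r2 - r1) \<le> 1 / d"
        using r1 r2 d by (auto intro!: divide_left_mono mult_pos_pos)
      have inv2: "1 / d \<le> X" using inv e3 eX[of 3] C(1) by linarith
      have e1: "exp x \<le> X" using eX[of 1] C(1) by simp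
      have Rnn: "0 < 1 / (R - r)" using R by simp
      have "nev_m r (\<lambda>z. deriv h z / h z) \<le> D * ln X"
      proof (rule D(2)[of r r1 r2])
        show "2 \<le> X" "r2 \<le> X" using e1 ex U_nonneg[of R] elim R Rnn r2 d by linarith+
        show "1 / (r1 - r) \<le> X" "1 / (r2 - r1) \<le> X" using d1 inv2 by linarith+
        show "nev_T r1 h \<le> X" by (rule Ts) (use r1 d in auto)
        show "nev_T r2 h \<le> X" by (rule Ts) (use r2 d in auto)
      qed (use r1 r2 d elim in auto)
      thus "nev_m r (\<lambda>z. deriv h z / h z) \<le> 0 + (D * (3 * C + 3)) * error_bound U r R"
        by (simp add: X_def x_def)
    qed
  qed
  thus ?thesis unfolding le_err_def using D(1) C(1) by (intro exI[of _ "D * (3 * C + 3)"]) auto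
qed

lemma moderate_deriv:
  assumes "moderate U h" "mero_nz (deriv h)"
  shows "moderate U (deriv h)"
proof (rule moderate_of_T_le[OF assms(2,1), of 2])
  have nz: "mero_nz h" using assms(1) by (rule moderate_mero_nz)
  have "le_err U (\<lambda>r. nev_T r (deriv h)) (\<lambda>r. 2 * nev_T r h + nev_m r (\<lambda>z. deriv h z / h z))"
    by (rule le_errI) (rule eventually_T_deriv[OF nz assms(2)])
  moreover have "le_err U (\<lambda>r. 2 * nev_T r h + nev_m r (\<lambda>z. deriv h z / h z)) (\<lambda>r. 2 * nev_T r h + 0)"
    by (rule le_err_add[OF le_err_refl log_derivative[OF assms(1)]])
  ultimately show "le_err U (\<lambda>r. nev_T r (deriv h)) (\<lambda>r. 2 * nev_T r h)"
    using le_err_trans by simp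
qed auto

end

section \<open>Derivatives of powers\<close>

text \<open>A sparse set is closed, so functions that agree off it agree near every point of its
  complement.\<close>

lemma deriv_cong_cosparse:
  fixes f g :: "complex \<Rightarrow> complex"
  assumes "\<forall>\<^sub>\<approx>z\<in>UNIV. f z = g z"
  shows "\<forall>\<^sub>\<approx>z\<in>UNIV. deriv f z = deriv g z"
proof -
  have "closed {z. f z \<noteq> g z}"
    using assms by (intro sparse_in_UNIV_imp_closed) (simp add: eventually_cosparse)
  hence op: "open {z. f z = g z}" by (simp add: closed_def Collect_neg_eq[symmetric])
  have "deriv f z = deriv g z" if "f z = g z" for z
    by (rule deriv_cong_ev) (use eventually_nhds_in_open[OF op, of z] that in auto)
  thus ?thesis using assms by (auto elim!: eventually_mono)
qed

lemma mero_nz_of_deriv: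
  assumes "h meromorphic_on UNIV" "mero_nz (deriv h)"
  shows "mero_nz h"
proof (rule ccontr)
  assume "\<not> mero_nz h"
  hence "\<forall>\<^sub>\<approx>z\<in>UNIV. h z = (\<lambda>_. 0) z" using mero_nz_or_0[OF assms(1)] by simp
  from deriv_cong_cosparse[OF this] have "\<forall>\<^sub>\<approx>z\<in>UNIV. deriv h z = 0" by simp
  moreover have "\<forall>\<^sub>\<approx>z\<in>UNIV. deriv h z \<noteq> 0" using assms(2) by (simp add: mero_nz_def)
  ultimately have "\<forall>\<^sub>\<approx>z\<in>(UNIV::complex set). False" by eventually_elim auto
  thus False by (simp add: eventually_False)
qed

lemma mero_nz_higher_deriv_le:
  assumes "h meromorphic_on UNIV" "mero_nz ((deriv ^^ k) h)" "j \<le> k"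
  shows "mero_nz ((deriv ^^ j) h)"
  using assms(3,2)
proof (induction k rule: dec_induct)
  case (step i)
  show ?case
    by (rule step.IH, rule mero_nz_of_deriv)
       (use step.prems in \<open>auto intro!: meromorphic_intros assms\<close>)
qed auto

text \<open>The plane stays connected when a sparse set is removed, so a function with zero
  derivative is constant on what remains.\<close>

lemma deriv_zero_imp_const:
  assumes "h meromorphic_on UNIV" "\<forall>\<^sub>\<approx>z\<in>UNIV. deriv h z = 0"
  shows "\<exists>c. \<forall>\<^sub>\<approx>z\<in>UNIV. h z = c"
proof -
  define S where "S = {z. h analytic_on {z} \<and> deriv h z = 0}"
  have ev: "\<forall>\<^sub>\<approx>z\<in>UNIV. z \<in> S"
    using meromorphic_on_imp_analytic_cosparse[OF assms(1)] assms(2)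
    by eventually_elim (auto simp: S_def)
  hence sp: "(- S) sparse_in UNIV" by (simp add: eventually_cosparse Compl_eq)
  have op: "open S"
    using sparse_in_UNIV_imp_closed[OF sp] by (simp add: open_closed)
  have con: "connected S"
    using sparse_imp_connected[OF _ _ _ sp] by (simp add: Diff_eq connected_UNIV)
  have "\<exists>c. \<forall>z\<in>S. h z = c"
  proof -
    have "(h has_field_derivative 0) (at z)" if "z \<in> S" for z
    proof -
      have "h field_differentiable (at z)" using that by (auto simp: S_def analytic_on_imp_differentiable_at)
      thus ?thesis using that DERIV_deriv_iff_field_differentiable[of h z] by (simp add: S_def)
    qed
    hence "continuous_on S h" "\<forall>z\<in>S - {}. (h has_field_derivative 0) (at z)"
      by (auto intro!: continuous_at_imp_continuous_on DERIV_isCont)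
    from DERIV_zero_connected_constant[OF con op finite.emptyI this] show ?thesis by metis
  qed
  then obtain c where "\<forall>z\<in>S. h z = c" by blast
  thus ?thesis using ev by (auto elim!: eventually_mono)
qed

section \<open>Orders of higher derivatives\<close>

lemma ord_higher_deriv_nonneg:
  assumes "h meromorphic_on UNIV" "mero_nz ((deriv ^^ k) h)" "0 \<le> mero_ord h z"
  shows "0 \<le> mero_ord ((deriv ^^ k) h) z"
  using assms(2)
proof (induction k)
  case (Suc k)
  have k: "mero_nz ((deriv ^^ k) h)" using mero_nz_higher_deriv_le[OF assms(1) Suc.prems, of k] by simp
  show ?case using ord_deriv_nonneg[OF k _ Suc.IH[OF k]] Suc.prems by simp
qed (use assms in simp)

text \<open>A derivation lowers the order by one whenever the order is not 0. This is so at every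
  stage if h has a pole, or a zero of order at least k: before the last derivation the order is then
  still at least 1.\<close>

lemma ord_higher_deriv:
  assumes "h meromorphic_on UNIV" "mero_nz ((deriv ^^ k) h)" "mero_ord h z < 0 \<or> real k \<le> mero_ord h z"
  shows "mero_ord ((deriv ^^ k) h) z = mero_ord h z - real k"
  using assms(2,3)
proof (induction k)
  case (Suc k)
  have k: "mero_nz ((deriv ^^ k) h)" using mero_nz_higher_deriv_le[OF assms(1) Suc.prems(1), of k] by simp
  have IH: "mero_ord ((deriv ^^ k) h) z = mero_ord h z - real k" using Suc.IH[OF k] Suc.prems(2) by auto
  hence "mero_ord ((deriv ^^ k) h) z \<noteq> 0" using Suc.prems(2) by auto
  thus ?case using ord_deriv[OF k] IH by simp
qed simp

lemma ord_int_cases: "mero_ord h z \<le> - 1 \<or> mero_ord h z = 0 \<or> 1 \<le> mero_ord h z"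
proof -
  have "zorder h z \<le> - 1 \<or> zorder h z = 0 \<or> 1 \<le> zorder h z" by linarith
  hence "real_of_int (zorder h z) \<le> real_of_int (-1) \<or> real_of_int (zorder h z) = real_of_int 0 \<or>
      real_of_int 1 \<le> real_of_int (zorder h z)"
    by (simp only: of_int_le_iff of_int_eq_iff)
  thus ?thesis unfolding mero_ord_def by simp
qed

text \<open>The four cases are a pole, a zero, a c-point and any other point of h. Stating them for
  real numbers, with the integrality of d kept as a gap around 0, makes the later local comparisons
  linear arithmetic.\<close>

definition local_orders :: "real \<Rightarrow> real \<Rightarrow> real \<Rightarrow> bool" where
  "local_orders s t d \<longleftrightarrow> (d \<le> -1 \<or> d = 0 \<or> 1 \<le> d) \<and> ((s \<le> -1 \<and> t = s \<and> d = s - 1) \<or> (1 \<le> s \<and> t = 0 \<and> d = s - 1) \<or>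
     (s = 0 \<and> 1 \<le> t \<and> d = t - 1) \<or> (s = 0 \<and> t = 0 \<and> 0 \<le> d))"

lemma deriv_add_const_mero:
  assumes "h meromorphic_on UNIV"
  shows "\<forall>\<^sub>\<approx>z\<in>UNIV. deriv (\<lambda>w. h w + c) z = deriv h z"
  using meromorphic_on_imp_analytic_cosparse[OF assms]
proof eventually_elim
  case (elim z)
  hence "h field_differentiable (at z)" by (simp add: analytic_on_imp_differentiable_at)
  thus ?case by (simp add: deriv_add)
qed

lemma ord_diff_const:
  assumes h: "mero_nz h" and hc: "mero_nz (\<lambda>z. h z - c)" and c: "c \<noteq> 0"
  shows "mero_ord h z < 0 \<Longrightarrow> mero_ord (\<lambda>z. h z - c) z = mero_ord h z"
    and "0 < mero_ord h z \<Longrightarrow> mero_ord (\<lambda>z. h z - c) z = 0"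
    and "0 \<le> mero_ord h z \<Longrightarrow> 0 \<le> mero_ord (\<lambda>z. h z - c) z"
proof -
  have c': "(\<lambda>_. c) meromorphic_on {z}" "\<exists>\<^sub>F z in at z. c \<noteq> 0" "zorder (\<lambda>_. c) z = 0"
    using c by auto
  show "mero_ord (\<lambda>z. h z - c) z = mero_ord h z" if "mero_ord h z < 0"
    unfolding mero_ord_def using that c'
    by (subst zorder_diff1[OF mero_nz_meromorphic[OF h] mero_nz_frequently[OF h]]) (auto simp: mero_ord_def)
  show "mero_ord (\<lambda>z. h z - c) z = 0" if "0 < mero_ord h z"
    unfolding mero_ord_def using that c'
    by (subst zorder_diff2[OF mero_nz_meromorphic[OF h] mero_nz_frequently[OF h]]) (auto simp: mero_ord_def)
  show "0 \<le> mero_ord (\<lambda>z. h z - c) z" if "0 \<le> mero_ord h z"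
    using zorder_diff_ge[OF mero_nz_meromorphic[OF h] mero_nz_frequently[OF h] c'(1,2), of 0]
      that c' mero_nz_frequently[OF hc] by (auto simp: mero_ord_def)
qed

lemma local_orders:
  assumes h: "mero_nz h" and hc: "mero_nz (\<lambda>z. h z - c)" and h': "mero_nz (deriv h)" and c: "c \<noteq> 0"
  shows "local_orders (mero_ord h z) (mero_ord (\<lambda>z. h z - c) z) (mero_ord (deriv h) z)"
proof -
  have dd: "mero_ord (deriv (\<lambda>z. h z - c)) z = mero_ord (deriv h) z"
    using ord_cong[OF deriv_add_const_mero[OF mero_nz_meromorphic[OF h], of "-c"]] by simp
  note 1 = ord_diff_const[OF h hc c, where z = z]
  note 2 = ord_deriv[OF h, of z] ord_deriv[OF hc, of z] ord_deriv_nonneg[OF h h', of z]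
  note 3 = ord_int_cases[of h z] ord_int_cases[of "\<lambda>z. h z - c" z] ord_int_cases[of "deriv h" z]
  show ?thesis unfolding local_orders_def using 1 2 3 dd by (smt (verit))
qed

section \<open>Small functions\<close>

context error_term
begin

text \<open>Modelled on nonzero polynomials: both proximity functions are negligible, and the zeros
  and poles can be put into a finite exceptional set.\<close>

definition small_function :: "(complex \<Rightarrow> complex) \<Rightarrow> bool" where
  "small_function \<eta> \<longleftrightarrow> mero_nz \<eta> \<and> le_err U (\<lambda>r. nev_m r \<eta>) (\<lambda>_. 0) \<and> le_err U (\<lambda>r. nev_m r (\<lambda>z. inverse (\<eta> z))) (\<lambda>_. 0) \<and>
     finite {z. mero_ord \<eta> z \<noteq> 0}"

lemma le_err_N_finite:
  assumes "finite {z. \<nu> z \<noteq> 0}"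
  shows "le_err U (\<lambda>r. nev_N r \<nu>) (\<lambda>_. 0)"
  by (rule le_errI_ln[where K = "\<Sum>z\<in>{z. \<nu> z \<noteq> 0}. \<bar>\<nu> z\<bar>"])
     (use nev_N_finite_le[OF assms] eventually_ge_radii[of 1] in \<open>auto elim!: eventually_mono\<close>)

lemma poly_bound:
  fixes p :: "complex poly"
  shows "\<exists>K\<ge>0. \<forall>z. norm (poly p z) \<le> K * max 1 (norm z) ^ degree p"
proof -
  define K where "K = (\<Sum>i\<le>degree p. norm (coeff p i))"
  have "norm (poly p z) \<le> K * max 1 (norm z) ^ degree p" for z
  proof -
    have "norm (poly p z) \<le> (\<Sum>i\<le>degree p. norm (coeff p i * z ^ i))"
      unfolding poly_altdef by (rule norm_sum)
    also have "\<dots> \<le> (\<Sum>i\<le>degree p. norm (coeff p i) * max 1 (norm z) ^ degree p)"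
    proof (intro sum_mono)
      fix i assume i: "i \<in> {..degree p}"
      have "norm z ^ i \<le> max 1 (norm z) ^ i" by (intro power_mono) auto
      also have "\<dots> \<le> max 1 (norm z) ^ degree p" using i by (intro power_increasing) auto
      finally show "norm (coeff p i * z ^ i) \<le> norm (coeff p i) * max 1 (norm z) ^ degree p"
        by (simp add: norm_mult norm_power mult_left_mono)
    qed
    finally show ?thesis by (simp add: K_def sum_distrib_right)
  qed
  moreover have "0 \<le> K" unfolding K_def by (intro sum_nonneg) auto
  ultimately show ?thesis by blast
qed

lemma le_err_m_poly: "le_err U (\<lambda>r. nev_m r (poly p)) (\<lambda>_. 0)"
proof -
  obtain K where K: "0 \<le> K" "\<And>z. norm (poly p z) \<le> K * max 1 (norm z) ^ degree p"
    using poly_bound by blast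
  have "\<forall>\<^sub>F r in radii. nev_m r (poly p) \<le> real (degree p) * ln r + ln (max 1 K)"
    using eventually_ge_radii[of 1]
  proof eventually_elim
    case (elim r)
    have "nev_m r (poly p) \<le> circle_mean r (\<lambda>_. real (degree p) * ln r + ln (max 1 K))"
      unfolding nev_m_def
    proof (rule circle_mean_mono)
      fix z :: complex assume z: "norm z = r"
      have "ln (max 1 (norm (poly p z))) \<le> ln (max 1 (K * r ^ degree p))"
        using K(2)[of z] z elim by (subst ln_le_cancel_iff) (auto simp: max_def)
      also have "\<dots> \<le> ln (max 1 K) + ln (max 1 (r ^ degree p))"
        by (rule ln_max_mult_le) (use K elim in auto)
      also have "max 1 (r ^ degree p) = r ^ degree p" using one_le_power[OF elim] by simp
      finally show "ln (max 1 (norm (poly p z))) \<le> real (degree p) * ln r + ln (max 1 K)"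
        using elim by (simp add: ln_realpow)
    qed (use elim in \<open>auto intro!: continuous_lnmax continuous_intros\<close>)
    thus ?case by simp
  qed
  hence "le_err U (\<lambda>r. nev_m r (poly p)) (\<lambda>r. real (degree p) * ln r)" by (rule le_errI_const)
  moreover have "le_err U (\<lambda>r. real (degree p) * ln r) (\<lambda>_. 0)"
    by (rule le_errI_ln[of _ _ "real (degree p)"]) simp
  ultimately show ?thesis by (rule le_err_trans)
qed

text \<open>By Jensen's formula m(r, 1 / p) is at most m(r, p) + O(1), because the counting term of
  a polynomial is nonnegative.\<close>

lemma small_poly:
  assumes "p \<noteq> 0"
  shows "small_function (poly p)"
proof -
  have an: "poly p analytic_on S" for S
    by (rule analytic_on_subset[of _ UNIV]) (auto simp: analytic_on_open intro!: holomorphic_intros)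
  have fin: "finite {z. poly p z = 0}" by (rule poly_roots_finite[OF assms])
  have nz: "mero_nz (poly p)" unfolding mero_nz_def
  proof
    show "poly p meromorphic_on UNIV" by (intro analytic_on_imp_meromorphic_on an)
    show "\<forall>\<^sub>\<approx>z\<in>UNIV. poly p z \<noteq> 0" using finite_imp_sparse[OF fin] by (simp add: eventually_cosparse)
  qed
  have mero_ord: "0 \<le> mero_ord (poly p) z" "mero_ord (poly p) z \<noteq> 0 \<Longrightarrow> poly p z = 0" for z
    using zorder_ge_0[OF an mero_nz_frequently[OF nz], of z] zorder_eq_0_iff[OF an mero_nz_frequently[OF nz], of z]
    by (auto simp: mero_ord_def)
  obtain K where K: "\<forall>\<^sub>F r in radii. \<bar>nev_m r (poly p) - nev_m r (\<lambda>z. inverse (poly p z)) - nev_N r (mero_ord (poly p))\<bar> \<le> K"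
    using eventually_jensen[OF nz] by metis
  have "le_err U (\<lambda>r. nev_m r (\<lambda>z. inverse (poly p z))) (\<lambda>r. nev_m r (poly p))"
    by (rule le_errI_const[of _ _ K])
       (use K in \<open>rule eventually_mono\<close>, use nev_N_nonneg[of "mero_ord (poly p)", OF mero_ord(1)] in \<open>smt (verit)\<close>)
  hence "le_err U (\<lambda>r. nev_m r (\<lambda>z. inverse (poly p z))) (\<lambda>_. 0)"
    by (rule le_err_trans[OF _ le_err_m_poly])
  moreover have "finite {z. mero_ord (poly p) z \<noteq> 0}"
    by (rule finite_subset[OF _ fin]) (use mero_ord(2) in auto)
  ultimately show ?thesis using nz le_err_m_poly by (simp add: small_function_def)
qed

lemma moderate_small:
  assumes "small_function \<eta>"
  shows "moderate U \<eta>"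
proof -
  have "le_err U (\<lambda>r. nev_m r \<eta> + nev_N r (\<lambda>z. max 0 (- mero_ord \<eta> z))) (\<lambda>r. 0 + 0)"
    by (rule le_err_add) (use assms in \<open>auto simp: small_function_def intro!: le_err_N_finite elim: rev_finite_subset\<close>)
  then obtain C where C: "0 \<le> C" "\<forall>\<^sub>F r in radii. \<forall>R>r. nev_T r \<eta> \<le> C * error_bound U r R"
    unfolding le_err_def nev_T_def by auto
  have "\<forall>\<^sub>F r in radii. \<forall>R>r. nev_T r \<eta> \<le> exp (C * error_bound U r R)"
    using C(2)
  proof eventually_elim
    case (elim r)
    show ?case
    proof (intro allI impI)
      fix R assume "r < R"
      hence "nev_T r \<eta> \<le> C * error_bound U r R" using elim by auto
      thus "nev_T r \<eta> \<le> exp (C * error_bound U r R)" using exp_ge_add_one_self[of "C * error_bound U r R"] by linarith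
    qed
  qed
  thus ?thesis using C(1) assms unfolding moderate_def small_function_def by blast
qed

lemma le_err_jensen:
  assumes "mero_nz h"
  shows "le_err U (\<lambda>r. nev_m r h) (\<lambda>r. nev_m r (\<lambda>z. inverse (h z)) + nev_N r (mero_ord h))"
    and "le_err U (\<lambda>r. nev_m r (\<lambda>z. inverse (h z)) + nev_N r (mero_ord h)) (\<lambda>r. nev_m r h)"
proof -
  obtain K where K: "\<forall>\<^sub>F r in radii. \<bar>nev_m r h - nev_m r (\<lambda>z. inverse (h z)) - nev_N r (mero_ord h)\<bar> \<le> K"
    using eventually_jensen[OF assms] by metis
  show "le_err U (\<lambda>r. nev_m r h) (\<lambda>r. nev_m r (\<lambda>z. inverse (h z)) + nev_N r (mero_ord h))"
    and "le_err U (\<lambda>r. nev_m r (\<lambda>z. inverse (h z)) + nev_N r (mero_ord h)) (\<lambda>r. nev_m r h)"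
    by (rule le_errI_const[of _ _ K]; use K in \<open>rule eventually_mono\<close>; linarith)+
qed

text \<open>Jensen's formula with the nonnegative term m(r, 1 / h) dropped: if m(r, h) is
  negligible, the zeros outweigh the poles by at most the error. For logarithmic derivatives this
  bounds the zeros by the poles.\<close>

lemma le_err_N_ord_logderiv:
  assumes h: "mero_nz h" and sm: "le_err U (\<lambda>r. nev_m r h) (\<lambda>_. 0)"
  shows "le_err U (\<lambda>r. nev_N r (mero_ord h)) (\<lambda>_. 0)"
proof -
  have "le_err U (\<lambda>r. nev_m r (\<lambda>z. inverse (h z)) + nev_N r (mero_ord h)) (\<lambda>_. 0)"
    by (rule le_err_trans[OF le_err_jensen(2)[OF h] sm])
  thus ?thesis
    by (rule le_err_mono) (use eventually_m_nonneg[OF mero_nz_meromorphic[OF mero_nz_inverse[OF h]]] in \<open>auto elim!: eventually_mono\<close>)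
qed

lemma le_err_N_pos_ord:
  assumes h: "mero_nz h"
  shows "le_err U (\<lambda>r. nev_N r (\<lambda>z. max 0 (mero_ord h z))) (\<lambda>r. nev_T r h)"
proof -
  obtain K where K: "\<And>r. 1 \<le> r \<Longrightarrow> regular_radius h r \<Longrightarrow>
    \<bar>nev_m r (\<lambda>z. inverse (h z)) + nev_N r (\<lambda>z. max 0 (mero_ord h z)) - nev_T r h\<bar> \<le> K"
    using jensen_T[OF h] by metis
  have "\<forall>\<^sub>F r in radii. nev_N r (\<lambda>z. max 0 (mero_ord h z)) \<le> nev_T r h + K"
    using eventually_regular_radius[OF h] eventually_ge_radii[of 1] eventually_m_nonneg[OF mero_nz_meromorphic[OF mero_nz_inverse[OF h]]]
    by eventually_elim (use K in \<open>smt (verit)\<close>)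
  thus ?thesis by (rule le_errI_const)
qed

text \<open>The quotient telescopes into logarithmic derivatives of P, P' and so on, each of which
  is moderate in turn.\<close>

lemma moderate_higher_deriv:
  assumes P: "moderate U P" and nz: "mero_nz ((deriv ^^ k) P)"
  shows "moderate U ((deriv ^^ k) P) \<and> le_err U (\<lambda>r. nev_m r (\<lambda>z. (deriv ^^ k) P z / P z)) (\<lambda>_. 0)"
  using nz
proof (induction k)
  case 0
  have "\<forall>\<^sub>\<approx>z\<in>UNIV. P z \<noteq> 0" using moderate_mero_nz[OF P] by (simp add: mero_nz_def)
  hence "\<forall>\<^sub>\<approx>z\<in>UNIV. P z / P z = 1" by eventually_elim auto
  from eventually_m_cong[OF this] have "le_err U (\<lambda>r. nev_m r (\<lambda>z. P z / P z)) (\<lambda>_. 0)"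
    by (intro le_errI) (auto simp: nev_m_const elim!: eventually_mono)
  thus ?case using P by simp
next
  case (Suc k)
  define h where "h = (deriv ^^ k) P"
  have nzP: "mero_nz P" by (rule moderate_mero_nz[OF P])
  have h: "mero_nz h" unfolding h_def
    by (rule mero_nz_higher_deriv_le[OF mero_nz_meromorphic[OF nzP] Suc.prems]) simp
  have IH: "moderate U h" "le_err U (\<lambda>r. nev_m r (\<lambda>z. h z / P z)) (\<lambda>_. 0)"
    using Suc.IH h by (auto simp: h_def)
  have h': "mero_nz (deriv h)" using Suc.prems by (simp add: h_def)
  have "\<forall>\<^sub>\<approx>z\<in>UNIV. h z \<noteq> 0" using h by (simp add: mero_nz_def)
  hence "\<forall>\<^sub>\<approx>z\<in>UNIV. deriv h z / P z = (deriv h z / h z) * (h z / P z)" by eventually_elim auto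
  from eventually_m_cong[OF this] eventually_m_mult[OF mero_nz_meromorphic[OF mero_nz_divide[OF h' h]] mero_nz_meromorphic[OF mero_nz_divide[OF h nzP]]]
  have "\<forall>\<^sub>F r in radii. nev_m r (\<lambda>z. deriv h z / P z) \<le> nev_m r (\<lambda>z. deriv h z / h z) + nev_m r (\<lambda>z. h z / P z)"
    by eventually_elim simp
  hence "le_err U (\<lambda>r. nev_m r (\<lambda>z. deriv h z / P z)) (\<lambda>r. nev_m r (\<lambda>z. deriv h z / h z) + nev_m r (\<lambda>z. h z / P z))"
    by (rule le_errI)
  moreover have "le_err U (\<lambda>r. nev_m r (\<lambda>z. deriv h z / h z) + nev_m r (\<lambda>z. h z / P z)) (\<lambda>_. 0 + 0)"
    by (rule le_err_add[OF log_derivative[OF IH(1)] IH(2)])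
  ultimately have "le_err U (\<lambda>r. nev_m r (\<lambda>z. deriv h z / P z)) (\<lambda>_. 0)"
    using le_err_trans by simp
  thus ?case using moderate_deriv[OF IH(1) h'] by (simp add: h_def)
qed

end

section \<open>Weighted sharing\<close>

lemma loc_fin_diff: "loc_fin \<nu> \<Longrightarrow> loc_fin \<mu> \<Longrightarrow> loc_fin (\<lambda>z. \<nu> z - \<mu> z)"
  using loc_fin_comp2[of \<nu> \<mu> "(-)"] by simp

lemma loc_fin_zero_ind: "loc_fin \<nu> \<Longrightarrow> loc_fin (\<lambda>z. of_bool (1 \<le> \<nu> z))"
  using loc_fin_comp[of \<nu> "\<lambda>x. of_bool (1 \<le> x)"] by simp

lemma loc_fin_pole_ind: "loc_fin \<nu> \<Longrightarrow> loc_fin (\<lambda>z. of_bool (\<nu> z \<le> -1))"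
  using loc_fin_comp[of \<nu> "\<lambda>x. of_bool (x \<le> -1)"] by simp

lemmas loc_fin_intros = loc_fin_add loc_fin_diff loc_fin_cmult loc_fin_pos_part loc_fin_neg_part loc_fin_zero_ind loc_fin_pole_ind loc_fin_ord

lemma nev_N_diff:
  assumes "loc_fin \<nu>" "loc_fin \<mu>" "1 \<le> r"
  shows "nev_N r (\<lambda>z. \<nu> z - \<mu> z) = nev_N r \<nu> - nev_N r \<mu>"
  using nev_N_add[OF assms(1) loc_fin_cmult[OF assms(2), of "-1"] assms(3)] nev_N_cmult[of r "-1" \<mu>] by simp

lemma mero_nz_diff_const_of_deriv:
  assumes "h meromorphic_on UNIV" "mero_nz (deriv h)"
  shows "mero_nz (\<lambda>z. h z - c)"
proof (rule mero_nz_of_deriv)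
  show "(\<lambda>z. h z - c) meromorphic_on UNIV" by (intro meromorphic_intros assms)
  have "\<forall>\<^sub>\<approx>z\<in>UNIV. deriv (\<lambda>z. h z - c) z = deriv h z"
    using deriv_add_const_mero[OF assms(1), of "-c"] by simp
  hence "\<forall>\<^sub>\<approx>z\<in>UNIV. deriv h z = deriv (\<lambda>z. h z - c) z" by eventually_elim simp
  thus "mero_nz (deriv (\<lambda>z. h z - c))" by (rule mero_nz_cong[OF assms(2)])
qed

text \<open>c is the limit of W at z. If W is constant, then W - c is identically 0 and its order
  means nothing, hence the guarded conclusion.\<close>

lemma ord_order_zero_diff:
  assumes W: "mero_nz W" and 0: "mero_ord W z = 0"
  obtains c where "mero_nz (\<lambda>w. W w - c) \<Longrightarrow> 1 \<le> mero_ord (\<lambda>w. W w - c) z"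
proof -
  have me: "W meromorphic_on {z}" by (rule mero_nz_meromorphic[OF W])
  have "\<not> is_pole W z" using is_pole_iff_ord[OF W] 0 by simp
  moreover have "not_essential W z" using me by (simp add: meromorphic_at_iff)
  ultimately obtain c where c: "W \<midarrow>z\<rightarrow> c" unfolding not_essential_def by blast
  show ?thesis
  proof (rule that)
    assume nz: "mero_nz (\<lambda>w. W w - c)"
    have "((\<lambda>w. W w - c) \<longlongrightarrow> c - c) (at z)" by (intro tendsto_intros c)
    hence "isolated_zero (\<lambda>w. W w - c) z"
      using mero_nz_eventually[OF nz, of z] by (simp add: isolated_zero_def)
    moreover have "isolated_singularity_at (\<lambda>w. W w - c) z"
      using mero_nz_meromorphic[OF nz, of "{z}"] by (simp add: meromorphic_at_iff)
    ultimately have "0 < zorder (\<lambda>w. W w - c) z" by (rule zorder_isolated_zero_pos')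
    thus "1 \<le> mero_ord (\<lambda>w. W w - c) z" by (simp add: mero_ord_def)
  qed
qed

text \<open>Everything follows from u' = - F' / (F - c)^2.\<close>

lemma deriv_inverse_diff_const:
  fixes c :: complex
  assumes F: "F meromorphic_on UNIV" "mero_nz (deriv F)"
  defines "u \<equiv> (\<lambda>z. inverse (F z - c))"
  shows "mero_nz u" "mero_nz (deriv u)" "mero_ord u z = - mero_ord (\<lambda>z. F z - c) z"
    "mero_ord (deriv u) z = mero_ord (deriv F) z - 2 * mero_ord (\<lambda>z. F z - c) z"
proof -
  have nz: "mero_nz (\<lambda>z. F z - c)" by (rule mero_nz_diff_const_of_deriv[OF F])
  show u: "mero_nz u" unfolding u_def by (rule mero_nz_inverse[OF nz])
  show "mero_ord u z = - mero_ord (\<lambda>z. F z - c) z" unfolding u_def by (rule ord_inverse[OF nz])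
  have "\<forall>\<^sub>\<approx>z\<in>UNIV. F z - c \<noteq> 0" using nz by (simp add: mero_nz_def)
  with meromorphic_on_imp_analytic_cosparse[OF F(1)]
  have ev: "\<forall>\<^sub>\<approx>z\<in>UNIV. (- 1) * (deriv F z / (F z - c) ^ 2) = deriv u z"
  proof eventually_elim
    case (elim z)
    hence "(F has_field_derivative deriv F z) (at z)"
      by (simp add: DERIV_deriv_iff_field_differentiable analytic_on_imp_differentiable_at)
    hence "(u has_field_derivative - (deriv F z / (F z - c) ^ 2)) (at z)"
      unfolding u_def using elim by (auto intro!: derivative_eq_intros simp: power2_eq_square divide_inverse)
    thus ?case by (simp add: DERIV_imp_deriv)
  qed
  have q: "mero_nz (\<lambda>z. deriv F z / (F z - c) ^ 2)" by (intro mero_nz_divide mero_nz_power F nz)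
  have q': "mero_nz (\<lambda>z. (- 1) * (deriv F z / (F z - c) ^ 2))" by (intro mero_nz_mult mero_nz_const q) auto
  show "mero_nz (deriv u)" by (rule mero_nz_cong[OF q' ev])
  have "mero_ord (deriv u) z = mero_ord (\<lambda>z. (- 1) * (deriv F z / (F z - c) ^ 2)) z"
    using ord_cong[OF ev] by simp
  also have "\<dots> = mero_ord (\<lambda>z. deriv F z / (F z - c) ^ 2) z"
    by (subst ord_mult[OF mero_nz_const q]) (auto simp: mero_ord_def)
  also have "\<dots> = mero_ord (deriv F) z - 2 * mero_ord (\<lambda>z. F z - c) z"
    by (subst ord_divide[OF F(2) mero_nz_power[OF nz]]) (simp add: ord_power[OF nz])
  finally show "mero_ord (deriv u) z = mero_ord (deriv F) z - 2 * mero_ord (\<lambda>z. F z - c) z" .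
qed

lemma deriv_diff_cmult_mero:
  assumes "u meromorphic_on UNIV" "v meromorphic_on UNIV"
  shows "\<forall>\<^sub>\<approx>z\<in>UNIV. deriv (\<lambda>w. u w - c * v w) z = deriv u z - c * deriv v z"
  using assms[THEN meromorphic_on_imp_analytic_cosparse]
proof eventually_elim
  case (elim z)
  hence "u field_differentiable (at z)" "v field_differentiable (at z)"
    by (auto simp: analytic_on_imp_differentiable_at)
  thus ?case by (simp add: deriv_diff deriv_cmult field_differentiable_mult)
qed

lemma mero_nz_imp_not_zero: "mero_nz h \<Longrightarrow> \<not> (\<forall>\<^sub>\<approx>z\<in>UNIV. h z = 0)"
proof
  assume "mero_nz h" "\<forall>\<^sub>\<approx>z\<in>UNIV. h z = 0"
  hence "\<forall>\<^sub>\<approx>z\<in>UNIV. h z \<noteq> 0" by (simp add: mero_nz_def)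
  with \<open>\<forall>\<^sub>\<approx>z\<in>UNIV. h z = 0\<close> have "\<forall>\<^sub>\<approx>z\<in>(UNIV::complex set). False" by eventually_elim auto
  thus False by (simp add: eventually_False)
qed

text \<open>
  At a common simple 1-point \<open>z\<^sub>0\<close> the derivatives of \<open>1 / (F - 1)\<close> and \<open>1 / (G - 1)\<close> have double
  poles without residue, so \<open>Q = c + O((z - z\<^sub>0)\<^sup>2)\<close>, whence the last claim.
\<close>

lemma ord_logderiv_quotient:
  assumes F: "F meromorphic_on UNIV" "mero_nz (deriv F)" and G: "G meromorphic_on UNIV" "mero_nz (deriv G)"
    and Qd: "Q = (\<lambda>z. deriv (\<lambda>z. inverse (F z - 1)) z / deriv (\<lambda>z. inverse (G z - 1)) z)"
    and Q': "mero_nz (deriv Q)" and H_def: "H = (\<lambda>z. deriv Q z / Q z)"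
    and y: "y = mero_ord (deriv F) z - 2 * mero_ord (\<lambda>z. F z - 1) z - mero_ord (deriv G) z + 2 * mero_ord (\<lambda>z. G z - 1) z"
  shows "mero_nz Q" "mero_nz H" "y \<noteq> 0 \<Longrightarrow> mero_ord H z = -1" "y = 0 \<Longrightarrow> 0 \<le> mero_ord H z"
    "mero_ord (\<lambda>z. F z - 1) z = 1 \<Longrightarrow> mero_ord (\<lambda>z. G z - 1) z = 1 \<Longrightarrow> 1 \<le> mero_ord H z"
proof -
  define u v where "u = (\<lambda>z. inverse (F z - 1))" and "v = (\<lambda>z. inverse (G z - 1))"
  have Q_def: "Q = (\<lambda>z. deriv u z / deriv v z)" by (simp add: Qd u_def v_def)
  note u = deriv_inverse_diff_const[OF F, of 1, folded u_def]
  note v = deriv_inverse_diff_const[OF G, of 1, folded v_def]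
  show Q: "mero_nz Q" unfolding Q_def by (rule mero_nz_divide[OF u(2) v(2)])
  show H: "mero_nz H" unfolding H_def by (rule mero_nz_divide[OF Q' Q])
  have oQ: "mero_ord Q z = y"
    unfolding Q_def y using ord_divide[OF u(2) v(2), of z] u(4)[of z] v(4)[of z] by simp
  have oH: "mero_ord H z = mero_ord (deriv Q) z - mero_ord Q z" unfolding H_def by (rule ord_divide[OF Q' Q])
  show "mero_ord H z = -1" if "y \<noteq> 0"
    using oH oQ ord_deriv[OF Q, of z] that by simp
  show "0 \<le> mero_ord H z" if "y = 0"
    using oH oQ ord_deriv_nonneg[OF Q Q', of z] that by simp
  show "1 \<le> mero_ord H z" if t: "mero_ord (\<lambda>z. F z - 1) z = 1" "mero_ord (\<lambda>z. G z - 1) z = 1"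
  proof -
    define W where "W = (\<lambda>z. u z / v z)"
    have W: "mero_nz W" unfolding W_def by (rule mero_nz_divide[OF u(1) v(1)])
    have "mero_ord W z = 0" unfolding W_def using ord_divide[OF u(1) v(1), of z] u(3)[of z] v(3)[of z] t by simp
    then obtain c where c: "mero_nz (\<lambda>w. W w - c) \<Longrightarrow> 1 \<le> mero_ord (\<lambda>w. W w - c) z"
      using ord_order_zero_diff[OF W] by metis
    have vnz: "\<forall>\<^sub>\<approx>z\<in>UNIV. v z \<noteq> 0" "\<forall>\<^sub>\<approx>z\<in>UNIV. deriv v z \<noteq> 0" using v(1,2) by (auto simp: mero_nz_def)
    have mero: "u meromorphic_on UNIV" "v meromorphic_on UNIV" using u(1) v(1) by (auto intro: mero_nz_meromorphic)
    \<comment> \<open>u and v have simple poles at z and u / v tends to c, so u - c v has no pole,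
      and neither has its derivative. Division by v', which has a double pole, gives Q - c a zero of
      order at least 2.\<close>
    define D where "D = (\<lambda>w. u w - c * v w)"
    have D_eq: "\<forall>\<^sub>\<approx>z\<in>UNIV. v z * (W z - c) = D z"
      using vnz(1) by eventually_elim (simp add: W_def D_def field_simps)
    have Q_eq: "\<forall>\<^sub>\<approx>z\<in>UNIV. deriv D z / deriv v z = Q z - c"
      using vnz(2) deriv_diff_cmult_mero[OF mero, of c] unfolding D_def Q_def
      by eventually_elim (simp add: field_simps)
    have Dm: "D meromorphic_on UNIV" unfolding D_def by (intro meromorphic_intros mero)
    have Qc: "mero_nz (\<lambda>z. Q z - c)" by (rule mero_nz_diff_const_of_deriv[OF mero_nz_meromorphic[OF Q] Q'])
    have D': "mero_nz (deriv D)"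
    proof (rule ccontr)
      assume "\<not> mero_nz (deriv D)"
      hence "\<forall>\<^sub>\<approx>z\<in>UNIV. deriv D z = 0" using mero_nz_or_0[of "deriv D"] Dm by (auto intro: meromorphic_intros)
      with Q_eq have "\<forall>\<^sub>\<approx>z\<in>UNIV. Q z - c = 0" by eventually_elim auto
      thus False using mero_nz_imp_not_zero[OF Qc] by simp
    qed
    have D: "mero_nz D" by (rule mero_nz_of_deriv[OF Dm D'])
    have Wc: "mero_nz (\<lambda>w. W w - c)"
    proof (rule ccontr)
      assume "\<not> mero_nz (\<lambda>w. W w - c)"
      moreover have "(\<lambda>w. W w - c) meromorphic_on UNIV"
        by (intro meromorphic_intros mero_nz_meromorphic[OF W])
      ultimately have "\<forall>\<^sub>\<approx>z\<in>UNIV. W z - c = 0" using mero_nz_or_0 by blast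
      with D_eq have "\<forall>\<^sub>\<approx>z\<in>UNIV. D z = 0" by eventually_elim auto
      thus False using mero_nz_imp_not_zero[OF D] by simp
    qed
    have "mero_ord D z = mero_ord (\<lambda>z. v z * (W z - c)) z" using ord_cong[OF D_eq] by simp
    also have "\<dots> = mero_ord v z + mero_ord (\<lambda>w. W w - c) z" by (rule ord_mult[OF v(1) Wc])
    finally have "0 \<le> mero_ord D z" using c[OF Wc] v(3)[of z] t by simp
    hence "0 \<le> mero_ord (deriv D) z" by (rule ord_deriv_nonneg[OF D D'])
    moreover have "mero_ord (deriv v) z \<le> -2" using v(3)[of z] ord_deriv[OF v(1), of z] t by simp
    ultimately have "2 \<le> mero_ord (\<lambda>z. Q z - c) z"
      using ord_cong[OF Q_eq, of z] ord_divide[OF D' v(2), of z] by simp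
    hence "1 \<le> mero_ord (deriv (\<lambda>z. Q z - c)) z" using ord_deriv[OF Qc, of z] by simp
    hence "1 \<le> mero_ord (deriv Q) z"
      using ord_cong[OF deriv_add_const_mero[OF mero_nz_meromorphic[OF Q], of "-c"], of z] by simp
    moreover have "mero_ord Q z = 0"
    proof -
      have "mero_ord (deriv u) z = -2" "mero_ord (deriv v) z = -2"
        using u(3)[of z] v(3)[of z] ord_deriv[OF u(1), of z] ord_deriv[OF v(1), of z] t by auto
      thus ?thesis unfolding Q_def using ord_divide[OF u(2) v(2), of z] by simp
    qed
    ultimately show ?thesis using oH by simp
  qed
qed

text \<open>
  The local comparison behind the two main inequalities. At a point, \<open>xf\<close>, \<open>xL\<close> are the orders of
  \<open>f\<close>, \<open>L\<close>; \<open>pf\<close>, \<open>pL\<close> those of their \<open>n\<close>-th powers; \<open>s\<close>, \<open>t\<close>, \<open>d\<close> with index \<open>F\<close> (\<open>G\<close>) those of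
  \<open>F\<close>, \<open>F - 1\<close>, \<open>F'\<close> (\<open>G\<close>, \<open>G - 1\<close>, \<open>G'\<close>); \<open>h\<close> that of \<open>H\<close>. Zeros of \<open>G'\<close> and
  \<open>F'\<close>, taken with the weights \<open>\<alpha>\<close> and \<open>\<beta>\<close>, pay for the multiple 1-points and for the poles of \<open>H\<close> at
  1-points of unequal order.
\<close>

lemma counting_inequality:
  fixes xf sF tF dF xL sG tG dG h k pf pL \<alpha> \<beta> :: real
  assumes ab: "(\<alpha> = 1 \<and> \<beta> = 0) \<or> (\<alpha> = 1 \<and> \<beta> = 1/2) \<or> (\<alpha> = 2 \<and> \<beta> = 2)"
    and k: "0 \<le> k"
    and F: "local_orders sF tF dF" and G: "local_orders sG tG dG"
    and f: "(xf \<le> -1 \<and> sF = pf - k \<and> sF \<le> -1) \<or> (1 \<le> xf \<and> sF = pf - k \<and> 1 \<le> sF) \<or> (xf = 0 \<and> pf = 0 \<and> 0 \<le> sF)"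
    and L: "(1 \<le> xL \<and> sG = pL - k \<and> 1 \<le> sG) \<or> (xL = 0 \<and> pL = 0 \<and> 0 \<le> sG)"
    and y': "dF - 2 * tF - dG + 2 * tG \<noteq> 0 \<longrightarrow> h = -1" "dF - 2 * tF - dG + 2 * tG = 0 \<longrightarrow> 0 \<le> h"
      "tF = 1 \<longrightarrow> tG = 1 \<longrightarrow> 1 \<le> h"
    and sh': "1 \<le> tF \<longleftrightarrow> 1 \<le> tG" "1 \<le> tF \<longrightarrow> tF \<noteq> tG \<longrightarrow> \<beta> = 2 \<or> 2 \<le> tF \<and> 2 \<le> tG \<and> (\<beta> = 1/2 \<or> 3 \<le> tF \<and> 3 \<le> tG)"
      "1 \<le> tF \<longrightarrow> tF = 1 \<or> 2 \<le> tF" "1 \<le> tG \<longrightarrow> tG = 1 \<or> 2 \<le> tG" "2 \<le> tF \<longrightarrow> tF = 2 \<or> 3 \<le> tF" "2 \<le> tG \<longrightarrow> tG = 2 \<or> 3 \<le> tG"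
  shows "(if 1 \<le> xf then pf else 0) + tF - dF \<le> (k + 2 + \<beta> * (k + 1)) * of_bool (1 \<le> xf) +
      (2 + \<beta> * (k + 1)) * of_bool (xf \<le> -1) + (1 + \<alpha> * (k + 1)) * of_bool (1 \<le> xL) +
      h + \<alpha> * (dG - pL) + \<beta> * (dF - pf)" (is ?A)
    and "(if 1 \<le> xL then pL else 0) + tG - dG \<le> (k + 2 + \<beta> * (k + 1)) * of_bool (1 \<le> xL) +
      (1 + \<alpha> * (k + 1)) * of_bool (1 \<le> xf) + (1 + \<alpha> * (k + 1)) * of_bool (xf \<le> -1) +
      h + \<alpha> * (dF - pf) + \<beta> * (dG - pL)" (is ?B)
proof -
  note y = y'[rule_format] and sh = sh'[rule_format]
  have h: "h = -1 \<or> 0 \<le> h" using y by blast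
  hence h1: "-1 \<le> h" by auto
  have ab1: "1 \<le> \<alpha>" "0 \<le> \<beta>" using ab by auto
  have prod: "x \<le> \<alpha> * x" "0 \<le> \<beta> * x" if "0 \<le> x" for x
    using mult_right_mono[OF ab1(1) that] mult_nonneg_nonneg[OF ab1(2) that] by auto
  have eF: "dF - pf = - (k + 1) \<and> tF \<le> 0 \<and> tF - dF \<le> 1 \<and> (1 \<le> xf \<longrightarrow> pf + tF - dF = k + 1)" if "xf \<noteq> 0"
    using f F that by (auto simp: local_orders_def)
  have eG: "dG - pL = - (k + 1) \<and> tG = 0 \<and> pL + tG - dG = k + 1" if "xL \<noteq> 0"
    using L G that by (auto simp: local_orders_def)
  have F0: "pf = 0 \<and> 0 \<le> dF \<and> 0 \<le> tF \<and> (dF = 0 \<or> 1 \<le> dF) \<and> (tF = 0 \<or> 1 \<le> tF) \<and> (1 \<le> tF \<longrightarrow> dF = tF - 1)" if "xf = 0"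
    using f F that by (auto simp: local_orders_def)
  have G0: "pL = 0 \<and> 0 \<le> dG \<and> 0 \<le> tG \<and> (dG = 0 \<or> 1 \<le> dG) \<and> (tG = 0 \<or> 1 \<le> tG) \<and> (1 \<le> tG \<longrightarrow> dG = tG - 1)" if "xL = 0"
    using L G that by (auto simp: local_orders_def)
  \<comment> \<open>The weights originate here. At a common 1-point of unequal orders H may
    contribute -1, so the zeros of the derivatives must supply 2. Sharing with weight 0 allows the
    orders 1 and 2, and both prices are 2. With weight 1 one order is at least 2 and the other at
    least 3, and the prices 1 and 1/2 suffice. With weight 2 both are at least 3, and \<alpha> = 1
    suffices alone.\<close>
  have one: "1 \<le> h + \<alpha> * (tG - 1) + \<beta> * (tF - 1) \<and> 1 \<le> h + \<alpha> * (tF - 1) + \<beta> * (tG - 1)"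
    if x: "xf = 0" "xL = 0" and t: "1 \<le> tF" "1 \<le> tG"
  proof -
    have d: "dF = tF - 1" "dG = tG - 1" using F0 G0 x t by auto
    note p = prod[of "tF - 1"] prod[of "tG - 1"]
    show ?thesis
    proof (cases "tF = tG")
      case True
      hence h0: "0 \<le> h" using y(2) d by simp
      show ?thesis
      proof (cases "tF = 1")
        case True
        thus ?thesis using y(3) \<open>tF = tG\<close> by simp
      next
        case False
        hence "2 \<le> tF" "2 \<le> tG" using sh(3)[OF t(1)] True by auto
        thus ?thesis using p h0 by linarith
      qed
    next
      case False
      from sh(2)[OF t(1) False] consider "\<beta> = 2" | "\<beta> = 1/2" "2 \<le> tF" "2 \<le> tG" | "3 \<le> tF" "3 \<le> tG"
        by blast
      thus ?thesis
      proof cases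
        case 1
        hence a: "\<alpha> = 2" using ab by auto
        have "2 \<le> tF \<or> 2 \<le> tG" using sh(3)[OF t(1)] sh(4)[OF t(2)] False by auto
        thus ?thesis using t h1 unfolding a 1 by auto
      next
        case 2
        hence a: "\<alpha> = 1" using ab by auto
        have "3 \<le> tF \<or> 3 \<le> tG" using sh(5)[OF 2(2)] sh(6)[OF 2(3)] False by auto
        thus ?thesis using 2 h1 unfolding a 2(1) by (auto simp: field_simps)
      next
        case 3
        thus ?thesis using p h1 by linarith
      qed
    qed
  qed
  \<comment> \<open>Away from 1-points H has a pole only where F' and G' have different orders, so
    that one of them vanishes. That zero, on the left or with weight \<alpha> \<ge> 1 on the right,
    makes up for the -1.\<close>
  have zero: "- dF \<le> h + \<alpha> * dG + \<beta> * dF \<and> - dG \<le> h + \<alpha> * dF + \<beta> * dG"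
    if x: "xf = 0" "xL = 0" and t: "tF = 0" "tG = 0"
  proof (cases "dF = dG")
    case True
    hence "0 \<le> h" using y(2) t by simp
    thus ?thesis using prod[of dF] prod[of dG] F0[OF x(1)] G0[OF x(2)] by linarith
  next
    case False
    hence "1 \<le> dF \<or> 1 \<le> dG" using F0[OF x(1)] G0[OF x(2)] by auto
    thus ?thesis using h1 prod[of dF] prod[of dG] F0[OF x(1)] G0[OF x(2)] by linarith
  qed
  have "?A \<and> ?B"
  proof (cases "xf = 0")
    case xf: True
    note F0 = F0[OF xf]
    have i: "(if 1 \<le> xf then pf else 0) = 0" "of_bool (1 \<le> xf) = (0::real)" "of_bool (xf \<le> -1) = (0::real)"
      using xf by auto
    show ?thesis
    proof (cases "xL = 0")
      case xL: True
      note G0 = G0[OF xL]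
      have j: "(if 1 \<le> xL then pL else 0) = 0" "of_bool (1 \<le> xL) = (0::real)" using xL by auto
      show ?thesis
      proof (cases "1 \<le> tF")
        case True
        hence "1 \<le> tG" using sh(1) by simp
        thus ?thesis unfolding i j using one[OF xf xL True] F0 G0 True by simp
      next
        case False
        hence "tF = 0" "tG = 0" using sh(1) F0 G0 by auto
        thus ?thesis unfolding i j using zero[OF xf xL] F0 G0 by simp
      qed
    next
      case xL: False
      have j: "(if 1 \<le> xL then pL else 0) = pL" "of_bool (1 \<le> xL) = (1::real)" using xL L by auto
      note eG = eG[OF xL]
      have tF: "tF = 0" using sh(1) eG F0 by auto
      have e: "dG - pL = - (k + 1)" "dF - pf = dF" using eG F0 by auto
      have "0 \<le> dF" using F0 by simp
      note q = prod[OF this]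
      show ?thesis unfolding i j e using q eG F0 tF h1 ab1 by (simp add: algebra_simps del: mult_nonneg_nonneg)
    qed
  next
    case xf: False
    note eF = eF[OF xf]
    have e: "dF - pf = - (k + 1)" using eF by simp
    show ?thesis
    proof (cases "xL = 0")
      case xL: True
      note G0 = G0[OF xL]
      have j: "(if 1 \<le> xL then pL else 0) = 0" "of_bool (1 \<le> xL) = (0::real)" "dG - pL = dG" using xL G0 by auto
      have tG: "tG = 0" using sh(1) eF G0 by auto
      have "0 \<le> dG" using G0 by simp
      note q = prod[OF this]
      show ?thesis
      proof (cases "1 \<le> xf")
        case True
        hence i: "(if 1 \<le> xf then pf else 0) = pf" "of_bool (1 \<le> xf) = (1::real)" "of_bool (xf \<le> -1) = (0::real)" by auto
        show ?thesis unfolding i j e using q eF G0 tG h1 k True by (simp add: algebra_simps del: mult_nonneg_nonneg)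
      next
        case False
        hence i: "(if 1 \<le> xf then pf else 0) = 0" "of_bool (1 \<le> xf) = (0::real)" "of_bool (xf \<le> -1) = (1::real)"
          using f xf by auto
        show ?thesis unfolding i j e using q eF G0 tG h1 k by (simp add: algebra_simps del: mult_nonneg_nonneg)
      qed
    next
      case xL: False
      have j: "(if 1 \<le> xL then pL else 0) = pL" "of_bool (1 \<le> xL) = (1::real)" using xL L by auto
      note eG = eG[OF xL]
      have eG': "dG - pL = - (k + 1)" using eG by simp
      show ?thesis
      proof (cases "1 \<le> xf")
        case True
        hence i: "(if 1 \<le> xf then pf else 0) = pf" "of_bool (1 \<le> xf) = (1::real)" "of_bool (xf \<le> -1) = (0::real)" by auto
        show ?thesis unfolding i j e eG' using eF eG h1 k True by (simp add: algebra_simps del: mult_nonneg_nonneg)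
      next
        case False
        hence i: "(if 1 \<le> xf then pf else 0) = 0" "of_bool (1 \<le> xf) = (0::real)" "of_bool (xf \<le> -1) = (1::real)"
          using f xf by auto
        show ?thesis unfolding i j e eG' using eF eG h1 k by (simp add: algebra_simps del: mult_nonneg_nonneg)
      qed
    qed
  qed
  thus ?A ?B by auto
qed

section \<open>The second main theorem for derivatives of powers\<close>

context error_term
begin

text \<open>A finite exceptional set contributes O(ln r), which the error covers.\<close>

lemma le_err_N_mono:
  assumes "loc_fin \<nu>" "loc_fin \<mu>" "finite E" "\<And>z. z \<notin> E \<Longrightarrow> \<nu> z \<le> \<mu> z"
  shows "le_err U (\<lambda>r. nev_N r \<nu>) (\<lambda>r. nev_N r \<mu>)"
proof -
  define \<delta> where "\<delta> = (\<lambda>z. if z \<in> E then max 0 (\<nu> z - \<mu> z) else 0)"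
  have fin: "finite {z. \<delta> z \<noteq> 0}" by (rule finite_subset[OF _ assms(3)]) (auto simp: \<delta>_def)
  have "\<forall>\<^sub>F r in radii. nev_N r \<nu> \<le> nev_N r \<mu> + nev_N r \<delta>"
    using eventually_ge_radii[of 1]
  proof eventually_elim
    case (elim r)
    have "nev_N r \<nu> \<le> nev_N r (\<lambda>z. \<mu> z + \<delta> z)"
      by (intro nev_N_mono loc_fin_add assms loc_fin_finite_supp fin elim) (use assms(4) in \<open>auto simp: \<delta>_def\<close>)
    also have "\<dots> = nev_N r \<mu> + nev_N r \<delta>" by (intro nev_N_add assms loc_fin_finite_supp fin elim)
    finally show ?case .
  qed
  hence "le_err U (\<lambda>r. nev_N r \<nu>) (\<lambda>r. nev_N r \<mu> + nev_N r \<delta>)" by (rule le_errI)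
  moreover have "le_err U (\<lambda>r. nev_N r \<mu> + nev_N r \<delta>) (\<lambda>r. nev_N r \<mu> + 0)"
    by (rule le_err_add[OF le_err_refl le_err_N_finite[OF fin]])
  ultimately show ?thesis using le_err_trans by simp
qed

text \<open>F is never close to both 0 and c: at each point one of |F|, |F - c| is at least |c| / 2
  and its inverse is bounded, while the other inverse is 1 / F' times a logarithmic
  derivative.\<close>

lemma le_err_m_inverse_pair:
  assumes F: "moderate U F" and Fc: "mero_nz (\<lambda>z. F z - c)" and F': "mero_nz (deriv F)" and c: "c \<noteq> 0"
  shows "le_err U (\<lambda>r. nev_m r (\<lambda>z. inverse (F z)) + nev_m r (\<lambda>z. inverse (F z - c))) (\<lambda>r. nev_m r (\<lambda>z. inverse (deriv F z)))"
proof -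
  have nz: "mero_nz F" by (rule moderate_mero_nz[OF F])
  have mc: "moderate U (\<lambda>z. F z - c)" using moderate_add_const[OF F, of "-c"] Fc by simp
  have dc: "\<forall>\<^sub>\<approx>z\<in>UNIV. deriv (\<lambda>z. F z - c) z / (F z - c) = deriv F z / (F z - c)"
    using deriv_add_const_mero[OF mero_nz_meromorphic[OF nz], of "-c"] by eventually_elim simp
  have l1: "le_err U (\<lambda>r. nev_m r (\<lambda>z. deriv F z / F z)) (\<lambda>_. 0)" by (rule log_derivative[OF F])
  have l2: "le_err U (\<lambda>r. nev_m r (\<lambda>z. deriv F z / (F z - c))) (\<lambda>_. 0)"
    by (rule le_err_mono[OF log_derivative[OF mc]]) (use eventually_m_cong[OF dc] in \<open>auto elim!: eventually_mono\<close>)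
  define K where "K = ln (max 1 (2 / norm c))"
  have nzs: "\<forall>\<^sub>\<approx>z\<in>UNIV. F z \<noteq> 0" "\<forall>\<^sub>\<approx>z\<in>UNIV. F z - c \<noteq> 0" "\<forall>\<^sub>\<approx>z\<in>UNIV. deriv F z \<noteq> 0"
    using nz Fc F' by (auto simp: mero_nz_def)
  have "\<forall>\<^sub>\<approx>z\<in>UNIV. ln (max 1 (norm (inverse (F z)))) + ln (max 1 (norm (inverse (F z - c))))
     \<le> (K + ln (max 1 (norm (inverse (deriv F z))))) + (ln (max 1 (norm (deriv F z / F z))) + ln (max 1 (norm (deriv F z / (F z - c)))))"
    using nzs
  proof eventually_elim
    case (elim z)
    have mono: "ln (max 1 x) \<le> ln (max 1 y)" if "x \<le> y" for x y :: real
      using that by (subst ln_le_cancel_iff) auto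
    have nn: "0 \<le> ln (max 1 x)" for x :: real by simp
    have A: "ln (max 1 (norm (inverse w))) \<le> ln (max 1 (norm (inverse (deriv F z)))) + ln (max 1 (norm (deriv F z / w)))" for w
    proof -
      have "norm (inverse w) = norm (inverse (deriv F z)) * norm (deriv F z / w)"
        using elim(3) by (simp add: norm_divide norm_inverse field_simps)
      thus ?thesis using ln_max_mult_le[of "norm (inverse (deriv F z))" "norm (deriv F z / w)"] by simp
    qed
    have B: "ln (max 1 (norm (inverse w))) \<le> K" if "norm c / 2 \<le> norm w" for w :: complex
    proof -
      have "norm (inverse w) \<le> inverse (norm c / 2)"
        unfolding norm_inverse by (rule le_imp_inverse_le) (use that c in auto)
      thus ?thesis unfolding K_def by (intro mono) (simp add: field_simps)
    qed
    show ?case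
    proof (cases "norm c / 2 \<le> norm (F z)")
      case True
      thus ?thesis using B[OF True] A[of "F z - c"] nn[of "norm (deriv F z / F z)"] by linarith
    next
      case False
      hence "norm c / 2 \<le> norm (F z - c)" using norm_triangle_ineq2[of c "F z"] norm_minus_commute[of "F z" c] by linarith
      thus ?thesis using B[of "F z - c"] A[of "F z"] nn[of "norm (deriv F z / (F z - c))"] by linarith
    qed
  qed
  note ev = eventually_sphere[OF this]
  have mero: "(\<lambda>z. inverse (F z)) meromorphic_on UNIV" "(\<lambda>z. inverse (F z - c)) meromorphic_on UNIV"
    "(\<lambda>z. inverse (deriv F z)) meromorphic_on UNIV" "(\<lambda>z. deriv F z / F z) meromorphic_on UNIV"
    "(\<lambda>z. deriv F z / (F z - c)) meromorphic_on UNIV"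
    using mero_nz_meromorphic[OF nz] by (auto intro!: meromorphic_intros)
  note conts = mero[THEN eventually_continuous_sphere]
  have "\<forall>\<^sub>F r in radii. nev_m r (\<lambda>z. inverse (F z)) + nev_m r (\<lambda>z. inverse (F z - c))
     \<le> (nev_m r (\<lambda>z. inverse (deriv F z)) + (nev_m r (\<lambda>z. deriv F z / F z) + nev_m r (\<lambda>z. deriv F z / (F z - c)))) + K"
    using ev conts eventually_ge_radii[of 0]
  proof eventually_elim
    case (elim r)
    note cl = elim(2-6)[THEN continuous_lnmax]
    have "nev_m r (\<lambda>z. inverse (F z)) + nev_m r (\<lambda>z. inverse (F z - c)) =
       circle_mean r (\<lambda>z. ln (max 1 (norm (inverse (F z)))) + ln (max 1 (norm (inverse (F z - c)))))"
      unfolding nev_m_def by (rule circle_mean_add[symmetric]) (intro cl elim)+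
    also have "\<dots> \<le> circle_mean r (\<lambda>z. (K + ln (max 1 (norm (inverse (deriv F z))))) +
        (ln (max 1 (norm (deriv F z / F z))) + ln (max 1 (norm (deriv F z / (F z - c))))))"
      by (rule circle_mean_mono; (intro continuous_on_add cl continuous_on_const elim)?) (use elim(1) in auto)
    also have "\<dots> = circle_mean r (\<lambda>z. K + ln (max 1 (norm (inverse (deriv F z))))) +
        circle_mean r (\<lambda>z. ln (max 1 (norm (deriv F z / F z))) + ln (max 1 (norm (deriv F z / (F z - c)))))"
      by (rule circle_mean_add) (intro continuous_on_add cl continuous_on_const elim)+
    also have "circle_mean r (\<lambda>z. K + ln (max 1 (norm (inverse (deriv F z))))) = circle_mean r (\<lambda>_. K) + nev_m r (\<lambda>z. inverse (deriv F z))"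
      unfolding nev_m_def by (rule circle_mean_add) (intro cl continuous_on_const elim)+
    also have "circle_mean r (\<lambda>z. ln (max 1 (norm (deriv F z / F z))) + ln (max 1 (norm (deriv F z / (F z - c))))) =
       nev_m r (\<lambda>z. deriv F z / F z) + nev_m r (\<lambda>z. deriv F z / (F z - c))"
      unfolding nev_m_def by (rule circle_mean_add) (intro cl elim)+
    finally show ?case by simp
  qed
  hence "le_err U (\<lambda>r. nev_m r (\<lambda>z. inverse (F z)) + nev_m r (\<lambda>z. inverse (F z - c)))
     (\<lambda>r. nev_m r (\<lambda>z. inverse (deriv F z)) + (nev_m r (\<lambda>z. deriv F z / F z) + nev_m r (\<lambda>z. deriv F z / (F z - c))))"
    by (rule le_errI_const)
  moreover have "le_err U (\<lambda>r. nev_m r (\<lambda>z. inverse (deriv F z)) + (nev_m r (\<lambda>z. deriv F z / F z) + nev_m r (\<lambda>z. deriv F z / (F z - c))))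
     (\<lambda>r. nev_m r (\<lambda>z. inverse (deriv F z)) + (0 + 0))"
    by (intro le_err_add le_err_refl l1 l2)
  ultimately show ?thesis using le_err_trans by simp
qed

text \<open>Used for f with F, for L with G, and for L with k = 0 in the final comparison of f^n
  with L^n.\<close>

definition quotient_setting :: "nat \<Rightarrow> nat \<Rightarrow> (complex \<Rightarrow> complex) \<Rightarrow> (complex \<Rightarrow> complex) \<Rightarrow> (complex \<Rightarrow> complex) \<Rightarrow> bool" where
  "quotient_setting n k \<eta> X F \<longleftrightarrow> moderate U X \<and> small_function \<eta> \<and> k < n \<and>
     F = (\<lambda>z. (deriv ^^ k) (\<lambda>w. X w ^ n) z / \<eta> z) \<and> mero_nz ((deriv ^^ k) (\<lambda>w. X w ^ n)) \<and> mero_nz (deriv F)"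

lemma quotient_setting_facts:
  assumes "quotient_setting n k \<eta> X F"
  shows "mero_nz X" "mero_nz F" "mero_nz (\<lambda>z. F z - c)" "mero_nz (deriv F)" "moderate U F" "mero_nz \<eta>" "finite {z. mero_ord \<eta> z \<noteq> 0}"
    "moderate U (deriv F)"
    "le_err U (\<lambda>r. nev_m r (\<lambda>z. F z / X z ^ n)) (\<lambda>_. 0)"
proof -
  have s: "moderate U X" "small_function \<eta>" "k < n" "F = (\<lambda>z. (deriv ^^ k) (\<lambda>w. X w ^ n) z / \<eta> z)"
    "mero_nz ((deriv ^^ k) (\<lambda>w. X w ^ n))" "mero_nz (deriv F)"
    using assms by (auto simp: quotient_setting_def)
  show X: "mero_nz X" by (rule moderate_mero_nz[OF s(1)])
  show e: "mero_nz \<eta>" and "finite {z. mero_ord \<eta> z \<noteq> 0}" using s(2) by (auto simp: small_function_def)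
  show F: "mero_nz F" unfolding s(4) by (rule mero_nz_divide[OF s(5) e])
  show "mero_nz (deriv F)" by fact
  show "mero_nz (\<lambda>z. F z - c)" by (rule mero_nz_diff_const_of_deriv[OF mero_nz_meromorphic[OF F] s(6)])
  have P: "moderate U (\<lambda>w. X w ^ n)" by (rule moderate_power[OF s(1)])
  note hd = moderate_higher_deriv[OF P s(5)]
  show mF: "moderate U F" unfolding s(4) by (rule moderate_divide[OF _ moderate_small[OF s(2)]]) (use hd in auto)
  show "moderate U (deriv F)" by (rule moderate_deriv[OF mF s(6)])
  define G where "G = (\<lambda>z. (deriv ^^ k) (\<lambda>w. X w ^ n) z / X z ^ n)"
  have "(\<lambda>z. F z / X z ^ n) = (\<lambda>z. G z * inverse (\<eta> z))"
    by (auto simp: s(4) G_def field_simps)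
  moreover have "G meromorphic_on UNIV" unfolding G_def
    by (intro mero_nz_meromorphic mero_nz_divide s mero_nz_power X)
  ultimately have "\<forall>\<^sub>F r in radii. nev_m r (\<lambda>z. F z / X z ^ n) \<le> nev_m r G + nev_m r (\<lambda>z. inverse (\<eta> z))"
    using eventually_m_mult[of G "\<lambda>z. inverse (\<eta> z)"] mero_nz_meromorphic[OF mero_nz_inverse[OF e]] by simp
  hence "le_err U (\<lambda>r. nev_m r (\<lambda>z. F z / X z ^ n)) (\<lambda>r. nev_m r G + nev_m r (\<lambda>z. inverse (\<eta> z)))" by (rule le_errI)
  moreover have "le_err U (\<lambda>r. nev_m r G + nev_m r (\<lambda>z. inverse (\<eta> z))) (\<lambda>r. 0 + 0)"
    by (rule le_err_add) (use hd s(2) in \<open>auto simp: G_def small_function_def\<close>)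
  ultimately show "le_err U (\<lambda>r. nev_m r (\<lambda>z. F z / X z ^ n)) (\<lambda>_. 0)" using le_err_trans by simp
qed

text \<open>Milloux's form of the second main theorem. The counting function stays one signed sum of
  orders, so that multiplicities cancel point by point: off the zeros and poles of
  \<open>\<eta>\<close>, a zero of X leaves k + 1, a pole of X or a c-point of F leaves 1.\<close>

theorem milloux:
  assumes S: "quotient_setting n k \<eta> X F" and c: "c \<noteq> 0"
  shows "le_err U (\<lambda>r. real n * nev_T r X)
    (\<lambda>r. nev_N r (\<lambda>z. real n * max 0 (mero_ord X z) + mero_ord (\<lambda>z. F z - c) z - mero_ord (deriv F) z))"
proof -
  note f = quotient_setting_facts[OF S]
  define P where "P = (\<lambda>z. X z ^ n)"
  have P: "mero_nz P" unfolding P_def by (rule mero_nz_power[OF f(1)])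
  have Fc: "mero_nz (\<lambda>z. F z - c)" by (rule f(3))
  have nzs: "\<forall>\<^sub>\<approx>z\<in>UNIV. F z \<noteq> 0" "\<forall>\<^sub>\<approx>z\<in>UNIV. P z \<noteq> 0" using f(2) P by (auto simp: mero_nz_def)
  have e1: "le_err U (\<lambda>r. nev_m r (\<lambda>z. inverse (P z))) (\<lambda>r. nev_m r (\<lambda>z. inverse (F z)))"
  proof -
    have "\<forall>\<^sub>\<approx>z\<in>UNIV. inverse (P z) = (F z / P z) * inverse (F z)"
      using nzs by eventually_elim (simp add: field_simps)
    from eventually_m_cong[OF this] eventually_m_mult[OF mero_nz_meromorphic[OF mero_nz_divide[OF f(2) P]] mero_nz_meromorphic[OF mero_nz_inverse[OF f(2)]]]
    have "\<forall>\<^sub>F r in radii. nev_m r (\<lambda>z. inverse (P z)) \<le> nev_m r (\<lambda>z. F z / P z) + nev_m r (\<lambda>z. inverse (F z))"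
      by eventually_elim simp
    hence "le_err U (\<lambda>r. nev_m r (\<lambda>z. inverse (P z))) (\<lambda>r. nev_m r (\<lambda>z. F z / P z) + nev_m r (\<lambda>z. inverse (F z)))" by (rule le_errI)
    moreover have "le_err U (\<lambda>r. nev_m r (\<lambda>z. F z / P z) + nev_m r (\<lambda>z. inverse (F z))) (\<lambda>r. 0 + nev_m r (\<lambda>z. inverse (F z)))"
      by (rule le_err_add[OF _ le_err_refl]) (use f(9) in \<open>simp add: P_def\<close>)
    ultimately show ?thesis using le_err_trans by simp
  qed
  have e2: "le_err U (\<lambda>r. nev_m r (\<lambda>z. inverse (F z)) + nev_m r (\<lambda>z. inverse (F z - c))) (\<lambda>r. nev_m r (\<lambda>z. inverse (deriv F z)))"
    by (rule le_err_m_inverse_pair[OF f(5) Fc f(4) c])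
  have e3: "le_err U (\<lambda>r. nev_m r P) (\<lambda>r. nev_m r (\<lambda>z. inverse (P z)) + nev_N r (mero_ord P))"
    by (rule le_err_jensen(1)[OF P])
  have e4: "le_err U (\<lambda>r. nev_m r (\<lambda>z. F z - c)) (\<lambda>r. nev_m r (\<lambda>z. inverse (F z - c)) + nev_N r (mero_ord (\<lambda>z. F z - c)))"
    by (rule le_err_jensen(1)[OF Fc])
  have e5: "le_err U (\<lambda>r. nev_m r F) (\<lambda>r. nev_m r (\<lambda>z. F z - c))"
    by (rule le_errI_const) (use eventually_m_add_const[OF mero_nz_meromorphic[OF Fc], of c] in simp)
  have e6: "le_err U (\<lambda>r. nev_m r (\<lambda>z. inverse (deriv F z)) + nev_N r (mero_ord (deriv F))) (\<lambda>r. nev_m r (deriv F))"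
    by (rule le_err_jensen(2)[OF f(4)])
  have e7: "le_err U (\<lambda>r. nev_m r (deriv F)) (\<lambda>r. nev_m r F)"
  proof -
    have "\<forall>\<^sub>\<approx>z\<in>UNIV. deriv F z = (deriv F z / F z) * F z"
      using nzs(1) by eventually_elim simp
    from eventually_m_cong[OF this] eventually_m_mult[OF mero_nz_meromorphic[OF mero_nz_divide[OF f(4,2)]] mero_nz_meromorphic[OF f(2)]]
    have "\<forall>\<^sub>F r in radii. nev_m r (deriv F) \<le> nev_m r (\<lambda>z. deriv F z / F z) + nev_m r F"
      by eventually_elim simp
    hence "le_err U (\<lambda>r. nev_m r (deriv F)) (\<lambda>r. nev_m r (\<lambda>z. deriv F z / F z) + nev_m r F)" by (rule le_errI)
    moreover have "le_err U (\<lambda>r. nev_m r (\<lambda>z. deriv F z / F z) + nev_m r F) (\<lambda>r. 0 + nev_m r F)"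
      by (rule le_err_add[OF log_derivative[OF f(5)] le_err_refl])
    ultimately show ?thesis using le_err_trans by simp
  qed
  \<comment> \<open>In the sum of these seven inequalities every proximity function except that of P
    occurs once on each side.\<close>
  note sum = le_err_add[OF e1 le_err_add[OF e2 le_err_add[OF e3 le_err_add[OF e4 le_err_add[OF e5 le_err_add[OF e6 e7]]]]]]
  have ev: "\<forall>\<^sub>F r in radii. real n * nev_T r X - nev_N r (\<lambda>z. real n * max 0 (mero_ord X z) + mero_ord (\<lambda>z. F z - c) z - mero_ord (deriv F) z)
     = nev_m r P - nev_N r (mero_ord P) - nev_N r (mero_ord (\<lambda>z. F z - c)) + nev_N r (mero_ord (deriv F))"
    using eventually_ge_radii[of 1]
  proof eventually_elim
    case (elim r)
    have "real n * nev_T r X = nev_T r P" by (simp add: P_def nev_T_power[OF f(1)])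
    also have "\<dots> = nev_m r P - nev_N r (mero_ord P) + nev_N r (\<lambda>z. max 0 (mero_ord P z))"
      using nev_N_parts[OF loc_fin_ord[OF P] elim] by (simp add: nev_T_def)
    also have "(\<lambda>z. max 0 (mero_ord P z)) = (\<lambda>z. real n * max 0 (mero_ord X z))"
      by (auto simp: P_def ord_power[OF f(1)] max_def fun_eq_iff mult_le_0_iff zero_le_mult_iff)
    finally show ?case
      using elim f(1,4) Fc by (simp add: nev_N_add nev_N_diff loc_fin_intros)
  qed
  show ?thesis
    by (subst le_err_move, rule le_err_mono[OF sum[THEN le_err_move[THEN iffD1]]])
       (use ev in \<open>auto elim!: eventually_mono\<close>)
qed

text \<open>Since n > k, a zero of X^n is still a zero after k derivations, and a pole remains one
  in any case. Where X has neither, F may still vanish, but it has no pole.\<close>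

lemma quotient_setting_orders:
  assumes S: "quotient_setting n k \<eta> X F" and z: "mero_ord \<eta> z = 0"
  shows "(mero_ord X z \<le> -1 \<and> mero_ord F z = real n * mero_ord X z - real k \<and> mero_ord F z \<le> -1) \<or>
    (1 \<le> mero_ord X z \<and> mero_ord F z = real n * mero_ord X z - real k \<and> 1 \<le> mero_ord F z) \<or> (mero_ord X z = 0 \<and> 0 \<le> mero_ord F z)"
proof -
  note f = quotient_setting_facts[OF S]
  define P where "P = (\<lambda>w. X w ^ n)"
  have s: "k < n" "F = (\<lambda>z. (deriv ^^ k) P z / \<eta> z)" "mero_nz ((deriv ^^ k) P)"
    using S by (auto simp: quotient_setting_def P_def)
  have P: "P meromorphic_on UNIV" "mero_ord P z = real n * mero_ord X z"
    unfolding P_def by (auto intro!: mero_nz_meromorphic mero_nz_power f ord_power)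
  have F: "mero_ord F z = mero_ord ((deriv ^^ k) P) z" unfolding s(2) using ord_divide[OF s(3) f(6), of z] z by simp
  have n: "real n \<ge> real k + 1" using s(1) by linarith
  show ?thesis
  proof -
    consider (neg) "mero_ord X z \<le> -1" | (zero) "mero_ord X z = 0" | (pos) "1 \<le> mero_ord X z"
      using ord_int_cases[of X z] by linarith
    thus ?thesis
    proof cases
    case x: neg
    have "real n * mero_ord X z \<le> real n * (-1)" using x by (intro mult_left_mono) auto
    thus ?thesis using ord_higher_deriv[OF P(1) s(3), of z] x F P(2) n by auto
  next
    case zero
    thus ?thesis using ord_higher_deriv_nonneg[OF P(1) s(3), of z] F P(2) by auto
  next
    case x: pos
    have "real n * 1 \<le> real n * mero_ord X z" using x by (intro mult_left_mono) auto
    hence a: "real k + 1 \<le> real n * mero_ord X z" using n by linarith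
    hence "real n * mero_ord X z < 0 \<or> real k \<le> real n * mero_ord X z" by linarith
    hence b: "mero_ord F z = real n * mero_ord X z - real k"
      using ord_higher_deriv[OF P(1) s(3), of z] F P(2) by presburger
    have "1 \<le> mero_ord F z" using a b by linarith
    thus ?thesis using x b by blast
    qed
  qed
qed

text \<open>F' / X^n = (F' / F) (F / X^n) has a negligible proximity function. Off the exceptional
  points its order at zeros and poles of X is -(k + 1), so the other zeros of F' number at most k +
  1 times the distinct zeros and poles of X, up to the error.\<close>

lemma le_err_N_deriv_over_power:
  assumes S: "quotient_setting n k \<eta> X F"
  shows "le_err U (\<lambda>r. nev_N r (\<lambda>z. mero_ord (deriv F) z - real n * mero_ord X z)) (\<lambda>_. 0)"
proof -
  note f = quotient_setting_facts[OF S]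
  define P where "P = (\<lambda>w. X w ^ n)"
  have P: "mero_nz P" unfolding P_def by (rule mero_nz_power[OF f(1)])
  have mq: "mero_nz (\<lambda>z. deriv F z / P z)" by (rule mero_nz_divide[OF f(4) P])
  have "\<forall>\<^sub>\<approx>z\<in>UNIV. F z \<noteq> 0" using f(2) by (simp add: mero_nz_def)
  hence "\<forall>\<^sub>\<approx>z\<in>UNIV. deriv F z / P z = (deriv F z / F z) * (F z / P z)" by eventually_elim simp
  from eventually_m_cong[OF this] eventually_m_mult[OF mero_nz_meromorphic[OF mero_nz_divide[OF f(4,2)]] mero_nz_meromorphic[OF mero_nz_divide[OF f(2) P]]]
  have "\<forall>\<^sub>F r in radii. nev_m r (\<lambda>z. deriv F z / P z) \<le> nev_m r (\<lambda>z. deriv F z / F z) + nev_m r (\<lambda>z. F z / P z)"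
    by eventually_elim simp
  hence "le_err U (\<lambda>r. nev_m r (\<lambda>z. deriv F z / P z)) (\<lambda>r. nev_m r (\<lambda>z. deriv F z / F z) + nev_m r (\<lambda>z. F z / P z))" by (rule le_errI)
  moreover have "le_err U (\<lambda>r. nev_m r (\<lambda>z. deriv F z / F z) + nev_m r (\<lambda>z. F z / P z)) (\<lambda>r. 0 + 0)"
    by (rule le_err_add[OF log_derivative[OF f(5)]]) (use f(9) in \<open>simp add: P_def\<close>)
  ultimately have "le_err U (\<lambda>r. nev_m r (\<lambda>z. deriv F z / P z)) (\<lambda>_. 0)" using le_err_trans by simp
  from le_err_N_ord_logderiv[OF mq this] have "le_err U (\<lambda>r. nev_N r (mero_ord (\<lambda>z. deriv F z / P z))) (\<lambda>_. 0)" .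
  moreover have "mero_ord (\<lambda>z. deriv F z / P z) = (\<lambda>z. mero_ord (deriv F) z - real n * mero_ord X z)"
    by (rule ext, subst ord_divide[OF f(4) P]) (simp add: P_def ord_power[OF f(1)])
  ultimately show ?thesis by simp
qed

lemma le_err_N_zero_ind:
  assumes "mero_nz X"
  shows "le_err U (\<lambda>r. nev_N r (\<lambda>z. of_bool (1 \<le> mero_ord X z))) (\<lambda>r. nev_T r X)"
  by (rule le_err_trans[OF le_err_N_mono[OF _ _ finite.emptyI] le_err_N_pos_ord[OF assms]])
     (auto intro!: loc_fin_intros assms)

lemma le_err_N_pole_ind:
  assumes "mero_nz X"
  shows "le_err U (\<lambda>r. nev_N r (\<lambda>z. of_bool (mero_ord X z \<le> -1))) (\<lambda>r. nev_T r X)"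
proof (rule le_err_trans[OF le_err_N_mono[OF _ _ finite.emptyI] le_errI])
  show "\<forall>\<^sub>F r in radii. nev_N r (\<lambda>z. max 0 (- mero_ord X z)) \<le> nev_T r X"
    using eventually_m_nonneg[OF mero_nz_meromorphic[OF assms]] by eventually_elim (simp add: nev_T_def)
qed (auto intro!: loc_fin_intros assms)

end

lemma ord_1_cases: "1 \<le> mero_ord h z \<Longrightarrow> mero_ord h z = 1 \<or> 2 \<le> mero_ord h z"
proof -
  assume "1 \<le> mero_ord h z"
  hence "1 \<le> zorder h z" unfolding mero_ord_def by linarith
  hence "zorder h z = 1 \<or> 2 \<le> zorder h z" by linarith
  thus ?thesis unfolding mero_ord_def by (metis of_int_1 of_int_le_iff of_int_numeral)
qed

lemma ord_2_cases: "2 \<le> mero_ord h z \<Longrightarrow> mero_ord h z = 2 \<or> 3 \<le> mero_ord h z"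
proof -
  assume "2 \<le> mero_ord h z"
  hence "2 \<le> zorder h z" unfolding mero_ord_def by linarith
  hence "zorder h z = 2 \<or> 3 \<le> zorder h z" by linarith
  thus ?thesis unfolding mero_ord_def by (metis of_int_le_iff of_int_numeral)
qed

lemma ord_gt_cases: "real w < mero_ord h z \<Longrightarrow> real w + 1 \<le> mero_ord h z"
proof -
  assume "real w < mero_ord h z"
  hence "int w < zorder h z" unfolding mero_ord_def by linarith
  thus ?thesis unfolding mero_ord_def by linarith
qed

lemma mult_max_ord: "real n * max 0 (mero_ord h z) = (if 1 \<le> mero_ord h z then real n * mero_ord h z else 0)"
  using ord_int_cases[of h z] by (auto simp: max_def)

section \<open>The two main inequalities\<close>

context error_term
begin

lemma le_err_cong_left:
  assumes "\<forall>\<^sub>F r in radii. \<phi>' r = \<phi> r" "le_err U \<phi> \<psi>"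
  shows "le_err U \<phi>' \<psi>"
  by (rule le_err_trans[OF le_errI assms(2)]) (use assms(1) in eventually_elim, simp)

lemma le_err_N_over_power:
  assumes S: "quotient_setting n k \<eta> X F"
  shows "le_err U (\<lambda>r. nev_N r (\<lambda>z. mero_ord F z - real n * mero_ord X z)) (\<lambda>_. 0)"
proof -
  note f = quotient_setting_facts[OF S]
  have P: "mero_nz (\<lambda>w. X w ^ n)" by (rule mero_nz_power[OF f(1)])
  from le_err_N_ord_logderiv[OF mero_nz_divide[OF f(2) P] f(9)]
  have "le_err U (\<lambda>r. nev_N r (mero_ord (\<lambda>z. F z / X z ^ n))) (\<lambda>_. 0)" .
  moreover have "mero_ord (\<lambda>z. F z / X z ^ n) = (\<lambda>z. mero_ord F z - real n * mero_ord X z)"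
    by (rule ext, subst ord_divide[OF f(2) P]) (simp add: ord_power[OF f(1)])
  ultimately show ?thesis by simp
qed

lemma le_err_N_sum3:
  assumes X: "mero_nz X" "mero_nz Y" "mero_nz Z" and g: "loc_fin g" "le_err U (\<lambda>r. nev_N r g) (\<lambda>_. 0)"
    and c: "0 \<le> c1" "0 \<le> c2" "0 \<le> c3"
    and I: "loc_fin i" "loc_fin j" "loc_fin l" "le_err U (\<lambda>r. nev_N r i) (\<lambda>r. nev_T r X)" "le_err U (\<lambda>r. nev_N r j) (\<lambda>r. nev_T r Y)" "le_err U (\<lambda>r. nev_N r l) (\<lambda>r. nev_T r Z)"
  shows "le_err U (\<lambda>r. nev_N r (\<lambda>z. c1 * i z + c2 * j z + c3 * l z + g z)) (\<lambda>r. c1 * nev_T r X + c2 * nev_T r Y + c3 * nev_T r Z)"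
proof -
  have "\<forall>\<^sub>F r in radii. nev_N r (\<lambda>z. c1 * i z + c2 * j z + c3 * l z + g z) = c1 * nev_N r i + c2 * nev_N r j + c3 * nev_N r l + nev_N r g"
    using eventually_ge_radii[of 1] by eventually_elim (use g(1) I in \<open>simp add: nev_N_add nev_N_cmult loc_fin_intros\<close>)
  moreover have "le_err U (\<lambda>r. c1 * nev_N r i + c2 * nev_N r j + c3 * nev_N r l + nev_N r g) (\<lambda>r. c1 * nev_T r X + c2 * nev_T r Y + c3 * nev_T r Z + 0)"
    by (intro le_err_add le_err_cmult g I c)
  ultimately show ?thesis by - (drule (1) le_err_cong_left, simp)
qed

text \<open>\<open>counting_inequality\<close> summed over the disc. The orders of H, F' / f^n and
  G' / L^n sum to at most the error, the indicators to at most T(f) or T(L). In each bound two of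
  the three terms belong to the same disc count of f: its zeros and its poles.\<close>

lemma main_inequalities:
  fixes \<alpha> \<beta> :: real and w :: nat
  assumes SF: "quotient_setting n k \<eta> f F" and SG: "quotient_setting n k \<eta> L G" and E: "finite E"
    and EE: "\<And>z. z \<notin> E \<Longrightarrow> mero_ord \<eta> z = 0" "\<And>z. z \<notin> E \<Longrightarrow> 0 \<le> mero_ord L z"
    and sh: "\<And>z. z \<notin> E \<Longrightarrow> max 0 (mero_ord (\<lambda>z. F z - 1) z) = max 0 (mero_ord (\<lambda>z. G z - 1) z) \<or>
        real w < mero_ord (\<lambda>z. F z - 1) z \<and> real w < mero_ord (\<lambda>z. G z - 1) z"
    and ab: "(w = 2 \<and> \<alpha> = 1 \<and> \<beta> = 0) \<or> (w = 1 \<and> \<alpha> = 1 \<and> \<beta> = 1/2) \<or> (w = 0 \<and> \<alpha> = 2 \<and> \<beta> = 2)"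
    and Q_def: "Q = (\<lambda>z. deriv (\<lambda>z. inverse (F z - 1)) z / deriv (\<lambda>z. inverse (G z - 1)) z)"
    and Q': "mero_nz (deriv Q)"
  shows "le_err U (\<lambda>r. real n * nev_T r f) (\<lambda>r. (real k + 2 + \<beta> * (real k + 1)) * nev_T r f + (2 + \<beta> * (real k + 1)) * nev_T r f + (1 + \<alpha> * (real k + 1)) * nev_T r L)"
    and "le_err U (\<lambda>r. real n * nev_T r L) (\<lambda>r. (real k + 2 + \<beta> * (real k + 1)) * nev_T r L + (1 + \<alpha> * (real k + 1)) * nev_T r f + (1 + \<alpha> * (real k + 1)) * nev_T r f)"
proof -
  note f = quotient_setting_facts[OF SF] and g = quotient_setting_facts[OF SG]
  define H where "H = (\<lambda>z. deriv Q z / Q z)"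
  note oH = ord_logderiv_quotient[OF mero_nz_meromorphic[OF f(2)] f(4) mero_nz_meromorphic[OF g(2)] g(4) Q_def Q' H_def refl]
  have "moderate U Q"
  proof -
    have mF: "moderate U (\<lambda>z. F z - 1)" using moderate_add_const[OF f(5), of "-1"] f(3)[of 1] by simp
    have mG: "moderate U (\<lambda>z. G z - 1)" using moderate_add_const[OF g(5), of "-1"] g(3)[of 1] by simp
    show ?thesis unfolding Q_def
      by (intro moderate_divide moderate_deriv moderate_inverse mF mG
           deriv_inverse_diff_const mero_nz_meromorphic f g)
  qed
  from log_derivative[OF this] have "le_err U (\<lambda>r. nev_m r H) (\<lambda>_. 0)" by (simp add: H_def)
  from le_err_N_ord_logderiv[OF oH(2) this] have NH: "le_err U (\<lambda>r. nev_N r (mero_ord H)) (\<lambda>_. 0)" .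
  define DF where "DF = (\<lambda>z. mero_ord (deriv F) z - real n * mero_ord f z)"
  define DG where "DG = (\<lambda>z. mero_ord (deriv G) z - real n * mero_ord L z)"
  have lfD: "loc_fin DF" "loc_fin DG" unfolding DF_def DG_def by (intro loc_fin_intros f g)+
  have ND: "le_err U (\<lambda>r. nev_N r DF) (\<lambda>_. 0)" "le_err U (\<lambda>r. nev_N r DG) (\<lambda>_. 0)"
    using le_err_N_deriv_over_power[OF SF] le_err_N_deriv_over_power[OF SG] by (simp_all add: DF_def DG_def)
  have ab': "(\<alpha> = 1 \<and> \<beta> = 0) \<or> (\<alpha> = 1 \<and> \<beta> = 1/2) \<or> (\<alpha> = 2 \<and> \<beta> = 2)" and ab0: "0 \<le> \<alpha>" "0 \<le> \<beta>"
    using ab by auto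
  have comb: "le_err U (\<lambda>r. nev_N r (\<lambda>z. mero_ord H z + a * DG z + b * DF z)) (\<lambda>_. 0)" if "0 \<le> a" "0 \<le> b" for a b
  proof -
    have "le_err U (\<lambda>r. nev_N r (mero_ord H) + a * nev_N r DG + b * nev_N r DF) (\<lambda>_. 0 + a * 0 + b * 0)"
      by (intro le_err_add le_err_cmult NH ND that)
    moreover have "\<forall>\<^sub>F r in radii. nev_N r (\<lambda>z. mero_ord H z + a * DG z + b * DF z) = nev_N r (mero_ord H) + a * nev_N r DG + b * nev_N r DF"
      using eventually_ge_radii[of 1] by eventually_elim (simp add: nev_N_add nev_N_cmult loc_fin_intros lfD oH(2))
    ultimately show ?thesis by - (drule (1) le_err_cong_left[rotated], simp)
  qed
  have key: "real n * max 0 (mero_ord f z) + mero_ord (\<lambda>z. F z - 1) z - mero_ord (deriv F) z \<le>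
       (real k + 2 + \<beta> * (real k + 1)) * of_bool (1 \<le> mero_ord f z) + (2 + \<beta> * (real k + 1)) * of_bool (mero_ord f z \<le> -1) +
       (1 + \<alpha> * (real k + 1)) * of_bool (1 \<le> mero_ord L z) + (mero_ord H z + \<alpha> * DG z + \<beta> * DF z)" (is ?A)
    "real n * max 0 (mero_ord L z) + mero_ord (\<lambda>z. G z - 1) z - mero_ord (deriv G) z \<le>
       (real k + 2 + \<beta> * (real k + 1)) * of_bool (1 \<le> mero_ord L z) + (1 + \<alpha> * (real k + 1)) * of_bool (1 \<le> mero_ord f z) +
       (1 + \<alpha> * (real k + 1)) * of_bool (mero_ord f z \<le> -1) + (mero_ord H z + \<beta> * DG z + \<alpha> * DF z)" (is ?B)
    if z: "z \<notin> E" for z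
  proof -
    define tF tG where "tF = mero_ord (\<lambda>z. F z - 1) z" and "tG = mero_ord (\<lambda>z. G z - 1) z"
    have lo: "local_orders (mero_ord F z) tF (mero_ord (deriv F) z)" "local_orders (mero_ord G z) tG (mero_ord (deriv G) z)"
      unfolding tF_def tG_def by (intro local_orders f g; simp)+
    have of: "(mero_ord f z \<le> -1 \<and> mero_ord F z = real n * mero_ord f z - real k \<and> mero_ord F z \<le> -1) \<or>
      (1 \<le> mero_ord f z \<and> mero_ord F z = real n * mero_ord f z - real k \<and> 1 \<le> mero_ord F z) \<or> (mero_ord f z = 0 \<and> real n * mero_ord f z = 0 \<and> 0 \<le> mero_ord F z)"
      using quotient_setting_orders[OF SF EE(1)[OF z]] by auto
    have oL: "(1 \<le> mero_ord L z \<and> mero_ord G z = real n * mero_ord L z - real k \<and> 1 \<le> mero_ord G z) \<or> (mero_ord L z = 0 \<and> real n * mero_ord L z = 0 \<and> 0 \<le> mero_ord G z)"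
      using quotient_setting_orders[OF SG EE(1)[OF z]] EE(2)[OF z] by auto
    have s: "max 0 tF = max 0 tG \<or> real w < tF \<and> real w < tG" using sh[OF z] by (simp add: tF_def tG_def)
    have s1: "1 \<le> tF \<longleftrightarrow> 1 \<le> tG"
      using s ord_gt_cases[of w "\<lambda>z. F z - 1" z] ord_gt_cases[of w "\<lambda>z. G z - 1" z]
      by (auto simp: tF_def tG_def max_def split: if_splits)
    have s2: "1 \<le> tF \<longrightarrow> tF \<noteq> tG \<longrightarrow> \<beta> = 2 \<or> 2 \<le> tF \<and> 2 \<le> tG \<and> (\<beta> = 1/2 \<or> 3 \<le> tF \<and> 3 \<le> tG)"
    proof (intro impI)
      assume that: "1 \<le> tF" "tF \<noteq> tG"
      have "real w < tF \<and> real w < tG" using s s1 that by (auto simp: max_def split: if_splits)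
      hence "real w + 1 \<le> tF" "real w + 1 \<le> tG" using ord_gt_cases by (auto simp: tF_def tG_def)
      thus "\<beta> = 2 \<or> 2 \<le> tF \<and> 2 \<le> tG \<and> (\<beta> = 1/2 \<or> 3 \<le> tF \<and> 3 \<le> tG)" using ab by auto
    qed
    have s3: "1 \<le> tF \<longrightarrow> tF = 1 \<or> 2 \<le> tF" "1 \<le> tG \<longrightarrow> tG = 1 \<or> 2 \<le> tG"
      unfolding tF_def tG_def by (rule impI, rule ord_1_cases, assumption)+
    have s4: "2 \<le> tF \<longrightarrow> tF = 2 \<or> 3 \<le> tF" "2 \<le> tG \<longrightarrow> tG = 2 \<or> 3 \<le> tG"
      unfolding tF_def tG_def by (rule impI, rule ord_2_cases, assumption)+
    have y3: "mero_ord (deriv F) z - 2 * tF - mero_ord (deriv G) z + 2 * tG \<noteq> 0 \<longrightarrow> mero_ord H z = -1"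
      "mero_ord (deriv F) z - 2 * tF - mero_ord (deriv G) z + 2 * tG = 0 \<longrightarrow> 0 \<le> mero_ord H z"
      "tF = 1 \<longrightarrow> tG = 1 \<longrightarrow> 1 \<le> mero_ord H z"
      using oH(3-5)[of z] by (auto simp: tF_def tG_def)
    note ci = counting_inequality[OF ab' of_nat_0_le_iff lo of oL y3 s1 s2 s3 s4]
    show ?A
      using ci(1) unfolding mult_max_ord DF_def DG_def tF_def[symmetric] tG_def[symmetric] by (simp only: add.assoc)
    have "mero_ord H z + \<beta> * DG z + \<alpha> * DF z = mero_ord H z + \<alpha> * DF z + \<beta> * DG z" by simp
    thus ?B
      using ci(2) unfolding mult_max_ord DF_def DG_def tF_def[symmetric] tG_def[symmetric] by (simp only: add.assoc)
  qed
  have ind: "le_err U (\<lambda>r. nev_N r (\<lambda>z. of_bool (1 \<le> mero_ord X z))) (\<lambda>r. nev_T r X)" "le_err U (\<lambda>r. nev_N r (\<lambda>z. of_bool (mero_ord X z \<le> -1))) (\<lambda>r. nev_T r X)"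
    if "mero_nz X" for X using le_err_N_zero_ind le_err_N_pole_ind that by auto
  note ind' = ind(1)[OF f(1)] ind(2)[OF f(1)] ind(1)[OF g(1)]
  have lfc: "loc_fin (\<lambda>z. mero_ord H z + a * DG z + b * DF z)" for a b by (intro loc_fin_intros lfD oH(2))
  show "le_err U (\<lambda>r. real n * nev_T r f) (\<lambda>r. (real k + 2 + \<beta> * (real k + 1)) * nev_T r f + (2 + \<beta> * (real k + 1)) * nev_T r f + (1 + \<alpha> * (real k + 1)) * nev_T r L)"
  proof (rule le_err_trans[OF milloux[OF SF, of 1]], simp, rule le_err_trans[OF le_err_N_mono[OF _ _ E key(1)]])
    show "le_err U (\<lambda>r. nev_N r (\<lambda>z. (real k + 2 + \<beta> * (real k + 1)) * of_bool (1 \<le> mero_ord f z) + (2 + \<beta> * (real k + 1)) * of_bool (mero_ord f z \<le> -1) +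
       (1 + \<alpha> * (real k + 1)) * of_bool (1 \<le> mero_ord L z) + (mero_ord H z + \<alpha> * DG z + \<beta> * DF z)))
       (\<lambda>r. (real k + 2 + \<beta> * (real k + 1)) * nev_T r f + (2 + \<beta> * (real k + 1)) * nev_T r f + (1 + \<alpha> * (real k + 1)) * nev_T r L)"
      by (rule le_err_N_sum3[OF f(1) f(1) g(1) lfc comb[OF ab0]]) (use ab0 ind' in \<open>auto intro!: loc_fin_intros f g\<close>)
  qed (intro loc_fin_intros lfc f g | assumption)+
  show "le_err U (\<lambda>r. real n * nev_T r L) (\<lambda>r. (real k + 2 + \<beta> * (real k + 1)) * nev_T r L + (1 + \<alpha> * (real k + 1)) * nev_T r f + (1 + \<alpha> * (real k + 1)) * nev_T r f)"
  proof (rule le_err_trans[OF milloux[OF SG, of 1]], simp, rule le_err_trans[OF le_err_N_mono[OF _ _ E key(2)]])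
    show "le_err U (\<lambda>r. nev_N r (\<lambda>z. (real k + 2 + \<beta> * (real k + 1)) * of_bool (1 \<le> mero_ord L z) + (1 + \<alpha> * (real k + 1)) * of_bool (1 \<le> mero_ord f z) +
       (1 + \<alpha> * (real k + 1)) * of_bool (mero_ord f z \<le> -1) + (mero_ord H z + \<beta> * DG z + \<alpha> * DF z)))
       (\<lambda>r. (real k + 2 + \<beta> * (real k + 1)) * nev_T r L + (1 + \<alpha> * (real k + 1)) * nev_T r f + (1 + \<alpha> * (real k + 1)) * nev_T r f)"
      by (rule le_err_N_sum3[OF g(1) f(1) f(1) lfc comb[OF ab0(2,1)]]) (use ab0 ind' in \<open>auto intro!: loc_fin_intros f g\<close>)
  qed (intro loc_fin_intros lfc f g | assumption)+
qed

text \<open>Elimination of S: chaining the two inequalities gives a c R \<le> b d R up to the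
  error.\<close>

lemma le_err_cross:
  assumes 1: "le_err U (\<lambda>r. a * S r) (\<lambda>r. b * R r)" and 2: "le_err U (\<lambda>r. c * R r) (\<lambda>r. d * S r)"
    and pos: "0 \<le> a" "0 \<le> d" "b * d < a * c"
  shows "le_err U R (\<lambda>_. 0)"
proof -
  have "le_err U (\<lambda>r. a * (c * R r)) (\<lambda>r. a * (d * S r))" by (rule le_err_cmult[OF 2 pos(1)])
  moreover have "le_err U (\<lambda>r. d * (a * S r)) (\<lambda>r. d * (b * R r))" by (rule le_err_cmult[OF 1 pos(2)])
  moreover have "(\<lambda>r. a * (d * S r)) = (\<lambda>r. d * (a * S r))" by (auto simp: algebra_simps)
  ultimately have "le_err U (\<lambda>r. a * (c * R r)) (\<lambda>r. d * (b * R r))" using le_err_trans by metis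
  hence "le_err U (\<lambda>r. (a * c - b * d) * R r) (\<lambda>_. 0)"
    by (subst (asm) le_err_move) (simp add: algebra_simps)
  from le_err_cmult[OF this, of "1 / (a * c - b * d)"] show ?thesis using pos(3) by simp
qed

end

section \<open>The case of a constant quotient\<close>

lemma ord_affine:
  assumes G: "mero_nz G" and P: "mero_nz (\<lambda>z. p * G z + q)"
  shows "0 \<le> mero_ord G z \<Longrightarrow> 0 \<le> mero_ord (\<lambda>z. p * G z + q) z"
    and "1 \<le> mero_ord G z \<Longrightarrow> q \<noteq> 0 \<Longrightarrow> mero_ord (\<lambda>z. p * G z + q) z = 0"
proof -
  have pG: "mero_nz (\<lambda>z. p * G z)" "mero_ord (\<lambda>z. p * G z) z = mero_ord G z" if "p \<noteq> 0"
    using mero_nz_mult[OF mero_nz_const[OF that] G] ord_mult[OF mero_nz_const[OF that] G, of z] that by (auto simp: mero_ord_def)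
  have P': "mero_nz (\<lambda>z. p * G z - (- q))" using P by simp
  show "0 \<le> mero_ord (\<lambda>z. p * G z + q) z" if "0 \<le> mero_ord G z"
  proof (cases "p = 0 \<or> q = 0")
    case True
    thus ?thesis
    proof
      assume "p = 0"
      thus ?thesis using mero_nz_frequently[OF P, of z] by (auto simp: mero_ord_def)
    next
      assume q: "q = 0"
      hence "p \<noteq> 0" using mero_nz_frequently[OF P, of z] by auto
      thus ?thesis using pG(2) q that by simp
    qed
  next
    case False
    thus ?thesis using ord_diff_const(3)[OF pG(1) P', of z] pG(2) that by simp
  qed
  show "mero_ord (\<lambda>z. p * G z + q) z = 0" if "1 \<le> mero_ord G z" "q \<noteq> 0"
  proof (cases "p = 0")
    case True
    thus ?thesis using that by (simp add: mero_ord_def)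
  next
    case False
    thus ?thesis using ord_diff_const(2)[OF pG(1) P', of z] pG(2) that by simp
  qed
qed

lemma ord_prod_eq:
  assumes "mero_nz a" "mero_nz b" "\<forall>\<^sub>\<approx>z\<in>UNIV. a z * b z = c z"
  shows "mero_ord a z + mero_ord b z = mero_ord c z"
  using ord_mult[OF assms(1,2), of z] ord_cong[OF assms(3), of z] by simp

lemma ord_const: "c \<noteq> 0 \<Longrightarrow> mero_ord (\<lambda>_. c) z = 0"
  by (simp add: mero_ord_def)

lemma ord_cmult: "mero_nz h \<Longrightarrow> c \<noteq> 0 \<Longrightarrow> mero_ord (\<lambda>z. c * h z) z = mero_ord h z"
  using ord_mult[OF mero_nz_const] by (simp add: ord_const)

text \<open>The hypothesis says F - 1 = (G - 1) / (B G + A - B), a Moebius transformation.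
  Multiplied out, it can be evaluated in terms of orders.\<close>

lemma moebius_denominator:
  assumes F: "\<And>c. mero_nz (\<lambda>z. F z - c)" and G: "\<And>c. mero_nz (\<lambda>z. G z - c)"
    and uv: "\<forall>\<^sub>\<approx>z\<in>UNIV. inverse (F z - 1) = A * inverse (G z - 1) + B"
  shows "\<forall>\<^sub>\<approx>z\<in>UNIV. (F z - 1) * (B * G z + (A - B)) = G z - 1" "mero_nz (\<lambda>z. B * G z + (A - B))"
proof -
  have nz: "\<forall>\<^sub>\<approx>z\<in>UNIV. F z - 1 \<noteq> 0" "\<forall>\<^sub>\<approx>z\<in>UNIV. G z - 1 \<noteq> 0" using F[of 1] G[of 1] by (auto simp: mero_nz_def)
  show ev: "\<forall>\<^sub>\<approx>z\<in>UNIV. (F z - 1) * (B * G z + (A - B)) = G z - 1"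
    using uv nz
  proof eventually_elim
    case (elim z)
    define x y where "x = F z - 1" and "y = G z - 1"
    have "x \<noteq> 0" "y \<noteq> 0" "inverse x = A * inverse y + B" using elim by (auto simp: x_def y_def)
    hence "y = x * (A + B * y)" by (simp add: field_simps)
    thus ?case by (simp add: x_def y_def algebra_simps)
  qed
  have "\<forall>\<^sub>\<approx>z\<in>UNIV. (G z - 1) / (F z - 1) = B * G z + (A - B)"
    using ev nz(1) by eventually_elim (simp add: field_simps)
  thus "mero_nz (\<lambda>z. B * G z + (A - B))" by (rule mero_nz_cong[OF mero_nz_divide[OF G F]])
qed

text \<open>F is a Moebius function of G. The value c1 is that of F where G = 0; if this is 0, it is
  the value at G = infinity, which F omits where G has no pole. The value c2 is that of G where F =
  0; if this is 0 or infinity, it is the value where F = infinity.\<close>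

lemma moebius_values:
  assumes F: "\<And>c. mero_nz (\<lambda>z. F z - c)" and G: "\<And>c. mero_nz (\<lambda>z. G z - c)"
    and uv: "\<forall>\<^sub>\<approx>z\<in>UNIV. inverse (F z - 1) = A * inverse (G z - 1) + B"
    and AB: "A \<noteq> 0" "B \<noteq> A" "\<not> (A = 1 \<and> B = 0)"
  shows "\<exists>c1 c2. c1 \<noteq> 0 \<and> c2 \<noteq> 0 \<and> (\<forall>z. 0 \<le> mero_ord G z \<longrightarrow>
     (1 \<le> mero_ord (\<lambda>z. F z - c1) z \<longrightarrow> 1 \<le> mero_ord G z) \<and> (1 \<le> mero_ord (\<lambda>z. G z - c2) z \<longrightarrow> mero_ord F z \<noteq> 0))"
proof -
  define D where "D = (\<lambda>z. B * G z + (A - B))"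
  have FD: "\<forall>\<^sub>\<approx>z\<in>UNIV. (F z - 1) * D z = G z - 1" and D: "mero_nz D"
    using moebius_denominator[OF F G uv] by (simp_all add: D_def)
  have G0: "mero_nz G" and F0: "mero_nz F" using G[of 0] F[of 0] by auto
  have oD: "0 \<le> mero_ord D z" if "0 \<le> mero_ord G z" for z
    using ord_affine(1)[OF G0 D[unfolded D_def] that] by (simp add: D_def)
  show ?thesis
  proof (cases "B = A - 1")
    case True
    hence B: "B \<noteq> 0" using AB by auto
    have A: "A = B + 1" using True by simp
    define c1 c2 where "c1 = A / B" and "c2 = - 1 / B"
    have c: "c1 \<noteq> 0" "c2 \<noteq> 0" using AB B by (auto simp: c1_def c2_def)
    have Fc: "\<forall>\<^sub>\<approx>z\<in>UNIV. (F z - c1) * D z = - A / B"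
      using FD
    proof eventually_elim
      case (elim z)
      have "(F z - c1) * D z = (F z - 1) * D z + (1 - c1) * D z" by (simp add: algebra_simps)
      also have "1 - c1 = - 1 / B" using B by (simp add: c1_def A field_simps)
      also note elim
      also have "(G z - 1) + - 1 / B * D z = - A / B" unfolding D_def using B by (simp add: A field_simps)
      finally show ?case .
    qed
    have FG: "\<forall>\<^sub>\<approx>z\<in>UNIV. F z * D z = A * G z"
      using FD by eventually_elim (simp add: D_def A algebra_simps)
    have DG: "D = (\<lambda>z. B * (G z - c2))" using B by (auto simp: D_def c2_def A field_simps)
    have "(1 \<le> mero_ord (\<lambda>z. F z - c1) z \<longrightarrow> 1 \<le> mero_ord G z) \<and> (1 \<le> mero_ord (\<lambda>z. G z - c2) z \<longrightarrow> mero_ord F z \<noteq> 0)"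
      if z: "0 \<le> mero_ord G z" for z
    proof -
      have "mero_ord (\<lambda>z. F z - c1) z + mero_ord D z = 0"
        using ord_prod_eq[OF F D Fc, of z] AB B by (simp add: ord_const)
      hence 1: "\<not> 1 \<le> mero_ord (\<lambda>z. F z - c1) z" using oD[OF z] by simp
      have "mero_ord F z \<noteq> 0" if o: "1 \<le> mero_ord (\<lambda>z. G z - c2) z"
      proof -
        have "mero_ord D z = mero_ord (\<lambda>z. G z - c2) z" unfolding DG by (rule ord_cmult[OF G B])
        moreover have "mero_ord G z = 0"
          using ord_affine(2)[OF G[of c2], of 1 c2 z] G0 o c by simp
        moreover have "mero_ord F z + mero_ord D z = mero_ord G z"
          using ord_prod_eq[OF F0 D FG, of z] ord_cmult[OF G0 AB(1), of z] by simp
        ultimately show ?thesis using o by simp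
      qed
      with 1 show ?thesis by simp
    qed
    with c show ?thesis by blast
  next
    case BA: False
    define c1 where "c1 = 1 + 1 / (B - A)"
    have "B - A \<noteq> 0" "B - A + 1 \<noteq> 0" using AB BA by (auto simp: algebra_simps)
    hence c1: "c1 \<noteq> 0" by (simp add: c1_def field_simps)
    have Fc: "\<forall>\<^sub>\<approx>z\<in>UNIV. (F z - c1) * D z = (- A / (B - A)) * G z"
      using FD
    proof eventually_elim
      case (elim z)
      have "(F z - c1) * D z = (F z - 1) * D z + (1 - c1) * D z" by (simp add: algebra_simps)
      also have "1 - c1 = - 1 / (B - A)" by (simp add: c1_def)
      also note elim
      also have "(G z - 1) + - 1 / (B - A) * D z = (- A / (B - A)) * G z"
      proof -
        define i where "i = 1 / (B - A)"
        have i: "i * (B - A) = 1" using \<open>B - A \<noteq> 0\<close> by (simp add: i_def)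
        have "(G z - 1) + - i * D z = (- A * i) * G z + (1 - i * (B - A)) * (G z - 1)"
          by (simp add: D_def algebra_simps)
        thus ?thesis using i by (simp add: i_def)
      qed
      finally show ?case .
    qed
    have 1: "1 \<le> mero_ord G z" if "0 \<le> mero_ord G z" "1 \<le> mero_ord (\<lambda>z. F z - c1) z" for z
    proof -
      have "mero_ord (\<lambda>z. F z - c1) z + mero_ord D z = mero_ord G z"
        using ord_prod_eq[OF F D Fc, of z] ord_cmult[OF G0, of "- A / (B - A)" z] AB \<open>B - A \<noteq> 0\<close> by simp
      thus ?thesis using oD that by fastforce
    qed
    have FG: "\<forall>\<^sub>\<approx>z\<in>UNIV. F z * D z = (1 + B) * G z + (A - B - 1)"
      using FD by eventually_elim (simp add: D_def algebra_simps)
    show ?thesis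
    proof (cases "B = -1")
      case True
      define c2 where "c2 = 1 + A"
      have c2: "c2 \<noteq> 0" using AB True by (auto simp: c2_def add_eq_0_iff)
      have DG: "D = (\<lambda>z. (-1) * (G z - c2))" using True by (auto simp: D_def c2_def)
      have FG': "\<forall>\<^sub>\<approx>z\<in>UNIV. F z * D z = A" using FG True by simp
      have "mero_ord F z \<noteq> 0" if o: "1 \<le> mero_ord (\<lambda>z. G z - c2) z" for z
      proof -
        have "mero_ord D z = mero_ord (\<lambda>z. G z - c2) z" unfolding DG by (rule ord_cmult[OF G]) simp
        moreover have "mero_ord F z + mero_ord D z = 0"
          using ord_prod_eq[OF F0 D FG', of z] AB by (simp add: ord_const)
        ultimately show ?thesis using o by simp
      qed
      with c1 c2 1 show ?thesis by blast
    next
      case False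
      hence B1: "1 + B \<noteq> 0" by (simp add: add_eq_0_iff)
      define c2 where "c2 = (1 + B - A) / (1 + B)"
      have c2: "c2 \<noteq> 0" using B1 \<open>B - A + 1 \<noteq> 0\<close> by (auto simp: c2_def algebra_simps)
      have FG': "\<forall>\<^sub>\<approx>z\<in>UNIV. F z * D z = (1 + B) * (G z - c2)"
        using FG
      proof eventually_elim
        case (elim z)
        have "(1 + B) * (G z - c2) = (1 + B) * G z - (1 + B) * c2" by (rule right_diff_distrib)
        also have "(1 + B) * c2 = 1 + B - A" using B1 by (simp add: c2_def)
        finally show ?case using elim by simp
      qed
      have DG: "D = (\<lambda>z. B * (G z - c2) + A / (1 + B))"
      proof
        fix z
        define i where "i = 1 / (1 + B)"
        have i: "(1 + B) * i = 1" using B1 by (simp add: i_def)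
        have "B * (G z - (1 + B - A) * i) + A * i - (B * G z + (A - B)) = (A - B) * ((1 + B) * i - 1)"
          by (simp add: algebra_simps)
        hence "B * (G z - (1 + B - A) * i) + A * i = B * G z + (A - B)" using i by simp
        thus "D z = B * (G z - c2) + A / (1 + B)" by (simp add: D_def c2_def i_def)
      qed
      have "mero_ord F z \<noteq> 0" if o: "1 \<le> mero_ord (\<lambda>z. G z - c2) z" for z
      proof -
        have "mero_ord D z = 0"
          using ord_affine(2)[OF G[of c2], of B "A / (1 + B)" z] D AB B1 o unfolding DG by simp
        moreover have "mero_ord F z + mero_ord D z = mero_ord (\<lambda>z. G z - c2) z"
          using ord_prod_eq[OF F0 D FG', of z] ord_cmult[OF G[of c2] B1, of z] by simp
        ultimately show ?thesis using o by simp
      qed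
      with c1 c2 1 show ?thesis by blast
    qed
  qed
qed

context error_term
begin

text \<open>With c1, c2 from \<open>moebius_values\<close> in place of 1, every c1-point of F off
  the exceptional set is a zero of G, and every c2-point of G a zero or pole of F. As F / f^n and G
  / L^n have negligible proximity functions, these points cost at most k + 1 per distinct zero or
  pole of f, or per distinct zero of L.\<close>

lemma moebius_case:
  assumes SF: "quotient_setting n k \<eta> f F" and SG: "quotient_setting n k \<eta> L G" and E: "finite E"
    and EE: "\<And>z. z \<notin> E \<Longrightarrow> mero_ord \<eta> z = 0" "\<And>z. z \<notin> E \<Longrightarrow> 0 \<le> mero_ord L z"
    and n: "real n > 5 * real k / 2 + 6"
    and uv: "\<forall>\<^sub>\<approx>z\<in>UNIV. inverse (F z - 1) = A * inverse (G z - 1) + B"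
    and AB: "A \<noteq> 0" "B \<noteq> A" "\<not> (A = 1 \<and> B = 0)"
  shows "le_err U (\<lambda>r. nev_T r L) (\<lambda>_. 0)"
proof -
  note f = quotient_setting_facts[OF SF] and g = quotient_setting_facts[OF SG]
  obtain c1 c2 where c: "c1 \<noteq> 0" "c2 \<noteq> 0" and val: "\<And>z. 0 \<le> mero_ord G z \<Longrightarrow>
     (1 \<le> mero_ord (\<lambda>z. F z - c1) z \<longrightarrow> 1 \<le> mero_ord G z) \<and> (1 \<le> mero_ord (\<lambda>z. G z - c2) z \<longrightarrow> mero_ord F z \<noteq> 0)"
    using moebius_values[OF f(3) g(3) uv AB] by blast
  have key: "real n * max 0 (mero_ord f z) + mero_ord (\<lambda>z. F z - c1) z - mero_ord (deriv F) z \<le>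
       (real k + 1) * of_bool (1 \<le> mero_ord f z) + 1 * of_bool (mero_ord f z \<le> -1) + (real k + 1) * of_bool (1 \<le> mero_ord L z) +
       (mero_ord G z - real n * mero_ord L z)" (is ?A)
    "real n * max 0 (mero_ord L z) + mero_ord (\<lambda>z. G z - c2) z - mero_ord (deriv G) z \<le>
       (real k + 1) * of_bool (1 \<le> mero_ord L z) + (real k + 1) * of_bool (1 \<le> mero_ord f z) + (real k + 1) * of_bool (mero_ord f z \<le> -1) +
       (mero_ord F z - real n * mero_ord f z)" (is ?B)
    if z: "z \<notin> E" for z
  proof -
    have lo: "local_orders (mero_ord F z) (mero_ord (\<lambda>z. F z - c1) z) (mero_ord (deriv F) z)"
      "local_orders (mero_ord G z) (mero_ord (\<lambda>z. G z - c2) z) (mero_ord (deriv G) z)"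
      by (intro local_orders f g c)+
    note oF = quotient_setting_orders[OF SF EE(1)[OF z]]
    have oL: "(1 \<le> mero_ord L z \<and> mero_ord G z = real n * mero_ord L z - real k \<and> 1 \<le> mero_ord G z) \<or> (mero_ord L z = 0 \<and> 0 \<le> mero_ord G z)"
      using quotient_setting_orders[OF SG EE(1)[OF z]] EE(2)[OF z] by auto
    have G0: "0 \<le> mero_ord G z" using oL by auto
    have kz: "0 \<le> real k" by simp
    note v = val[OF G0]
    have i: "mero_ord F z \<le> -1 \<or> mero_ord F z = 0 \<or> 1 \<le> mero_ord F z" by (rule ord_int_cases)
    have LI: "0 \<le> (real k + 1) * of_bool (1 \<le> mero_ord L z) + (mero_ord G z - real n * mero_ord L z)" using oL by auto
    have LI2: "1 \<le> (real k + 1) * of_bool (1 \<le> mero_ord L z) + (mero_ord G z - real n * mero_ord L z)" if "1 \<le> mero_ord G z"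
      using oL that by auto
    have FI: "0 \<le> (real k + 1) * of_bool (1 \<le> mero_ord f z) + (real k + 1) * of_bool (mero_ord f z \<le> -1) + (mero_ord F z - real n * mero_ord f z)"
      using oF by auto
    have FI2: "1 \<le> (real k + 1) * of_bool (1 \<le> mero_ord f z) + (real k + 1) * of_bool (mero_ord f z \<le> -1) + (mero_ord F z - real n * mero_ord f z)"
      if "mero_ord F z \<noteq> 0" using oF i that by auto
    have "(if 1 \<le> mero_ord f z then real n * mero_ord f z else 0) + mero_ord (\<lambda>z. F z - c1) z - mero_ord (deriv F) z \<le>
        (real k + 1) * of_bool (1 \<le> mero_ord f z) + 1 * of_bool (mero_ord f z \<le> -1) + of_bool (1 \<le> mero_ord (\<lambda>z. F z - c1) z)"
      using oF lo(1) unfolding local_orders_def by auto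
    thus ?A unfolding mult_max_ord using LI LI2 v by (cases "1 \<le> mero_ord (\<lambda>z. F z - c1) z") auto
    have "(if 1 \<le> mero_ord L z then real n * mero_ord L z else 0) + mero_ord (\<lambda>z. G z - c2) z - mero_ord (deriv G) z \<le>
        (real k + 1) * of_bool (1 \<le> mero_ord L z) + of_bool (1 \<le> mero_ord (\<lambda>z. G z - c2) z)"
      using oL lo(2) unfolding local_orders_def by auto
    thus ?B unfolding mult_max_ord using FI FI2 v by (cases "1 \<le> mero_ord (\<lambda>z. G z - c2) z") auto
  qed
  note ind = le_err_N_zero_ind[OF f(1)] le_err_N_pole_ind[OF f(1)] le_err_N_zero_ind[OF g(1)]
  have lfd: "loc_fin (\<lambda>z. mero_ord F z - real n * mero_ord f z)" "loc_fin (\<lambda>z. mero_ord G z - real n * mero_ord L z)"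
    by (intro loc_fin_intros f g)+
  have 1: "le_err U (\<lambda>r. real n * nev_T r f) (\<lambda>r. (real k + 1) * nev_T r f + 1 * nev_T r f + (real k + 1) * nev_T r L)"
  proof (rule le_err_trans[OF milloux[OF SF c(1)]], rule le_err_trans[OF le_err_N_mono[OF _ _ E key(1)]])
    show "le_err U (\<lambda>r. nev_N r (\<lambda>z. (real k + 1) * of_bool (1 \<le> mero_ord f z) + 1 * of_bool (mero_ord f z \<le> -1) + (real k + 1) * of_bool (1 \<le> mero_ord L z) +
       (mero_ord G z - real n * mero_ord L z))) (\<lambda>r. (real k + 1) * nev_T r f + 1 * nev_T r f + (real k + 1) * nev_T r L)"
      by (rule le_err_N_sum3[OF f(1) f(1) g(1) lfd(2) le_err_N_over_power[OF SG]])
         (use ind in \<open>auto intro!: loc_fin_intros f g\<close>)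
  qed (intro loc_fin_intros lfd f g | assumption)+
  have 2: "le_err U (\<lambda>r. real n * nev_T r L) (\<lambda>r. (real k + 1) * nev_T r L + (real k + 1) * nev_T r f + (real k + 1) * nev_T r f)"
  proof (rule le_err_trans[OF milloux[OF SG c(2)]], rule le_err_trans[OF le_err_N_mono[OF _ _ E key(2)]])
    show "le_err U (\<lambda>r. nev_N r (\<lambda>z. (real k + 1) * of_bool (1 \<le> mero_ord L z) + (real k + 1) * of_bool (1 \<le> mero_ord f z) + (real k + 1) * of_bool (mero_ord f z \<le> -1) +
       (mero_ord F z - real n * mero_ord f z))) (\<lambda>r. (real k + 1) * nev_T r L + (real k + 1) * nev_T r f + (real k + 1) * nev_T r f)"
      by (rule le_err_N_sum3[OF g(1) f(1) f(1) lfd(1) le_err_N_over_power[OF SF]])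
         (use ind in \<open>auto intro!: loc_fin_intros f g\<close>)
  qed (intro loc_fin_intros lfd f g | assumption)+
  have e1: "le_err U (\<lambda>r. (real n - real k - 2) * nev_T r f) (\<lambda>r. (real k + 1) * nev_T r L)"
    using 1 by (subst le_err_move, subst (asm) le_err_move) (simp add: algebra_simps)
  have e2: "le_err U (\<lambda>r. (real n - real k - 1) * nev_T r L) (\<lambda>r. (2 * (real k + 1)) * nev_T r f)"
    using 2 by (subst le_err_move, subst (asm) le_err_move) (simp add: algebra_simps)
  show ?thesis
  proof (rule le_err_cross[OF e1 e2])
    \<comment> \<open>The bound on n is the weakest of the three in the theorem, so this case is
      settled for all weights at once.\<close>
    have a: "3/2 * real k + 4 \<le> real n - real k - 2" "3/2 * real k + 5 \<le> real n - real k - 1" using n by auto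
    have "(real k + 1) * (2 * (real k + 1)) < (3/2 * real k + 4) * (3/2 * real k + 5)"
    proof -
      have "(3/2 * x + 4) * (3/2 * x + 5) - (x + 1) * (2 * (x + 1)) = x * x / 4 + 19/2 * x + 18" for x :: real
        by (simp add: field_simps)
      from this[of "real k"] show ?thesis by (smt (verit) mult_nonneg_nonneg of_nat_0_le_iff divide_nonneg_nonneg)
    qed
    also have "\<dots> \<le> (real n - real k - 2) * (real n - real k - 1)" using a by (intro mult_mono) auto
    finally show "(real k + 1) * (2 * (real k + 1)) < (real n - real k - 2) * (real n - real k - 1)" .
  qed (use n in auto)
qed

text \<open>At a zero of L of order m, G has a zero of order n m - k, so F has a pole of that order.
  Then f has a pole of some order j with n j + k = n m - k. So n divides 2 k, which is impossible
  for 0 < 2 k < n.\<close>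

lemma inverse_moebius_impossible:
  assumes SF: "quotient_setting n k \<eta> f F" and SG: "quotient_setting n k \<eta> L G" and z: "mero_ord \<eta> z = 0" "1 \<le> mero_ord L z"
    and n: "2 * k < n" "0 < k" and A: "A \<noteq> 0"
    and uv: "\<forall>\<^sub>\<approx>z\<in>UNIV. inverse (F z - 1) = A * inverse (G z - 1) + A"
  shows False
proof -
  note f = quotient_setting_facts[OF SF] and g = quotient_setting_facts[OF SG]
  note D = moebius_denominator[OF f(3) g(3) uv]
  have G: "mero_ord G z = real n * mero_ord L z - real k" "1 \<le> mero_ord G z"
    using quotient_setting_orders[OF SG z(1)] z(2) by auto
  have "mero_ord (\<lambda>z. A * G z) z = mero_ord G z" by (rule ord_cmult[OF g(2) A])
  moreover have "mero_ord (\<lambda>z. F z - 1) z + mero_ord (\<lambda>z. A * G z) z = mero_ord (\<lambda>z. G z - 1) z"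
    using ord_prod_eq[OF f(3) D(2) D(1), of z] by simp
  moreover have "mero_ord (\<lambda>z. G z - 1) z = 0"
    using ord_diff_const(2)[OF g(2) g(3), of 1 z] G by simp
  ultimately have t: "mero_ord (\<lambda>z. F z - 1) z = - mero_ord G z" by simp
  have F: "mero_ord F z = - mero_ord G z"
    using local_orders[OF f(2) f(3) f(4), of 1 z] t G(2) unfolding local_orders_def by auto
  hence "mero_ord f z \<le> -1" "mero_ord F z = real n * mero_ord f z - real k"
    using quotient_setting_orders[OF SF z(1)] G(2) by auto
  hence eq: "real n * (mero_ord f z + mero_ord L z) = 2 * real k" using F G(1) by (simp add: algebra_simps)
  hence "0 < real n * (mero_ord f z + mero_ord L z)" using n by simp
  hence "0 < mero_ord f z + mero_ord L z" by (simp add: zero_less_mult_iff)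
  hence "0 < real_of_int (zorder f z + zorder L z)" by (simp add: mero_ord_def)
  hence "1 \<le> zorder f z + zorder L z" by linarith
  hence "real_of_int 1 \<le> real_of_int (zorder f z + zorder L z)" by (simp only: of_int_le_iff)
  hence "1 \<le> mero_ord f z + mero_ord L z" by (simp add: mero_ord_def)
  hence "real n * 1 \<le> real n * (mero_ord f z + mero_ord L z)" by (intro mult_left_mono) auto
  thus False using eq n by linarith
qed

end

section \<open>Growth of the characteristic\<close>

lemma zero_error_term: "error_term (\<lambda>_. 0)"
  by unfold_locales auto

text \<open>Each zero contributes ln r - O(1) to the counting function, so sufficiently many zeros
  beat any fixed multiple of ln r.\<close>

lemma zeros_not_negligible:
  assumes L: "mero_nz L" and inf: "infinite {z. 1 \<le> mero_ord L z}"
  shows "\<not> le_err (\<lambda>_. 0) (\<lambda>r. nev_T r L) (\<lambda>_. 0)"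
proof
  interpret error_term "\<lambda>_. 0" by (rule zero_error_term)
  define \<nu> where "\<nu> = (\<lambda>z. of_bool (1 \<le> mero_ord L z) :: real)"
  assume "le_err (\<lambda>_. 0) (\<lambda>r. nev_T r L) (\<lambda>_. 0)"
  from le_err_trans[OF le_err_N_zero_ind[OF L] this]
  obtain C where C: "0 \<le> C" "\<forall>\<^sub>F r in radii. \<forall>R>r. nev_N r \<nu> \<le> C * error_bound (\<lambda>_. 0) r R"
    unfolding le_err_def \<nu>_def by auto
  obtain M where M: "C + 1 \<le> real M" using real_arch_simple by blast
  obtain S where S: "S \<subseteq> {z. 1 \<le> mero_ord L z}" "finite S" "card S = M"
    using infinite_arbitrarily_large[OF inf] by blast
  obtain \<rho> where \<rho>: "\<And>z. z \<in> S \<Longrightarrow> norm z \<le> \<rho>" "1 \<le> \<rho>"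
  proof -
    obtain b where "\<forall>z\<in>S. norm z \<le> b" using finite_imp_bounded[OF S(2)] by (auto simp: bounded_iff)
    thus ?thesis by (intro that[of "max 1 b"]) fastforce+
  qed
  define r0 where "r0 = max (\<rho> + 1) (exp (real M * ln \<rho> + C * ln 5 + 1))"
  from radii_ex[OF C(2)] obtain r1 where r1: "\<forall>a\<ge>r1. \<forall>b>a. \<exists>r. a < r \<and> r < b \<and> (\<forall>R>r. nev_N r \<nu> \<le> C * error_bound (\<lambda>_. 0) r R)" ..
  have "r1 \<le> max r0 r1" "max r0 r1 < max r0 r1 + 1" by auto
  then obtain r where r: "max r0 r1 < r" "\<And>R. R > r \<Longrightarrow> nev_N r \<nu> \<le> C * error_bound (\<lambda>_. 0) r R" using r1 by blast
  have r': "\<rho> < r" "1 \<le> r" "exp (real M * ln \<rho> + C * ln 5 + 1) < r" using r(1) \<rho>(2) by (auto simp: r0_def)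
  have loc_fin: "loc_fin \<nu>" unfolding \<nu>_def by (intro loc_fin_intros L)
  have "nev_N r \<nu> = (\<Sum>z\<in>{z. \<nu> z \<noteq> 0 \<and> norm z \<le> r}. \<nu> z * log_kernel r z)" by (simp add: nev_N_def)
  also have "\<dots> \<ge> (\<Sum>z\<in>S. \<nu> z * log_kernel r z)"
  proof (rule sum_mono2[OF loc_fin_finite[OF loc_fin]])
    show "S \<subseteq> {z. \<nu> z \<noteq> 0 \<and> norm z \<le> r}"
      using S(1) \<rho>(1) r'(1) by (fastforce simp: \<nu>_def)
  qed (simp add: \<nu>_def log_kernel_nonneg)
  also have "(\<Sum>z\<in>S. \<nu> z * log_kernel r z) \<ge> (\<Sum>z\<in>S. ln r - ln \<rho>)"
  proof (rule sum_mono)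
    fix z assume z: "z \<in> S"
    hence "norm z < r" using \<rho>(1)[OF z] r' by simp
    moreover have "ln (max 1 (norm z)) \<le> ln \<rho>" using \<rho>(1)[OF z] \<rho>(2) by (subst ln_le_cancel_iff) auto
    ultimately show "ln r - ln \<rho> \<le> \<nu> z * log_kernel r z" using z S(1) r' by (auto simp: \<nu>_def log_kernel_inside)
  qed
  finally have lower: "real M * (ln r - ln \<rho>) \<le> nev_N r \<nu>" using S(3) by simp
  \<comment> \<open>With R = 2 r the gap term 1 / (R - r) stays below r, and the error is
    logarithmic.\<close>
  have "error_bound (\<lambda>_. 0) r (2 * r) \<le> ln (5 * r)"
  proof -
    have "1 / r \<le> r" using r' by (simp add: divide_le_eq mult_le_one order_trans[of 1 r "r * r"])
    thus ?thesis unfolding error_bound_def using r' by (subst ln_le_cancel_iff) (auto simp: add_pos_pos)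
  qed
  hence "C * error_bound (\<lambda>_. 0) r (2 * r) \<le> C * ln (5 * r)" using C(1) by (rule mult_left_mono)
  moreover have "nev_N r \<nu> \<le> C * error_bound (\<lambda>_. 0) r (2 * r)" using r(2)[of "2 * r"] r' by simp
  ultimately have "real M * (ln r - ln \<rho>) \<le> C * (ln 5 + ln r)" using lower r' by (simp add: ln_mult)
  hence "(real M - C) * ln r \<le> real M * ln \<rho> + C * ln 5" by (simp add: algebra_simps)
  moreover have "1 * ln r \<le> (real M - C) * ln r" using M r' by (intro mult_right_mono) auto
  moreover have "real M * ln \<rho> + C * ln 5 + 1 < ln r"
    using r' by (metis exp_gt_zero ln_exp ln_less_cancel_iff less_trans)
  ultimately show False by simp
qed

text \<open>Ensures that the infimum in \<open>ess_T\<close> is taken over a nonempty set. Although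
  h is unbounded near irregular circles, the means of the absolute values of ln |z - a| are bounded
  uniformly in the radius.\<close>

lemma nev_T_bounded:
  assumes h: "mero_nz h"
  shows "\<exists>B. \<forall>r. 1 \<le> r \<longrightarrow> r \<le> R \<longrightarrow> regular_radius h r \<longrightarrow> nev_T r h \<le> B"
proof -
  from radii_ex[OF eventually_regular_radius[OF h]] obtain r0 where
    r0: "\<forall>a\<ge>r0. \<forall>b>a. \<exists>r. a < r \<and> r < b \<and> regular_radius h r" ..
  have "r0 \<le> max r0 (max R 1)" "max r0 (max R 1) < max r0 (max R 1) + 1" by auto
  then obtain R1 where R1: "max r0 (max R 1) < R1" "regular_radius h R1" using r0 by blast
  hence R1': "R < R1" "1 < R1" by auto
  define A where "A = irregular_points h \<inter> ball 0 R1"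
  have finA: "finite A" unfolding A_def by (intro finite_irregular_points h) auto
  obtain H where H: "continuous_on (cball 0 R1) H"
    "\<And>z. z \<in> cball 0 R1 \<Longrightarrow> H z \<noteq> 0"
    "\<And>z. z \<in> cball 0 R1 \<Longrightarrow> z \<notin> irregular_points h \<Longrightarrow> h z = H z * (\<Prod>a\<in>A. (z - a) powi zorder h a)"
  proof -
    have "0 < R1" "sphere 0 R1 \<inter> irregular_points h = {}" using R1 R1' by (auto simp: regular_radius_def)
    from factorization_disc[OF h this] obtain g R' where g: "R1 < R'" "g holomorphic_on ball 0 R'"
      "\<And>z. z \<in> ball 0 R' \<Longrightarrow> g z \<noteq> 0"
      "\<And>z. z \<notin> irregular_points h \<Longrightarrow> z \<in> ball 0 R' \<Longrightarrow>
         h z = g z * (\<Prod>a\<in>irregular_points h \<inter> ball 0 R1. (z - a) powi zorder h a)"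
      by metis
    have sub: "cball 0 R1 \<subseteq> ball (0::complex) R'" using g(1) by auto
    show ?thesis
    proof (rule that[of g])
      show "continuous_on (cball 0 R1) g"
        by (rule continuous_on_subset[OF holomorphic_on_imp_continuous_on[OF g(2)] sub])
    qed (use g(3,4) sub in \<open>auto simp: A_def\<close>)
  qed
  have "compact ((\<lambda>z. \<bar>ln (norm (H z))\<bar>) ` cball 0 R1)"
    by (intro compact_continuous_image continuous_intros H(1)) (use H(2) in auto)
  from compact_imp_bounded[OF this] obtain K where
    "\<forall>y\<in>(\<lambda>z. \<bar>ln (norm (H z))\<bar>) ` cball 0 R1. norm y \<le> K"
    unfolding bounded_iff by blast
  hence K: "\<bar>ln (norm (H z))\<bar> \<le> K" if "z \<in> cball 0 R1" for z using that by fastforce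
  define B where "B = K + (\<Sum>a\<in>A. \<bar>mero_ord h a\<bar> * (2 * ln (2 * R1))) + (\<Sum>a\<in>A. \<bar>mero_ord h a\<bar> * ln R1)"
  have "nev_T r h \<le> B" if r: "1 \<le> r" "r \<le> R" "regular_radius h r" for r
  proof -
    have neA: "norm a \<noteq> r" if "a \<in> A" for a using that r(3) by (auto simp: A_def regular_radius_def)
    have "nev_m r h \<le> circle_mean r (\<lambda>z. K + (\<Sum>a\<in>A. \<bar>mero_ord h a\<bar> * \<bar>ln (norm (z - a))\<bar>))"
      unfolding nev_m_def
    proof (rule circle_mean_mono)
      fix z :: complex assume z: "norm z = r"
      have zb: "z \<notin> irregular_points h" using z r(3) by (auto simp: regular_radius_def)
      have zR: "z \<in> cball 0 R1" using z r R1' by auto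
      have za: "z \<noteq> a" if "a \<in> A" for a using neA[OF that] z by auto
      have "ln (max 1 (norm (h z))) \<le> \<bar>ln (norm (h z))\<bar>"
        using regular_radius_nonzero[OF r(3) z] by (auto simp: max_def)
      also have "ln (norm (h z)) = ln (norm (H z)) + ln (norm (\<Prod>a\<in>A. (z - a) powi zorder h a))"
        unfolding H(3)[OF zR zb] norm_mult using za finA H(2)[OF zR] by (subst ln_mult) auto
      also have "ln (norm (\<Prod>a\<in>A. (z - a) powi zorder h a)) = (\<Sum>a\<in>A. zorder h a * ln (norm (z - a)))"
        by (rule prod_powi_zorder_norm[OF finA za])
      also have "\<bar>ln (norm (H z)) + (\<Sum>a\<in>A. zorder h a * ln (norm (z - a)))\<bar> \<le>
          K + (\<Sum>a\<in>A. \<bar>zorder h a * ln (norm (z - a))\<bar>)"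
        using K[OF zR] sum_abs[of "\<lambda>a. zorder h a * ln (norm (z - a))" A] by linarith
      finally show "ln (max 1 (norm (h z))) \<le> K + (\<Sum>a\<in>A. \<bar>mero_ord h a\<bar> * \<bar>ln (norm (z - a))\<bar>)"
        by (simp add: abs_mult mero_ord_def)
    next
      show "continuous_on (sphere 0 r) (\<lambda>z. ln (max 1 (norm (h z))))"
        by (intro continuous_lnmax regular_radius_continuous r)
      show "continuous_on (sphere 0 r) (\<lambda>z. K + (\<Sum>a\<in>A. \<bar>mero_ord h a\<bar> * \<bar>ln (norm (z - a))\<bar>))"
        by (intro continuous_intros) (use neA in auto)
    qed (use r in auto)
    also have "\<dots> = K + circle_mean r (\<lambda>z. \<Sum>a\<in>A. \<bar>mero_ord h a\<bar> * \<bar>ln (norm (z - a))\<bar>)"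
      by (subst circle_mean_add) (use r neA in \<open>auto intro!: continuous_intros\<close>)
    also have "circle_mean r (\<lambda>z. \<Sum>a\<in>A. \<bar>mero_ord h a\<bar> * \<bar>ln (norm (z - a))\<bar>) =
        (\<Sum>a\<in>A. circle_mean r (\<lambda>z. \<bar>mero_ord h a\<bar> * \<bar>ln (norm (z - a))\<bar>))"
      by (rule circle_mean_sum) (use r neA finA in \<open>auto intro!: continuous_intros\<close>)
    also have "\<dots> \<le> (\<Sum>a\<in>A. \<bar>mero_ord h a\<bar> * (2 * ln (2 * R1)))"
      unfolding circle_mean_cmult
      by (intro sum_mono mult_left_mono circle_mean_abs_ln_linear_le)
         (use r R1' neA in \<open>auto simp: A_def\<close>)
    finally have nev_m: "nev_m r h \<le> K + (\<Sum>a\<in>A. \<bar>mero_ord h a\<bar> * (2 * ln (2 * R1)))" by simp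
    have "nev_N r (\<lambda>z. max 0 (- mero_ord h z)) = (\<Sum>a\<in>A. max 0 (- mero_ord h a) * log_kernel r a)"
      by (rule nev_N_eq_sum[OF finA]) (use r R1' zorder_not_irregular_points[of _ h] in \<open>auto simp: A_def mero_ord_def max_def split: if_splits\<close>)
    also have "\<dots> \<le> (\<Sum>a\<in>A. \<bar>mero_ord h a\<bar> * ln R1)"
    proof (intro sum_mono mult_mono log_kernel_nonneg)
      fix a
      have "log_kernel r a \<le> ln r" by (rule log_kernel_le[OF r(1)])
      also have "\<dots> \<le> ln R1" using r R1' by simp
      finally show "log_kernel r a \<le> ln R1" .
    qed auto
    finally show ?thesis using nev_m by (simp add: nev_T_def B_def)
  qed
  thus ?thesis by blast
qed

text \<open>
  \<open>nev_T\<close> has junk values on countably many radii, and its monotonicity elsewhere is not needed: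
  the essential supremum is monotone for free.
\<close>

definition ess_T :: "(complex \<Rightarrow> complex) \<Rightarrow> real \<Rightarrow> real" where
  "ess_T h R = Inf {c. 0 \<le> c \<and> (\<exists>B. countable B \<and> (\<forall>r. 1 \<le> r \<longrightarrow> r \<le> R \<longrightarrow> r \<notin> B \<longrightarrow> nev_T r h \<le> c))}"

lemma ess_T_le:
  assumes "countable B" "0 \<le> c" "\<And>r. 1 \<le> r \<Longrightarrow> r \<le> R \<Longrightarrow> r \<notin> B \<Longrightarrow> nev_T r h \<le> c"
  shows "ess_T h R \<le> c"
  unfolding ess_T_def by (rule cInf_lower) (use assms in \<open>auto intro!: bdd_belowI[of _ 0]\<close>)

lemma ess_T_set_nonempty:
  assumes "mero_nz h"
  shows "{c. 0 \<le> c \<and> (\<exists>B. countable B \<and> (\<forall>r. 1 \<le> r \<longrightarrow> r \<le> R \<longrightarrow> r \<notin> B \<longrightarrow> nev_T r h \<le> c))} \<noteq> {}"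
proof -
  obtain c where c: "\<forall>r. 1 \<le> r \<longrightarrow> r \<le> R \<longrightarrow> regular_radius h r \<longrightarrow> nev_T r h \<le> c" using nev_T_bounded[OF assms] by blast
  have "countable (norm ` irregular_points h)" using countable_irregular_points[OF assms] by simp
  moreover have "regular_radius h r" if "r \<notin> norm ` irregular_points h" for r using that by (auto simp: regular_radius_def)
  ultimately have "max 0 c \<in> {c. 0 \<le> c \<and> (\<exists>B. countable B \<and> (\<forall>r. 1 \<le> r \<longrightarrow> r \<le> R \<longrightarrow> r \<notin> B \<longrightarrow> nev_T r h \<le> c))}"
    using c by (auto intro!: exI[of _ "norm ` irregular_points h"] le_max_iff_disj[THEN iffD2])
  thus ?thesis by blast
qed

lemma ess_T_nonneg: "mero_nz h \<Longrightarrow> 0 \<le> ess_T h R"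
  unfolding ess_T_def by (rule cInf_greatest[OF ess_T_set_nonempty]) auto

text \<open>The infimum is attained: the exceptional sets belonging to the bounds
  \<open>ess_T h R + 1 / real (Suc n)\<close> have a countable union.\<close>

lemma ess_T_ge:
  assumes "mero_nz h"
  obtains B where "countable B" "\<And>r. 1 \<le> r \<Longrightarrow> r \<le> R \<Longrightarrow> r \<notin> B \<Longrightarrow> nev_T r h \<le> ess_T h R"
proof -
  define X where "X = {c. 0 \<le> c \<and> (\<exists>B. countable B \<and> (\<forall>r. 1 \<le> r \<longrightarrow> r \<le> R \<longrightarrow> r \<notin> B \<longrightarrow> nev_T r h \<le> c))}"
  have "\<exists>B. countable B \<and> (\<forall>r. 1 \<le> r \<longrightarrow> r \<le> R \<longrightarrow> r \<notin> B \<longrightarrow> nev_T r h \<le> ess_T h R + 1 / real (Suc n))" for n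
  proof -
    have "Inf X < ess_T h R + 1 / real (Suc n)" by (simp add: ess_T_def X_def)
    moreover have "X \<noteq> {}" "bdd_below X"
      using ess_T_set_nonempty[OF assms] by (auto simp: X_def intro!: bdd_belowI[of _ 0])
    ultimately obtain c where c: "c \<in> X" "c < ess_T h R + 1 / real (Suc n)" using cInf_less_iff by metis
    then obtain B where B: "countable B" "\<forall>r. 1 \<le> r \<longrightarrow> r \<le> R \<longrightarrow> r \<notin> B \<longrightarrow> nev_T r h \<le> c" unfolding X_def by blast
    show ?thesis by (intro exI[of _ B] conjI B(1) allI impI) (use B(2) c(2) in fastforce)
  qed
  then obtain B where B: "\<And>n. countable (B n)"
    "\<And>n r. 1 \<le> r \<Longrightarrow> r \<le> R \<Longrightarrow> r \<notin> B n \<Longrightarrow> nev_T r h \<le> ess_T h R + 1 / real (Suc n)"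
    by metis
  show ?thesis
  proof (rule that[of "\<Union>n. B n"])
    fix r assume r: "1 \<le> r" "r \<le> R" "r \<notin> (\<Union>n. B n)"
    have "(\<lambda>n. ess_T h R + 1 / real (Suc n)) \<longlonglongrightarrow> ess_T h R + 0"
      by (intro tendsto_intros LIMSEQ_Suc[OF lim_inverse_n'])
    thus "nev_T r h \<le> ess_T h R"
      by (intro LIMSEQ_le_const[of _ "ess_T h R"]) (use B(2)[OF r(1,2)] r(3) in auto)
  qed (use B(1) in auto)
qed

lemma ess_T_mono: "mero_nz h \<Longrightarrow> r \<le> R \<Longrightarrow> ess_T h r \<le> ess_T h R"
proof -
  assume h: "mero_nz h" and le: "r \<le> R"
  obtain B where B: "countable B" "\<And>r. 1 \<le> r \<Longrightarrow> r \<le> R \<Longrightarrow> r \<notin> B \<Longrightarrow> nev_T r h \<le> ess_T h R"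
    using ess_T_ge[OF h] by metis
  show ?thesis by (rule ess_T_le[OF B(1) ess_T_nonneg[OF h]]) (use B(2) le in auto)
qed

text \<open>The exceptional set of \<open>ess_T_ge\<close> depends on R. Taking rational R only
  keeps the union countable, and monotonicity extends the bound to all R.\<close>

lemma eventually_T_le_ess_T:
  assumes h: "mero_nz h"
  shows "\<forall>\<^sub>F r in radii. \<forall>R>r. nev_T r h \<le> ess_T h R"
proof -
  have "\<exists>B. countable B \<and> (\<forall>r. 1 \<le> r \<longrightarrow> r \<le> real_of_rat q \<longrightarrow> r \<notin> B \<longrightarrow> nev_T r h \<le> ess_T h (real_of_rat q))" for q
    using ess_T_ge[OF h, of "real_of_rat q"] by metis
  then obtain B where B: "\<And>q. countable (B q)"
    "\<And>q r. 1 \<le> r \<Longrightarrow> r \<le> real_of_rat q \<Longrightarrow> r \<notin> B q \<Longrightarrow> nev_T r h \<le> ess_T h (real_of_rat q)"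
    by metis
  have "nev_T r h \<le> ess_T h R" if r: "1 \<le> r" "r \<notin> (\<Union>q. B q)" "r < R" for r R
  proof -
    obtain q where q: "r < real_of_rat q" "real_of_rat q < R" using of_rat_dense[OF r(3)] by blast
    have "nev_T r h \<le> ess_T h (real_of_rat q)" using B(2)[of r q] r q by auto
    also have "\<dots> \<le> ess_T h R" using ess_T_mono[OF h] q by auto
    finally show ?thesis .
  qed
  moreover have "countable (\<Union>q. B q)" using B(1) by auto
  ultimately show ?thesis unfolding eventually_radii by blast
qed

text \<open>A Borel argument that ends in a contradiction instead of an exceptional set. Above the
  threshold, V at least doubles on a step of length 1 / V s. These lengths shrink geometrically, so
  infinitely many doublings fit into [r, r + 2], where V is at most V (r + 2).\<close>

lemma growth_lemma:
  fixes V :: "real \<Rightarrow> real"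
  assumes mono: "\<And>r s. r \<le> s \<Longrightarrow> V r \<le> V s" and nn: "\<And>r. 0 \<le> V r" and K: "1 \<le> K" and r0: "1 \<le> r0"
    and le: "\<And>r R. r0 \<le> r \<Longrightarrow> r < R \<Longrightarrow> V r \<le> K * (r + 5) ^ q + K * ln (2 + R + 1 / (R - r) + V R)"
    and r: "r0 \<le> r"
  shows "V r \<le> 2 * K * (r + 7) ^ q + 40 * K^2 + (r + 7)"
proof (rule ccontr)
  assume "\<not> ?thesis"
  hence big: "2 * K * (r + 7) ^ q + 40 * K^2 + (r + 7) < V r" by simp
  have K0: "0 < K" using K by simp
  have q0: "0 \<le> 2 * K * (r + 7) ^ q" using K r r0 by simp
  have x0: "40 * K^2 < V r" "r + 7 < V r" "2 * K * (r + 7) ^ q < V r"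
  proof -
    have "0 \<le> 40 * K^2" "0 \<le> r + 7" using r r0 by auto
    thus "40 * K^2 < V r" "r + 7 < V r" "2 * K * (r + 7) ^ q < V r" using big q0 by linarith+
  qed
  have x1: "1 \<le> V r" using x0(2) r r0 by linarith
  have step: "2 * V s \<le> V (s + 1 / V s)" if s: "r \<le> s" "s \<le> r + 2" for s
  proof -
    define x where "x = V s"
    have x: "V r \<le> x" unfolding x_def by (rule mono[OF s(1)])
    have xp: "0 < x" using x x1 by linarith
    have inv: "1 / x \<le> 1" using x x1 by (simp add: divide_le_eq)
    \<comment> \<open>With this R the term 1 / (R - s) is just V s, so the argument of the logarithm
      contains only R, V s and V R.\<close>
    define R where "R = s + 1 / x"
    have R: "s < R" "R - s = 1 / x" "R \<le> r + 3" using xp inv s unfolding R_def by (simp, simp, linarith)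
    have arg: "0 < 2 + R + x + V R" using R(1) s r r0 xp nn[of R] by linarith
    have "x \<le> K * (s + 5) ^ q + K * ln (2 + R + x + V R)"
      using le[of s R] R s r xp by (simp add: x_def[symmetric])
    moreover have "K * (s + 5) ^ q \<le> K * (r + 7) ^ q"
      using K0 s r r0 by (intro mult_left_mono power_mono) auto
    ultimately have "x / 2 \<le> K * ln (2 + R + x + V R)" using x0(3) x by linarith
    hence "x / (2 * K) \<le> ln (2 + R + x + V R)" using K0 by (simp add: field_simps)
    hence "exp (x / (2 * K)) \<le> 2 + R + x + V R" using arg by (simp add: ln_ge_iff)
    moreover have "(x / (2 * K))^2 / 2 \<le> exp (x / (2 * K))"
    proof -
      have "0 \<le> x / (2 * K)" using xp K0 by simp
      with exp_lower_Taylor_quadratic[OF this] show ?thesis by linarith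
    qed
    \<comment> \<open>The origin of 40 K^2: beyond it (x / (2 K))^2 / 2 exceeds 5 x. Of these five,
      two pay for 2 + R and one for x, which leaves V R \<ge> 2 x.\<close>
    moreover have "5 * x \<le> (x / (2 * K))^2 / 2"
    proof -
      have "40 * K^2 * x \<le> x * x" using x0(1) x xp by (intro mult_right_mono) auto
      thus ?thesis using K0 by (simp add: field_simps power2_eq_square)
    qed
    ultimately have "5 * x \<le> 2 + R + x + V R" by linarith
    moreover have "2 + R \<le> 2 * x" using R(3) x0(2) x x1 by linarith
    ultimately show ?thesis by (simp add: x_def R_def)
  qed
  define s where "s = rec_nat r (\<lambda>_ s. s + 1 / V s)"
  have s0: "s 0 = r" and sS: "s (Suc j) = s j + 1 / V (s j)" for j by (simp_all add: s_def)
  \<comment> \<open>V (s j) \<ge> 2^j bounds the j-th step by 1 / 2^j, so all steps together stay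
    within a length of 2.\<close>
  have inv: "r \<le> s j \<and> s j \<le> r + 2 - 2 / 2 ^ j \<and> 2 ^ j * V r \<le> V (s j)" for j
  proof (induction j)
    case 0
    thus ?case by (simp add: s0)
  next
    case (Suc j)
    have V1: "2 ^ j \<le> V (s j)"
    proof -
      have "2 ^ j * 1 \<le> 2 ^ j * V r" using x1 by (intro mult_left_mono) auto
      thus ?thesis using Suc.IH by linarith
    qed
    hence Vp: "0 < V (s j)" using less_le_trans[of 0 "2 ^ j" "V (s j)"] by simp
    have le2: "s j \<le> r + 2" using Suc.IH by (smt (verit) divide_nonneg_nonneg zero_le_power)
    have "1 / V (s j) \<le> 1 / 2 ^ j" using V1 by (intro divide_left_mono) (auto simp: Vp)
    hence "s (Suc j) \<le> r + 2 - 2 / 2 ^ Suc j" using Suc.IH unfolding sS by (simp add: field_simps)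
    moreover have "r \<le> s (Suc j)" using Suc.IH Vp unfolding sS by (simp add: add_increasing2)
    moreover have "2 ^ Suc j * V r \<le> V (s (Suc j))"
      using step[of "s j"] Suc.IH le2 unfolding sS by simp
    ultimately show ?case by blast
  qed
  obtain j where j: "V (r + 2) < 2 ^ j" using real_arch_pow[of 2 "V (r + 2)"] by auto
  have "2 ^ j * 1 \<le> 2 ^ j * V r" using x1 by (intro mult_left_mono) auto
  also have "\<dots> \<le> V (s j)" using inv by blast
  also have "\<dots> \<le> V (r + 2)" using inv[of j] by (intro mono) (smt (verit) divide_nonneg_nonneg zero_le_power)
  finally show False using j by simp
qed

lemma (in error_term) moderate_of_polynomial_growth:
  assumes h: "mero_nz h" and le: "\<forall>\<^sub>F r in radii. nev_T r h \<le> C * (r + 5) ^ q"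
  shows "moderate U h"
proof -
  define D where "D = \<bar>C\<bar> + 3 * real q"
  have "\<forall>\<^sub>F r in radii. \<forall>R>r. nev_T r h \<le> exp (D * error_bound U r R)"
    using le eventually_ge_radii[of 1]
  proof eventually_elim
    case (elim r)
    show ?case
    proof (intro allI impI)
      fix R assume R: "r < R"
      define x where "x = error_bound U r R"
      have x: "1 \<le> x" unfolding x_def by (rule error_bound_ge_1) (use elim R in auto)
      have "0 \<le> 1 / (R - r)" using R by simp
      hence ex: "r + 2 \<le> exp x" unfolding x_def exp_error_bound[OF elim(2) R] using R U_nonneg[of R] by linarith
      have "3 \<le> exp (2 * x)" using exp_ge_add_one_self[of "2 * x"] x by linarith
      hence "3 * (r + 2) \<le> exp (2 * x) * exp x" using ex elim by (intro mult_mono) auto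
      moreover have "r + 5 \<le> 3 * (r + 2)" using elim by simp
      ultimately have "r + 5 \<le> exp (3 * x)" by (simp add: exp_add[symmetric])
      hence "(r + 5) ^ q \<le> exp (3 * x) ^ q" using elim by (intro power_mono) auto
      also have "\<dots> = exp (3 * real q * x)" by (simp add: exp_of_nat_mult[symmetric] algebra_simps)
      finally have pq: "(r + 5) ^ q \<le> exp (3 * real q * x)" .
      have "C \<le> exp (\<bar>C\<bar> * x)"
      proof -
        have "\<bar>C\<bar> * 1 \<le> \<bar>C\<bar> * x" using x by (intro mult_left_mono) auto
        thus ?thesis using exp_ge_add_one_self[of "\<bar>C\<bar> * x"] by linarith
      qed
      hence "C * (r + 5) ^ q \<le> exp (\<bar>C\<bar> * x) * exp (3 * real q * x)"
        using pq elim by (intro mult_mono) auto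
      thus "nev_T r h \<le> exp (D * error_bound U r R)" using elim(1) by (simp add: D_def x_def exp_add[symmetric] distrib_right)
    qed
  qed
  moreover have "0 \<le> D" by (simp add: D_def)
  ultimately show ?thesis using h unfolding moderate_def by blast
qed

text \<open>For U = 0 and R = r + 1 the exponential of the error is linear in r.\<close>

lemma polynomial_growth_of_moderate:
  assumes "moderate (\<lambda>_. 0) h"
  obtains C q where "0 \<le> C" "\<forall>\<^sub>F r in radii. nev_T r h \<le> C * (r + 5) ^ q"
proof -
  obtain C where C: "0 \<le> C" "\<forall>\<^sub>F r in radii. \<forall>R>r. nev_T r h \<le> exp (C * error_bound (\<lambda>_. 0) r R)"
    using assms unfolding moderate_def by blast
  define q where "q = nat \<lceil>C\<rceil>"
  have q: "C \<le> real q" unfolding q_def by linarith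
  have "\<forall>\<^sub>F r in radii. nev_T r h \<le> 3 ^ q * (r + 5) ^ q"
    using C(2) eventually_ge_radii[of 1]
  proof eventually_elim
    case (elim r)
    interpret error_term "\<lambda>_. 0" by (rule zero_error_term)
    have "1 / (r + 1 - r) = (1 :: real)" by simp
    hence e: "exp (error_bound (\<lambda>_. 0) r (r + 1)) = 2 + (r + 1) + 1" using exp_error_bound[of r "r + 1"] elim by simp
    have "nev_T r h \<le> exp (C * error_bound (\<lambda>_. 0) r (r + 1))" using elim by simp
    also have "\<dots> \<le> exp (real q * error_bound (\<lambda>_. 0) r (r + 1))"
      using q error_bound_ge_1[of r "r + 1"] elim by (auto intro: mult_right_mono)
    also have "\<dots> = (2 + (r + 1) + 1) ^ q" by (simp only: exp_of_nat_mult e)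
    also have "\<dots> \<le> (3 * (r + 5)) ^ q" using elim by (intro power_mono) auto
    finally show ?case by (simp only: power_mult_distrib)
  qed
  thus ?thesis by (intro that[of "3 ^ q" q]) auto
qed

lemma ln_error_bound_mono:
  assumes "1 \<le> s" "s \<le> r" "r < R" "\<And>R. 0 \<le> V R"
  shows "error_bound V s R \<le> error_bound V r R"
proof -
  interpret error_term V by unfold_locales (rule assms)
  have "1 / (R - s) \<le> 1 / (R - r)" using assms by (intro divide_left_mono) auto
  hence "exp (error_bound V s R) \<le> exp (error_bound V r R)" using assms by (simp add: exp_error_bound)
  thus ?thesis by simp
qed

text \<open>
  The hypothesis has the shape that the second main theorem gives when every term not involving
  \<open>h\<close> grows polynomially. No exceptional set of radii appears in the conclusion.
\<close>

lemma polynomial_growth_of_self_bound: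
  assumes h: "mero_nz h" and K: "0 \<le> K" "0 \<le> C"
    and le: "\<forall>\<^sub>F r in radii. \<forall>R>r. nev_T r h \<le> C * (r + 5) ^ q + K * error_bound (ess_T h) r R"
  shows "\<exists>C q. \<forall>\<^sub>F r in radii. nev_T r h \<le> C * (r + 5) ^ q"
proof -
  have nn: "0 \<le> ess_T h R" for R by (rule ess_T_nonneg[OF h])
  interpret error_term "ess_T h" by unfold_locales (rule nn)
  obtain B r1 where B: "countable B" "\<And>r R. r1 \<le> r \<Longrightarrow> r \<notin> B \<Longrightarrow> r < R \<Longrightarrow>
      nev_T r h \<le> C * (r + 5) ^ q + K * error_bound (ess_T h) r R"
    using le unfolding eventually_radii by blast
  define r0 where "r0 = max 1 r1"
  obtain B0 where B0: "countable B0" "\<And>r. 1 \<le> r \<Longrightarrow> r \<le> r0 \<Longrightarrow> r \<notin> B0 \<Longrightarrow> nev_T r h \<le> ess_T h r0"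
    using ess_T_ge[OF h, of r0] by metis
  \<comment> \<open>The constant includes \<open>ess_T h r0\<close> to cover the radii below r0,
    where the hypothesis says nothing.\<close>
  define L where "L = 1 + C + K + ess_T h r0"
  have L: "1 \<le> L" using K nn[of r0] by (simp add: L_def)
  have key: "ess_T h r \<le> L * (r + 5) ^ q + L * ln (2 + R + 1 / (R - r) + ess_T h R)" if r: "r0 \<le> r" "r < R" for r R
  proof -
    have r': "1 \<le> r" "r1 \<le> r" using r by (auto simp: r0_def)
    have Ph: "1 \<le> error_bound (ess_T h) r R" by (rule error_bound_ge_1) (use r' r in auto)
    have pw: "1 \<le> (r + 5) ^ q" using r' by (intro one_le_power) auto
    have a: "ess_T h r0 * 1 \<le> ess_T h r0 * (r + 5) ^ q" using nn pw by (intro mult_left_mono) auto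
    have "ess_T h r \<le> ess_T h r0 + C * (r + 5) ^ q + K * error_bound (ess_T h) r R"
    proof (rule ess_T_le)
      show "countable (B \<union> B0)" using B(1) B0(1) by simp
      show "0 \<le> ess_T h r0 + C * (r + 5) ^ q + K * error_bound (ess_T h) r R"
        using K nn[of r0] r' Ph by simp
      fix s assume s: "1 \<le> s" "s \<le> r" "s \<notin> B \<union> B0"
      show "nev_T s h \<le> ess_T h r0 + C * (r + 5) ^ q + K * error_bound (ess_T h) r R"
      proof (cases "s \<le> r0")
        case True
        hence "nev_T s h \<le> ess_T h r0" using B0(2) s by auto
        moreover have "0 \<le> C * (r + 5) ^ q" "0 \<le> K * error_bound (ess_T h) r R" using K r' Ph by auto
        ultimately show ?thesis by linarith
      next
        case False
        hence "nev_T s h \<le> C * (s + 5) ^ q + K * error_bound (ess_T h) s R"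
          using B(2)[of s R] s r by (auto simp: r0_def)
        moreover have "C * (s + 5) ^ q \<le> C * (r + 5) ^ q"
          using K s by (intro mult_left_mono power_mono) auto
        moreover have "K * error_bound (ess_T h) s R \<le> K * error_bound (ess_T h) r R"
          using K ln_error_bound_mono[OF s(1,2) r(2) nn] by (intro mult_left_mono) auto
        ultimately show ?thesis using nn[of r0] by linarith
      qed
    qed
    also have "\<dots> \<le> (ess_T h r0 + C) * (r + 5) ^ q + K * error_bound (ess_T h) r R" using a by (simp add: algebra_simps)
    also have "\<dots> \<le> L * (r + 5) ^ q + L * error_bound (ess_T h) r R"
    proof (intro add_mono mult_right_mono)
      show "ess_T h r0 + C \<le> L" "K \<le> L" using K nn[of r0] by (auto simp: L_def)
    qed (use r' Ph in auto)
    finally show ?thesis by (simp add: error_bound_def)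
  qed
  have r01: "1 \<le> r0" by (simp add: r0_def)
  have bnd: "ess_T h r \<le> 2 * L * (r + 7) ^ q + 40 * L^2 + (r + 7)" if "r0 \<le> r" for r
    by (rule growth_lemma[OF ess_T_mono[OF h] nn L r01 key that])
  define D where "D = (2 * L + 40 * L^2 + 1) * 2 ^ (q + 1)"
  have "\<forall>\<^sub>F r in radii. nev_T r h \<le> D * (r + 5) ^ (q + 1)"
    using eventually_T_le_ess_T[OF h] eventually_ge_radii[of r0]
  proof eventually_elim
    case (elim r)
    have r: "1 \<le> r + 1" "r0 \<le> r + 1" using elim r01 by auto
    define y where "y = r + 1 + 7"
    have y: "1 \<le> y" "y \<le> 2 * (r + 5)" using r01 elim by (auto simp: y_def)
    have "nev_T r h \<le> ess_T h (r + 1)" using elim by simp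
    also have "\<dots> \<le> 2 * L * y ^ q + 40 * L^2 + y" unfolding y_def by (rule bnd[OF r(2)])
    also have "\<dots> \<le> 2 * L * y ^ (q + 1) + 40 * L^2 * y ^ (q + 1) + 1 * y ^ (q + 1)"
    proof (intro add_mono)
      show "2 * L * y ^ q \<le> 2 * L * y ^ (q + 1)" using L y by (intro mult_left_mono power_increasing) auto
      show "40 * L^2 \<le> 40 * L^2 * y ^ (q + 1)"
        using mult_left_mono[OF one_le_power[OF y(1), of "q + 1"], of "40 * L^2"] by simp
      show "y \<le> 1 * y ^ (q + 1)" using power_increasing[of 1 "q + 1" y] y by simp
    qed
    also have "\<dots> = (2 * L + 40 * L^2 + 1) * y ^ (q + 1)" by (simp only: distrib_right)
    also have "\<dots> \<le> (2 * L + 40 * L^2 + 1) * (2 * (r + 5)) ^ (q + 1)"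
      using L y by (intro mult_left_mono power_mono) auto
    also have "\<dots> = D * (r + 5) ^ (q + 1)" by (simp only: D_def power_mult_distrib mult.assoc)
    finally show ?case .
  qed
  thus ?thesis by blast
qed

section \<open>Functions with a vanishing higher derivative, and identities off sparse sets\<close>

lemma pderiv_sum': "pderiv (\<Sum>i\<in>A. f i) = (\<Sum>i\<in>A. pderiv (f i :: complex poly))"
  by (induction A rule: infinite_finite_induct) (simp_all add: pderiv_add)

lemma ex_pderiv: "\<exists>q :: complex poly. pderiv q = p"
proof -
  define q where "q = (\<Sum>i\<le>degree p. monom (coeff p i / of_nat (Suc i)) (Suc i))"
  have "pderiv q = (\<Sum>i\<le>degree p. monom (coeff p i) i)"
    unfolding q_def pderiv_sum'
    by (intro sum.cong refl) (simp add: pderiv_monom del: of_nat_Suc)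
  also have "\<dots> = p" by (rule poly_as_sum_of_monoms)
  finally show ?thesis by blast
qed

lemma poly_meromorphic: "poly p meromorphic_on (UNIV :: complex set)"
  by (intro analytic_on_imp_meromorphic_on) (auto simp: analytic_on_open intro!: holomorphic_intros)

lemma deriv_poly: "deriv (poly p) z = poly (pderiv p) (z :: complex)"
  by (rule DERIV_imp_deriv) (rule poly_DERIV)

lemma poly_of_higher_deriv_zero:
  assumes "h meromorphic_on UNIV" "\<forall>\<^sub>\<approx>z\<in>UNIV. (deriv ^^ k) h z = 0"
  shows "\<exists>p. \<forall>\<^sub>\<approx>z\<in>UNIV. h z = poly p z"
  using assms
proof (induction k arbitrary: h)
  case 0
  thus ?case by (intro exI[of _ 0]) simp
next
  case (Suc k)
  have "\<exists>p. \<forall>\<^sub>\<approx>z\<in>UNIV. deriv h z = poly p z"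
    by (rule Suc.IH) (use Suc.prems in \<open>auto intro: meromorphic_intros simp: funpow_Suc_right simp del: funpow.simps\<close>)
  then obtain p where p: "\<forall>\<^sub>\<approx>z\<in>UNIV. deriv h z = poly p z" by blast
  obtain q where q: "pderiv q = p" using ex_pderiv by blast
  have "\<forall>\<^sub>\<approx>z\<in>UNIV. deriv (\<lambda>z. h z - 1 * poly q z) z = deriv h z - 1 * deriv (poly q) z"
    by (rule deriv_diff_cmult_mero[OF Suc.prems(1) poly_meromorphic])
  with p have "\<forall>\<^sub>\<approx>z\<in>UNIV. deriv (\<lambda>z. h z - 1 * poly q z) z = 0"
    by eventually_elim (simp add: deriv_poly q)
  moreover have "(\<lambda>z. h z - 1 * poly q z) meromorphic_on UNIV"
    by (intro meromorphic_intros Suc.prems(1) poly_meromorphic)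
  ultimately obtain c where "\<forall>\<^sub>\<approx>z\<in>UNIV. h z - 1 * poly q z = c"
    using deriv_zero_imp_const by blast
  hence "\<forall>\<^sub>\<approx>z\<in>UNIV. h z = poly (q + [:c:]) z" by eventually_elim (simp add: algebra_simps)
  thus ?case by blast
qed

lemma higher_deriv_diff_mero:
  assumes "u meromorphic_on UNIV" "v meromorphic_on UNIV"
  shows "\<forall>\<^sub>\<approx>z\<in>UNIV. (deriv ^^ k) (\<lambda>z. u z - v z) z = (deriv ^^ k) u z - (deriv ^^ k) v z"
proof (induction k)
  case (Suc k)
  have "\<forall>\<^sub>\<approx>z\<in>UNIV. deriv ((deriv ^^ k) (\<lambda>z. u z - v z)) z = deriv (\<lambda>z. (deriv ^^ k) u z - (deriv ^^ k) v z) z"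
    by (rule deriv_cong_cosparse[OF Suc.IH])
  moreover have "\<forall>\<^sub>\<approx>z\<in>UNIV. deriv (\<lambda>z. (deriv ^^ k) u z - 1 * (deriv ^^ k) v z) z = deriv ((deriv ^^ k) u) z - 1 * deriv ((deriv ^^ k) v) z"
    by (rule deriv_diff_cmult_mero) (intro meromorphic_intros assms)+
  ultimately show ?case by eventually_elim simp
qed simp

text \<open>At each point such a function takes its limit, or 0 at a pole, so its values are
  determined by punctured neighbourhoods.\<close>

lemma nicely_meromorphic_eqI:
  assumes "f nicely_meromorphic_on UNIV" "g nicely_meromorphic_on UNIV" "\<forall>\<^sub>\<approx>z\<in>UNIV. f z = g z"
  shows "f = g"
proof
  fix z
  have ev: "\<forall>\<^sub>F w in at z. f w = g w"
    by (rule eventually_cosparse_imp_eventually_at[OF assms(3)]) auto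
  have R: "remove_sings h z = h z" if "h nicely_meromorphic_on UNIV" for h
  proof -
    have "is_pole h z \<and> h z = 0 \<or> h \<midarrow>z\<rightarrow> h z" using that by (auto simp: nicely_meromorphic_on_def)
    thus ?thesis by auto
  qed
  have "remove_sings f z = remove_sings g z" by (rule remove_sings_cong[OF ev refl])
  thus "f z = g z" using R assms by simp
qed

lemma infinite_zeros_imp_not_poly:
  assumes P: "P meromorphic_on UNIV" and inf: "infinite {z. 1 \<le> mero_ord P z}" and eq: "\<forall>\<^sub>\<approx>z\<in>UNIV. P z = poly p z"
  shows "p = 0"
proof (rule ccontr)
  assume p: "p \<noteq> 0"
  interpret error_term "\<lambda>_. 0" by (rule zero_error_term)
  have "finite {z. mero_ord (poly p) z \<noteq> 0}" using small_poly[OF p] by (simp add: small_function_def)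
  moreover have "{z. 1 \<le> mero_ord P z} \<subseteq> {z. mero_ord (poly p) z \<noteq> 0}" using ord_cong[OF eq] by auto
  ultimately show False using inf finite_subset by blast
qed

section \<open>L-functions\<close>

lemma has_prod_nonzero:
  fixes g :: "nat \<Rightarrow> complex"
  assumes "g has_prod p" "\<And>n. g n \<noteq> 0"
  shows "p \<noteq> 0"
  using assms unfolding has_prod_def raw_has_prod_def by auto

text \<open>Every Euler factor is an exponential or 1, and convergence of a product of nonzero
  factors means convergence to a nonzero value.\<close>

lemma L_function_nonzero:
  assumes "L_function L" "Re s > 1"
  shows "L s \<noteq> 0"
proof -
  obtain b :: "nat \<Rightarrow> complex" where "\<forall>s. Re s > 1 \<longrightarrow>
           (\<lambda>p. if prime p
                then exp (\<Sum>k. b (p ^ Suc k) * of_nat p powr (- (of_nat (Suc k) * s)))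
                else 1) has_prod L s"
    using assms(1) unfolding L_function_def by blast
  hence "(\<lambda>p. if prime p
                then exp (\<Sum>k. b (p ^ Suc k) * of_nat p powr (- (of_nat (Suc k) * s)))
                else 1) has_prod L s" using assms(2) by blast
  thus ?thesis by (rule has_prod_nonzero) auto
qed

lemma L_function_mero_nz:
  assumes "L_function L"
  shows "mero_nz L"
proof (rule mero_nz_iff_frequently)
  show "L meromorphic_on UNIV" using assms by (auto simp: L_function_def nicely_meromorphic_on_def)
  have "\<forall>\<^sub>F z in at 2. z \<in> {s. 1 < Re s} - {2}"
    by (rule eventually_at_in_open) (auto simp: open_halfspace_Re_gt)
  hence "\<forall>\<^sub>F z in at 2. L z \<noteq> 0" by eventually_elim (use L_function_nonzero[OF assms] in auto)
  thus "\<exists>\<^sub>F z in at 2. L z \<noteq> 0" by (intro eventually_frequently) auto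
qed

lemma L_function_entire:
  assumes "L_function L"
  obtains k g where "entire_of_finite_order g" "\<And>s. s \<noteq> 1 \<Longrightarrow> g s = (s - 1) ^ k * L s"
proof -
  have "\<exists>(k::nat) g. entire_of_finite_order g \<and> (\<forall>s. s \<noteq> 1 \<longrightarrow> g s = (s - 1) ^ k * L s)"
    using assms unfolding L_function_def by (elim conjE)
  then obtain k g where kg: "entire_of_finite_order g" "\<forall>s. s \<noteq> 1 \<longrightarrow> g s = (s - 1) ^ k * L s"
    by (elim exE conjE)
  show ?thesis by (rule that[of g k]) (use kg in auto)
qed

lemma L_function_analytic:
  assumes "L_function L" "z \<noteq> 1"
  shows "L analytic_on {z}"
proof -
  obtain k g where g: "entire_of_finite_order g" "\<And>s. s \<noteq> 1 \<Longrightarrow> g s = (s - 1) ^ k * L s"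
    using L_function_entire[OF assms(1)] by metis
  have "(\<lambda>s. g s / (s - 1) ^ k) holomorphic_on - {1}"
    using g(1) by (auto simp: entire_of_finite_order_def intro!: holomorphic_intros intro: holomorphic_on_subset)
  moreover have "(\<lambda>s. g s / (s - 1) ^ k) holomorphic_on - {1} \<longleftrightarrow> L holomorphic_on - {1}"
    by (rule holomorphic_cong) (use g(2) in auto)
  ultimately have "L holomorphic_on - {1}" by simp
  hence "L analytic_on - {1}" by (subst analytic_on_open) auto
  thus ?thesis by (rule analytic_on_subset) (use assms(2) in auto)
qed

lemma L_function_ord_nonneg:
  assumes "L_function L" "z \<noteq> 1"
  shows "0 \<le> mero_ord L z"
  using zorder_ge_0[OF L_function_analytic[OF assms] mero_nz_frequently[OF L_function_mero_nz[OF assms(1)]]]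
  by (simp add: mero_ord_def)

text \<open>Finite order bounds ln |g| on large circles by a power of r, and |L| \<le> |g| there
  because |s - 1| \<ge> 1. The only possible pole, at 1, adds a multiple of ln r.\<close>

lemma L_function_growth:
  assumes "L_function L"
  obtains C q where "\<forall>\<^sub>F r in radii. nev_T r L \<le> C * (r + 5) ^ q"
proof -
  obtain k g where g: "entire_of_finite_order g" "\<And>s. s \<noteq> 1 \<Longrightarrow> g s = (s - 1) ^ k * L s"
    using L_function_entire[OF assms] by metis
  obtain \<rho> :: real where "g \<in> O[at_infinity](\<lambda>s. of_real (exp (norm s powr \<rho>)))"
    using g(1) by (auto simp: entire_of_finite_order_def)
  then obtain c where c: "0 < c" "\<forall>\<^sub>F s in at_infinity. norm (g s) \<le> c * exp (norm s powr \<rho>)"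
    by (auto elim!: landau_o.bigE)
  then obtain b where b: "\<And>s. b \<le> norm s \<Longrightarrow> norm (g s) \<le> c * exp (norm s powr \<rho>)"
    by (auto simp: eventually_at_infinity)
  \<comment> \<open>At least 1, so that the same power of r + 5 also dominates the term ln r coming
    from the pole.\<close>
  define q where "q = Suc (nat \<lceil>\<rho>\<rceil>)"
  have q: "\<rho> \<le> real q" unfolding q_def by linarith
  have nz: "mero_nz L" by (rule L_function_mero_nz[OF assms])
  have fin: "finite {z. max 0 (- mero_ord L z) \<noteq> 0}"
  proof (rule finite_subset)
    show "{z. max 0 (- mero_ord L z) \<noteq> 0} \<subseteq> {1}"
    proof
      fix z assume "z \<in> {z. max 0 (- mero_ord L z) \<noteq> 0}"
      thus "z \<in> {1}" using L_function_ord_nonneg[OF assms, of z] by (cases "z = 1") auto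
    qed
  qed auto
  define d where "d = (\<Sum>z\<in>{z. max 0 (- mero_ord L z) \<noteq> 0}. \<bar>max 0 (- mero_ord L z)\<bar>)"
  have d: "0 \<le> d" unfolding d_def by (intro sum_nonneg) auto
  have mero: "L meromorphic_on UNIV" using nz by (rule mero_nz_meromorphic)
  have "\<forall>\<^sub>F r in radii. nev_T r L \<le> (ln (max 1 c) + 1 + d) * (r + 5) ^ q"
    using eventually_ge_radii[of 2] eventually_ge_radii[of b] eventually_continuous_sphere[OF mero]
  proof eventually_elim
    case (elim r)
    have pw: "r \<le> (r + 5) ^ q" "1 \<le> (r + 5) ^ q"
    proof -
      have "(r + 5) ^ 1 \<le> (r + 5) ^ q" unfolding q_def using elim by (intro power_increasing) auto
      thus "r \<le> (r + 5) ^ q" "1 \<le> (r + 5) ^ q" using elim by auto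
    qed
    have rp: "r powr \<rho> \<le> (r + 5) ^ q"
    proof -
      have "r powr \<rho> \<le> r powr real q" using q elim by (intro powr_mono) auto
      also have "\<dots> = r ^ q" using elim by (simp add: powr_realpow)
      also have "\<dots> \<le> (r + 5) ^ q" using elim by (intro power_mono) auto
      finally show ?thesis .
    qed
    have "nev_m r L \<le> circle_mean r (\<lambda>_. ln (max 1 c) + r powr \<rho>)"
      unfolding nev_m_def
    proof (rule circle_mean_mono)
      fix z :: complex assume z: "norm z = r"
      have "1 \<le> norm (z - 1)" using norm_triangle_ineq2[of z 1] z elim by simp
      hence p: "1 \<le> norm (z - 1) ^ k" by (rule one_le_power)
      have "z \<noteq> 1" using z elim by auto
      have "1 * norm (L z) \<le> norm (z - 1) ^ k * norm (L z)" using p by (intro mult_right_mono) auto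
      also have "\<dots> = norm (g z)" using g(2)[OF \<open>z \<noteq> 1\<close>] by (simp add: norm_mult norm_power)
      also have "\<dots> \<le> c * exp (r powr \<rho>)" using b[of z] z elim by simp
      finally have "ln (max 1 (norm (L z))) \<le> ln (max 1 (c * exp (r powr \<rho>)))"
        by (subst ln_le_cancel_iff) auto
      also have "\<dots> \<le> ln (max 1 c) + ln (max 1 (exp (r powr \<rho>)))"
        by (rule ln_max_mult_le) (use c(1) in auto)
      also have "max 1 (exp (r powr \<rho>)) = exp (r powr \<rho>)" by simp
      finally show "ln (max 1 (norm (L z))) \<le> ln (max 1 c) + r powr \<rho>" by simp
    qed (use elim in \<open>auto intro!: continuous_lnmax\<close>)
    hence "nev_m r L \<le> ln (max 1 c) + r powr \<rho>" by simp
    moreover have "nev_N r (\<lambda>z. max 0 (- mero_ord L z)) \<le> d * ln r"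
      unfolding d_def by (rule nev_N_finite_le[OF fin]) (use elim in auto)
    moreover have "d * ln r \<le> d * (r + 5) ^ q"
      using d pw ln_bound[of r] elim by (intro mult_left_mono) auto
    moreover have "ln (max 1 c) * 1 \<le> ln (max 1 c) * (r + 5) ^ q" using pw by (intro mult_left_mono) auto
    ultimately show ?case using rp by (simp add: nev_T_def algebra_simps)
  qed
  thus ?thesis by (rule that)
qed

section \<open>Trivial zeros\<close>

lemma mero_nz_rGamma_affine:
  assumes "l \<noteq> (0 :: complex)"
  shows "mero_nz (\<lambda>s. rGamma (l * s + v))"
proof (rule mero_nz_iff_frequently)
  have holo: "(\<lambda>s. rGamma (l * s + v)) holomorphic_on UNIV"
    by (intro holomorphic_intros)
  thus "(\<lambda>s. rGamma (l * s + v)) meromorphic_on UNIV"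
    by (intro analytic_on_imp_meromorphic_on) (simp add: analytic_on_open)
  \<comment> \<open>Here the argument of \<open>rGamma\<close> is 1.\<close>
  define s where "s = (1 - v) / l"
  have "isCont (\<lambda>s. rGamma (l * s + v)) s"
    using holomorphic_on_imp_continuous_on[OF holo] by (simp add: continuous_on_eq_continuous_at)
  hence "((\<lambda>s. rGamma (l * s + v)) \<longlongrightarrow> rGamma (l * s + v)) (at s)" by (simp add: isCont_def)
  moreover have "rGamma (l * s + v) \<noteq> 0" using assms by (simp add: s_def)
  ultimately have "\<forall>\<^sub>F s in at s. rGamma (l * s + v) \<noteq> 0" by (rule tendsto_imp_eventually_ne)
  thus "\<exists>\<^sub>F s in at s. rGamma (l * s + v) \<noteq> 0" by (intro eventually_frequently) auto
qed

text \<open>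
  The trivial zeros: at a pole of the first Gamma factor in \<open>Re s < 0\<close> the functional equation
  keeps the completed function bounded, so \<open>L\<close> has to vanish there.
\<close>

lemma L_function_infinite_zeros:
  assumes L: "L_function L"
  shows "infinite {z. 1 \<le> mero_ord L z}"
proof -
  obtain K :: nat and Q :: real and lam :: "nat \<Rightarrow> real" and v :: "nat \<Rightarrow> complex" and \<omega> :: complex where
    K: "K > 0" "Q > 0" "\<And>j. j \<in> {1..K} \<Longrightarrow> lam j > 0 \<and> Re (v j) \<ge> 0"
    and fe: "\<forall>\<^sub>\<approx>s\<in>UNIV. completed_L L K Q lam v s = \<omega> * cnj (completed_L L K Q lam v (1 - cnj s))"
  proof -
    have "\<exists>(K::nat) (Q::real) (lam :: nat \<Rightarrow> real) (v :: nat \<Rightarrow> complex) (\<omega>::complex).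
        K > 0 \<and> Q > 0 \<and> (\<forall>j\<in>{1..K}. lam j > 0 \<and> Re (v j) \<ge> 0) \<and> norm \<omega> = 1 \<and>
        (\<forall>\<^sub>\<approx>s\<in>UNIV. completed_L L K Q lam v s = \<omega> * cnj (completed_L L K Q lam v (1 - cnj s)))"
      using L unfolding L_function_def by (elim conjE)
    then obtain K :: nat and Q :: real and lam :: "nat \<Rightarrow> real" and v :: "nat \<Rightarrow> complex" and \<omega> :: complex where
      "K > 0" "Q > 0" "\<forall>j\<in>{1..K}. lam j > 0 \<and> Re (v j) \<ge> 0"
      "\<forall>\<^sub>\<approx>s\<in>UNIV. completed_L L K Q lam v s = \<omega> * cnj (completed_L L K Q lam v (1 - cnj s))"
      by (elim exE conjE)
    thus ?thesis by (intro that[of K Q lam v \<omega>]) auto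
  qed
  have l1: "lam 1 > 0" "Re (v 1) \<ge> 0" using K(1,3) by auto
  \<comment> \<open>The point where the argument of the first Gamma factor is -M. Taking M \<ge> 1
    puts it strictly into the left half-plane even if Re (v 1) = 0.\<close>
  define s where "s = (\<lambda>M::nat. - (v 1 + of_nat M) / of_real (lam 1))"
  have Re_s: "Re (s M) < 0" if "M \<ge> 1" for M using l1 that by (simp add: s_def divide_neg_pos)
  have zero: "1 \<le> mero_ord L (s M)" if M: "M \<ge> 1" for M
  proof -
    define z where "z = s M"
    have z: "Re z < 0" "z \<noteq> 1" using Re_s[OF M] by (auto simp: z_def)
    define \<Lambda> where "\<Lambda> = completed_L L K Q lam v"
    have "isCont \<Lambda> (1 - cnj z)"
    proof -
      have "isCont L (1 - cnj z)"
        by (intro analytic_at_imp_isCont L_function_analytic[OF L]) (use z in \<open>auto simp: complex_eq_iff\<close>)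
      \<comment> \<open>The reflected point has real part greater than 1, so all Gamma arguments
        have positive real part and stay away from the poles.\<close>
      moreover have "of_real (lam j) * (1 - cnj z) + v j \<notin> \<int>\<^sub>\<le>\<^sub>0" if "j \<in> {1..K}" for j
      proof
        assume "of_real (lam j) * (1 - cnj z) + v j \<in> \<int>\<^sub>\<le>\<^sub>0"
        then obtain n where n: "of_real (lam j) * (1 - cnj z) + v j = of_int n" "n \<le> 0"
          by (elim nonpos_Ints_cases)
        from arg_cong[OF n(1), of Re] have "lam j * (1 - Re z) + Re (v j) = of_int n" by simp
        moreover have "0 < lam j * (1 - Re z)" using K(3)[OF that] z by simp
        moreover have "real_of_int n \<le> 0" using n(2) by simp
        ultimately show False using K(3)[OF that] by simp
      qed
      ultimately show ?thesis unfolding \<Lambda>_def completed_L_def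
        by (intro continuous_intros) (use K(2) in auto)
    qed
    moreover have "((\<lambda>s. 1 - cnj s) \<longlongrightarrow> 1 - cnj z) (at z)" by (intro tendsto_intros)
    ultimately have "((\<lambda>s. \<Lambda> (1 - cnj s)) \<longlongrightarrow> \<Lambda> (1 - cnj z)) (at z)"
      by (rule isCont_tendsto_compose)
    hence R: "((\<lambda>s. \<omega> * cnj (\<Lambda> (1 - cnj s))) \<longlongrightarrow> \<omega> * cnj (\<Lambda> (1 - cnj z))) (at z)"
      by (intro tendsto_intros)
    \<comment> \<open>Reciprocal Gamma factors are entire. Multiplying the functional equation by W
      isolates L, and the limit at z can be taken although Gamma factors have poles there.\<close>
    define W where "W = (\<lambda>s. of_real Q powr (- s) * (\<Prod>j=1..K. rGamma (of_real (lam j) * s + v j)))"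
    have "isCont W z" unfolding W_def by (intro continuous_intros) (use K(2) in auto)
    hence W: "(W \<longlongrightarrow> W z) (at z)" by (simp add: isCont_def)
    have "of_real (lam 1) * z + v 1 = - of_nat M" using l1 by (simp add: z_def s_def field_simps)
    hence "rGamma (of_real (lam 1) * z + v 1) = 0" by (simp add: rGamma_eq_zero_iff)
    hence W0: "W z = 0" unfolding W_def using K(1) by (auto intro!: bexI[of _ 1])
    have nzG: "\<forall>\<^sub>F s in at z. \<forall>j\<in>{1..K}. rGamma (of_real (lam j) * s + v j) \<noteq> 0"
    proof (intro eventually_ball_finite ballI)
      fix j assume "j \<in> {1..K}"
      hence "complex_of_real (lam j) \<noteq> 0" using K(3)[of j] by auto
      thus "\<forall>\<^sub>F s in at z. rGamma (of_real (lam j) * s + v j) \<noteq> 0"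
        by (intro mero_nz_eventually mero_nz_rGamma_affine)
    qed auto
    have "\<forall>\<^sub>F s in at z. completed_L L K Q lam v s = \<omega> * cnj (completed_L L K Q lam v (1 - cnj s))"
      by (rule eventually_cosparse_imp_eventually_at[OF fe]) auto
    with nzG have "\<forall>\<^sub>F s in at z. L s = \<omega> * cnj (\<Lambda> (1 - cnj s)) * W s"
    proof eventually_elim
      case (elim s)
      have Qs: "of_real Q powr s * of_real Q powr (- s) = (1 :: complex)"
        using K(2) by (simp add: powr_minus field_simps)
      have "(\<Prod>j=1..K. Gamma (of_real (lam j) * s + v j)) * (\<Prod>j=1..K. rGamma (of_real (lam j) * s + v j)) = 1"
        unfolding prod.distrib[symmetric]
        by (intro prod.neutral ballI) (use elim(1) in \<open>auto simp: rGamma_inverse_Gamma\<close>)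
      hence "completed_L L K Q lam v s * W s = L s"
        unfolding completed_L_def W_def using Qs by (simp add: algebra_simps)
      thus ?case using elim(2) by (simp add: \<Lambda>_def)
    qed
    moreover have "((\<lambda>s. \<omega> * cnj (\<Lambda> (1 - cnj s)) * W s) \<longlongrightarrow> \<omega> * cnj (\<Lambda> (1 - cnj z)) * W z) (at z)"
      by (intro tendsto_mult R W)
    ultimately have "(L \<longlongrightarrow> 0) (at z)" using W0 tendsto_cong[of L] by auto
    hence "isolated_zero L z" using mero_nz_eventually[OF L_function_mero_nz[OF L], of z] by (simp add: isolated_zero_def)
    hence "0 < zorder L z" using L_function_analytic[OF L z(2)] by (rule zorder_isolated_zero_pos)
    thus ?thesis by (simp add: mero_ord_def z_def)
  qed
  have "inj_on s {1..}" using l1 by (auto simp: inj_on_def s_def)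
  hence "infinite (s ` {1..})" by (simp add: finite_image_iff infinite_Ici)
  moreover have "s ` {1..} \<subseteq> {z. 1 \<le> mero_ord L z}" using zero by auto
  ultimately show ?thesis using finite_subset by blast
qed

section \<open>Sharing with an L-function\<close>

lemma ord_of_const_ae: "\<forall>\<^sub>\<approx>z\<in>UNIV. h z = c \<Longrightarrow> c \<noteq> 0 \<Longrightarrow> mero_ord h z = 0"
  using ord_cong[of h "\<lambda>_. c"] by (simp add: ord_const)

text \<open>Serves to exclude a constant F: sharing would then leave G without 1-points off a finite
  set, and in \<open>milloux\<close> only the distinct zeros of L remain, each with weight k +
  1.\<close>

lemma (in error_term) no_one_points:
  assumes SG: "quotient_setting n k \<eta> L G" and E: "finite E"
    and EE: "\<And>z. z \<notin> E \<Longrightarrow> mero_ord \<eta> z = 0" "\<And>z. z \<notin> E \<Longrightarrow> 0 \<le> mero_ord L z" "\<And>z. z \<notin> E \<Longrightarrow> mero_ord (\<lambda>z. G z - 1) z \<le> 0"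
    and n: "k + 1 < n"
  shows "le_err U (\<lambda>r. nev_T r L) (\<lambda>_. 0)"
proof -
  note g = quotient_setting_facts[OF SG]
  have key: "real n * max 0 (mero_ord L z) + mero_ord (\<lambda>z. G z - 1) z - mero_ord (deriv G) z \<le> (real k + 1) * of_bool (1 \<le> mero_ord L z)"
    if z: "z \<notin> E" for z
  proof -
    have lo: "local_orders (mero_ord G z) (mero_ord (\<lambda>z. G z - 1) z) (mero_ord (deriv G) z)"
      by (intro local_orders g) simp
    show ?thesis unfolding mult_max_ord
      using quotient_setting_orders[OF SG EE(1)[OF z]] EE(2,3)[OF z] lo unfolding local_orders_def by auto
  qed
  have "le_err U (\<lambda>r. real n * nev_T r L) (\<lambda>r. nev_N r (\<lambda>z. (real k + 1) * of_bool (1 \<le> mero_ord L z)))"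
    by (rule le_err_trans[OF milloux[OF SG, of 1]], simp, rule le_err_N_mono[OF _ _ E key])
       (intro loc_fin_intros g | assumption)+
  hence "le_err U (\<lambda>r. real n * nev_T r L) (\<lambda>r. (real k + 1) * nev_N r (\<lambda>z. of_bool (1 \<le> mero_ord L z)))"
    by (simp add: nev_N_cmult)
  moreover have "le_err U (\<lambda>r. (real k + 1) * nev_N r (\<lambda>z. of_bool (1 \<le> mero_ord L z))) (\<lambda>r. (real k + 1) * nev_T r L)"
    by (rule le_err_cmult[OF le_err_N_zero_ind[OF g(1)]]) simp
  ultimately have "le_err U (\<lambda>r. real n * nev_T r L) (\<lambda>r. (real k + 1) * nev_T r L)" by (rule le_err_trans)
  hence "le_err U (\<lambda>r. (real n - real k - 1) * nev_T r L) (\<lambda>_. 0)"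
    by (subst (asm) le_err_move) (simp add: algebra_simps)
  from le_err_cmult[OF this, of "1 / (real n - real k - 1)"] show ?thesis using n by simp
qed

text \<open>A one-sided inequality, valid for every majorant U for which f is moderate, so that it
  can be used before the growth of f is known. The 1-points of F are counted as zeros of G -
  1.\<close>

lemma (in error_term) second_main_for_shared:
  assumes SF: "quotient_setting n k \<eta> f F" and G1: "mero_nz (\<lambda>z. G z - 1)" and E: "finite E"
    and EE: "\<And>z. z \<notin> E \<Longrightarrow> mero_ord \<eta> z = 0"
      "\<And>z. z \<notin> E \<Longrightarrow> 1 \<le> mero_ord (\<lambda>z. F z - 1) z \<Longrightarrow> 1 \<le> mero_ord (\<lambda>z. G z - 1) z"
  shows "le_err U (\<lambda>r. (real n - real k - 2) * nev_T r f) (\<lambda>r. nev_T r (\<lambda>z. G z - 1))"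
proof -
  note f = quotient_setting_facts[OF SF]
  have key: "real n * max 0 (mero_ord f z) + mero_ord (\<lambda>z. F z - 1) z - mero_ord (deriv F) z \<le>
       (real k + 1) * of_bool (1 \<le> mero_ord f z) + 1 * of_bool (mero_ord f z \<le> -1) + 1 * max 0 (mero_ord (\<lambda>z. G z - 1) z) + 0"
    if z: "z \<notin> E" for z
  proof -
    have lo: "local_orders (mero_ord F z) (mero_ord (\<lambda>z. F z - 1) z) (mero_ord (deriv F) z)"
      by (intro local_orders f) simp
    show ?thesis unfolding mult_max_ord
      using quotient_setting_orders[OF SF EE(1)[OF z]] EE(2)[OF z] lo unfolding local_orders_def by auto
  qed
  have lf0: "loc_fin (\<lambda>_. 0)" by (simp add: loc_fin_def)
  have N0: "le_err U (\<lambda>r. nev_N r (\<lambda>_. 0)) (\<lambda>_. 0)" by (rule le_errI) (simp add: nev_N_def)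
  have "le_err U (\<lambda>r. real n * nev_T r f) (\<lambda>r. (real k + 1) * nev_T r f + 1 * nev_T r f + 1 * nev_T r (\<lambda>z. G z - 1))"
  proof (rule le_err_trans[OF milloux[OF SF, of 1]], simp, rule le_err_trans[OF le_err_N_mono[OF _ _ E key]])
    show "le_err U (\<lambda>r. nev_N r (\<lambda>z. (real k + 1) * of_bool (1 \<le> mero_ord f z) + 1 * of_bool (mero_ord f z \<le> -1) +
        1 * max 0 (mero_ord (\<lambda>z. G z - 1) z) + 0)) (\<lambda>r. (real k + 1) * nev_T r f + 1 * nev_T r f + 1 * nev_T r (\<lambda>z. G z - 1))"
      by (rule le_err_N_sum3[OF f(1) f(1) G1 lf0 N0])
         (auto intro!: loc_fin_intros f G1 le_err_N_zero_ind le_err_N_pole_ind le_err_N_pos_ord)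
  qed (intro loc_fin_intros lf0 f G1 | assumption)+
  thus ?thesis by (subst le_err_move, subst (asm) le_err_move) (simp add: algebra_simps)
qed

text \<open>The bootstrap. For U = \<open>ess_T f\<close> the function f is moderate by
  construction, since T(r, f) \<le> U R \<le> exp of the error. The shared 1-points number at most
  T(r, G - 1) up to the error, which grows polynomially, so
  \<open>polynomial_growth_of_self_bound\<close> applies.\<close>

lemma moderate_of_sharing:
  assumes f: "mero_nz f" and L: "moderate (\<lambda>_. 0) L" and p: "p \<noteq> 0" and n: "k + 2 < n"
    and Fd: "F = (\<lambda>z. (deriv ^^ k) (\<lambda>w. f w ^ n) z / poly p z)" and F: "mero_nz ((deriv ^^ k) (\<lambda>w. f w ^ n))" "mero_nz (deriv F)"
    and G: "moderate (\<lambda>_. 0) (\<lambda>z. G z - 1)"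
    and E: "finite E" "\<And>z. z \<notin> E \<Longrightarrow> mero_ord (poly p) z = 0"
      "\<And>z. z \<notin> E \<Longrightarrow> 1 \<le> mero_ord (\<lambda>z. F z - 1) z \<Longrightarrow> 1 \<le> mero_ord (\<lambda>z. G z - 1) z"
  shows "moderate (\<lambda>_. 0) f"
proof -
  interpret e: error_term "ess_T f" by unfold_locales (rule ess_T_nonneg[OF f])
  have "moderate (ess_T f) f"
    unfolding moderate_def
  proof (intro conjI f exI[of _ 1])
    show "\<forall>\<^sub>F r in radii. \<forall>R>r. nev_T r f \<le> exp (1 * error_bound (ess_T f) r R)"
      using eventually_T_le_ess_T[OF f] eventually_ge_radii[of 1]
    proof eventually_elim
      case (elim r)
      show ?case
      proof (intro allI impI)
        fix R assume R: "r < R"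
        have "0 \<le> 1 / (R - r)" using R by simp
        moreover have "nev_T r f \<le> ess_T f R" using elim(1) R by simp
        ultimately have "nev_T r f \<le> exp (error_bound (ess_T f) r R)"
          unfolding e.exp_error_bound[OF elim(2) R] using elim(2) R by linarith
        thus "nev_T r f \<le> exp (1 * error_bound (ess_T f) r R)" by simp
      qed
    qed
  qed auto
  hence "e.quotient_setting n k (poly p) f F"
    unfolding e.quotient_setting_def using e.small_poly[OF p] n Fd F by simp
  from e.second_main_for_shared[OF this error_term.moderate_mero_nz[OF zero_error_term G] E]
  obtain K where K: "0 \<le> K" "\<forall>\<^sub>F r in radii. \<forall>R>r. (real n - real k - 2) * nev_T r f \<le> nev_T r (\<lambda>z. G z - 1) + K * error_bound (ess_T f) r R"
    unfolding le_err_def by blast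
  obtain C q where C: "0 \<le> C" "\<forall>\<^sub>F r in radii. nev_T r (\<lambda>z. G z - 1) \<le> C * (r + 5) ^ q"
    using polynomial_growth_of_moderate[OF G] by metis
  have "\<forall>\<^sub>F r in radii. \<forall>R>r. nev_T r f \<le> C * (r + 5) ^ q + K * error_bound (ess_T f) r R"
    using K(2) C(2) eventually_T_nonneg[OF f]
  proof eventually_elim
    case (elim r)
    \<comment> \<open>k + 2 < n holds between integers, so the coefficient is at least 1.\<close>
    have "1 * nev_T r f \<le> (real n - real k - 2) * nev_T r f" using n elim(3) by (intro mult_right_mono) auto
    thus ?case using elim(1,2) by fastforce
  qed
  then obtain C' q' where "\<forall>\<^sub>F r in radii. nev_T r f \<le> C' * (r + 5) ^ q'"
    using polynomial_growth_of_self_bound[OF f K(1) C(1)] by blast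
  from error_term.moderate_of_polynomial_growth[OF zero_error_term f this] show ?thesis .
qed

text \<open>W = f / L satisfies W^n = 1, and differentiating this gives W' = 0.\<close>

lemma unity_of_power_eq:
  assumes f: "f meromorphic_on UNIV" and L: "mero_nz L" and n: "0 < n"
    and eq: "\<forall>\<^sub>\<approx>z\<in>UNIV. f z ^ n = L z ^ n"
  shows "\<exists>t. t ^ n = 1 \<and> (\<forall>\<^sub>\<approx>z\<in>UNIV. f z = t * L z)"
proof -
  define W where "W = (\<lambda>z. f z / L z)"
  have nzL: "\<forall>\<^sub>\<approx>z\<in>UNIV. L z \<noteq> 0" using L by (simp add: mero_nz_def)
  have W: "W meromorphic_on UNIV" unfolding W_def by (intro meromorphic_intros f mero_nz_meromorphic L)
  have Wn: "\<forall>\<^sub>\<approx>z\<in>UNIV. W z ^ n = 1"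
    using eq nzL by eventually_elim (simp add: W_def power_divide)
  have "\<forall>\<^sub>\<approx>z\<in>UNIV. deriv (\<lambda>z. W z ^ n) z = deriv (\<lambda>_. 1) z"
    by (rule deriv_cong_cosparse) (use Wn in simp)
  with Wn meromorphic_on_imp_analytic_cosparse[OF W] have "\<forall>\<^sub>\<approx>z\<in>UNIV. deriv W z = 0"
  proof eventually_elim
    case (elim z)
    have "(W has_field_derivative deriv W z) (at z)"
      using elim by (simp add: DERIV_deriv_iff_field_differentiable analytic_on_imp_differentiable_at)
    hence "((\<lambda>z. W z ^ n) has_field_derivative of_nat n * W z ^ (n - 1) * deriv W z) (at z)"
      by (auto intro!: derivative_eq_intros)
    hence "of_nat n * W z ^ (n - 1) * deriv W z = 0" using elim by (simp add: DERIV_imp_deriv)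
    moreover have "W z \<noteq> 0" using elim(1) n by (auto simp: power_0_left)
    ultimately show ?case using n by simp
  qed
  from deriv_zero_imp_const[OF W this] obtain t where t: "\<forall>\<^sub>\<approx>z\<in>UNIV. W z = t" by blast
  have "\<forall>\<^sub>\<approx>z\<in>(UNIV :: complex set). t ^ n = 1" using t Wn by eventually_elim simp
  hence "t ^ n = 1" by (cases "t ^ n = 1") (auto simp: eventually_False)
  moreover have "\<forall>\<^sub>\<approx>z\<in>UNIV. f z = t * L z" using t nzL by eventually_elim (auto simp: W_def)
  ultimately show ?thesis by blast
qed

text \<open>With F = L^n / p one has F + 1 = f^n / p, so off a finite set the (-1)-points of F are
  zeros of f. Hence n T(L) \<le> T(L) + T(f), while T(f) \<le> T(L) because f has finitely many
  poles, both up to the error. For n > 2 this makes T(L) negligible.\<close>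

lemma power_diff_not_poly:
  assumes f: "mero_nz f" and L: "moderate (\<lambda>_. 0) L" and n: "2 < n" and p: "p \<noteq> 0"
    and inf: "infinite {z. 1 \<le> mero_ord L z}" and E: "finite E" "\<And>z. z \<notin> E \<Longrightarrow> 0 \<le> mero_ord L z"
    and eq: "\<forall>\<^sub>\<approx>z\<in>UNIV. f z ^ n - L z ^ n = poly p z"
  shows False
proof -
  interpret error_term "\<lambda>_. 0" by (rule zero_error_term)
  have nzL: "mero_nz L" by (rule moderate_mero_nz[OF L])
  have sm: "small_function (poly p)" by (rule small_poly[OF p])
  hence pn: "mero_nz (poly p)" "finite {z. mero_ord (poly p) z \<noteq> 0}" by (auto simp: small_function_def)
  define P where "P = (\<lambda>z. L z ^ n)"
  have P: "mero_nz P" unfolding P_def by (rule mero_nz_power[OF nzL])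
  define F where "F = (\<lambda>z. P z / poly p z)"
  have F: "mero_nz F" unfolding F_def by (rule mero_nz_divide[OF P pn(1)])
  have infP: "infinite {z. 1 \<le> mero_ord P z}"
  proof
    assume "finite {z. 1 \<le> mero_ord P z}"
    moreover have "1 \<le> mero_ord P z" if "1 \<le> mero_ord L z" for z
    proof -
      have "1 * 1 \<le> real n * mero_ord L z" using that n by (intro mult_mono) auto
      thus ?thesis by (simp add: P_def ord_power[OF nzL])
    qed
    ultimately show False using inf finite_subset[of "{z. 1 \<le> mero_ord L z}" "{z. 1 \<le> mero_ord P z}"] by auto
  qed
  \<comment> \<open>If F were constant, L^n would be a polynomial in spite of its infinitely many
    zeros.\<close>
  have F': "mero_nz (deriv F)"
  proof (rule ccontr)
    assume "\<not> mero_nz (deriv F)"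
    moreover have "deriv F meromorphic_on UNIV" by (intro meromorphic_intros mero_nz_meromorphic F)
    ultimately have "\<forall>\<^sub>\<approx>z\<in>UNIV. deriv F z = 0" using mero_nz_or_0 by blast
    then obtain c where "\<forall>\<^sub>\<approx>z\<in>UNIV. F z = c" using deriv_zero_imp_const mero_nz_meromorphic[OF F] by blast
    moreover have "\<forall>\<^sub>\<approx>z\<in>UNIV. poly p z \<noteq> 0" using pn by (simp add: mero_nz_def)
    ultimately have "\<forall>\<^sub>\<approx>z\<in>UNIV. P z = poly (smult c p) z"
      by eventually_elim (auto simp: F_def field_simps)
    from infinite_zeros_imp_not_poly[OF mero_nz_meromorphic[OF P] infP this] have "smult c p = 0" .
    with \<open>\<forall>\<^sub>\<approx>z\<in>UNIV. P z = poly (smult c p) z\<close> show False using mero_nz_imp_not_zero[OF P] by simp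
  qed
  have S: "quotient_setting n 0 (poly p) L F"
    unfolding quotient_setting_def using L sm n F' P by (simp add: F_def P_def)
  have Fc: "mero_nz (\<lambda>z. F z - (-1))" by (rule quotient_setting_facts(3)[OF S])
  have "\<forall>\<^sub>\<approx>z\<in>UNIV. poly p z \<noteq> 0" using pn by (simp add: mero_nz_def)
  with eq have fp: "\<forall>\<^sub>\<approx>z\<in>UNIV. f z ^ n / poly p z = F z - (-1)"
    by eventually_elim (simp add: F_def P_def field_simps)
  define E' where "E' = E \<union> {z. mero_ord (poly p) z \<noteq> 0}"
  have E': "finite E'" using E pn by (simp add: E'_def)
  have ofc: "mero_ord (\<lambda>z. F z - (-1)) z = real n * mero_ord f z" if "z \<notin> E'" for z
    using ord_cong[OF fp, of z] ord_divide[OF mero_nz_power[OF f] pn(1), of n z] ord_power[OF f, of n z] that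
    by (simp add: E'_def)
  have key: "real n * max 0 (mero_ord L z) + mero_ord (\<lambda>z. F z - (-1)) z - mero_ord (deriv F) z \<le>
     1 * of_bool (1 \<le> mero_ord L z) + 1 * of_bool (1 \<le> mero_ord f z) + 0 * of_bool (1 \<le> mero_ord f z) + 0" if z: "z \<notin> E'" for z
  proof -
    have lo: "local_orders (mero_ord F z) (mero_ord (\<lambda>z. F z - (-1)) z) (mero_ord (deriv F) z)"
      by (rule local_orders[OF F Fc F']) simp
    have "1 \<le> mero_ord f z" if "1 \<le> mero_ord (\<lambda>z. F z - (-1)) z"
    proof -
      have "0 < real n * mero_ord f z" using that ofc[OF z] by simp
      hence "0 < mero_ord f z" by (simp add: zero_less_mult_iff)
      thus ?thesis using ord_int_cases[of f z] by linarith
    qed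
    thus ?thesis unfolding mult_max_ord
      using quotient_setting_orders[OF S, of z] E(2)[of z] z lo unfolding local_orders_def E'_def by auto
  qed
  have lf0: "loc_fin (\<lambda>_. 0)" by (simp add: loc_fin_def)
  have N0: "le_err (\<lambda>_. 0) (\<lambda>r. nev_N r (\<lambda>_. 0)) (\<lambda>_. 0)" by (rule le_errI) (simp add: nev_N_def)
  have 1: "le_err (\<lambda>_. 0) (\<lambda>r. real n * nev_T r L) (\<lambda>r. 1 * nev_T r L + 1 * nev_T r f + 0 * nev_T r f)"
  proof (rule le_err_trans[OF milloux[OF S, of "-1"]], simp, rule le_err_trans[OF le_err_N_mono[OF _ _ E' key]])
    show "le_err (\<lambda>_. 0) (\<lambda>r. nev_N r (\<lambda>z. 1 * of_bool (1 \<le> mero_ord L z) + 1 * of_bool (1 \<le> mero_ord f z) + 0 * of_bool (1 \<le> mero_ord f z) + 0))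
       (\<lambda>r. 1 * nev_T r L + 1 * nev_T r f + 0 * nev_T r f)"
      by (rule le_err_N_sum3[OF nzL f f lf0 N0]) (auto intro!: loc_fin_intros f nzL le_err_N_zero_ind)
  qed (intro loc_fin_intros lf0 f nzL Fc F' | assumption)+
  have 2: "le_err (\<lambda>_. 0) (\<lambda>r. real n * nev_T r f) (\<lambda>r. real n * nev_T r L)"
  proof -
    have "\<forall>\<^sub>\<approx>z\<in>UNIV. f z ^ n = P z + poly p z" using eq by eventually_elim (simp add: P_def algebra_simps)
    from eventually_m_cong[OF this] eventually_m_add[OF mero_nz_meromorphic[OF P] mero_nz_meromorphic[OF pn(1)]]
      eventually_m_nonneg[OF mero_nz_meromorphic[OF f]]
    have "\<forall>\<^sub>F r in radii. real n * nev_T r f \<le> (nev_m r P + nev_m r (poly p) + real n * nev_N r (\<lambda>z. max 0 (- mero_ord f z))) + ln 2"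
      by eventually_elim (simp add: nev_T_def nev_m_power algebra_simps)
    hence "le_err (\<lambda>_. 0) (\<lambda>r. real n * nev_T r f) (\<lambda>r. nev_m r P + nev_m r (poly p) + real n * nev_N r (\<lambda>z. max 0 (- mero_ord f z)))"
      by (rule le_errI_const)
    moreover have "le_err (\<lambda>_. 0) (\<lambda>r. nev_m r P + nev_m r (poly p) + real n * nev_N r (\<lambda>z. max 0 (- mero_ord f z))) (\<lambda>r. real n * nev_T r L + 0 + real n * 0)"
    proof (intro le_err_add le_err_cmult)
      show "le_err (\<lambda>_. 0) (\<lambda>r. nev_m r P) (\<lambda>r. real n * nev_T r L)"
        by (rule le_errI) (simp add: P_def nev_m_power nev_T_def nev_N_neg_part_nonneg algebra_simps)
      show "le_err (\<lambda>_. 0) (\<lambda>r. nev_m r (poly p)) (\<lambda>_. 0)" by (rule le_err_m_poly)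
      \<comment> \<open>A pole of f off E' would be a pole of F + 1, hence of F and of L.\<close>
      have nnf: "0 \<le> mero_ord f z" if z: "z \<notin> E'" for z
      proof -
        have G0: "0 \<le> mero_ord F z" using quotient_setting_orders[OF S, of z] E(2)[of z] z by (auto simp: E'_def)
        hence "0 \<le> mero_ord (\<lambda>z. F z - (-1)) z" by (intro ord_diff_const(3)[OF F Fc]) auto
        thus ?thesis using ofc[OF z] n by (simp add: zero_le_mult_iff)
      qed
      have "z \<in> E'" if "max 0 (- mero_ord f z) \<noteq> 0" for z
        using that nnf[of z] by (cases "z \<in> E'") auto
      hence "{z. max 0 (- mero_ord f z) \<noteq> 0} \<subseteq> E'" by blast
      thus "le_err (\<lambda>_. 0) (\<lambda>r. nev_N r (\<lambda>z. max 0 (- mero_ord f z))) (\<lambda>_. 0)"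
        by (intro le_err_N_finite) (rule finite_subset[OF _ E'])
    qed auto
    ultimately show ?thesis using le_err_trans by simp
  qed
  have 3: "le_err (\<lambda>_. 0) (\<lambda>r. (real n - 1) * nev_T r L) (\<lambda>r. 1 * nev_T r f)"
    using 1 by (subst le_err_move, subst (asm) le_err_move) (simp add: algebra_simps)
  have "le_err (\<lambda>_. 0) (\<lambda>r. nev_T r L) (\<lambda>_. 0)"
    by (rule le_err_cross[OF 2 3]) (use n in \<open>auto simp: algebra_simps\<close>)
  thus False using zeros_not_negligible[OF nzL inf] by simp
qed

section \<open>Weighted sharing in terms of orders\<close>

lemma share_zeros_orders:
  assumes sh: "share g1 g2 (Some 0) l" and g: "mero_nz g1" "mero_nz g2" and w: "enat w \<le> l"
  shows "max 0 (mero_ord g1 z) = max 0 (mero_ord g2 z) \<or> real w < mero_ord g1 z \<and> real w < mero_ord g2 z"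
proof -
  have pm: "point_mult (Some 0) h z = enat (nat (zorder h z))" if "mero_nz h" for h
  proof -
    have "\<not> (\<forall>\<^sub>F w in at z. h w = 0)" using mero_nz_frequently[OF that, of z] by (simp add: frequently_def)
    thus ?thesis by (simp add: point_mult_def)
  qed
  define q1 q2 where "q1 = nat (zorder g1 z)" and "q2 = nat (zorder g2 z)"
  have "(if enat q1 \<le> l then enat q1 else l + 1) = (if enat q2 \<le> l then enat q2 else l + 1)"
    using fun_cong[OF sh[unfolded share_def], of z] unfolding E_set_def pm[OF g(1)] pm[OF g(2)]
    by (simp only: q1_def q2_def Let_def)
  \<comment> \<open>Equal truncated multiplicities are equal multiplicities, unless both exceed l
    and hence w. For infinite l nothing is truncated.\<close>
  hence "q1 = q2 \<or> (w < q1 \<and> w < q2)"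
  proof (cases l)
    case (enat l')
    thus ?thesis using w \<open>(if enat q1 \<le> l then enat q1 else l + 1) = (if enat q2 \<le> l then enat q2 else l + 1)\<close>
      by (auto simp: one_enat_def split: if_splits)
  qed (auto split: if_splits)
  thus ?thesis
  proof
    assume "q1 = q2"
    hence "max 0 (zorder g1 z) = max 0 (zorder g2 z)" unfolding q1_def q2_def by linarith
    hence "real_of_int (max 0 (zorder g1 z)) = real_of_int (max 0 (zorder g2 z))" by simp
    thus ?thesis by (simp add: mero_ord_def of_int_max)
  next
    assume "w < q1 \<and> w < q2"
    hence "int w < zorder g1 z" "int w < zorder g2 z" unfolding q1_def q2_def by linarith+
    hence "real_of_int (int w) < real_of_int (zorder g1 z)" "real_of_int (int w) < real_of_int (zorder g2 z)"
      by (simp_all only: of_int_less_iff)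
    thus ?thesis by (simp add: mero_ord_def)
  qed
qed

text \<open>An identically vanishing function has infinite multiplicity everywhere, truncated to a
  positive value, whereas the other function has multiplicity 0 at some point.\<close>

lemma share_zeros_mero_nz:
  assumes sh: "share g1 g2 (Some 0) l" and g: "g1 meromorphic_on UNIV" "mero_nz g2"
  shows "mero_nz g1"
proof (rule ccontr)
  assume "\<not> mero_nz g1"
  hence z1: "\<forall>\<^sub>\<approx>z\<in>UNIV. g1 z = 0" using mero_nz_or_0[OF g(1)] by blast
  obtain z where z: "z \<notin> irregular_points g2"
  proof -
    have "countable (irregular_points g2)" by (rule countable_irregular_points[OF g(2)])
    thus ?thesis using that uncountable_UNIV_complex by (metis UNIV_eq_I)
  qed
  have "\<forall>\<^sub>F w in at z. g1 w = 0" by (rule eventually_cosparse_imp_eventually_at[OF z1]) auto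
  hence 1: "point_mult (Some 0) g1 z = \<infinity>" by (simp add: point_mult_def)
  have "\<not> (\<forall>\<^sub>F w in at z. g2 w = 0)" using mero_nz_frequently[OF g(2), of z] by (simp add: frequently_def)
  hence 2: "point_mult (Some 0) g2 z = 0"
    using zorder_not_irregular_points[OF z] by (simp add: point_mult_def zero_enat_def)
  have "E_set l (Some 0) g1 z = E_set l (Some 0) g2 z" using sh by (simp add: share_def)
  thus False unfolding E_set_def 1 2 by (cases l) (auto simp: Let_def zero_enat_def one_enat_def split: if_splits)
qed

text \<open>These are the conditions of \<open>le_err_cross\<close> for the two main inequalities,
  after the multiples of T(f) in the first and of T(L) in the second have been moved to the
  left.\<close>

lemma main_coefficients_incompatible:
  fixes \<alpha> \<beta> K n :: real
  assumes "1 \<le> K" and n: "(\<alpha> = 1 \<and> \<beta> = 0 \<and> 5 * K / 2 + 6 < n) \<or> (\<alpha> = 1 \<and> \<beta> = 1/2 \<and> 13 * K / 4 + 27 / 4 < n) \<or>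
    (\<alpha> = 2 \<and> \<beta> = 2 \<and> 7 * K + 11 \<le> n)"
  shows "0 \<le> n - (K + 4) - 2 * \<beta> * (K + 1)"
    and "(1 + \<alpha> * (K + 1)) * (2 * (1 + \<alpha> * (K + 1))) < (n - (K + 4) - 2 * \<beta> * (K + 1)) * (n - (K + 2) - \<beta> * (K + 1))"
proof -
  have KK: "K * 1 \<le> K * K" using assms(1) by (intro mult_left_mono) auto
  have "0 \<le> n - (K + 4) - 2 * \<beta> * (K + 1) \<and>
    (1 + \<alpha> * (K + 1)) * (2 * (1 + \<alpha> * (K + 1))) < (n - (K + 4) - 2 * \<beta> * (K + 1)) * (n - (K + 2) - \<beta> * (K + 1))"
    using n
  proof (elim disjE conjE)
    assume ab: "\<alpha> = 1" "\<beta> = 0" and n: "5 * K / 2 + 6 < n"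
    have a: "3/2 * K + 2 < n - (K + 4)" "3/2 * K + 4 < n - (K + 2)" using n by auto
    have "(1 + 1 * (K + 1)) * (2 * (1 + 1 * (K + 1))) = 2 * (K * K) + 8 * K + 8" by (simp add: field_simps)
    also have "\<dots> < 9/4 * (K * K) + 9 * K + 8"
    proof -
      have "2 * x + 8 * K + 8 < 9/4 * x + 9 * K + 8" if "0 \<le> x" for x using that assms(1) by linarith
      thus ?thesis by simp
    qed
    also have "\<dots> = (3/2 * K + 2) * (3/2 * K + 4)" by (simp add: field_simps)
    also have "\<dots> < (n - (K + 4)) * (n - (K + 2))"
      by (rule mult_strict_mono) (use a assms(1) in auto)
    finally show ?thesis using a assms(1) by (simp add: ab)
  next
    assume ab: "\<alpha> = 1" "\<beta> = 1/2" and n: "13 * K / 4 + 27 / 4 < n"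
    have a: "5/4 * K + 7/4 < n - (K + 4) - 2 * (1/2) * (K + 1)" "7/4 * K + 17/4 < n - (K + 2) - 1/2 * (K + 1)"
      using n by (auto simp: field_simps)
    have "(1 + 1 * (K + 1)) * (2 * (1 + 1 * (K + 1))) = 2 * (K * K) + 8 * K + 8" by (simp add: field_simps)
    \<comment> \<open>The difference is 3/16 (K - 1) (K + 3). It vanishes at K = 1, where strictness
      comes from the strict hypothesis on n alone.\<close>
    also have "\<dots> \<le> 35/16 * (K * K) + 134/16 * K + 119/16"
    proof -
      have "2 * x + 8 * K + 8 \<le> 35/16 * x + 134/16 * K + 119/16" if "K * 1 \<le> x" for x using that assms(1) by linarith
      thus ?thesis using KK by blast
    qed
    also have "\<dots> = (5/4 * K + 7/4) * (7/4 * K + 17/4)" by (simp add: field_simps)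
    also have "\<dots> < (n - (K + 4) - 2 * (1/2) * (K + 1)) * (n - (K + 2) - 1/2 * (K + 1))"
      by (rule mult_strict_mono) (use a assms(1) in auto)
    finally show ?thesis unfolding ab using assms(1) by (intro conjI order_trans[OF _ order.strict_implies_order[OF a(1)]]) auto
  next
    assume ab: "\<alpha> = 2" "\<beta> = 2" and n: "7 * K + 11 \<le> n"
    have a: "2 * K + 3 \<le> n - (K + 4) - 2 * 2 * (K + 1)" "4 * K + 7 \<le> n - (K + 2) - 2 * (K + 1)"
      using n by (auto simp: field_simps)
    have "(1 + 2 * (K + 1)) * (2 * (1 + 2 * (K + 1))) = 8 * (K * K) + 24 * K + 18" by (simp add: field_simps)
    also have "\<dots> < 8 * (K * K) + 26 * K + 21" using assms(1) by simp
    also have "\<dots> = (2 * K + 3) * (4 * K + 7)" by (simp add: field_simps)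
    also have "\<dots> \<le> (n - (K + 4) - 2 * 2 * (K + 1)) * (n - (K + 2) - 2 * (K + 1))"
      by (rule mult_mono) (use a assms(1) in auto)
    finally show ?thesis unfolding ab using assms(1) by (intro conjI order_trans[OF _ a(1)]) auto
  qed
  thus "0 \<le> n - (K + 4) - 2 * \<beta> * (K + 1)"
    and "(1 + \<alpha> * (K + 1)) * (2 * (1 + \<alpha> * (K + 1))) < (n - (K + 4) - 2 * \<beta> * (K + 1)) * (n - (K + 2) - \<beta> * (K + 1))"
    by auto
qed

text \<open>Nondegeneracy is obtained step by step: for G and G', then for F - 1 by sharing, then
  for F' and finally for f. Accordingly the sharing hypotheses are guarded by what is known when
  they are used.\<close>

lemma sharing_imp_derivs_eq:
  fixes n k w :: nat and \<alpha> \<beta> :: real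
  defines "F1 \<equiv> \<lambda>f :: complex \<Rightarrow> complex. (deriv ^^ k) (\<lambda>w. f w ^ n)"
  assumes f: "f meromorphic_on UNIV" and L: "moderate (\<lambda>_. 0) L" and inf: "infinite {z. 1 \<le> mero_ord L z}"
    and E0: "finite E0" "\<And>z. z \<notin> E0 \<Longrightarrow> 0 \<le> mero_ord L z"
    and p: "p \<noteq> 0" and k: "0 < k" and n: "real n > 5 * real k / 2 + 6"
    and sh: "mero_nz (\<lambda>z. F1 L z - poly p z) \<Longrightarrow> mero_nz (\<lambda>z. F1 f z - poly p z)"
      "\<And>z. mero_nz (\<lambda>z. F1 L z - poly p z) \<Longrightarrow> mero_nz (\<lambda>z. F1 f z - poly p z) \<Longrightarrow>
        max 0 (mero_ord (\<lambda>z. F1 f z - poly p z) z) = max 0 (mero_ord (\<lambda>z. F1 L z - poly p z) z) \<or>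
        real w < mero_ord (\<lambda>z. F1 f z - poly p z) z \<and> real w < mero_ord (\<lambda>z. F1 L z - poly p z) z"
    and ab: "(w = 2 \<and> \<alpha> = 1 \<and> \<beta> = 0) \<or> (w = 1 \<and> \<alpha> = 1 \<and> \<beta> = 1/2 \<and> real n > 13 * real k / 4 + 27 / 4) \<or>
       (w = 0 \<and> \<alpha> = 2 \<and> \<beta> = 2 \<and> real n \<ge> 7 * real k + 11)"
  shows "mero_nz f" "\<forall>\<^sub>\<approx>z\<in>UNIV. F1 f z = F1 L z"
proof -
  interpret error_term "\<lambda>_. 0" by (rule zero_error_term)
  define \<eta> where "\<eta> = poly p"
  have sm: "small_function \<eta>" unfolding \<eta>_def by (rule small_poly[OF p])
  hence \<eta>: "mero_nz \<eta>" "finite {z. mero_ord \<eta> z \<noteq> 0}" by (auto simp: small_function_def)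
  hence \<eta>nz: "\<forall>\<^sub>\<approx>z\<in>UNIV. \<eta> z \<noteq> 0" by (simp add: mero_nz_def)
  have nzL: "mero_nz L" by (rule moderate_mero_nz[OF L])
  have kn: "k + 2 < n" "2 * k < n"
  proof -
    have "real (k + 2) < real n" "real (2 * k) < real n" using n by auto
    thus "k + 2 < n" "2 * k < n" by (simp_all only: of_nat_less_iff)
  qed
  define E where "E = E0 \<union> {z. mero_ord \<eta> z \<noteq> 0}"
  have E: "finite E" "\<And>z. z \<notin> E \<Longrightarrow> mero_ord \<eta> z = 0" "\<And>z. z \<notin> E \<Longrightarrow> 0 \<le> mero_ord L z"
    using E0 \<eta> by (auto simp: E_def)
  have notneg: "\<not> le_err (\<lambda>_. 0) (\<lambda>r. nev_T r L) (\<lambda>_. 0)" by (rule zeros_not_negligible[OF nzL inf])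
  have mF1: "F1 h meromorphic_on UNIV" if "h meromorphic_on UNIV" for h
    unfolding F1_def by (intro meromorphic_intros that)
  have ordP: "real k < mero_ord (\<lambda>w. L w ^ n) z" if "1 \<le> mero_ord L z" for z
  proof -
    have "real n * 1 \<le> real n * mero_ord L z" using that by (intro mult_left_mono) auto
    moreover have "real k < real n" using kn by simp
    ultimately have "real k < real n * mero_ord L z" by linarith
    thus ?thesis by (simp add: ord_power[OF nzL])
  qed
  have G1: "mero_nz (F1 L)"
  proof (rule ccontr)
    assume "\<not> mero_nz (F1 L)"
    hence "\<forall>\<^sub>\<approx>z\<in>UNIV. F1 L z = 0" using mero_nz_or_0 mF1[OF mero_nz_meromorphic[OF nzL]] by blast
    then obtain q where q: "\<forall>\<^sub>\<approx>z\<in>UNIV. L z ^ n = poly q z"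
      unfolding F1_def using poly_of_higher_deriv_zero mero_nz_meromorphic[OF mero_nz_power[OF nzL]] by blast
    have "infinite {z. 1 \<le> mero_ord (\<lambda>w. L w ^ n) z}"
    proof
      assume "finite {z. 1 \<le> mero_ord (\<lambda>w. L w ^ n) z}"
      moreover have "{z. 1 \<le> mero_ord L z} \<subseteq> {z. 1 \<le> mero_ord (\<lambda>w. L w ^ n) z}"
      proof
        fix z assume "z \<in> {z. 1 \<le> mero_ord L z}"
        hence "0 < mero_ord (\<lambda>w. L w ^ n) z" using ordP[of z] by simp
        thus "z \<in> {z. 1 \<le> mero_ord (\<lambda>w. L w ^ n) z}" using ord_int_cases[of "\<lambda>w. L w ^ n" z] by auto
      qed
      ultimately show False using inf finite_subset by blast
    qed
    from infinite_zeros_imp_not_poly[OF mero_nz_meromorphic[OF mero_nz_power[OF nzL]] this q] have "q = 0" .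
    with q show False using mero_nz_imp_not_zero[OF mero_nz_power[OF nzL, of n]] by simp
  qed
  define F G where "F = (\<lambda>z. F1 f z / \<eta> z)" and "G = (\<lambda>z. F1 L z / \<eta> z)"
  have G: "mero_nz G" unfolding G_def by (rule mero_nz_divide[OF G1 \<eta>(1)])
  \<comment> \<open>L has infinitely many zeros, so one of them avoids the zeros of
    \<open>\<eta>\<close>. It serves twice: to show that G is not constant, and to exclude B =
    A.\<close>
  obtain z0 where z0: "1 \<le> mero_ord L z0" "mero_ord \<eta> z0 = 0"
  proof -
    have "\<not> {z. 1 \<le> mero_ord L z} \<subseteq> {z. mero_ord \<eta> z \<noteq> 0}" using inf \<eta>(2) finite_subset by blast
    thus ?thesis using that by blast
  qed
  have G': "mero_nz (deriv G)"
  proof (rule ccontr)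
    assume "\<not> mero_nz (deriv G)"
    hence "\<forall>\<^sub>\<approx>z\<in>UNIV. deriv G z = 0"
      using mero_nz_or_0 meromorphic_on_deriv[OF mero_nz_meromorphic[OF G]] by blast
    then obtain c where c: "\<forall>\<^sub>\<approx>z\<in>UNIV. G z = c" using deriv_zero_imp_const mero_nz_meromorphic[OF G] by blast
    hence "c \<noteq> 0" using mero_nz_imp_not_zero[OF G] by auto
    hence "mero_ord G z0 = 0" using ord_of_const_ae[OF c] by simp
    moreover have "mero_ord G z0 = mero_ord (F1 L) z0" unfolding G_def using ord_divide[OF G1 \<eta>(1), of z0] z0 by simp
    moreover have "mero_ord (F1 L) z0 = mero_ord (\<lambda>w. L w ^ n) z0 - real k"
      unfolding F1_def by (rule ord_higher_deriv) (use G1 ordP[OF z0(1)] mero_nz_meromorphic[OF mero_nz_power[OF nzL]] in \<open>auto simp: F1_def\<close>)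
    ultimately show False using ordP[OF z0(1)] by simp
  qed
  have SG: "quotient_setting n k \<eta> L G"
    unfolding quotient_setting_def using L sm kn G1 G' by (simp add: G_def F1_def)
  have diff_eq: "\<forall>\<^sub>\<approx>z\<in>UNIV. (F1 h z / \<eta> z - 1) * \<eta> z = F1 h z - poly p z" for h
    using \<eta>nz by eventually_elim (simp add: field_simps \<eta>_def)
  have GmL: "mero_nz (\<lambda>z. F1 L z - poly p z)"
    by (rule mero_nz_cong[OF mero_nz_mult[OF quotient_setting_facts(3)[OF SG, of 1] \<eta>(1)]]) (use diff_eq[of L] in \<open>simp add: G_def\<close>)
  have Fmf: "mero_nz (\<lambda>z. F1 f z - poly p z)" by (rule sh(1)[OF GmL])
  have F1m: "mero_nz (\<lambda>z. F z - 1)"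
  proof (rule mero_nz_cong[OF mero_nz_divide[OF Fmf \<eta>(1)]])
    show "\<forall>\<^sub>\<approx>z\<in>UNIV. (F1 f z - poly p z) / \<eta> z = F z - 1"
      using \<eta>nz by eventually_elim (simp add: F_def diff_divide_distrib \<eta>_def)
  qed
  have dF: "\<forall>\<^sub>\<approx>z\<in>UNIV. (F z - 1) * \<eta> z = F1 f z - poly p z"
    and dG: "\<forall>\<^sub>\<approx>z\<in>UNIV. (G z - 1) * \<eta> z = F1 L z - poly p z"
    unfolding F_def G_def by (rule diff_eq)+
  have oF: "mero_ord (\<lambda>z. F1 f z - poly p z) z = mero_ord (\<lambda>z. F z - 1) z"
    and oG: "mero_ord (\<lambda>z. F1 L z - poly p z) z = mero_ord (\<lambda>z. G z - 1) z" if "z \<notin> E" for z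
    using ord_prod_eq[OF F1m \<eta>(1) dF, of z]
      ord_prod_eq[OF quotient_setting_facts(3)[OF SG, of 1] \<eta>(1) dG, of z] E(2)[OF that]
    by auto
  have shFG: "max 0 (mero_ord (\<lambda>z. F z - 1) z) = max 0 (mero_ord (\<lambda>z. G z - 1) z) \<or>
        real w < mero_ord (\<lambda>z. F z - 1) z \<and> real w < mero_ord (\<lambda>z. G z - 1) z" if "z \<notin> E" for z
    using sh(2)[OF GmL Fmf, of z] oF[OF that] oG[OF that] by simp
  have not_const: "\<not> (\<forall>\<^sub>\<approx>z\<in>UNIV. F z - 1 = c)" for c
  proof
    assume c: "\<forall>\<^sub>\<approx>z\<in>UNIV. F z - 1 = c"
    hence "c \<noteq> 0" using mero_nz_imp_not_zero[OF F1m] by auto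
    hence o0: "mero_ord (\<lambda>z. F z - 1) z = 0" for z using ord_of_const_ae[OF c] by simp
    have "mero_ord (\<lambda>z. G z - 1) z \<le> 0" if "z \<notin> E" for z using shFG[OF that] o0[of z] by auto
    with no_one_points[OF SG E(1,2,3)] kn notneg show False by simp
  qed
  have mero_F: "F meromorphic_on UNIV" unfolding F_def by (intro meromorphic_intros mF1 f mero_nz_meromorphic \<eta>)
  have F': "mero_nz (deriv F)"
  proof (rule ccontr)
    assume "\<not> mero_nz (deriv F)"
    hence "\<forall>\<^sub>\<approx>z\<in>UNIV. deriv F z = 0" using mero_nz_or_0 meromorphic_on_deriv[OF mero_F] by blast
    then obtain c where "\<forall>\<^sub>\<approx>z\<in>UNIV. F z = c" using deriv_zero_imp_const mero_F by blast
    hence "\<forall>\<^sub>\<approx>z\<in>UNIV. F z - 1 = c - 1" by eventually_elim simp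
    thus False using not_const by blast
  qed
  have F0: "mero_nz F" by (rule mero_nz_of_deriv[OF mero_F F'])
  have F1f: "mero_nz (F1 f)"
    by (rule mero_nz_cong[OF mero_nz_mult[OF F0 \<eta>(1)]]) (use \<eta>nz in eventually_elim, simp add: F_def)
  have fn: "mero_nz (\<lambda>w. f w ^ n)"
    using mero_nz_higher_deriv_le[of "\<lambda>w. f w ^ n" k 0] F1f f unfolding F1_def by (auto intro: meromorphic_intros)
  have "\<forall>\<^sub>\<approx>z\<in>UNIV. f z \<noteq> 0"
  proof -
    have "\<forall>\<^sub>\<approx>z\<in>UNIV. f z ^ n \<noteq> 0" using fn by (simp add: mero_nz_def)
    thus ?thesis by eventually_elim (use kn in auto)
  qed
  with f show nzf: "mero_nz f" by (simp add: mero_nz_def)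
  have modG: "moderate (\<lambda>_. 0) (\<lambda>z. G z - 1)"
    using moderate_add_const[OF quotient_setting_facts(5)[OF SG], of "-1"] quotient_setting_facts(3)[OF SG, of 1] by simp
  have modf: "moderate (\<lambda>_. 0) f"
  proof (rule moderate_of_sharing[OF nzf L p kn(1) _ _ F' modG E(1)])
    show "F = (\<lambda>z. (deriv ^^ k) (\<lambda>w. f w ^ n) z / poly p z)" by (simp add: F_def F1_def \<eta>_def)
    show "mero_nz ((deriv ^^ k) (\<lambda>w. f w ^ n))" using F1f by (simp add: F1_def)
    show "mero_ord (poly p) z = 0" if "z \<notin> E" for z using E(2)[OF that] by (simp add: \<eta>_def)
    show "1 \<le> mero_ord (\<lambda>z. G z - 1) z" if "z \<notin> E" "1 \<le> mero_ord (\<lambda>z. F z - 1) z" for z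
      using shFG[OF that(1)] that(2) ord_gt_cases[of w "\<lambda>z. G z - 1" z] by (auto simp: max_def split: if_splits)
  qed
  have SF: "quotient_setting n k \<eta> f F"
    unfolding quotient_setting_def using modf sm kn F1f F' by (simp add: F_def F1_def)
  define Q where "Q = (\<lambda>z. deriv (\<lambda>z. inverse (F z - 1)) z / deriv (\<lambda>z. inverse (G z - 1)) z)"
  note u = deriv_inverse_diff_const[OF mero_F F', of 1] and v = deriv_inverse_diff_const[OF mero_nz_meromorphic[OF G] G', of 1]
  have Q: "mero_nz Q" unfolding Q_def by (rule mero_nz_divide[OF u(2) v(2)])
  have Qconst: "\<not> mero_nz (deriv Q)"
  proof
    assume Q': "mero_nz (deriv Q)"
    have k1: "1 \<le> real k" using k by simp
    have nn: "(\<alpha> = 1 \<and> \<beta> = 0 \<and> 5 * real k / 2 + 6 < real n) \<or> (\<alpha> = 1 \<and> \<beta> = 1/2 \<and> 13 * real k / 4 + 27 / 4 < real n) \<or>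
       (\<alpha> = 2 \<and> \<beta> = 2 \<and> 7 * real k + 11 \<le> real n)" using ab n by auto
    note num = main_coefficients_incompatible[OF k1 nn]
    have ab': "(w = 2 \<and> \<alpha> = 1 \<and> \<beta> = 0) \<or> (w = 1 \<and> \<alpha> = 1 \<and> \<beta> = 1/2) \<or> (w = 0 \<and> \<alpha> = 2 \<and> \<beta> = 2)" using ab by auto
    have mi: "le_err (\<lambda>_. 0) (\<lambda>r. real n * nev_T r f)
        (\<lambda>r. (real k + 2 + \<beta> * (real k + 1)) * nev_T r f + (2 + \<beta> * (real k + 1)) * nev_T r f + (1 + \<alpha> * (real k + 1)) * nev_T r L)"
      "le_err (\<lambda>_. 0) (\<lambda>r. real n * nev_T r L)
        (\<lambda>r. (real k + 2 + \<beta> * (real k + 1)) * nev_T r L + (1 + \<alpha> * (real k + 1)) * nev_T r f + (1 + \<alpha> * (real k + 1)) * nev_T r f)"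
      by (rule main_inequalities[OF SF SG E shFG ab' Q_def Q']; assumption)+
    have a1: "le_err (\<lambda>_. 0) (\<lambda>r. (real n - (real k + 4) - 2 * \<beta> * (real k + 1)) * nev_T r f) (\<lambda>r. (1 + \<alpha> * (real k + 1)) * nev_T r L)"
      using mi(1) by (subst le_err_move, subst (asm) le_err_move) (simp add: algebra_simps)
    have a2: "le_err (\<lambda>_. 0) (\<lambda>r. (real n - (real k + 2) - \<beta> * (real k + 1)) * nev_T r L) (\<lambda>r. (2 * (1 + \<alpha> * (real k + 1))) * nev_T r f)"
      using mi(2) by (subst le_err_move, subst (asm) le_err_move) (simp add: algebra_simps)
    have "le_err (\<lambda>_. 0) (\<lambda>r. nev_T r L) (\<lambda>_. 0)"
      by (rule le_err_cross[OF a1 a2]) (use num k1 ab n in auto)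
    thus False using notneg by simp
  qed
  have "\<forall>\<^sub>\<approx>z\<in>UNIV. deriv Q z = 0"
    using Qconst mero_nz_or_0 meromorphic_on_deriv[OF mero_nz_meromorphic[OF Q]] by blast
  then obtain A where A: "\<forall>\<^sub>\<approx>z\<in>UNIV. Q z = A" using deriv_zero_imp_const mero_nz_meromorphic[OF Q] by blast
  have A0: "A \<noteq> 0" using A mero_nz_imp_not_zero[OF Q] by auto
  have "\<forall>\<^sub>\<approx>z\<in>UNIV. deriv (\<lambda>z. inverse (G z - 1)) z \<noteq> 0" using v(2) by (simp add: mero_nz_def)
  with A deriv_diff_cmult_mero[OF mero_nz_meromorphic[OF u(1)] mero_nz_meromorphic[OF v(1)], of A]
  have "\<forall>\<^sub>\<approx>z\<in>UNIV. deriv (\<lambda>z. inverse (F z - 1) - A * inverse (G z - 1)) z = 0"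
    unfolding Q_def by eventually_elim (simp add: field_simps)
  moreover have "(\<lambda>z. inverse (F z - 1) - A * inverse (G z - 1)) meromorphic_on UNIV"
    by (intro meromorphic_intros mero_nz_meromorphic F0 G)
  ultimately obtain B where "\<forall>\<^sub>\<approx>z\<in>UNIV. inverse (F z - 1) - A * inverse (G z - 1) = B"
    using deriv_zero_imp_const by blast
  hence uv: "\<forall>\<^sub>\<approx>z\<in>UNIV. inverse (F z - 1) = A * inverse (G z - 1) + B" by eventually_elim (simp add: algebra_simps)
  have "B \<noteq> A"
  proof
    assume "B = A"
    with uv show False using inverse_moebius_impossible[OF SF SG z0(2,1) kn(2) k A0] by simp
  qed
  moreover have "A = 1 \<and> B = 0"
  proof (rule ccontr)
    assume "\<not> (A = 1 \<and> B = 0)"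
    have "le_err (\<lambda>_. 0) (\<lambda>r. nev_T r L) (\<lambda>_. 0)"
      by (rule moebius_case[OF SF SG E n uv A0 \<open>B \<noteq> A\<close> \<open>\<not> (A = 1 \<and> B = 0)\<close>])
    thus False using notneg by simp
  qed
  ultimately have "\<forall>\<^sub>\<approx>z\<in>UNIV. inverse (F z - 1) = inverse (G z - 1)" using uv by simp
  with \<eta>nz show "\<forall>\<^sub>\<approx>z\<in>UNIV. F1 f z = F1 L z"
    by eventually_elim (simp add: F_def G_def)
qed

theorem corollary1p1:
  fixes f L :: "complex \<Rightarrow> complex" and n k :: nat and a b :: complex and l :: enat
  assumes "f nicely_meromorphic_on UNIV" and "\<not> f constant_on UNIV"
    and "L_function L"
    and "n > 0" and "k > 0"
    and "norm a + norm b \<noteq> 0"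
    and "share (\<lambda>z. (deriv ^^ k) (\<lambda>w. f w ^ n) z - (a * z + b))
               (\<lambda>z. (deriv ^^ k) (\<lambda>w. L w ^ n) z - (a * z + b)) (Some 0) l"
    and "(l \<ge> 2 \<and> real n > 5 * real k / 2 + 6) \<or>
         (l = 1 \<and> real n > 13 * real k / 4 + 27 / 4) \<or>
         (l = 0 \<and> real n > 7 * real k + 21 / 2)"
  shows "\<exists>t. t ^ n = 1 \<and> f = (\<lambda>z. t * L z)"
proof -
  interpret error_term "\<lambda>_. 0" by (rule zero_error_term)
  define p where "p = [:b, a:]"
  have p: "p \<noteq> 0" using assms(6) by (auto simp: p_def)
  have pz: "poly p z = a * z + b" for z by (simp add: p_def algebra_simps)
  have nzL: "mero_nz L" by (rule L_function_mero_nz[OF assms(3)])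
  have f: "f meromorphic_on UNIV" using assms(1) by (simp add: nicely_meromorphic_on_def)
  obtain C q where "\<forall>\<^sub>F r in radii. nev_T r L \<le> C * (r + 5) ^ q" using L_function_growth[OF assms(3)] by metis
  hence L: "moderate (\<lambda>_. 0) L" by (rule moderate_of_polynomial_growth[OF nzL])
  have inf: "infinite {z. 1 \<le> mero_ord L z}" by (rule L_function_infinite_zeros[OF assms(3)])
  have E0: "finite {1 :: complex}" "\<And>z. z \<notin> {1} \<Longrightarrow> 0 \<le> mero_ord L z"
    using L_function_ord_nonneg[OF assms(3)] by auto
  have n: "real n > 5 * real k / 2 + 6" using assms(5,8) by auto
  \<comment> \<open>Only the weights 0, 1 and 2 are distinguished; sharing with weight l yields the
    order condition for every smaller weight.\<close>
  obtain w :: nat and \<alpha> \<beta> :: real where w: "enat w \<le> l" and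
    ab: "(w = 2 \<and> \<alpha> = 1 \<and> \<beta> = 0) \<or> (w = 1 \<and> \<alpha> = 1 \<and> \<beta> = 1/2 \<and> real n > 13 * real k / 4 + 27 / 4) \<or>
       (w = 0 \<and> \<alpha> = 2 \<and> \<beta> = 2 \<and> real n \<ge> 7 * real k + 11)"
    using assms(8)
  proof (elim disjE conjE)
    assume "l \<ge> 2"
    thus ?thesis by (intro that[of 2 1 0]) (auto simp: numeral_eq_enat)
  next
    assume "l = 1" "real n > 13 * real k / 4 + 27 / 4"
    thus ?thesis by (intro that[of 1 1 "1/2"]) (auto simp: one_enat_def)
  next
    assume l: "l = 0" "real n > 7 * real k + 21 / 2"
    \<comment> \<open>Integrality of n matters: at n = 7 k + 21 / 2 the product condition would read
      8 k^2 + 24 k + 18 < 8 k^2 + 23 k + 65 / 4, which is false, whereas it holds from n = 7 k + 11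
      on.\<close>
    hence "real (7 * k + 10) < real n" by simp
    hence "7 * k + 10 < n" by (simp only: of_nat_less_iff)
    hence "real (7 * k + 11) \<le> real n" by (intro of_nat_mono) auto
    thus ?thesis using l by (intro that[of 0 2 2]) (auto simp: zero_enat_def)
  qed
  note sh = assms(7)[folded pz]
  have mf: "(\<lambda>z. (deriv ^^ k) (\<lambda>w. f w ^ n) z - poly p z) meromorphic_on UNIV"
    by (intro meromorphic_intros f poly_meromorphic)
  have res: "mero_nz f" "\<forall>\<^sub>\<approx>z\<in>UNIV. (deriv ^^ k) (\<lambda>w. f w ^ n) z = (deriv ^^ k) (\<lambda>w. L w ^ n) z"
    by (rule sharing_imp_derivs_eq[OF f L inf E0 p assms(5) n _ _ ab, rotated];
        (assumption | rule share_zeros_mero_nz[OF sh mf] share_zeros_orders[OF sh _ _ w]; assumption))+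
  note nzf = res(1) and eq = res(2)
  have mP: "(\<lambda>w. f w ^ n) meromorphic_on UNIV" "(\<lambda>w. L w ^ n) meromorphic_on UNIV"
    by (intro meromorphic_intros f mero_nz_meromorphic nzL)+
  have "\<forall>\<^sub>\<approx>z\<in>UNIV. (deriv ^^ k) (\<lambda>z. f z ^ n - L z ^ n) z = 0"
    using higher_deriv_diff_mero[OF mP, of k] eq by eventually_elim simp
  then obtain q where q: "\<forall>\<^sub>\<approx>z\<in>UNIV. f z ^ n - L z ^ n = poly q z"
    using poly_of_higher_deriv_zero meromorphic_on_diff[OF mP] by blast
  have "2 < n"
  proof -
    have "real 2 < real n" using n by simp
    thus ?thesis by (simp only: of_nat_less_iff)
  qed
  hence "q = 0" using power_diff_not_poly[OF nzf L _ _ inf E0 q] by blast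
  hence "\<forall>\<^sub>\<approx>z\<in>UNIV. f z ^ n = L z ^ n" using q by simp
  from unity_of_power_eq[OF f nzL assms(4) this] obtain t where
    t: "t ^ n = 1" "\<forall>\<^sub>\<approx>z\<in>UNIV. f z = t * L z" by blast
  have "L nicely_meromorphic_on UNIV" using assms(3) by (simp add: L_function_def)
  hence "(\<lambda>z. t * L z) nicely_meromorphic_on UNIV" by (rule nicely_meromorphic_on_cmult_left)
  \<comment> \<open>Both functions are normalized at their poles, so equality off a sparse set is
    equality everywhere.\<close>
  from nicely_meromorphic_eqI[OF assms(1) this t(2)] t(1) show ?thesis by blast
qed

end
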